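(* There exists a constant $C>0$, independent of the mesh size $h$ and of the polynomial degree $k$, such that for every integer $k\ge1$, every mesh of the family and every $f\in L^2(\Omega)$, the following holds. Let $u\in H_0^1(\Omega)$ be the solution of $(\nabla u,\nabla v)_\Omega=(f,v)_\Omega$ for all $v\in H_0^1(\Omega)$, and let $\mu_h\in\mathcal M_h^k$ be the solution of the condensed HHO problem $a_h^k(\mu_h,\nu_h)=(f,U_h^k\nu_h)_\Omega$ for all $\nu_h\in\mathcal M_h^k$. Then $$\|\mu_h-\Pi_{\mathcal F_h}^ku\|_{a_h^k}\le C\,\frac hk\,\|f\|_\Omega.$$
   Context: **Mesh.** $\Omega\subset\mathbb R^d$, $d\in\{2,3\}$, is a convex polytope; $h_X$ is the diameter of $X$. $(\mathcal T_h,\mathcal F_h)_h$ is a regular polytopal mesh sequence: $\mathcal T_h$ is a finite set of disjoint polytopes (elements) whose closures cover $\overline\Omega$; $\mathcal F_h$ is a finite set of disjoint planar faces whose closures cover $\bigcup_{T}\partial T$, each face being contained either in $\partial T_1\cap\partial T_2$ for two distinct elements or in $\partial T\cap\partial\Omega$ for one element; and there are $\rho\in(0,1)$ independent of $h$ and, for each $h$, a conforming simplicial submesh such that each simplex $S$ lies in a unique $T\in\mathcal T_h$, each simplicial face is either contained in or disjoint from any given $F\in\mathcal F_h$, $\rho h_S\le r_S$ ($r_S$ the inradius of $S$) and $\rho h_T\le h_S$ if $S\subseteq T$. Set $h=\max_T h_T$; the mesh is quasi-uniform: $h\le C_{qu}h_T$ for all $T$, with $C_{qu}$ independent of $h$.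 All elements are convex. $\mathcal F_T=\{F\in\mathcal F_h:F\subset\partial T\}$, $\Gamma_h=\bigcup_{F\in\mathcal F_h}\overline F$, and $\boldsymbol n_{\partial T}$ is the outward unit normal to $T$. **Notation.** $(\cdot,\cdot)_X,\|\cdot\|_X$ are the $L^2(X)$ inner product and norm, $\|\cdot\|_{m,X}$ the $H^m(X)$ norm. $\mathbb P^k(X)$: polynomials of total degree $\le k$ on $X$; $\mathbb P^k(\mathcal T_h),\mathbb P^k(\mathcal F_h),\mathbb P^k(\mathcal F_T)$: the broken polynomial spaces on elements, on faces, and on the faces of $T$. $\Pi_T^k,\Pi_{\mathcal F_T}^k,\Pi_{\mathcal F_h}^k$: $L^2$-orthogonal projectors onto $\mathbb P^k(T),\mathbb P^k(\mathcal F_T),\mathbb P^k(\mathcal F_h)$. **HHO scheme** ($k\ge1$). $\mathcal U_h^k=\mathbb P^k(\mathcal T_h)$, $\mathcal M_h^k=\{\mu_h\in\mathbb P^k(\mathcal F_h):\mu_h|_F=0\text{ for all }F\subset\partial\Omega\}$, $\mathcal U_T^k=\mathbb P^k(T)$, $\mathcal M_T^k=\mathbb P^k(\mathcal F_T)$; $(v_T,\nu_T)$ is the restriction of $(v_h,\nu_h)$ to $T$ and its faces. The gradient reconstruction $\boldsymbol G_T^k:\mathcal U_T^k\times\mathcal M_T^k\to\mathbb P^k(T)^d$ is defined by $(\boldsymbol G_T^k(v_T,\nu_T),\boldsymbol\tau)_T=(\nabla v_T,\boldsymbol\tau)_T+(\nu_T-v_T,\boldsymbol\tau\cdot\boldsymbol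 n_{\partial T})_{\partial T}$ for all $\boldsymbol\tau\in\mathbb P^k(T)^d$. The potential reconstruction $p_T^{k+1}(v_T,\nu_T)\in\mathbb P^{k+1}(T)$ is defined by $(\nabla p_T^{k+1}(v_T,\nu_T),\nabla w)_T=(\boldsymbol G_T^k(v_T,\nu_T),\nabla w)_T$ for all $w\in\mathbb P^{k+1}(T)$ and $\int_Tp_T^{k+1}(v_T,\nu_T)=\int_Tv_T$. Put $(\delta_T^k,\delta_{\partial T}^k)(v_T,\nu_T)=(v_T,\nu_T)-(\Pi_T^kp,\Pi_{\mathcal F_T}^kp)$ with $p=p_T^{k+1}(v_T,\nu_T)$. For $\underline u=(u_T,\mu_T)$, $\underline v=(v_T,\nu_T)$, $$\underline s_T^k(\underline u,\underline v)=\tfrac{k}{h_T}\big(\delta_{\partial T}^k\underline u-\delta_T^k\underline u,\delta_{\partial T}^k\underline v-\delta_T^k\underline v\big)_{\partial T},\qquad \underline a_T^k(\underline u,\underline v)=(\boldsymbol G_T^k\underline u,\boldsymbol G_T^k\underline v)_T+\underline s_T^k(\underline u,\underline v),$$ and $\underline a_h^k=\sum_{T}\underline a_T^k$ (applied to the restrictions). **Condensation.** $U_T^k:\mathcal M_T^k\to\mathcal U_T^k$ is defined by $\underline a_T^k((U_T^k\mu_T,0),(v_T,0))=-\underline a_T^k((0,\mu_T),(v_T,0))$ for all $v_T\in\mathcal U_T^k$ (well posed, since $\underline a_T^k$ is coercive on $\mathcal U_T^k\times\{0\}$), and $U_h^k:\mathcal M_h^k\to\mathcal U_h^k$ by $(U_h^k\mu_h)|_T=U_T^k\mu_T$.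 Then $a_h^k(\mu_h,\nu_h)=\underline a_h^k((U_h^k\mu_h,\mu_h),(U_h^k\nu_h,\nu_h))$ and $\|\nu_h\|_{a_h^k}=a_h^k(\nu_h,\nu_h)^{1/2}$. **Standing assumptions** (constants independent of $h$, $T$ and $k$). (i) For $k\ge1$, $1\le m\le k+1$, $v\in H^m(T)$: $\|v-\Pi_T^kv\|_{\partial T}\lesssim (h_T/k)^{m-1/2}\|v\|_{m,T}$ and $\|v-\Pi_T^kv\|_{\partial T}\lesssim(h_T/k)^{1/2}\|\nabla v\|_T$. (ii) Elliptic regularity: for $D=\Omega$ or $D=T\in\mathcal T_h$ and $g\in L^2(D)$, the solution $w\in H_0^1(D)$ of $(\nabla w,\nabla v)_D=(g,v)_D$ for all $v\in H_0^1(D)$ is in $H^2(D)$ with $\|w\|_{2,D}\lesssim\|g\|_D$. Constants may depend on $d$, $\Omega$, the mesh regularity and quasi-uniformity parameters, and the constants in the standing assumptions. *)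

theory Defs
  imports "HOL-Analysis.Analysis"
begin

section \<open>Square-integrable functions\<close>

definition l2_inner :: "'a measure \<Rightarrow> ('a \<Rightarrow> 'b::euclidean_space) \<Rightarrow> ('a \<Rightarrow> 'b) \<Rightarrow> real" where
  "l2_inner M f g = (\<integral>x. f x \<bullet> g x \<partial>M)"

definition l2_norm :: "'a measure \<Rightarrow> ('a \<Rightarrow> 'b::euclidean_space) \<Rightarrow> real" where
  "l2_norm M f = sqrt (l2_inner M f f)"

definition sq_integrable :: "'a measure \<Rightarrow> ('a \<Rightarrow> real) \<Rightarrow> bool" where
  "sq_integrable M f \<longleftrightarrow> f \<in> borel_measurable M \<and> integrable M (\<lambda>x. (f x)\<^sup>2)"

section \<open>Polynomials\<close>

text \<open>A multi-index is a multiset of basis vectors; its order is its size.\<close>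

definition multi_indices :: "nat \<Rightarrow> 'a::euclidean_space multiset set" where
  "multi_indices k = {\<alpha>. set_mset \<alpha> \<subseteq> Basis \<and> size \<alpha> \<le> k}"

definition polys :: "nat \<Rightarrow> ('a::euclidean_space \<Rightarrow> real) set" where
  "polys k = {p. \<exists>c. \<forall>x. p x = (\<Sum>\<alpha>\<in>multi_indices k. c \<alpha> * (\<Prod>i\<in>#\<alpha>. x \<bullet> i))}"

definition vec_polys :: "nat \<Rightarrow> ('a::euclidean_space \<Rightarrow> 'a) set" where
  "vec_polys k = {\<tau>. \<forall>i\<in>Basis. (\<lambda>x. \<tau> x \<bullet> i) \<in> polys k}"

text \<open>Broken polynomials on a family of pairwise disjoint planar faces. The polynomials on a
  face of a hyperplane are the restrictions of the polynomials on the whole space. The values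
  outside the faces are irrelevant and left unspecified.\<close>

definition face_polys :: "nat \<Rightarrow> 'a::euclidean_space set set \<Rightarrow> ('a \<Rightarrow> real) set" where
  "face_polys k Fs = {\<mu>. \<forall>F\<in>Fs. \<exists>p\<in>polys k. \<forall>x\<in>F. \<mu> x = p x}"

section \<open>Sobolev spaces\<close>

definition pdiff :: "'a::euclidean_space \<Rightarrow> ('a \<Rightarrow> real) \<Rightarrow> 'a \<Rightarrow> real" where
  "pdiff i f x = frechet_derivative f (at x) i"

definition grad :: "('a::euclidean_space \<Rightarrow> real) \<Rightarrow> 'a \<Rightarrow> 'a" where
  "grad f x = (\<Sum>i\<in>Basis. pdiff i f x *\<^sub>R i)"

definition smooth :: "('a::euclidean_space \<Rightarrow> real) \<Rightarrow> bool" where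
  "smooth f \<longleftrightarrow> (\<forall>is. set is \<subseteq> Basis \<longrightarrow> (\<forall>x. foldr pdiff is f differentiable (at x)))"

definition test_fun :: "'a::euclidean_space set \<Rightarrow> ('a \<Rightarrow> real) \<Rightarrow> bool" where
  "test_fun D \<phi> \<longleftrightarrow> smooth \<phi> \<and> (\<exists>K. compact K \<and> K \<subseteq> D \<and> (\<forall>x. x \<notin> K \<longrightarrow> \<phi> x = 0))"

definition is_weak_deriv ::
  "'a::euclidean_space set \<Rightarrow> 'a multiset \<Rightarrow> ('a \<Rightarrow> real) \<Rightarrow> ('a \<Rightarrow> real) \<Rightarrow> bool" where
  "is_weak_deriv D \<alpha> u g \<longleftrightarrow> (\<forall>\<phi> is. test_fun D \<phi> \<and> mset is = \<alpha> \<longrightarrow>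
     l2_inner (lebesgue_on D) u (foldr pdiff is \<phi>) = (-1) ^ size \<alpha> * l2_inner (lebesgue_on D) g \<phi>)"

text \<open>A representative of the weak derivative, which is unique almost everywhere in \<open>D\<close>.\<close>

definition weak_deriv ::
  "'a::euclidean_space set \<Rightarrow> 'a multiset \<Rightarrow> ('a \<Rightarrow> real) \<Rightarrow> 'a \<Rightarrow> real" where
  "weak_deriv D \<alpha> u = (SOME g. sq_integrable (lebesgue_on D) g \<and> is_weak_deriv D \<alpha> u g)"

definition weak_grad :: "'a::euclidean_space set \<Rightarrow> ('a \<Rightarrow> real) \<Rightarrow> 'a \<Rightarrow> 'a" where
  "weak_grad D u x = (\<Sum>i\<in>Basis. weak_deriv D {#i#} u x *\<^sub>R i)"

definition sobolev :: "nat \<Rightarrow> 'a::euclidean_space set \<Rightarrow> ('a \<Rightarrow> real) set" where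
  "sobolev m D = {u. sq_integrable (lebesgue_on D) u \<and>
     (\<forall>\<alpha>\<in>multi_indices m. \<exists>g. sq_integrable (lebesgue_on D) g \<and> is_weak_deriv D \<alpha> u g)}"

definition sobolev_norm :: "nat \<Rightarrow> 'a::euclidean_space set \<Rightarrow> ('a \<Rightarrow> real) \<Rightarrow> real" where
  "sobolev_norm m D u =
     sqrt (\<Sum>\<alpha>\<in>multi_indices m. (l2_norm (lebesgue_on D) (weak_deriv D \<alpha> u))\<^sup>2)"

definition sobolev0 :: "'a::euclidean_space set \<Rightarrow> ('a \<Rightarrow> real) set" where
  "sobolev0 D = {u \<in> sobolev 1 D. \<exists>\<phi> :: nat \<Rightarrow> 'a \<Rightarrow> real. (\<forall>n. test_fun D (\<phi> n)) \<and>
     (\<lambda>n. sobolev_norm 1 D (\<lambda>x. u x - \<phi> n x)) \<longlonglongrightarrow> 0}"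

text \<open>Weak solution of the homogeneous Dirichlet problem for the Poisson equation.\<close>

definition poisson_solution :: "'a::euclidean_space set \<Rightarrow> ('a \<Rightarrow> real) \<Rightarrow> ('a \<Rightarrow> real) \<Rightarrow> bool" where
  "poisson_solution D g w \<longleftrightarrow> w \<in> sobolev0 D \<and> (\<forall>v\<in>sobolev0 D.
     l2_inner (lebesgue_on D) (weak_grad D w) (weak_grad D v) = l2_inner (lebesgue_on D) g v)"

section \<open>Planar faces, surface measure, traces\<close>

definition planar_face :: "'a::euclidean_space set \<Rightarrow> bool" where
  "planar_face F \<longleftrightarrow> F \<noteq> {} \<and> aff_dim F = int DIM('a) - 1 \<and> F = rel_interior (closure F) \<and>
     (\<exists>\<P>. finite \<P> \<and> (\<forall>P\<in>\<P>. polytope P) \<and> closure F = \<Union>\<P>)"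

definition unit_normal :: "'a::euclidean_space set \<Rightarrow> 'a" where
  "unit_normal F = (SOME n. norm n = 1 \<and> (\<forall>x\<in>F. \<forall>y\<in>F. n \<bullet> (x - y) = 0))"

text \<open>The (d-1)-dimensional Lebesgue measure on a face \<open>F\<close> lying in a hyperplane: a subset of
  \<open>F\<close> gets the volume of the right prism of height one over it. It is obtained by projecting
  the Lebesgue measure of the prism over \<open>F\<close> orthogonally onto \<open>F\<close>.\<close>

definition face_measure :: "'a::euclidean_space set \<Rightarrow> 'a measure" where
  "face_measure F =
     distr (lebesgue_on {x + t *\<^sub>R unit_normal F |x t. x \<in> F \<and> 0 \<le> t \<and> t \<le> 1})
           (restrict_space borel F) (closest_point (affine hull F))"

text \<open>The \<open>L\<^sup>2\<close> inner product and norm on the union of finitely many disjoint faces. With the mesh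
  faces on the boundary of \<open>T\<close>, these are the inner product and norm of \<open>L\<^sup>2(\<partial>T)\<close>.\<close>

definition faces_inner :: "'a::euclidean_space set set \<Rightarrow> ('a \<Rightarrow> real) \<Rightarrow> ('a \<Rightarrow> real) \<Rightarrow> real" where
  "faces_inner Fs f g = (\<Sum>F\<in>Fs. l2_inner (face_measure F) f g)"

definition faces_norm :: "'a::euclidean_space set set \<Rightarrow> ('a \<Rightarrow> real) \<Rightarrow> real" where
  "faces_norm Fs f = sqrt (faces_inner Fs f f)"

text \<open>The trace on the faces \<open>Fs\<close> of an \<open>H\<^sup>1(D)\<close> function, \<open>Fs\<close> being contained in the closure of
  \<open>D\<close>: the limit in \<open>L\<^sup>2\<close> of the restrictions of smooth functions that converge to it in
  \<open>H\<^sup>1(D)\<close>.\<close>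

definition is_trace ::
  "'a::euclidean_space set \<Rightarrow> 'a set set \<Rightarrow> ('a \<Rightarrow> real) \<Rightarrow> ('a \<Rightarrow> real) \<Rightarrow> bool" where
  "is_trace D Fs v g \<longleftrightarrow> (\<forall>F\<in>Fs. sq_integrable (face_measure F) g) \<and>
     (\<exists>\<phi> :: nat \<Rightarrow> 'a \<Rightarrow> real. (\<forall>n. smooth (\<phi> n)) \<and>
       (\<lambda>n. sobolev_norm 1 D (\<lambda>x. v x - \<phi> n x)) \<longlonglongrightarrow> 0 \<and>
       (\<lambda>n. faces_norm Fs (\<lambda>x. g x - \<phi> n x)) \<longlonglongrightarrow> 0)"

definition trace_on ::
  "'a::euclidean_space set \<Rightarrow> 'a set set \<Rightarrow> ('a \<Rightarrow> real) \<Rightarrow> 'a \<Rightarrow> real" where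
  "trace_on D Fs v = (SOME g. is_trace D Fs v g)"

section \<open>Meshes\<close>

definition open_convex_polytope :: "'a::euclidean_space set \<Rightarrow> bool" where
  "open_convex_polytope X \<longleftrightarrow> X \<noteq> {} \<and> open X \<and> convex X \<and> polytope (closure X)"

definition inradius :: "'a::euclidean_space set \<Rightarrow> real" where
  "inradius S = Sup {r. \<exists>x. ball x r \<subseteq> S}"

text \<open>Library simplices are closed, hence the interiors of the simplices and the relative
  interiors of their facets below.\<close>

definition regular_submesh ::
  "real \<Rightarrow> 'a::euclidean_space set \<Rightarrow> 'a set set \<Rightarrow> 'a set set \<Rightarrow> 'a set set \<Rightarrow> bool" where
  "regular_submesh \<rho> \<Omega> Th Fh \<S> \<longleftrightarrow>
     triangulation \<S> \<and> (\<forall>S\<in>\<S>. int DIM('a) simplex S) \<and> \<Union>\<S> = closure \<Omega> \<and>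
     (\<forall>S\<in>\<S>. \<exists>!T. T \<in> Th \<and> interior S \<subseteq> T) \<and>
     (\<forall>S\<in>\<S>. \<forall>E. E facet_of S \<longrightarrow>
        (\<forall>F\<in>Fh. rel_interior E \<subseteq> F \<or> rel_interior E \<inter> F = {})) \<and>
     (\<forall>S\<in>\<S>. \<rho> * diameter S \<le> inradius S) \<and>
     (\<forall>S\<in>\<S>. \<forall>T\<in>Th. interior S \<subseteq> T \<longrightarrow> \<rho> * diameter T \<le> diameter S)"

definition regular_convex_mesh ::
  "real \<Rightarrow> 'a::euclidean_space set \<Rightarrow> 'a set set \<Rightarrow> 'a set set \<Rightarrow> bool" where
  "regular_convex_mesh \<rho> \<Omega> Th Fh \<longleftrightarrow>
     finite Th \<and> (\<forall>T\<in>Th. open_convex_polytope T) \<and> pairwise disjnt Th \<and>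
     (\<Union>T\<in>Th. closure T) = closure \<Omega> \<and>
     finite Fh \<and> (\<forall>F\<in>Fh. planar_face F) \<and> pairwise disjnt Fh \<and>
     (\<Union>F\<in>Fh. closure F) = (\<Union>T\<in>Th. frontier T) \<and>
     (\<forall>F\<in>Fh. (\<exists>T1\<in>Th. \<exists>T2\<in>Th. T1 \<noteq> T2 \<and> F \<subseteq> frontier T1 \<inter> frontier T2) \<or>
              (\<exists>T\<in>Th. F \<subseteq> frontier T \<inter> frontier \<Omega>)) \<and>
     (\<exists>\<S>. regular_submesh \<rho> \<Omega> Th Fh \<S>)"

definition mesh_size :: "'a::euclidean_space set set \<Rightarrow> real" where
  "mesh_size Th = Max (diameter ` Th)"

definition quasi_uniform :: "real \<Rightarrow> 'a::euclidean_space set set \<Rightarrow> bool" where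
  "quasi_uniform C Th \<longleftrightarrow> (\<forall>T\<in>Th. mesh_size Th \<le> C * diameter T)"

definition faces_of :: "'a::euclidean_space set set \<Rightarrow> 'a set \<Rightarrow> 'a set set" where
  "faces_of Fh T = {F \<in> Fh. F \<subseteq> frontier T}"

text \<open>The outward unit normal to the open convex set \<open>T\<close> on a face in its boundary.\<close>

definition outward_normal :: "'a::euclidean_space set \<Rightarrow> 'a set \<Rightarrow> 'a" where
  "outward_normal T F = (THE n. norm n = 1 \<and> (\<forall>x\<in>F. \<forall>y\<in>T. n \<bullet> (y - x) \<le> 0))"

section \<open>Projectors and standing assumptions\<close>

text \<open>A polynomial on an element \<open>T\<close> (a nonempty open set) is identified with the polynomial on
  the whole space that extends it.\<close>

definition elem_proj :: "nat \<Rightarrow> 'a::euclidean_space set \<Rightarrow> ('a \<Rightarrow> real) \<Rightarrow> 'a \<Rightarrow> real" where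
  "elem_proj k T v = (THE p. p \<in> polys k \<and>
     (\<forall>q\<in>polys k. l2_inner (lebesgue_on T) p q = l2_inner (lebesgue_on T) v q))"

definition faces_proj :: "nat \<Rightarrow> 'a::euclidean_space set set \<Rightarrow> ('a \<Rightarrow> real) \<Rightarrow> 'a \<Rightarrow> real" where
  "faces_proj k Fs g = (SOME \<mu>. \<mu> \<in> face_polys k Fs \<and>
     (\<forall>\<nu>\<in>face_polys k Fs. faces_inner Fs \<mu> \<nu> = faces_inner Fs g \<nu>))"

definition approximation_property ::
  "(nat \<Rightarrow> real) \<Rightarrow> 'a::euclidean_space set \<Rightarrow> 'a set set \<Rightarrow> bool" where
  "approximation_property C T Fs \<longleftrightarrow>
     (\<forall>k\<ge>1. \<forall>m\<in>{1..k+1}. \<forall>v\<in>sobolev m T.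
        faces_norm Fs (\<lambda>x. trace_on T Fs v x - elem_proj k T v x)
          \<le> C m * (diameter T / real k) powr (real m - 1/2) * sobolev_norm m T v \<and>
        faces_norm Fs (\<lambda>x. trace_on T Fs v x - elem_proj k T v x)
          \<le> C m * (diameter T / real k) powr (1/2) * l2_norm (lebesgue_on T) (weak_grad T v))"

definition elliptic_regularity :: "real \<Rightarrow> 'a::euclidean_space set \<Rightarrow> bool" where
  "elliptic_regularity C D \<longleftrightarrow>
     (\<forall>g w. sq_integrable (lebesgue_on D) g \<and> poisson_solution D g w \<longrightarrow>
        w \<in> sobolev 2 D \<and> sobolev_norm 2 D w \<le> C * l2_norm (lebesgue_on D) g)"

section \<open>Local HHO operators\<close>

text \<open>Here \<open>Fs\<close> is the set of the mesh faces on the boundary of the element \<open>T\<close>.\<close>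

fun grad_rec :: "nat \<Rightarrow> 'a::euclidean_space set \<Rightarrow> 'a set set \<Rightarrow>
    ('a \<Rightarrow> real) \<times> ('a \<Rightarrow> real) \<Rightarrow> 'a \<Rightarrow> 'a" where
  "grad_rec k T Fs (v, \<nu>) = (THE G. G \<in> vec_polys k \<and> (\<forall>\<tau>\<in>vec_polys k.
     l2_inner (lebesgue_on T) G \<tau> = l2_inner (lebesgue_on T) (grad v) \<tau> +
       (\<Sum>F\<in>Fs. l2_inner (face_measure F) (\<lambda>x. \<nu> x - v x) (\<lambda>x. \<tau> x \<bullet> outward_normal T F))))"

fun pot_rec :: "nat \<Rightarrow> 'a::euclidean_space set \<Rightarrow> 'a set set \<Rightarrow>
    ('a \<Rightarrow> real) \<times> ('a \<Rightarrow> real) \<Rightarrow> 'a \<Rightarrow> real" where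
  "pot_rec k T Fs (v, \<nu>) = (THE p. p \<in> polys (k+1) \<and>
     (\<forall>w\<in>polys (k+1). l2_inner (lebesgue_on T) (grad p) (grad w) =
        l2_inner (lebesgue_on T) (grad_rec k T Fs (v, \<nu>)) (grad w)) \<and>
     (\<integral>x. p x \<partial>lebesgue_on T) = (\<integral>x. v x \<partial>lebesgue_on T))"

definition delta_elem :: "nat \<Rightarrow> 'a::euclidean_space set \<Rightarrow> 'a set set \<Rightarrow>
    ('a \<Rightarrow> real) \<times> ('a \<Rightarrow> real) \<Rightarrow> 'a \<Rightarrow> real" where
  "delta_elem k T Fs v x = fst v x - elem_proj k T (pot_rec k T Fs v) x"

definition delta_faces :: "nat \<Rightarrow> 'a::euclidean_space set \<Rightarrow> 'a set set \<Rightarrow>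
    ('a \<Rightarrow> real) \<times> ('a \<Rightarrow> real) \<Rightarrow> 'a \<Rightarrow> real" where
  "delta_faces k T Fs v x = snd v x - faces_proj k Fs (pot_rec k T Fs v) x"

definition stab_form :: "nat \<Rightarrow> 'a::euclidean_space set \<Rightarrow> 'a set set \<Rightarrow>
    ('a \<Rightarrow> real) \<times> ('a \<Rightarrow> real) \<Rightarrow> ('a \<Rightarrow> real) \<times> ('a \<Rightarrow> real) \<Rightarrow> real" where
  "stab_form k T Fs u v = real k / diameter T *
     faces_inner Fs (\<lambda>x. delta_faces k T Fs u x - delta_elem k T Fs u x)
                    (\<lambda>x. delta_faces k T Fs v x - delta_elem k T Fs v x)"

definition local_form :: "nat \<Rightarrow> 'a::euclidean_space set \<Rightarrow> 'a set set \<Rightarrow>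
    ('a \<Rightarrow> real) \<times> ('a \<Rightarrow> real) \<Rightarrow> ('a \<Rightarrow> real) \<times> ('a \<Rightarrow> real) \<Rightarrow> real" where
  "local_form k T Fs u v =
     l2_inner (lebesgue_on T) (grad_rec k T Fs u) (grad_rec k T Fs v) + stab_form k T Fs u v"

definition local_lift :: "nat \<Rightarrow> 'a::euclidean_space set \<Rightarrow> 'a set set \<Rightarrow>
    ('a \<Rightarrow> real) \<Rightarrow> 'a \<Rightarrow> real" where
  "local_lift k T Fs \<mu> = (THE w. w \<in> polys k \<and> (\<forall>v\<in>polys k.
     local_form k T Fs (w, \<lambda>_. 0) (v, \<lambda>_. 0) = - local_form k T Fs (\<lambda>_. 0, \<mu>) (v, \<lambda>_. 0)))"

section \<open>Global HHO scheme and static condensation\<close>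

text \<open>A broken polynomial on the elements is given by the family of its element polynomials,
  indexed by the elements, so that its one-sided values on the faces are available.\<close>

definition global_form :: "nat \<Rightarrow> 'a::euclidean_space set set \<Rightarrow> 'a set set \<Rightarrow>
    ('a set \<Rightarrow> 'a \<Rightarrow> real) \<times> ('a \<Rightarrow> real) \<Rightarrow> ('a set \<Rightarrow> 'a \<Rightarrow> real) \<times> ('a \<Rightarrow> real) \<Rightarrow> real" where
  "global_form k Th Fh u v =
     (\<Sum>T\<in>Th. local_form k T (faces_of Fh T) (fst u T, snd u) (fst v T, snd v))"

definition global_lift :: "nat \<Rightarrow> 'a::euclidean_space set set \<Rightarrow> ('a \<Rightarrow> real) \<Rightarrow>
    'a set \<Rightarrow> 'a \<Rightarrow> real" where
  "global_lift k Fh \<mu> T = local_lift k T (faces_of Fh T) \<mu>"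

definition broken_fun :: "'a::euclidean_space set set \<Rightarrow> ('a set \<Rightarrow> 'a \<Rightarrow> real) \<Rightarrow> 'a \<Rightarrow> real" where
  "broken_fun Th v x = (\<Sum>T\<in>Th. indicator T x * v T x)"

definition skeletal_space :: "nat \<Rightarrow> 'a::euclidean_space set \<Rightarrow> 'a set set \<Rightarrow> ('a \<Rightarrow> real) set" where
  "skeletal_space k \<Omega> Fh =
     {\<mu> \<in> face_polys k Fh. \<forall>F\<in>Fh. F \<subseteq> frontier \<Omega> \<longrightarrow> (\<forall>x\<in>F. \<mu> x = 0)}"

definition condensed_form :: "nat \<Rightarrow> 'a::euclidean_space set set \<Rightarrow> 'a set set \<Rightarrow>
    ('a \<Rightarrow> real) \<Rightarrow> ('a \<Rightarrow> real) \<Rightarrow> real" where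
  "condensed_form k Th Fh \<mu> \<nu> =
     global_form k Th Fh (global_lift k Fh \<mu>, \<mu>) (global_lift k Fh \<nu>, \<nu>)"

definition condensed_norm :: "nat \<Rightarrow> 'a::euclidean_space set set \<Rightarrow> 'a set set \<Rightarrow>
    ('a \<Rightarrow> real) \<Rightarrow> real" where
  "condensed_norm k Th Fh \<nu> = sqrt (condensed_form k Th Fh \<nu> \<nu>)"

definition condensed_solution :: "nat \<Rightarrow> 'a::euclidean_space set \<Rightarrow> 'a set set \<Rightarrow> 'a set set \<Rightarrow>
    ('a \<Rightarrow> real) \<Rightarrow> ('a \<Rightarrow> real) \<Rightarrow> bool" where
  "condensed_solution k \<Omega> Th Fh f \<mu> \<longleftrightarrow> \<mu> \<in> skeletal_space k \<Omega> Fh \<and>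
     (\<forall>\<nu>\<in>skeletal_space k \<Omega> Fh. condensed_form k Th Fh \<mu> \<nu> =
        l2_inner (lebesgue_on \<Omega>) f (broken_fun Th (global_lift k Fh \<nu>)))"

end

theory Submission
  imports Defs
begin

text \<open>Write \<open>\<nu> = \<mu>\<^sub>h - \<Pi>u\<close> and \<open>\<Pi>\<^sub>h u = (\<Pi>\<^sub>T u, \<Pi>u)\<close>. Since the lift is orthogonal to pure cell unknowns,
  the squared error is the sum over the elements of \<open>(f, U\<nu>)\<^sub>T - a\<^sub>T(\<Pi>\<^sub>h u, (U\<nu>, \<nu>))\<close>. The gradient
  reconstruction of \<open>\<Pi>\<^sub>h u\<close> is the projection of \<open>\<nabla>u\<close>, so Green's formula, together with the
  cancellation of the fluxes of \<open>\<nabla>u\<close> across interior faces, leaves on each element two terms: the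
  projection error of \<open>\<nabla>u\<close> on the boundary tested with \<open>\<nu> - U\<nu>\<close>, and the stabilization.
  The approximation property, applied to the potential reconstruction, bounds \<open>\<nu> - U\<nu>\<close> by
  \<open>(h/k)\<^sup>1\<^sup>/\<^sup>2\<close> times the energy norm. For the stabilization, let \<open>p\<close> be the potential reconstruction
  of \<open>\<Pi>\<^sub>h u\<close> and \<open>d\<close> the difference of \<open>p\<close> and the elliptic projection of degree \<open>k\<close>. Then
  \<open>p - \<Pi>\<^sub>T p = d - \<Pi>\<^sub>T d\<close>, and \<open>\<parallel>\<nabla>d\<parallel>\<^sup>2 = (u - \<Pi>\<^sub>T u, \<partial>\<^sub>n d)\<close> on the boundary of the element, because the
  Laplacian of \<open>d\<close> has degree less than \<open>k\<close>. A Rellich identity for \<open>d\<close> bounds the normal derivative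
  with the optimal power of \<open>k\<close>, and no inverse inequality is needed. Elliptic regularity on
  \<open>\<Omega>\<close> turns the resulting \<open>H\<^sup>2\<close> norm of \<open>u\<close> into the norm of \<open>f\<close>.\<close>

section \<open>Symmetric positive semidefinite forms\<close>

text \<open>The scale that balances everything is \<open>t\<close>, the square root of h/k. The
  defect of a discrete pair and the projection error of the flux are each of order \<open>t\<close>
  on an element boundary, so their product has order h/k. The stabilization carries the weight
  1/t^2, hence its jump must have order t^3. The critical quantity is \<open>t\<close> times the
  gradient norm of d: duality leaves the boundary norm of grad d, and any bound losing more than the
  factor 1/t would spoil the power of k. The radial field behind the Rellich identity needs a ball
  of radius comparable to h inside the element, which the regular submesh supplies. A second
  obstacle lies in the objects. Traces are limits of restrictions, weak derivatives are arbitrary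
  representatives, and the face measure comes from a prism over the face. Existence and uniqueness
  of traces rest on density of smooth functions and a trace inequality; that inequality and Green's
  formula rest on a divergence theorem for polytopes whose faces may be nonconvex. It is obtained by
  translating the element and counting how a segment crosses its boundary.\<close>

locale semi_inner =
  fixes V :: "'v set" and comb :: "'v \<Rightarrow> real \<Rightarrow> 'v \<Rightarrow> 'v" and B :: "'v \<Rightarrow> 'v \<Rightarrow> real"
  assumes comb_closed: "u \<in> V \<Longrightarrow> v \<in> V \<Longrightarrow> comb u c v \<in> V"
    and form_comb: "u \<in> V \<Longrightarrow> v \<in> V \<Longrightarrow> w \<in> V \<Longrightarrow> B (comb u c v) w = B u w + c * B v w"
    and form_commute: "u \<in> V \<Longrightarrow> v \<in> V \<Longrightarrow> B u v = B v u"
    and form_nonneg: "u \<in> V \<Longrightarrow> 0 \<le> B u u"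
begin

lemma form_comb_right: "u \<in> V \<Longrightarrow> v \<in> V \<Longrightarrow> w \<in> V \<Longrightarrow> B w (comb u c v) = B w u + c * B w v"
  using form_comb form_commute comb_closed by metis

lemma form_comb_self:
  assumes "u \<in> V" "v \<in> V"
  shows "B (comb u c v) (comb u c v) = B u u + 2 * c * B u v + c\<^sup>2 * B v v"
  using assms form_commute[OF assms]
  by (simp add: form_comb form_comb_right comb_closed algebra_simps power2_eq_square)

lemma cauchy_schwarz:
  assumes "u \<in> V" "v \<in> V"
  shows "\<bar>B u v\<bar> \<le> sqrt (B u u) * sqrt (B v v)"
proof -
  have q: "0 \<le> B u u + 2 * c * B u v + c\<^sup>2 * B v v" for c
    using form_nonneg[OF comb_closed[OF assms, of c]] form_comb_self[OF assms] by simp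
  have "(B u v)\<^sup>2 \<le> B u u * B v v"
  proof (cases "B v v = 0")
    case True
    have "B u v = 0"
    proof (rule ccontr)
      assume "B u v \<noteq> 0"
      \<comment> \<open>For \<open>B v v = 0\<close> the quadratic is affine in \<open>c\<close>,
        and this value of \<open>c\<close> makes it equal to -1.\<close>
      then show False using q[of "- (B u u + 1) / (2 * B u v)"] True by (simp add: field_simps)
    qed
    then show ?thesis using True by simp
  next
    case False
    then have pos: "0 < B v v" using form_nonneg[OF assms(2)] by simp
    have "0 \<le> B u u - (B u v)\<^sup>2 / B v v"
      using q[of "- B u v / B v v"] pos by (simp add: power2_eq_square field_simps)
    then show ?thesis using pos by (simp add: field_simps)
  qed
  then have "sqrt ((B u v)\<^sup>2) \<le> sqrt (B u u * B v v)" by (rule real_sqrt_le_mono)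
  then show ?thesis by (simp add: real_sqrt_mult)
qed

lemma null_form: "u \<in> V \<Longrightarrow> v \<in> V \<Longrightarrow> B v v = 0 \<Longrightarrow> B u v = 0"
  using cauchy_schwarz[of u v] by simp

lemma triangle:
  assumes "u \<in> V" "v \<in> V"
  shows "sqrt (B (comb u c v) (comb u c v)) \<le> sqrt (B u u) + \<bar>c\<bar> * sqrt (B v v)"
proof -
  have "c * B u v \<le> \<bar>c\<bar> * (sqrt (B u u) * sqrt (B v v))"
    using cauchy_schwarz[OF assms]
    by (metis abs_ge_self abs_mult mult_left_mono abs_ge_zero order_trans)
  then have "B (comb u c v) (comb u c v) \<le> (sqrt (B u u) + \<bar>c\<bar> * sqrt (B v v))\<^sup>2"
    using form_nonneg[OF assms(1)] form_nonneg[OF assms(2)]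
    by (simp add: form_comb_self assms power2_sum power_mult_distrib mult_ac)
  then show ?thesis
    by (intro real_le_lsqrt) (auto intro!: add_nonneg_nonneg mult_nonneg_nonneg form_nonneg assms)
qed

end

definition fspan :: "('i \<Rightarrow> 'x \<Rightarrow> real) \<Rightarrow> 'i set \<Rightarrow> ('x \<Rightarrow> real) set" where
  "fspan m I = range (\<lambda>c x. \<Sum>a\<in>I. c a * m a x)"

lemma fspan_comb:
  assumes "u \<in> fspan m I" "v \<in> fspan m I" shows "(\<lambda>x. u x + t * v x) \<in> fspan m I"
proof -
  obtain c d where "u = (\<lambda>x. \<Sum>a\<in>I. c a * m a x)" "v = (\<lambda>x. \<Sum>a\<in>I. d a * m a x)"
    using assms by (auto simp: fspan_def)
  then have "(\<lambda>x. u x + t * v x) = (\<lambda>x. \<Sum>a\<in>I. (c a + t * d a) * m a x)"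
    by (simp add: sum.distrib sum_distrib_left algebra_simps)
  then show ?thesis unfolding fspan_def by auto
qed

lemma fspan_zero: "(\<lambda>_. 0) \<in> fspan m I"
  unfolding fspan_def by (rule range_eqI[of _ _ "\<lambda>_. 0"]) simp

lemma fspan_insert:
  assumes "finite I" "a \<notin> I"
  shows "fspan m (insert a I) = {\<lambda>x. u x + t * m a x |u t. u \<in> fspan m I}"
proof (intro set_eqI iffI)
  fix v assume "v \<in> {\<lambda>x. u x + t * m a x |u t. u \<in> fspan m I}"
  then obtain c t where v: "v = (\<lambda>x. (\<Sum>b\<in>I. c b * m b x) + t * m a x)" by (auto simp: fspan_def)
  have "(\<Sum>b\<in>I. (c(a := t)) b * m b x) = (\<Sum>b\<in>I. c b * m b x)" for x
    using assms by (intro sum.cong) auto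
  then show "v \<in> fspan m (insert a I)"
    using assms unfolding fspan_def v by (intro range_eqI[of _ _ "c(a := t)"]) (simp add: add.commute)
qed (use assms in \<open>force simp: fspan_def add.commute\<close>)

text \<open>Only vanishing of the functional on the null space of the form is needed, which is what the
  potential reconstruction requires, its form being degenerate on constants.\<close>

lemma fspan_riesz:
  assumes "finite I" "semi_inner (fspan m I) (\<lambda>u c v x. u x + c * v x) B"
    and "\<And>u v c. u \<in> fspan m I \<Longrightarrow> v \<in> fspan m I \<Longrightarrow> l (\<lambda>x. u x + c * v x) = l u + c * l v"
    and "\<And>u. u \<in> fspan m I \<Longrightarrow> B u u = 0 \<Longrightarrow> l u = 0"
  shows "\<exists>u\<in>fspan m I. \<forall>v\<in>fspan m I. B u v = l v"
  using assms
proof (induction I arbitrary: l)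
  case empty
  interpret semi_inner "fspan m {}" "\<lambda>u c v x. u x + c * v x" B by fact
  have "B (\<lambda>_. 0) (\<lambda>_. 0) = B (\<lambda>_. 0) (\<lambda>_. 0) + B (\<lambda>_. 0) (\<lambda>_. 0)"
    using form_comb[of "\<lambda>_. 0" "\<lambda>_. 0" "\<lambda>_. 0" 1] fspan_zero[of m "{}"] by simp
  then show ?case using empty(3)[of "\<lambda>_. 0"] by (simp add: fspan_def)
next
  case (insert a I)
  let ?b = "m a" and ?V = "fspan m (insert a I)" and ?c = "\<lambda>u c v x. u x + c * v x"
  interpret semi_inner ?V ?c B by fact
  note span = fspan_insert[OF insert.hyps, of m]
  have sub: "u \<in> ?V" if "u \<in> fspan m I" for u
    unfolding span using that by (auto intro!: exI[of _ u] exI[of _ 0])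
  have bV: "?b \<in> ?V"
    unfolding span using fspan_zero[of m I] by (auto intro!: exI[of _ "\<lambda>_. 0"] exI[of _ 1])
  have sb: "semi_inner (fspan m I) ?c B"
    by unfold_locales (use form_comb form_commute form_nonneg sub in \<open>auto intro: fspan_comb\<close>)
  \<comment> \<open>Gram-Schmidt: \<open>p\<close> is the projection of the new generator onto the
    old span, so that \<open>e\<close> below is orthogonal to that span.\<close>
  have "\<exists>u\<in>fspan m I. \<forall>v\<in>fspan m I. B u v = B ?b v"
    by (rule insert.IH[OF sb]) (use form_comb_right null_form sub bV in auto)
  then obtain p where p: "p \<in> fspan m I" "\<And>v. v \<in> fspan m I \<Longrightarrow> B p v = B ?b v" by auto
  have "\<exists>u\<in>fspan m I. \<forall>v\<in>fspan m I. B u v = l v"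
    by (rule insert.IH[OF sb]) (use insert.prems(2,3) sub in auto)
  then obtain u where u: "u \<in> fspan m I" "\<And>v. v \<in> fspan m I \<Longrightarrow> B u v = l v" by auto
  define e where "e = ?c ?b (-1) p"
  have eV: "e \<in> ?V" unfolding e_def by (intro comb_closed bV sub p)
  have e_perp: "B e v = 0" if "v \<in> fspan m I" for v
    using form_comb[OF bV sub[OF p(1)] sub[OF that], of "-1"] p(2)[OF that] by (simp add: e_def)
  \<comment> \<open>If \<open>B e e = 0\<close>, division yields \<open>t = 0\<close>, and the
    identity below still holds because \<open>l\<close> vanishes on null vectors.\<close>
  define t where "t = l e / B e e"
  have t: "t * B e e = l e"
    using insert.prems(3)[OF eV] by (auto simp: t_def)
  define w where "w = ?c u t e"
  have wV: "w \<in> ?V" unfolding w_def by (intro comb_closed sub u eV)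
  have "B w v = l v" if "v \<in> ?V" for v
  proof -
    from that obtain v' s where v: "v = ?c v' s ?b" and v': "v' \<in> fspan m I" unfolding span by auto
    define v0 where "v0 = ?c v' s p"
    have v0: "v0 \<in> fspan m I" unfolding v0_def by (intro fspan_comb v' p)
    have ve: "v = ?c v0 s e" by (auto simp: v v0_def e_def algebra_simps)
    have 1: "B u e = 0" using form_commute[OF sub[OF u(1)] eV] e_perp[OF u(1)] by simp
    have "B w v = B u v + t * B e v"
      unfolding w_def by (rule form_comb[OF sub[OF u(1)] eV that])
    moreover have "B u v = B u v0 + s * B u e"
      unfolding ve by (rule form_comb_right[OF sub[OF v0] eV sub[OF u(1)]])
    moreover have "B e v = B e v0 + s * B e e"
      unfolding ve by (rule form_comb_right[OF sub[OF v0] eV eV])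
    moreover have "l v = l v0 + s * l e"
      unfolding ve by (rule insert.prems(2)[OF sub[OF v0] eV])
    ultimately show ?thesis
      using u(2)[OF v0] e_perp[OF v0] 1 t by (simp add: algebra_simps)
  qed
  then show ?case using wV by blast
qed

section \<open>Square-integrable functions\<close>

text \<open>Vector-valued version of \<open>sq_integrable\<close>, with which it agrees on real
  functions; gradients and scalars then share one Hilbert space calculus.\<close>

definition sqi :: "'a measure \<Rightarrow> ('a \<Rightarrow> 'b::euclidean_space) \<Rightarrow> bool" where
  "sqi M f \<longleftrightarrow> f \<in> borel_measurable M \<and> integrable M (\<lambda>x. f x \<bullet> f x)"

abbreviation "sqi_on D \<equiv> sqi (lebesgue_on D)"
abbreviation "inner_on D \<equiv> l2_inner (lebesgue_on D)"
abbreviation "norm_on D \<equiv> l2_norm (lebesgue_on D)"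
abbreviation "face_sqi F \<equiv> sqi (face_measure F)"
abbreviation "face_inner F \<equiv> l2_inner (face_measure F)"
abbreviation "face_norm F \<equiv> l2_norm (face_measure F)"

lemma sq_integrable_eq_sqi: "sq_integrable M = sqi M"
  by (auto simp: sq_integrable_def sqi_def power2_eq_square fun_eq_iff)

lemma sqi_measurable: "sqi M f \<Longrightarrow> f \<in> borel_measurable M"
  by (simp add: sqi_def)

lemma sqi_inner:
  assumes "sqi M f" "sqi M g"
  shows "integrable M (\<lambda>x. f x \<bullet> g x)"
proof (rule Bochner_Integration.integrable_bound)
  show "integrable M (\<lambda>x. f x \<bullet> f x + g x \<bullet> g x)"
    using assms by (auto simp: sqi_def)
  show "(\<lambda>x. f x \<bullet> g x) \<in> borel_measurable M"
    using assms by (auto simp: sqi_def)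
  have "\<bar>a \<bullet> b\<bar> \<le> a \<bullet> a + b \<bullet> b" for a b :: 'b
  proof -
    have "\<bar>a \<bullet> b\<bar> \<le> norm a * norm b" by (rule Cauchy_Schwarz_ineq2)
    also have "\<dots> \<le> (norm a)\<^sup>2 + (norm b)\<^sup>2"
      using sum_squares_bound[of "norm a" "norm b"] zero_le_power2[of "norm a"] zero_le_power2[of "norm b"]
        mult_nonneg_nonneg[OF norm_ge_zero[of a] norm_ge_zero[of b]] by linarith
    finally show ?thesis by (simp add: power2_norm_eq_inner)
  qed
  then show "AE x in M. norm (f x \<bullet> g x) \<le> norm (f x \<bullet> f x + g x \<bullet> g x)"
    by (auto simp: abs_of_nonneg)
qed

lemma sqi_mult:
  fixes f g :: "'a \<Rightarrow> real"
  shows "sqi M f \<Longrightarrow> sqi M g \<Longrightarrow> integrable M (\<lambda>x. f x * g x)"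
  using sqi_inner[of M f g] by simp

lemma sqi_comb:
  assumes "sqi M f" "sqi M g"
  shows "sqi M (\<lambda>x. f x + c *\<^sub>R g x)"
proof -
  have "integrable M (\<lambda>x. f x \<bullet> f x + 2 * c * (f x \<bullet> g x) + c\<^sup>2 * (g x \<bullet> g x))"
    using assms sqi_inner[OF assms] by (auto simp: sqi_def)
  also have "(\<lambda>x. f x \<bullet> f x + 2 * c * (f x \<bullet> g x) + c\<^sup>2 * (g x \<bullet> g x)) =
      (\<lambda>x. (f x + c *\<^sub>R g x) \<bullet> (f x + c *\<^sub>R g x))"
    by (auto simp: inner_add_left inner_add_right inner_commute power2_eq_square)
  finally show ?thesis
    using assms by (auto simp: sqi_def)
qed

lemma sqi_zero: "sqi M (\<lambda>_. 0)"
  by (simp add: sqi_def)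

lemma sqi_add: "sqi M f \<Longrightarrow> sqi M g \<Longrightarrow> sqi M (\<lambda>x. f x + g x)"
  using sqi_comb[of M f g 1] by simp

lemma sqi_diff: "sqi M f \<Longrightarrow> sqi M g \<Longrightarrow> sqi M (\<lambda>x. f x - g x)"
  using sqi_comb[of M f g "-1"] by simp

lemma sqi_scaleR: "sqi M f \<Longrightarrow> sqi M (\<lambda>x. c *\<^sub>R f x)"
  using sqi_comb[of M "\<lambda>_. 0" f c] by (simp add: sqi_zero)

lemma sqi_sum: "(\<And>i. i \<in> I \<Longrightarrow> sqi M (f i)) \<Longrightarrow> sqi M (\<lambda>x. \<Sum>i\<in>I. f i x)"
  by (induction I rule: infinite_finite_induct) (auto simp: sqi_zero sqi_add)

lemma sqi_cong_AE:
  assumes "sqi M f" "g \<in> borel_measurable M" "AE x in M. f x = g x"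
  shows "sqi M g"
proof -
  have "integrable M (\<lambda>x. g x \<bullet> g x) \<longleftrightarrow> integrable M (\<lambda>x. f x \<bullet> f x)"
    using assms by (intro integrable_cong_AE) (auto simp: sqi_def)
  then show ?thesis using assms by (auto simp: sqi_def)
qed

lemma sqi_cong: "(\<And>x. x \<in> space M \<Longrightarrow> f x = g x) \<Longrightarrow> sqi M f \<longleftrightarrow> sqi M g"
  by (auto simp: sqi_def cong: measurable_cong Bochner_Integration.integrable_cong)

lemma sqi_bounded:
  fixes f :: "'a \<Rightarrow> 'b::euclidean_space"
  assumes "finite_measure M" "f \<in> borel_measurable M" "\<And>x. x \<in> space M \<Longrightarrow> norm (f x) \<le> C"
  shows "sqi M f"
proof -
  interpret finite_measure M by fact
  have "norm (f x \<bullet> f x) \<le> C * C" if "x \<in> space M" for x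
    using mult_mono[OF assms(3)[OF that] assms(3)[OF that]] order_trans[OF norm_ge_zero assms(3)[OF that]]
    by (simp add: dot_square_norm power2_eq_square)
  then have "integrable M (\<lambda>x. f x \<bullet> f x)"
    using assms(2) by (intro integrable_const_bound[where B = "C * C"]) auto
  then show ?thesis using assms by (simp add: sqi_def)
qed

lemma l2_inner_commute: "l2_inner M f g = l2_inner M g f"
  by (simp add: l2_inner_def inner_commute)

lemma l2_inner_comb:
  "sqi M f \<Longrightarrow> sqi M g \<Longrightarrow> sqi M h \<Longrightarrow> l2_inner M (\<lambda>x. f x + c *\<^sub>R g x) h = l2_inner M f h + c * l2_inner M g h"
  by (simp add: l2_inner_def inner_add_left sqi_inner)

lemma l2_inner_nonneg: "0 \<le> l2_inner M f f"
  by (simp add: l2_inner_def)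

lemma semi_inner_l2: "semi_inner {f. sqi M f} (\<lambda>u c v x. u x + c *\<^sub>R v x) (l2_inner M)"
  by unfold_locales (auto simp: sqi_comb l2_inner_comb l2_inner_nonneg intro: l2_inner_commute)

lemma l2_norm_nonneg: "0 \<le> l2_norm M f"
  by (simp add: l2_norm_def l2_inner_nonneg)

lemma l2_norm_sq: "(l2_norm M f)\<^sup>2 = l2_inner M f f"
  by (simp add: l2_norm_def l2_inner_nonneg)

lemma l2_cauchy_schwarz: "sqi M f \<Longrightarrow> sqi M g \<Longrightarrow> \<bar>l2_inner M f g\<bar> \<le> l2_norm M f * l2_norm M g"
  unfolding l2_norm_def by (rule semi_inner.cauchy_schwarz[OF semi_inner_l2]) auto

lemma l2_triangle: "sqi M f \<Longrightarrow> sqi M g \<Longrightarrow> l2_norm M (\<lambda>x. f x + g x) \<le> l2_norm M f + l2_norm M g"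
  using semi_inner.triangle[OF semi_inner_l2, of f M g 1] by (simp add: l2_norm_def)

lemma l2_norm_minus: "l2_norm M (\<lambda>x. - f x) = l2_norm M f"
  by (simp add: l2_norm_def l2_inner_def)

lemma l2_norm_minus_commute: "l2_norm M (\<lambda>x. f x - g x) = l2_norm M (\<lambda>x. g x - f x)"
  using l2_norm_minus[of M "\<lambda>x. f x - g x"] by simp

lemma l2_triangle_between:
  "sqi M f \<Longrightarrow> sqi M g \<Longrightarrow> sqi M h \<Longrightarrow>
    l2_norm M (\<lambda>x. f x - h x) \<le> l2_norm M (\<lambda>x. f x - g x) + l2_norm M (\<lambda>x. g x - h x)"
  using l2_triangle[of M "\<lambda>x. f x - g x" "\<lambda>x. g x - h x"] by (simp add: sqi_diff)

lemma l2_inner_cong_AE: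
  assumes "sqi M f" "sqi M f'" "sqi M g" "sqi M g'" "AE x in M. f x = f' x" "AE x in M. g x = g' x"
  shows "l2_inner M f g = l2_inner M f' g'"
  unfolding l2_inner_def
  by (rule integral_cong_AE) (use assms in \<open>auto simp: sqi_def\<close>)

lemma l2_norm_cong_AE:
  "sqi M f \<Longrightarrow> sqi M f' \<Longrightarrow> AE x in M. f x = f' x \<Longrightarrow> l2_norm M f = l2_norm M f'"
  unfolding l2_norm_def using l2_inner_cong_AE[of M f f' f f'] by simp

lemma l2_norm_cong: "(\<And>x. x \<in> space M \<Longrightarrow> f x = f' x) \<Longrightarrow> l2_norm M f = l2_norm M f'"
  unfolding l2_norm_def l2_inner_def by (auto intro!: Bochner_Integration.integral_cong arg_cong[of _ _ sqrt])

lemma l2_inner_diff_left: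
  "sqi M f \<Longrightarrow> sqi M g \<Longrightarrow> sqi M h \<Longrightarrow> l2_inner M (\<lambda>x. f x - g x) h = l2_inner M f h - l2_inner M g h"
  using l2_inner_comb[of M f g h "-1"] by simp

lemma l2_inner_diff_right:
  "sqi M f \<Longrightarrow> sqi M g \<Longrightarrow> sqi M h \<Longrightarrow> l2_inner M h (\<lambda>x. f x - g x) = l2_inner M h f - l2_inner M h g"
  using l2_inner_diff_left[of M f g h] by (simp add: l2_inner_commute)

lemma l2_norm_eq_0_AE:
  assumes "sqi M f" shows "l2_norm M f = 0 \<longleftrightarrow> (AE x in M. f x = 0)"
proof -
  have "l2_norm M f = 0 \<longleftrightarrow> (\<integral>x. f x \<bullet> f x \<partial>M) = 0"
    by (simp add: l2_norm_def l2_inner_def)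
  also have "\<dots> \<longleftrightarrow> (AE x in M. f x \<bullet> f x = 0)"
    using assms by (intro integral_nonneg_eq_0_iff_AE) (auto simp: sqi_def)
  finally show ?thesis by simp
qed

text \<open>This is how identities proved for smooth functions, Green's formula in particular, pass
  to Sobolev functions and their traces.\<close>

lemma l2_inner_continuous:
  assumes "sqi M f" "\<And>n. sqi M (p n)" "sqi M g" "(\<lambda>n. l2_norm M (\<lambda>x. f x - p n x)) \<longlonglongrightarrow> 0"
  shows "(\<lambda>n. l2_inner M (p n) g) \<longlonglongrightarrow> l2_inner M f g"
proof -
  have "(\<lambda>n. l2_inner M f g - l2_inner M (p n) g) \<longlonglongrightarrow> 0"
  proof (rule Lim_null_comparison)
    show "\<forall>\<^sub>F n in sequentially. norm (l2_inner M f g - l2_inner M (p n) g)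
        \<le> l2_norm M (\<lambda>x. f x - p n x) * l2_norm M g"
      using l2_cauchy_schwarz[OF sqi_diff[OF assms(1,2)] assms(3)]
      by (simp add: l2_inner_diff_left assms)
    show "(\<lambda>n. l2_norm M (\<lambda>x. f x - p n x) * l2_norm M g) \<longlonglongrightarrow> 0"
      using tendsto_mult_left_zero[OF assms(4)] .
  qed
  from tendsto_diff[OF tendsto_const[of "l2_inner M f g"] this] show ?thesis by simp
qed

lemma l2_norm_nn:
  fixes f :: "'a \<Rightarrow> real"
  assumes "sqi M f" shows "ennreal ((l2_norm M f)\<^sup>2) = (\<integral>\<^sup>+x. ennreal ((f x)\<^sup>2) \<partial>M)"
  unfolding l2_norm_sq l2_inner_def
  using assms by (subst nn_integral_eq_integral) (auto simp: sqi_def power2_eq_square)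

lemma l2_dominated:
  fixes f :: "nat \<Rightarrow> 'a \<Rightarrow> real"
  assumes "\<And>n. f n \<in> borel_measurable M" "sqi M h" "AE x in M. (\<lambda>n. f n x) \<longlonglongrightarrow> 0" "\<And>n x. \<bar>f n x\<bar> \<le> \<bar>h x\<bar>"
  shows "(\<lambda>n. l2_norm M (f n)) \<longlonglongrightarrow> 0"
proof -
  have "(\<lambda>n. \<integral>x. f n x * f n x \<partial>M) \<longlonglongrightarrow> (\<integral>x. 0 \<partial>M)"
  proof (rule integral_dominated_convergence[where w = "\<lambda>x. h x * h x"])
    show "integrable M (\<lambda>x. h x * h x)" using assms(2) by (simp add: sqi_def)
    show "AE x in M. (\<lambda>n. f n x * f n x) \<longlonglongrightarrow> 0"
      using assms(3) by eventually_elim (auto intro: tendsto_mult_zero)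
    show "AE x in M. norm (f n x * f n x) \<le> h x * h x" for n
      using assms(4) by (simp add: abs_le_square_iff flip: power2_eq_square)
  qed (use assms(1) in auto)
  then have "(\<lambda>n. l2_norm M (f n)) \<longlonglongrightarrow> sqrt 0"
    unfolding l2_norm_def l2_inner_def inner_real_def by (intro tendsto_real_sqrt) simp
  then show ?thesis by simp
qed

section \<open>Smooth functions\<close>

lemma pdiff_eq: "(f has_derivative f') (at x) \<Longrightarrow> pdiff i f x = f' i"
  unfolding pdiff_def using frechet_derivative_at by metis

text \<open>Smoothness quantifies over all finite lists of partial derivatives, so it is proved by
  an invariant: a class of differentiable functions stable under partial differentiation.\<close>

lemma smoothI:
  assumes "f \<in> S"
    and "\<And>f x. f \<in> S \<Longrightarrow> f differentiable (at x)"
    and "\<And>f i. f \<in> S \<Longrightarrow> i \<in> Basis \<Longrightarrow> pdiff i f \<in> S"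
  shows "smooth f"
proof -
  have "foldr pdiff is f \<in> S" if "set is \<subseteq> Basis" for "is"
    using that by (induction "is") (auto intro: assms)
  then show ?thesis unfolding smooth_def using assms(2) by blast
qed

lemma smooth_differentiable: "smooth f \<Longrightarrow> f differentiable (at x)"
  unfolding smooth_def by (metis empty_subsetI foldr_Nil id_apply list.set(1))

lemma smooth_pdiff:
  assumes "smooth f" "i \<in> Basis" shows "smooth (pdiff i f)"
  unfolding smooth_def
proof (intro allI impI)
  fix "is" :: "'a list" and x assume "set is \<subseteq> Basis"
  then have "set (is @ [i]) \<subseteq> Basis" using assms by auto
  then have "foldr pdiff (is @ [i]) f differentiable (at x)"
    using assms(1) unfolding smooth_def by blast
  then show "foldr pdiff is (pdiff i f) differentiable (at x)" by simp
qed

lemma grad_inner: "i \<in> Basis \<Longrightarrow> grad f x \<bullet> i = pdiff i f x"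
  unfolding grad_def by (simp add: inner_sum_left inner_Basis if_distrib sum.delta cong: if_cong)

lemma differentiable_has_grad:
  assumes "f differentiable (at x)"
  shows "(f has_derivative (\<lambda>h. grad f x \<bullet> h)) (at x)"
proof -
  let ?D = "frechet_derivative f (at x)"
  have D: "(f has_derivative ?D) (at x)" using assms by (simp add: frechet_derivative_works)
  then have lin: "linear ?D" by (rule has_derivative_linear)
  have "?D = (\<lambda>h. grad f x \<bullet> h)"
  proof
    fix h :: 'a
    have "?D h = ?D (\<Sum>i\<in>Basis. (h \<bullet> i) *\<^sub>R i)" by (simp add: euclidean_representation)
    also have "\<dots> = (\<Sum>i\<in>Basis. (h \<bullet> i) * ?D i)"
      by (simp add: linear_sum[OF lin] linear_scale[OF lin] del: euclidean_representation)
    also have "\<dots> = grad f x \<bullet> h"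
      by (simp add: grad_def pdiff_def inner_sum_left inner_commute[of h] mult.commute)
    finally show "?D h = grad f x \<bullet> h" .
  qed
  then show ?thesis using D by simp
qed

lemma smooth_has_derivative: "smooth f \<Longrightarrow> (f has_derivative (\<lambda>h. grad f x \<bullet> h)) (at x)"
  by (intro differentiable_has_grad smooth_differentiable)

lemma smooth_continuous: "smooth f \<Longrightarrow> continuous_on S f"
  by (meson continuous_at_imp_continuous_on differentiable_imp_continuous_within smooth_differentiable)

lemma smooth_continuous_grad: "smooth f \<Longrightarrow> continuous_on S (grad f)"
  unfolding grad_def[abs_def] by (intro continuous_intros smooth_continuous smooth_pdiff)

lemma smooth_measurable [measurable]: "smooth f \<Longrightarrow> f \<in> borel_measurable borel"
  by (intro borel_measurable_continuous_onI smooth_continuous)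

lemma pdiff_add:
  "f differentiable (at x) \<Longrightarrow> g differentiable (at x) \<Longrightarrow> pdiff i (\<lambda>x. f x + g x) x = pdiff i f x + pdiff i g x"
  using pdiff_eq[OF has_derivative_add[OF differentiable_has_grad[of f x] differentiable_has_grad[of g x]]]
    pdiff_eq[OF differentiable_has_grad[of f x]] pdiff_eq[OF differentiable_has_grad[of g x]] by metis

lemma pdiff_mult:
  assumes "f differentiable (at x)" "g differentiable (at x)"
  shows "pdiff i (\<lambda>x. f x * g x) x = pdiff i f x * g x + f x * pdiff i g x"
  using pdiff_eq[OF has_derivative_mult[OF assms[THEN differentiable_has_grad]], of i]
    pdiff_eq[OF differentiable_has_grad[OF assms(1)], of i] pdiff_eq[OF differentiable_has_grad[OF assms(2)], of i]
  by simp

lemma pdiff_const [simp]: "pdiff i (\<lambda>_. c) = (\<lambda>_. 0)"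
  by (auto intro!: pdiff_eq)

lemma pdiff_cmult:
  "f differentiable (at x) \<Longrightarrow> pdiff i (\<lambda>x. c * f x) x = c * pdiff i f x"
  using pdiff_mult[of "\<lambda>_. c" x f i] by simp

lemma pdiff_linear: "pdiff i (\<lambda>x. w \<bullet> x + b) = (\<lambda>_. w \<bullet> i)"
  by (rule ext, rule pdiff_eq) (auto intro!: derivative_eq_intros)

lemma smooth_const: "smooth (\<lambda>_. c)"
proof (rule smoothI[where S = "range (\<lambda>c _. c)"])
qed (auto intro!: image_eqI)

lemma smooth_add:
  assumes "smooth f" "smooth g" shows "smooth (\<lambda>x. f x + g x)"
proof (rule smoothI[where S = "{\<lambda>x. f x + g x |f g. smooth f \<and> smooth g}"])
  fix h :: "'a \<Rightarrow> real" and x assume "h \<in> {\<lambda>x. f x + g x |f g. smooth f \<and> smooth g}"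
  then obtain f g where "h = (\<lambda>x. f x + g x)" "smooth f" "smooth g" by auto
  then show "h differentiable (at x)"
    using differentiable_add[OF smooth_differentiable smooth_differentiable] by blast
next
  fix h :: "'a \<Rightarrow> real" and i :: 'a assume "h \<in> {\<lambda>x. f x + g x |f g. smooth f \<and> smooth g}" and i: "i \<in> Basis"
  then obtain f g where fg: "h = (\<lambda>x. f x + g x)" "smooth f" "smooth g" by auto
  have "pdiff i h = (\<lambda>x. pdiff i f x + pdiff i g x)"
    using fg by (auto simp: pdiff_add smooth_differentiable)
  then show "pdiff i h \<in> {\<lambda>x. f x + g x |f g. smooth f \<and> smooth g}"
    using fg smooth_pdiff i by blast
qed (use assms in blast)

lemma smooth_linear: "smooth (\<lambda>x. w \<bullet> x + b)"
proof (rule smoothI[where S = "{\<lambda>x. w \<bullet> x + b |w b. True}"])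
  fix f :: "'a \<Rightarrow> real" and i :: 'a assume "f \<in> {\<lambda>x. w \<bullet> x + b |w b. True}"
  then obtain w b where "f = (\<lambda>x. w \<bullet> x + b)" by auto
  then have "pdiff i f = (\<lambda>x. 0 \<bullet> x + w \<bullet> i)" by (simp add: pdiff_linear)
  then show "pdiff i f \<in> {\<lambda>x. w \<bullet> x + b |w b. True}" by blast
next
  fix f :: "'a \<Rightarrow> real" and x :: 'a assume "f \<in> {\<lambda>x. w \<bullet> x + b |w b. True}"
  then obtain w b where "f = (\<lambda>x. w \<bullet> x + b)" by auto
  moreover have "((\<lambda>x. w \<bullet> x + b) has_derivative (\<lambda>h. w \<bullet> h)) (at x)"
    by (auto intro!: derivative_eq_intros)
  ultimately show "f differentiable (at x)" by (auto simp: differentiable_def)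
qed auto

text \<open>Single products are not stable under partial derivatives because of the Leibniz rule;
  finite sums of products are, and they form the invariant class for \<open>smoothI\<close>.\<close>

inductive_set product_sums :: "('a::euclidean_space \<Rightarrow> real) set" where
  product: "smooth f \<Longrightarrow> smooth g \<Longrightarrow> (\<lambda>x. f x * g x) \<in> product_sums"
| plus: "f \<in> product_sums \<Longrightarrow> g \<in> product_sums \<Longrightarrow> (\<lambda>x. f x + g x) \<in> product_sums"

lemma smooth_mult:
  assumes "smooth f" "smooth g" shows "smooth (\<lambda>x. f x * g x)"
proof -
  have diff: "h differentiable (at x)" if "h \<in> product_sums" for h :: "'a \<Rightarrow> real" and x
    using that by induction (auto intro: differentiable_mult differentiable_add smooth_differentiable)
  have "pdiff i h \<in> product_sums" if "h \<in> product_sums" "i \<in> Basis" for h and i :: 'a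
    using that(1)
  proof induction
    case (product f g)
    have "pdiff i (\<lambda>x. f x * g x) = (\<lambda>x. pdiff i f x * g x + f x * pdiff i g x)"
      using product by (auto simp: pdiff_mult smooth_differentiable)
    then show ?case using product that(2)
      by (auto intro!: product_sums.plus product_sums.product smooth_pdiff)
  next
    case (plus f g)
    then have "pdiff i (\<lambda>x. f x + g x) = (\<lambda>x. pdiff i f x + pdiff i g x)"
      by (auto simp: pdiff_add diff)
    then show ?case using plus by (auto intro: product_sums.plus)
  qed
  with diff show ?thesis
    by (intro smoothI[where S = product_sums]) (auto intro: product_sums.product assms)
qed

lemma smooth_cmult: "smooth f \<Longrightarrow> smooth (\<lambda>x. c * f x)"
  by (intro smooth_mult smooth_const)

lemma smooth_diff: "smooth f \<Longrightarrow> smooth g \<Longrightarrow> smooth (\<lambda>x. f x - g x)"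
  using smooth_add[of f "\<lambda>x. -1 * g x"] smooth_cmult[of g "-1"] by simp

lemma pdiff_diff:
  "smooth f \<Longrightarrow> smooth g \<Longrightarrow> pdiff i (\<lambda>x. f x - g x) x = pdiff i f x - pdiff i g x"
  using pdiff_add[of f x "\<lambda>x. -1 * g x" i] pdiff_cmult[of g x i "-1"] smooth_cmult[of g "-1"]
  by (simp add: smooth_differentiable)

lemma grad_comb:
  "smooth f \<Longrightarrow> smooth g \<Longrightarrow> grad (\<lambda>x. f x + c * g x) x = grad f x + c *\<^sub>R grad g x"
  by (simp add: grad_def pdiff_add pdiff_cmult smooth_differentiable smooth_cmult
      scaleR_left.add sum.distrib scaleR_sum_right)

lemma smooth_sum: "(\<And>i. i \<in> I \<Longrightarrow> smooth (f i)) \<Longrightarrow> smooth (\<lambda>x. \<Sum>i\<in>I. f i x)"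
  by (induction I rule: infinite_finite_induct) (auto intro: smooth_const smooth_add)

lemma pdiff_sum:
  "(\<And>i. i \<in> I \<Longrightarrow> smooth (f i)) \<Longrightarrow> pdiff j (\<lambda>x. \<Sum>i\<in>I. f i x) x = (\<Sum>i\<in>I. pdiff j (f i) x)"
  by (induction I rule: infinite_finite_induct) (auto simp: pdiff_add smooth_differentiable smooth_sum)

lemma smooth_prod: "(\<And>i. i \<in> I \<Longrightarrow> smooth (f i)) \<Longrightarrow> smooth (\<lambda>x. \<Prod>i\<in>I. f i x)"
  by (induction I rule: infinite_finite_induct) (auto intro: smooth_const smooth_mult)

lemma smooth_inner_const: "smooth (\<lambda>x. x \<bullet> w)"
  using smooth_linear[of w 0] by (simp add: inner_commute)

lemma pdiff_inner_const: "pdiff i (\<lambda>x. x \<bullet> w) x = i \<bullet> w"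
  using pdiff_linear[of i w 0] by (simp add: inner_commute fun_eq_iff)

section \<open>Polynomials\<close>

definition monomial :: "'a::euclidean_space multiset \<Rightarrow> 'a \<Rightarrow> real" where
  "monomial A x = (\<Prod>i\<in>#A. x \<bullet> i)"

lemma monomial_simps [simp]:
  "monomial {#} x = 1" "monomial (add_mset i A) x = (x \<bullet> i) * monomial A x"
  by (auto simp: monomial_def)

lemma finite_multi_indices: "finite (multi_indices k :: 'a::euclidean_space multiset set)"
proof (rule finite_subset)
  show "multi_indices k \<subseteq> mset ` {xs :: 'a list. set xs \<subseteq> Basis \<and> length xs \<le> k}"
  proof
    fix A :: "'a multiset" assume "A \<in> multi_indices k"
    moreover obtain xs where "mset xs = A" using ex_mset by blast
    ultimately show "A \<in> mset ` {xs. set xs \<subseteq> Basis \<and> length xs \<le> k}"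
      by (force simp: multi_indices_def)
  qed
  show "finite (mset ` {xs :: 'a list. set xs \<subseteq> Basis \<and> length xs \<le> k})"
    by (intro finite_imageI finite_lists_length_le) simp
qed

lemma multi_indices_mono: "j \<le> k \<Longrightarrow> multi_indices j \<subseteq> multi_indices k"
  by (auto simp: multi_indices_def)

lemma polys_eq: "polys k = {p. \<exists>c. p = (\<lambda>x. \<Sum>A\<in>multi_indices k. c A * monomial A x)}"
  by (auto simp: polys_def monomial_def fun_eq_iff)

lemma polys_fspan: "polys k = fspan monomial (multi_indices k)"
  by (auto simp: polys_eq fspan_def)

lemmas polys_comb = fspan_comb[of _ monomial "multi_indices k" for k, folded polys_fspan]
lemmas polys_zero = fspan_zero[of monomial "multi_indices k" for k, folded polys_fspan]
lemmas polys_riesz = fspan_riesz[OF finite_multi_indices, of monomial, folded polys_fspan]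

lemma polys_add: "p \<in> polys k \<Longrightarrow> q \<in> polys k \<Longrightarrow> (\<lambda>x. p x + q x) \<in> polys k"
  using polys_comb[of p k q 1] by simp

lemma polys_cmult: "q \<in> polys k \<Longrightarrow> (\<lambda>x. c * q x) \<in> polys k"
  using polys_comb[OF polys_zero, of q k c] by simp

lemma polys_diff: "p \<in> polys k \<Longrightarrow> q \<in> polys k \<Longrightarrow> (\<lambda>x. p x - q x) \<in> polys k"
  using polys_comb[of p k q "-1"] by simp

lemma polys_sum: "(\<And>i. i \<in> I \<Longrightarrow> p i \<in> polys k) \<Longrightarrow> (\<lambda>x. \<Sum>i\<in>I. p i x) \<in> polys k"
  by (induction I rule: infinite_finite_induct) (auto intro: polys_zero polys_add)

lemma monomial_polys: "A \<in> multi_indices k \<Longrightarrow> monomial A \<in> polys k"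
  unfolding polys_eq
  by (auto intro!: exI[of _ "\<lambda>\<beta>. if \<beta> = A then 1 else 0"] ext
      simp: if_distrib[of "\<lambda>t. t * _"] sum.delta[OF finite_multi_indices] cong: if_cong)

text \<open>Reduces linear statements about polynomials to statements about monomials.\<close>

lemma polys_induct [consumes 1, case_names zero step]:
  assumes "p \<in> polys k" "P (\<lambda>_. 0)"
    and "\<And>p A c. p \<in> polys k \<Longrightarrow> P p \<Longrightarrow> A \<in> multi_indices k \<Longrightarrow> P (\<lambda>x. p x + c * monomial A x)"
  shows "P p"
proof -
  obtain c where p: "p = (\<lambda>x. \<Sum>A\<in>multi_indices k. c A * monomial A x)"
    using assms(1) by (auto simp: polys_eq)
  have "(\<lambda>x. \<Sum>A\<in>I. c A * monomial A x) \<in> polys k \<and> P (\<lambda>x. \<Sum>A\<in>I. c A * monomial A x)"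
    if "finite I" "I \<subseteq> multi_indices k" for I
    using that
  proof (induction I)
    case (insert A I)
    have eq: "(\<lambda>x. \<Sum>A\<in>insert A I. c A * monomial A x) = (\<lambda>x. (\<Sum>A\<in>I. c A * monomial A x) + c A * monomial A x)"
      using insert by (auto simp: add.commute)
    show ?case unfolding eq using insert by (auto intro!: assms(3) polys_comb monomial_polys)
  qed (simp add: polys_zero assms)
  then show ?thesis using p finite_multi_indices by blast
qed

lemma polys_mono:
  assumes "p \<in> polys j" "j \<le> k" shows "p \<in> polys k"
  using assms(1)
proof (induction rule: polys_induct)
  case (step p A c)
  then have "A \<in> multi_indices k" using multi_indices_mono[OF assms(2)] by blast
  then show ?case by (intro polys_comb monomial_polys step)
qed (rule polys_zero)

lemma const_polys: "(\<lambda>_. c) \<in> polys k"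
  using polys_cmult[OF monomial_polys[of "{#}" k], of c] by (simp add: multi_indices_def)

lemma inner_polys: "1 \<le> k \<Longrightarrow> (\<lambda>x. x \<bullet> w) \<in> polys k"
proof -
  assume k: "1 \<le> k"
  have "(\<lambda>x. \<Sum>i\<in>Basis. (w \<bullet> i) * monomial {#i#} x) \<in> polys k"
    using k by (intro polys_sum polys_cmult monomial_polys) (auto simp: multi_indices_def)
  also have "(\<lambda>x. \<Sum>i\<in>Basis. (w \<bullet> i) * monomial {#i#} x) = (\<lambda>x. x \<bullet> w)"
    by (subst euclidean_inner) (simp add: mult.commute)
  finally show ?thesis .
qed

lemma smooth_monomial: "smooth (monomial A)"
proof (induction A)
  case empty
  have "monomial ({#} :: 'a multiset) = (\<lambda>_. 1)" by auto
  then show ?case by (simp add: smooth_const)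
next
  case (add i A)
  have "monomial (add_mset i A) = (\<lambda>x. (x \<bullet> i) * monomial A x)" by auto
  then show ?case using add by (simp add: smooth_mult smooth_inner_const)
qed

lemma smooth_polys: "p \<in> polys k \<Longrightarrow> smooth p"
  by (induction rule: polys_induct) (auto intro!: smooth_const smooth_add smooth_cmult smooth_monomial)

lemma pdiff_monomial:
  assumes "set_mset A \<subseteq> Basis" "j \<in> Basis"
  shows "pdiff j (monomial A) x = real (count A j) * monomial (A - {#j#}) x"
  using assms(1)
proof (induction A)
  case empty
  have "monomial ({#} :: 'a multiset) = (\<lambda>_. 1)" by auto
  then show ?case by simp
next
  case (add b A)
  have "monomial (add_mset b A) = (\<lambda>x. (x \<bullet> b) * monomial A x)" by auto
  then have "pdiff j (monomial (add_mset b A)) x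
      = (j \<bullet> b) * monomial A x + (x \<bullet> b) * (real (count A j) * monomial (A - {#j#}) x)"
    using add by (simp add: pdiff_mult smooth_differentiable smooth_inner_const smooth_monomial pdiff_inner_const)
  also have "\<dots> = real (count (add_mset b A) j) * monomial (add_mset b A - {#j#}) x"
  proof (cases "j = b")
    case True
    show ?thesis
    proof (cases "b \<in># A")
      case inA: True
      then have "(x \<bullet> b) * monomial (A - {#b#}) x = monomial A x"
        by (metis insert_DiffM monomial_simps(2))
      then show ?thesis using True add.prems assms(2) by (simp add: algebra_simps)
    next
      case False
      then have "count A b = 0" by (simp add: not_in_iff)
      then show ?thesis using True add.prems assms(2) by simp
    qed
  next
    case False
    then have "add_mset b A - {#j#} = add_mset b (A - {#j#})" by simp
    then show ?thesis using False add.prems assms(2) by (simp add: inner_Basis)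
  qed
  finally show ?case .
qed

text \<open>All three facts are linear in \<open>p\<close> and reduce to monomials. For the third,
  the radial operator multiplies a monomial by its order, so subtracting \<open>k\<close> times the
  polynomial cancels exactly the part of degree \<open>k\<close>.\<close>

lemma pdiff_polys_aux:
  assumes "p \<in> polys k" "j \<in> Basis"
  shows "pdiff j p \<in> polys (k - 1)" "i \<in> Basis \<Longrightarrow> pdiff i (pdiff j p) = pdiff j (pdiff i p)"
    "(\<lambda>x. (\<Sum>i\<in>Basis. (x \<bullet> i) * pdiff i p x) - real k * p x) \<in> polys (k - 1)"
proof -
  have cm: "smooth p \<Longrightarrow> pdiff i (\<lambda>x. p x + c * monomial A x) = (\<lambda>x. pdiff i p x + c * pdiff i (monomial A) x)"
    for p A c i
    by (auto simp: pdiff_add pdiff_cmult smooth_differentiable smooth_monomial smooth_cmult)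
  have m: "pdiff i (monomial A) = (\<lambda>x. real (count A i) * monomial (A - {#i#}) x)"
    if "A \<in> multi_indices k" "i \<in> Basis" for A i
    using that by (auto simp: multi_indices_def pdiff_monomial)
  have mp: "pdiff i (monomial A) \<in> polys (k - 1)" if "A \<in> multi_indices k" "i \<in> Basis" for A i
  proof (cases "i \<in># A")
    case True
    then have "A - {#i#} \<in> multi_indices (k - 1)"
      using that by (auto simp: multi_indices_def size_Diff_singleton dest: in_diffD)
    then show ?thesis unfolding m[OF that] by (intro polys_cmult monomial_polys)
  next
    case False
    then show ?thesis unfolding m[OF that] by (simp add: not_in_iff polys_zero)
  qed
  show "pdiff j p \<in> polys (k - 1)"
    using assms(1) by (induction rule: polys_induct)
      (use mp assms(2) in \<open>auto simp: cm smooth_polys polys_zero intro!: polys_comb\<close>)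
  show "pdiff i (pdiff j p) = pdiff j (pdiff i p)" if i: "i \<in> Basis"
    using assms(1)
  proof (induction rule: polys_induct)
    case (step p A c)
    have "pdiff i (pdiff j (monomial A)) = pdiff j (pdiff i (monomial A))"
    proof
      fix x
      have s: "set_mset (A - {#j#}) \<subseteq> Basis" "set_mset (A - {#i#}) \<subseteq> Basis"
        using step.hyps(2) by (auto simp: multi_indices_def dest: in_diffD)
      show "pdiff i (pdiff j (monomial A)) x = pdiff j (pdiff i (monomial A)) x"
        unfolding m[OF step.hyps(2) i] m[OF step.hyps(2) assms(2)]
        using s i assms(2) by (simp add: pdiff_cmult smooth_differentiable smooth_monomial pdiff_monomial add_mset_commute)
    qed
    moreover have "pdiff a (\<lambda>x. pdiff b p x + c * pdiff b (monomial A) x)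
        = (\<lambda>x. pdiff a (pdiff b p) x + c * pdiff a (pdiff b (monomial A)) x)" if "b \<in> Basis" for a b
      using step(1) that
      by (auto simp: pdiff_add pdiff_cmult smooth_differentiable smooth_monomial smooth_cmult smooth_pdiff smooth_polys)
    ultimately show ?case using step i assms(2) by (simp add: cm smooth_polys)
  qed simp
  show "(\<lambda>x. (\<Sum>i\<in>Basis. (x \<bullet> i) * pdiff i p x) - real k * p x) \<in> polys (k - 1)"
    using assms(1)
  proof (induction rule: polys_induct)
    case (step p A c)
    have A: "set_mset A \<subseteq> Basis" using step.hyps(2) by (simp add: multi_indices_def)
    have "(\<Sum>i\<in>Basis. (x \<bullet> i) * pdiff i (monomial A) x) = real (size A) * monomial A x" for x
    proof -
      have "(x \<bullet> i) * pdiff i (monomial A) x = real (count A i) * monomial A x" if "i \<in> Basis" for i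
      proof (cases "i \<in># A")
        case True
        then have "(x \<bullet> i) * monomial (A - {#i#}) x = monomial A x"
          by (metis insert_DiffM monomial_simps(2))
        then show ?thesis using A that by (simp add: pdiff_monomial)
      next
        case False
        then show ?thesis using A that by (simp add: pdiff_monomial not_in_iff)
      qed
      moreover have "(\<Sum>i\<in>Basis. real (count A i)) = real (size A)"
      proof -
        have "(\<Sum>i\<in>Basis. count A i) = (\<Sum>i\<in>set_mset A. count A i)"
          using A by (intro sum.mono_neutral_right) (auto simp: not_in_iff)
        then show ?thesis by (simp add: size_multiset_overloaded_eq flip: of_nat_sum)
      qed
      ultimately show ?thesis by (simp flip: sum_distrib_right)
    qed
    then have "(\<lambda>x. (\<Sum>i\<in>Basis. (x \<bullet> i) * pdiff i (\<lambda>x. p x + c * monomial A x) x) - real k * (p x + c * monomial A x))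
       = (\<lambda>x. ((\<Sum>i\<in>Basis. (x \<bullet> i) * pdiff i p x) - real k * p x) + (c * (real (size A) - real k)) * monomial A x)"
      using step(1) by (auto simp: cm smooth_polys algebra_simps sum.distrib simp flip: sum_distrib_left)
    moreover have "(\<lambda>x. (c * (real (size A) - real k)) * monomial A x) \<in> polys (k - 1)"
    \<comment> \<open>The factor \<open>size A - k\<close> removes the top-degree monomials. The
      others have order at most \<open>k - 1\<close>, and the truncated subtraction is harmless
      since \<open>k\<close> is positive for them.\<close>
    proof (cases "size A = k")
      case False
      then have "A \<in> multi_indices (k - 1)" using step.hyps(2) by (auto simp: multi_indices_def)
      then show ?thesis by (intro polys_cmult monomial_polys)
    qed (simp add: polys_zero)
    ultimately show ?case using step.IH by (simp add: polys_add)
  qed (simp add: polys_zero)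
qed

lemmas pdiff_polys = pdiff_polys_aux(1)
lemmas pdiff_polys_commute = pdiff_polys_aux(2)

text \<open>Euler's relation for the top-degree part; recentring at \<open>a\<close> changes lower-order terms only.\<close>

lemma euler_polys:
  assumes "p \<in> polys k"
  shows "(\<lambda>x. (x - a) \<bullet> grad p x - real k * p x) \<in> polys (k - 1)"
proof -
  have g: "grad p x \<bullet> w = (\<Sum>i\<in>Basis. (w \<bullet> i) * pdiff i p x)" for w x
    by (simp add: grad_def inner_sum_left inner_commute[of w] mult.commute)
  have "(\<lambda>x. (\<Sum>i\<in>Basis. (a \<bullet> i) * pdiff i p x)) \<in> polys (k - 1)"
    by (intro polys_sum polys_cmult pdiff_polys assms)
  from polys_diff[OF pdiff_polys_aux(3)[OF assms SOME_Basis] this]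
  show ?thesis by (simp add: inner_diff_left inner_commute[of _ "grad p _"] g algebra_simps)
qed

lemma polys_line:
  assumes "p \<in> polys k"
  shows "\<exists>q :: real poly. \<forall>t. p (a + t *\<^sub>R w) = poly q t"
  using assms
proof (induction rule: polys_induct)
  case zero
  show ?case by (rule exI[of _ 0]) simp
next
  case (step p A c)
  have "\<exists>q :: real poly. \<forall>t. monomial A (a + t *\<^sub>R w) = poly q t"
  proof (induction A)
    case empty
    show ?case by (rule exI[of _ 1]) simp
  next
    case (add i A)
    then obtain q where "\<forall>t. monomial A (a + t *\<^sub>R w) = poly q t" by auto
    then show ?case
      by (intro exI[of _ "[:a \<bullet> i, w \<bullet> i:] * q"]) (simp add: inner_add_left distrib_right)
  qed
  with step.IH obtain q r where "\<forall>t. p (a + t *\<^sub>R w) = poly q t" "\<forall>t. monomial A (a + t *\<^sub>R w) = poly r t"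
    by auto
  then show ?case by (intro exI[of _ "q + smult c r"]) simp
qed

text \<open>On the line from a point of the open set to any \<open>x\<close>, the polynomial becomes
  univariate and has infinitely many roots.\<close>

lemma polys_zero_on_open:
  assumes "p \<in> polys k" "open T" "a \<in> T" "\<And>x. x \<in> T \<Longrightarrow> p x = 0"
  shows "p = (\<lambda>_. 0)"
proof
  fix x
  obtain q :: "real poly" where q: "\<And>t. p (a + t *\<^sub>R (x - a)) = poly q t"
    using polys_line[OF assms(1)] by blast
  obtain e where e: "0 < e" "ball a e \<subseteq> T" using assms openE by blast
  \<comment> \<open>The \<open>+ 1\<close> covers the case \<open>x = a\<close>.\<close>
  let ?d = "e / (norm (x - a) + 1)"
  have d: "0 < ?d" using e by (simp add: add_nonneg_pos)
  have "poly q t = 0" if "t \<in> {0<..<?d}" for t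
  proof -
    have "norm (t *\<^sub>R (x - a)) \<le> t * (norm (x - a) + 1)" using that by (simp add: mult_left_mono)
    also have "\<dots> < e" using that by (simp add: pos_less_divide_eq add_nonneg_pos)
    finally have "a + t *\<^sub>R (x - a) \<in> ball a e" by (simp add: dist_norm)
    then show ?thesis using assms(4) e(2) q by (metis subsetD)
  qed
  then have "{0<..<?d} \<subseteq> {t. poly q t = 0}" by blast
  moreover have "infinite {0<..<?d}" using d infinite_Ioo by blast
  ultimately have "q = 0" using poly_roots_finite finite_subset by blast
  then show "p x = 0" using q[of 1] by simp
qed

lemma grad_vec_polys: "p \<in> polys (k + 1) \<Longrightarrow> grad p \<in> vec_polys k"
  unfolding vec_polys_def using pdiff_polys[of p "k + 1"] by (simp add: grad_inner)

lemma vec_polys_comb: "\<sigma> \<in> vec_polys k \<Longrightarrow> s \<in> vec_polys k \<Longrightarrow> (\<lambda>x. \<sigma> x + c *\<^sub>R s x) \<in> vec_polys k"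
  by (simp add: vec_polys_def inner_add_left polys_comb)

lemma vec_polys_component: "s \<in> vec_polys k \<Longrightarrow> (\<lambda>x. s x \<bullet> w) \<in> polys k"
proof -
  assume "s \<in> vec_polys k"
  then have "(\<lambda>x. \<Sum>i\<in>Basis. (w \<bullet> i) * (s x \<bullet> i)) \<in> polys k"
    by (intro polys_sum polys_cmult) (auto simp: vec_polys_def)
  also have "(\<lambda>x. \<Sum>i\<in>Basis. (w \<bullet> i) * (s x \<bullet> i)) = (\<lambda>x. s x \<bullet> w)"
    by (subst euclidean_inner[of _ w]) (simp add: mult.commute)
  finally show ?thesis .
qed

lemma vec_polys_continuous: "s \<in> vec_polys k \<Longrightarrow> continuous_on S s"
  unfolding vec_polys_def
  by (subst continuous_on_componentwise) (auto intro: smooth_continuous smooth_polys)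

section \<open>Test functions\<close>

text \<open>The flat function exp(-1/t), extended by zero and divided by powers of t; the powers
  make the family stable under differentiation up to linear combinations.\<close>

definition exp_tail :: "nat \<Rightarrow> real \<Rightarrow> real" where
  "exp_tail m t = (if t \<le> 0 then 0 else exp (- 1 / t) / t ^ m)"

lemma exp_tail_derivative:
  "(exp_tail m has_real_derivative exp_tail (m + 2) t - real m * exp_tail (m + 1) t) (at t)"
proof -
  consider "t > 0" | "t < 0" | "t = 0" by linarith
  then show ?thesis
  proof cases
    case 1
    have e: "((\<lambda>t. exp (- 1 / t)) has_real_derivative exp (- 1 / t) / (t * t)) (at t)"
      using 1 by (auto intro!: derivative_eq_intros simp: power2_eq_square)
    have "(exp (- 1 / t) / (t * t) * t ^ m - exp (- 1 / t) * (real m * t ^ (m - Suc 0))) / (t ^ m * t ^ m)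
        = exp_tail (m + 2) t - real m * exp_tail (m + 1) t"
      using 1 by (cases m) (auto simp: exp_tail_def field_simps)
    with DERIV_divide[OF e DERIV_pow[of m t UNIV]] 1
    have "((\<lambda>t. exp (- 1 / t) / t ^ m) has_real_derivative exp_tail (m + 2) t - real m * exp_tail (m + 1) t) (at t)"
      by simp
    then show ?thesis
      by (rule has_field_derivative_transform_within_open[where S = "{0<..}"]) (use 1 in \<open>auto simp: exp_tail_def\<close>)
  next
    case 2
    have "((\<lambda>t. 0) has_real_derivative exp_tail (m + 2) t - real m * exp_tail (m + 1) t) (at t)"
      using 2 by (auto intro!: derivative_eq_intros simp: exp_tail_def)
    then show ?thesis
      by (rule has_field_derivative_transform_within_open[where S = "{..<0}"]) (use 2 in \<open>auto simp: exp_tail_def\<close>)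
  next
    case 3
    have "((\<lambda>h. exp_tail m h / h) \<longlongrightarrow> 0) (at 0)"
    proof (rule filterlim_split_at)
      show "((\<lambda>h. exp_tail m h / h) \<longlongrightarrow> 0) (at_left 0)"
        by (rule tendsto_eventually) (auto simp: exp_tail_def eventually_at_filter)
      \<comment> \<open>On the right of the origin, substituting 1/h turns the difference quotient
        into a power divided by an exponential.\<close>
      have "((\<lambda>h. inverse h ^ (m + 1) / exp (inverse h)) \<longlongrightarrow> (0::real)) (at_right 0)"
        by (rule filterlim_compose[OF tendsto_power_div_exp_0 filterlim_inverse_at_top_right])
      then show "((\<lambda>h. exp_tail m h / h) \<longlongrightarrow> 0) (at_right 0)"
        by (rule Lim_transform_eventually)
          (auto simp: exp_tail_def eventually_at_filter exp_minus field_simps)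
    qed
    then show ?thesis by (simp add: 3 has_field_derivative_iff exp_tail_def)
  qed
qed

inductive_set tail_sums :: "'a::euclidean_space \<Rightarrow> real \<Rightarrow> ('a \<Rightarrow> real) set" for w b where
  scaled: "(\<lambda>x. c * exp_tail m (w \<bullet> x + b)) \<in> tail_sums w b"
| plus: "f \<in> tail_sums w b \<Longrightarrow> g \<in> tail_sums w b \<Longrightarrow> (\<lambda>x. f x + g x) \<in> tail_sums w b"

lemma smooth_exp_tail: "smooth (\<lambda>x. exp_tail m (w \<bullet> x + b))"
proof -
  have D: "((\<lambda>x. c * exp_tail m (w \<bullet> x + b)) has_derivative
      (\<lambda>h. c * (w \<bullet> h) * (exp_tail (m + 2) (w \<bullet> x + b) - real m * exp_tail (m + 1) (w \<bullet> x + b)))) (at x)" for c m x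
  proof -
    have "((\<lambda>x. exp_tail m (w \<bullet> x + b)) has_derivative
        (\<lambda>h. (w \<bullet> h) * (exp_tail (m + 2) (w \<bullet> x + b) - real m * exp_tail (m + 1) (w \<bullet> x + b)))) (at x)"
      by (rule has_derivative_eq_rhs[OF has_derivative_compose[OF _ exp_tail_derivative[unfolded has_field_derivative_def]]])
        (auto intro!: derivative_eq_intros)
    from has_derivative_mult_right[OF this, of c] show ?thesis by (simp add: mult.assoc)
  qed
  have diff: "f differentiable (at x)" if "f \<in> tail_sums w b" for f x
    using that by induction (use D in \<open>auto simp: differentiable_def intro!: differentiable_add[unfolded differentiable_def]\<close>)
  have "pdiff i f \<in> tail_sums w b" if "f \<in> tail_sums w b" for f i
    using that
  proof induction
    case (scaled c m)
    have eq: "pdiff i (\<lambda>x. c * exp_tail m (w \<bullet> x + b)) =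
        (\<lambda>x. c * (w \<bullet> i) * exp_tail (m + 2) (w \<bullet> x + b) + (- c * (w \<bullet> i) * real m) * exp_tail (m + 1) (w \<bullet> x + b))"
      by (rule ext, subst pdiff_eq[OF D]) (simp add: algebra_simps)
    show ?case unfolding eq by (rule tail_sums.plus) (rule tail_sums.scaled)+
  next
    case (plus f g)
    then have "pdiff i (\<lambda>x. f x + g x) = (\<lambda>x. pdiff i f x + pdiff i g x)"
      by (auto simp: pdiff_add diff)
    then show ?case using plus by (auto intro: tail_sums.plus)
  qed
  with diff show ?thesis
    using tail_sums.scaled[of 1 m w b] by (intro smoothI[where S = "tail_sums w b"]) auto
qed

text \<open>Positive exactly on the open box: this supplies test functions, and it allows the bump
  to be divided out again in the fundamental lemma.\<close>

definition box_bump :: "'a::euclidean_space \<Rightarrow> 'a \<Rightarrow> 'a \<Rightarrow> real" where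
  "box_bump l u x = (\<Prod>i\<in>Basis. exp_tail 0 (x \<bullet> i - l \<bullet> i) * exp_tail 0 (u \<bullet> i - x \<bullet> i))"

lemma smooth_box_bump: "smooth (box_bump l u)"
proof -
  have "smooth (\<lambda>x. exp_tail 0 (x \<bullet> i - l \<bullet> i))" "smooth (\<lambda>x. exp_tail 0 (u \<bullet> i - x \<bullet> i))" for i
    using smooth_exp_tail[of 0 i "- (l \<bullet> i)"] smooth_exp_tail[of 0 "- i" "u \<bullet> i"] by (simp_all add: inner_commute)
  then show ?thesis unfolding box_bump_def[abs_def] by (intro smooth_prod smooth_mult)
qed

lemma box_bump_nonneg: "0 \<le> box_bump l u x"
  unfolding box_bump_def by (intro prod_nonneg) (auto simp: exp_tail_def)

lemma box_bump_eq_0: "x \<notin> box l u \<Longrightarrow> box_bump l u x = 0"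
proof -
  assume "x \<notin> box l u"
  then obtain i where "i \<in> Basis" "x \<bullet> i \<le> l \<bullet> i \<or> u \<bullet> i \<le> x \<bullet> i" by (auto simp: box_def not_less)
  then show ?thesis unfolding box_bump_def by (intro prod_zero bexI[of _ i]) (auto simp: exp_tail_def)
qed

lemma box_bump_pos: "x \<in> box l u \<Longrightarrow> 0 < box_bump l u x"
  unfolding box_bump_def by (intro prod_pos mult_pos_pos) (auto simp: exp_tail_def box_def)

lemma test_fun_smooth: "test_fun D \<phi> \<Longrightarrow> smooth \<phi>"
  by (simp add: test_fun_def)

lemma test_fun_mono: "test_fun D \<phi> \<Longrightarrow> D \<subseteq> D' \<Longrightarrow> test_fun D' \<phi>"
  unfolding test_fun_def by blast

lemma test_fun_eq_0: "test_fun D \<phi> \<Longrightarrow> x \<notin> D \<Longrightarrow> \<phi> x = 0"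
  unfolding test_fun_def by blast

lemma test_fun_box_bump: "cbox l u \<subseteq> D \<Longrightarrow> test_fun D (box_bump l u)"
  unfolding test_fun_def using smooth_box_bump box_bump_eq_0 box_subset_cbox compact_cbox
  by (metis subsetD)

lemma test_fun_pdiff:
  assumes "test_fun D \<phi>" "i \<in> Basis" shows "test_fun D (pdiff i \<phi>)"
proof -
  obtain K where K: "compact K" "K \<subseteq> D" "\<And>x. x \<notin> K \<Longrightarrow> \<phi> x = 0"
    using assms(1) by (auto simp: test_fun_def)
  have "pdiff i \<phi> x = 0" if "x \<notin> K" for x
  proof -
    have "((\<lambda>_. 0) has_derivative (\<lambda>_. 0)) (at x)" by simp
    then have "(\<phi> has_derivative (\<lambda>_. 0)) (at x)"
      by (rule has_derivative_transform_within_open[where s = "- K"])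
        (use that K in \<open>auto simp: compact_imp_closed open_Compl\<close>)
    then show ?thesis by (rule pdiff_eq)
  qed
  then show ?thesis using K assms smooth_pdiff by (auto simp: test_fun_def)
qed

lemma test_fun_mult:
  assumes "test_fun D \<phi>" "smooth u" shows "test_fun D (\<lambda>x. u x * \<phi> x)"
proof -
  obtain K where "compact K" "K \<subseteq> D" "\<forall>x. x \<notin> K \<longrightarrow> \<phi> x = 0"
    using assms(1) by (auto simp: test_fun_def)
  then show ?thesis
    unfolding test_fun_def using smooth_mult[OF assms(2) test_fun_smooth[OF assms(1)]]
    by (intro conjI exI[of _ K]) auto
qed

lemma test_fun_cmult: "test_fun D \<phi> \<Longrightarrow> test_fun D (\<lambda>x. c * \<phi> x)"
  by (rule test_fun_mult[OF _ smooth_const])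

lemma test_fun_foldr_pdiff: "test_fun D \<phi> \<Longrightarrow> set is \<subseteq> Basis \<Longrightarrow> test_fun D (foldr pdiff is \<phi>)"
  by (induction "is") (auto intro: test_fun_pdiff)

lemma test_fun_integrable:
  assumes "test_fun D \<phi>" shows "integrable lborel \<phi>"
proof -
  obtain K where K: "compact K" "\<And>x. x \<notin> K \<Longrightarrow> \<phi> x = 0"
    using assms by (auto simp: test_fun_def)
  have "integrable lborel (\<lambda>x. indicator K x *\<^sub>R \<phi> x)"
    using K(1) smooth_continuous[OF test_fun_smooth[OF assms]] by (rule borel_integrable_compact)
  also have "(\<lambda>x. indicator K x *\<^sub>R \<phi> x) = \<phi>"
    using K(2) by (auto simp: indicator_def fun_eq_iff)
  finally show ?thesis .
qed

lemma open_sets_lebesgue: "open D \<Longrightarrow> D \<in> sets lebesgue"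
  using borel_open[of D] by (simp add: sets_completionI_sets)

lemma borel_measurable_lebesgue_on: "f \<in> borel_measurable borel \<Longrightarrow> f \<in> borel_measurable (lebesgue_on D)"
  by (intro measurable_restrict_space1 measurable_completion) simp

lemma test_fun_sqi:
  assumes "test_fun E \<phi>" "D \<in> sets lebesgue" shows "sqi_on D \<phi>"
proof -
  have m: "\<phi> \<in> borel_measurable borel" using assms test_fun_smooth smooth_measurable by blast
  have "integrable lborel (\<lambda>x. \<phi> x * \<phi> x)"
    using test_fun_integrable[OF test_fun_mult[OF assms(1) test_fun_smooth[OF assms(1)]]] .
  then have "integrable lebesgue (\<lambda>x. \<phi> x * \<phi> x)"
    using m by (subst integrable_completion) auto
  from integrable_mult_indicator[OF assms(2) this]
  have "integrable (lebesgue_on D) (\<lambda>x. \<phi> x * \<phi> x)"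
    using assms(2) by (simp add: integrable_restrict_space)
  then show ?thesis using m by (auto simp: sqi_def borel_measurable_lebesgue_on)
qed

lemma smooth_sqi:
  assumes "smooth \<phi>" "bounded D" "D \<in> sets lebesgue" shows "sqi_on D \<phi>"
proof -
  have "compact (closure D)" using assms(2) by simp
  then have "bounded (\<phi> ` closure D)"
    using assms by (intro compact_imp_bounded compact_continuous_image smooth_continuous)
  then obtain C where C: "\<And>x. x \<in> closure D \<Longrightarrow> norm (\<phi> x) \<le> C"
    by (auto simp: bounded_iff)
  have "D \<in> lmeasurable" using assms bounded_set_imp_lmeasurable by blast
  then have "finite_measure (lebesgue_on D)" by (simp add: finite_measure_lebesgue_on)
  then show ?thesis
    using C closure_subset assms(1) by (intro sqi_bounded[where C = C]) (auto intro!: borel_measurable_lebesgue_on smooth_measurable)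
qed

lemma l2_inner_test:
  fixes u \<phi> :: "'a::euclidean_space \<Rightarrow> real"
  assumes "D \<subseteq> E" "D \<in> sets lebesgue" "E \<in> sets lebesgue" "\<And>x. x \<notin> D \<Longrightarrow> \<phi> x = 0"
  shows "inner_on D u \<phi> = inner_on E u \<phi>"
proof -
  have "indicator D x *\<^sub>R (u x * \<phi> x) = indicator E x *\<^sub>R (u x * \<phi> x)" for x
    using assms by (auto simp: indicator_def)
  then have eq: "(\<lambda>x. indicator D x *\<^sub>R (u x * \<phi> x)) = (\<lambda>x. indicator E x *\<^sub>R (u x * \<phi> x))" by blast
  have "integral\<^sup>L (lebesgue_on D) (\<lambda>x. u x * \<phi> x) = integral\<^sup>L (lebesgue_on E) (\<lambda>x. u x * \<phi> x)"
    using assms by (subst (1 2) integral_restrict_space) (simp_all only: eq, auto)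
  then show ?thesis by (simp add: l2_inner_def)
qed

section \<open>The fundamental lemma of the calculus of variations\<close>

lemma sqi_subset:
  fixes f :: "'a::euclidean_space \<Rightarrow> 'b::euclidean_space"
  assumes "T \<subseteq> D" "T \<in> sets lebesgue" "D \<in> sets lebesgue" "sqi_on D f"
  shows "sqi_on T f"
proof -
  have eq: "restrict_space (lebesgue_on D) T = lebesgue_on T"
    using assms(1-3) by (subst restrict_restrict_space) (auto simp: inf.absorb2)
  have T: "T \<in> sets (lebesgue_on D)"
    using assms(1-3) by (auto simp: sets_restrict_space_iff)
  then have T': "T \<inter> space (lebesgue_on D) \<in> sets (lebesgue_on D)"
    by (subst sets.Int_space_eq2)
  have f: "f \<in> borel_measurable (lebesgue_on D)" "integrable (lebesgue_on D) (\<lambda>x. f x \<bullet> f x)"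
    using assms(4) by (simp_all add: sqi_def)
  have "integrable (restrict_space (lebesgue_on D) T) (\<lambda>x. f x \<bullet> f x)"
    unfolding integrable_restrict_space[OF T'] by (rule integrable_mult_indicator[OF T f(2)])
  moreover have "f \<in> borel_measurable (restrict_space (lebesgue_on D) T)"
    using f(1) by (rule measurable_restrict_space1)
  ultimately show ?thesis unfolding sqi_def eq by blast
qed

lemma sqi_integrable:
  fixes f :: "'a \<Rightarrow> real"
  assumes "finite_measure M" "sqi M f" shows "integrable M f"
proof -
  interpret finite_measure M by fact
  have "sqi M (\<lambda>_. 1 :: real)" by (simp add: sqi_def)
  from sqi_mult[OF assms(2) this] show ?thesis by simp
qed

lemma real_polynomial_function_smooth: "real_polynomial_function p \<Longrightarrow> smooth p"
proof (induction rule: real_polynomial_function.induct)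
  case (linear f)
  have "f x = (\<Sum>i\<in>Basis. f i *\<^sub>R i) \<bullet> x + 0" for x
    using Linear_Algebra.linear_componentwise[OF bounded_linear.linear[OF linear], of x 1]
    unfolding inner_sum_left by (simp add: inner_commute mult.commute)
  then have "f = (\<lambda>x. (\<Sum>i\<in>Basis. f i *\<^sub>R i) \<bullet> x + 0)" by blast
  then show ?case using smooth_linear by metis
qed (simp_all add: smooth_const smooth_add smooth_mult)

text \<open>Polynomials converge almost everywhere on a box to the sign of \<open>g\<close>; multiplied by a bump
  function they become test functions.\<close>

lemma fundamental_lemma:
  fixes g :: "'a::euclidean_space \<Rightarrow> real"
  assumes D: "open D" and g: "sqi_on D g"
    and z: "\<And>\<phi>. test_fun D \<phi> \<Longrightarrow> inner_on D g \<phi> = 0"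
  shows "AE x in lebesgue_on D. g x = 0"
proof -
  note DL = open_sets_lebesgue[OF D]
  have loc: "AE x in lebesgue. x \<in> cbox a b \<longrightarrow> g x = 0" if ab: "cbox a b \<subseteq> D" for a b
  proof -
    \<comment> \<open>The clamp \<open>?c\<close> fixes the values of \<open>sgn\<close> and keeps
      the approximants bounded: polynomials within distance one of a clamped function are at most 2
      in absolute value, which yields the dominating function.\<close>
    let ?B = "cbox a b" and ?c = "\<lambda>t::real. max (-1) (min 1 t)" and ?\<beta> = "box_bump a b"
    have BL: "?B \<in> sets lebesgue" by simp
    have fin: "finite_measure (lebesgue_on ?B)" by (rule finite_measure_lebesgue_on) simp
    have gB: "sqi_on ?B g" by (rule sqi_subset[OF ab BL DL g])
    note gm = sqi_measurable[OF gB]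
    have "(\<lambda>x. sgn (g x)) measurable_on ?B"
      by (subst measurable_on_iff_borel_measurable[OF BL]) (rule measurable_compose[OF gm borel_measurable_sgn])
    \<comment> \<open>Measurability provides continuous functions that converge to the sign of
      \<open>g\<close> outside a null set.\<close>
    then obtain Z h where Z: "negligible Z" and h: "\<And>n. continuous_on UNIV (h n)"
        "\<And>x. x \<notin> Z \<Longrightarrow> (\<lambda>n. h n x) \<longlonglongrightarrow> (if x \<in> ?B then sgn (g x) else 0)"
      unfolding measurable_on_def by blast
    have cc: "continuous_on UNIV ?c" by (intro continuous_intros)
    have "\<exists>p. real_polynomial_function p \<and> (\<forall>x\<in>?B. \<bar>?c (h n x) - p x\<bar> < 1 / real (Suc n))" for n
      using Stone_Weierstrass_real_polynomial_function[of ?B "\<lambda>x. ?c (h n x)" "1 / real (Suc n)"]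
        continuous_on_compose2[OF cc continuous_on_subset[OF h(1)]] by (metis compact_cbox of_nat_0_less_iff subset_UNIV zero_less_Suc zero_less_divide_1_iff)
    then obtain p where p: "\<And>n. smooth (p n)" "\<And>n x. x \<in> ?B \<Longrightarrow> \<bar>?c (h n x) - p n x\<bar> < 1 / real (Suc n)"
      using real_polynomial_function_smooth by metis
    have \<phi>: "test_fun D (\<lambda>x. p n x * ?\<beta> x)" for n
      by (intro test_fun_mult test_fun_box_bump ab p)
    have "(\<lambda>n. \<integral>x. g x * (p n x * ?\<beta> x) \<partial>lebesgue_on ?B) \<longlonglongrightarrow> (\<integral>x. g x * (sgn (g x) * ?\<beta> x) \<partial>lebesgue_on ?B)"
    proof (rule integral_dominated_convergence[where w = "\<lambda>x. 2 * \<bar>g x * ?\<beta> x\<bar>"])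
      have bm: "?\<beta> \<in> borel_measurable (lebesgue_on ?B)" "p n \<in> borel_measurable (lebesgue_on ?B)" for n
        by (intro borel_measurable_lebesgue_on smooth_measurable smooth_box_bump p)+
      show "(\<lambda>x. g x * (p n x * ?\<beta> x)) \<in> borel_measurable (lebesgue_on ?B)" for n
        by (intro borel_measurable_times gm bm)
      show "(\<lambda>x. g x * (sgn (g x) * ?\<beta> x)) \<in> borel_measurable (lebesgue_on ?B)"
        by (intro borel_measurable_times gm bm measurable_compose[OF gm borel_measurable_sgn])
      have "sqi_on ?B ?\<beta>" by (intro smooth_sqi smooth_box_bump) auto
      then show "integrable (lebesgue_on ?B) (\<lambda>x. 2 * \<bar>g x * ?\<beta> x\<bar>)"
        using sqi_mult[OF gB] by (intro integrable_mult_right integrable_abs) blast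
      have "\<bar>p n x\<bar> \<le> 2" if "x \<in> ?B" for n x
      proof -
        have "1 / real (Suc n) \<le> 1" by simp
        then show ?thesis using p(2)[OF that, of n] by linarith
      qed
      then have "\<bar>g x\<bar> * (\<bar>p n x\<bar> * \<bar>?\<beta> x\<bar>) \<le> 2 * \<bar>g x * ?\<beta> x\<bar>" if "x \<in> ?B" for n x
        using that mult_right_mono[of "\<bar>p n x\<bar>" 2 "\<bar>g x * ?\<beta> x\<bar>"] by (simp add: abs_mult mult_ac)
      then show "AE x in lebesgue_on ?B. norm (g x * (p n x * ?\<beta> x)) \<le> 2 * \<bar>g x * ?\<beta> x\<bar>" for n
        by (intro AE_I2) (simp add: abs_mult)
      have "AE x in lebesgue. x \<notin> Z" using Z AE_not_in negligible_iff_null_sets by blast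
      then have "AE x in lebesgue_on ?B. x \<notin> Z"
        using BL by (simp add: AE_restrict_space_iff) (auto elim: eventually_mono)
      then show "AE x in lebesgue_on ?B. (\<lambda>n. g x * (p n x * ?\<beta> x)) \<longlonglongrightarrow> g x * (sgn (g x) * ?\<beta> x)"
        using AE_space
      proof eventually_elim
        case (elim x)
        then have x: "x \<in> ?B" by simp
        have "(\<lambda>n. ?c (h n x)) \<longlonglongrightarrow> ?c (sgn (g x))"
          using h(2)[OF elim(1)] x by (intro continuous_on_tendsto_compose[OF cc]) auto
        moreover have "?c (sgn (g x)) = sgn (g x)" by (simp add: sgn_if)
        moreover have "(\<lambda>n. ?c (h n x) - p n x) \<longlonglongrightarrow> 0"
          using less_imp_le[OF p(2)[OF x]] by (intro Lim_null_comparison[OF _ lim_inverse_n'[THEN LIMSEQ_Suc]]) auto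
        ultimately have "(\<lambda>n. ?c (h n x) - (?c (h n x) - p n x)) \<longlonglongrightarrow> sgn (g x) - 0" by (intro tendsto_diff) simp_all
        then show ?case by (intro tendsto_mult tendsto_const) simp
      qed
    qed
    moreover have "(\<integral>x. g x * (p n x * ?\<beta> x) \<partial>lebesgue_on ?B) = 0" for n
    proof -
      have "?\<beta> x = 0" if "x \<notin> ?B" for x using that box_subset_cbox box_bump_eq_0 by blast
      then have "inner_on ?B g (\<lambda>x. p n x * ?\<beta> x) = inner_on D g (\<lambda>x. p n x * ?\<beta> x)"
        by (intro l2_inner_test ab BL DL) simp
      then show ?thesis using z[OF \<phi>] by (simp add: l2_inner_def)
    qed
    ultimately have "(\<integral>x. \<bar>g x\<bar> * ?\<beta> x \<partial>lebesgue_on ?B) = 0"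
      by (simp add: LIMSEQ_const_iff abs_sgn mult.assoc)
    moreover have "integrable (lebesgue_on ?B) (\<lambda>x. \<bar>g x * ?\<beta> x\<bar>)"
      by (intro integrable_abs sqi_mult gB smooth_sqi smooth_box_bump) auto
    then have "integrable (lebesgue_on ?B) (\<lambda>x. \<bar>g x\<bar> * ?\<beta> x)"
      by (simp add: abs_mult box_bump_nonneg)
    ultimately have "AE x in lebesgue_on ?B. \<bar>g x\<bar> * ?\<beta> x = 0"
      by (subst (asm) integral_nonneg_eq_0_iff_AE) (simp_all add: box_bump_nonneg)
    then have "AE x in lebesgue. x \<in> ?B \<longrightarrow> \<bar>g x\<bar> * ?\<beta> x = 0" by (simp add: AE_restrict_space_iff)
    \<comment> \<open>The bump vanishes on the boundary of the box, so nothing is learnt about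
      \<open>g\<close> there; that boundary is a null set.\<close>
    moreover have "AE x in lebesgue. x \<notin> ?B - box a b"
      using negligible_frontier_interval AE_not_in negligible_iff_null_sets by blast
    ultimately show ?thesis
      by eventually_elim (use box_bump_pos[of _ a b] in force)
  qed
  \<comment> \<open>Countably many closed boxes exhaust the open set, so the local null sets add up
    to one null set.\<close>
  obtain \<D> where \<D>: "countable \<D>" "\<D> \<subseteq> Pow D" "\<And>X. X \<in> \<D> \<Longrightarrow> \<exists>a b. X = cbox a b" "\<Union>\<D> = D"
    using open_countable_Union_open_cbox[OF D] by metis
  have "AE x in lebesgue. \<forall>X\<in>\<D>. x \<in> X \<longrightarrow> g x = 0"
  proof (subst AE_ball_countable[OF \<D>(1)], rule ballI)
    fix X assume "X \<in> \<D>"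
    moreover from this obtain a b where "X = cbox a b" using \<D>(3) by blast
    ultimately show "AE x in lebesgue. x \<in> X \<longrightarrow> g x = 0" using \<D>(2) loc by auto
  qed
  then have "AE x in lebesgue. x \<in> D \<longrightarrow> g x = 0"
    by eventually_elim (use \<D>(4) in blast)
  then show ?thesis using DL by (simp add: AE_restrict_space_iff)
qed

section \<open>Convolution integrals\<close>

lemma smooth_affine:
  assumes "smooth q" shows "smooth (\<lambda>x. q (c *\<^sub>R x + b))"
    and pdiff_affine: "pdiff i (\<lambda>x. q (c *\<^sub>R x + b)) = (\<lambda>x. c * pdiff i q (c *\<^sub>R x + b))"
proof -
  have D: "((\<lambda>x. d * q (c *\<^sub>R x + b)) has_derivative (\<lambda>h. d * (grad q (c *\<^sub>R x + b) \<bullet> (c *\<^sub>R h)))) (at x)"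
    if "smooth q" for d q x
    by (rule has_derivative_mult_right,
        rule has_derivative_compose[OF _ smooth_has_derivative[OF that], of "\<lambda>x. c *\<^sub>R x + b" "\<lambda>h. c *\<^sub>R h" x UNIV])
      (auto intro!: derivative_eq_intros)
  have P: "pdiff i (\<lambda>x. d * q (c *\<^sub>R x + b)) = (\<lambda>x. (d * c) * pdiff i q (c *\<^sub>R x + b))" if "smooth q" for d q i
    by (rule ext, subst pdiff_eq[OF D[OF that]], subst pdiff_eq[OF smooth_has_derivative[OF that]]) simp
  show "smooth (\<lambda>x. q (c *\<^sub>R x + b))"
  proof (rule smoothI[where S = "{\<lambda>x. d * q (c *\<^sub>R x + b) |d q. smooth q}"])
    show "(\<lambda>x. q (c *\<^sub>R x + b)) \<in> {\<lambda>x. d * q (c *\<^sub>R x + b) |d q. smooth q}"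
      using assms by (auto intro!: exI[of _ 1] exI[of _ q])
    fix f and x :: 'a assume "f \<in> {\<lambda>x. d * q (c *\<^sub>R x + b) |d q. smooth q}"
    then show "f differentiable (at x)" using D by (auto simp: differentiable_def)
  next
    fix f and i :: 'a assume "f \<in> {\<lambda>x. d * q (c *\<^sub>R x + b) |d q. smooth q}" and i: "i \<in> Basis"
    then obtain d q where f: "f = (\<lambda>x. d * q (c *\<^sub>R x + b))" "smooth q" by auto
    show "pdiff i f \<in> {\<lambda>x. d * q (c *\<^sub>R x + b) |d q. smooth q}"
      unfolding f(1) P[OF f(2)] using smooth_pdiff[OF f(2) i] by blast
  qed
  show "pdiff i (\<lambda>x. q (c *\<^sub>R x + b)) = (\<lambda>x. c * pdiff i q (c *\<^sub>R x + b))"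
    using P[OF assms, of i 1] by simp
qed

lemma smooth_lipschitz_on_cball:
  fixes u :: "'a::euclidean_space \<Rightarrow> real"
  assumes "smooth u"
  obtains B where "0 \<le> B" "\<And>x y. x \<in> cball 0 R \<Longrightarrow> y \<in> cball 0 R \<Longrightarrow> \<bar>u x - u y\<bar> \<le> B * norm (x - y)"
proof -
  have "bounded (grad u ` cball 0 R)"
    by (intro compact_imp_bounded compact_continuous_image smooth_continuous_grad assms) simp
  then obtain B where B: "B > 0" "\<And>x. x \<in> cball 0 R \<Longrightarrow> norm (grad u x) \<le> B"
    by (auto simp: bounded_pos)
  have "norm (u x - u y) \<le> B * norm (x - y)" if "x \<in> cball 0 R" "y \<in> cball 0 R" for x y
  proof (rule differentiable_bound[OF convex_cball _ _ that])
    show "(u has_derivative (\<lambda>h. grad u z \<bullet> h)) (at z within cball 0 R)" for z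
      using smooth_has_derivative[OF assms] has_derivative_at_withinI by blast
    show "onorm (\<lambda>h. grad u z \<bullet> h) \<le> B" if "z \<in> cball 0 R" for z
    proof (rule onorm_le)
      fix h
      have "norm (grad u z \<bullet> h) \<le> norm (grad u z) * norm h" by (rule Cauchy_Schwarz_ineq2[folded real_norm_def])
      also have "\<dots> \<le> B * norm h" using B(2)[OF that] by (intro mult_right_mono) auto
      finally show "norm (grad u z \<bullet> h) \<le> B * norm h" .
    qed
  qed
  then show ?thesis using B by (intro that[of B]) auto
qed

lemma smooth_directional:
  assumes "smooth u" "\<epsilon> \<longlonglongrightarrow> 0" "\<And>n. \<epsilon> n \<noteq> 0"
  shows "(\<lambda>n. (u (x + \<epsilon> n *\<^sub>R v) - u x) / \<epsilon> n) \<longlonglongrightarrow> grad u x \<bullet> v"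
proof -
  have "((\<lambda>t. u (x + t *\<^sub>R v)) has_derivative (\<lambda>t. grad u (x + 0 *\<^sub>R v) \<bullet> (t *\<^sub>R v))) (at 0)"
    by (rule has_derivative_compose[OF _ smooth_has_derivative[OF assms(1)]])
      (auto intro!: derivative_eq_intros)
  then have "((\<lambda>t. u (x + t *\<^sub>R v)) has_real_derivative grad u x \<bullet> v) (at 0)"
    by (simp add: has_field_derivative_def mult_commute_abs)
  then have "((\<lambda>h. (u (x + h *\<^sub>R v) - u x) / h) \<longlongrightarrow> grad u x \<bullet> v) (at 0)"
    by (simp add: DERIV_def)
  moreover have "filterlim \<epsilon> (at 0) sequentially"
    using assms(2,3) by (intro filterlim_atI) auto
  ultimately show ?thesis by (rule filterlim_compose)
qed

text \<open>The quadratic remainder is uniform over a ball, so it can be integrated against a weight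
  of bounded support. The radius \<open>R + 1\<close> inside leaves room for increments of length
  one.\<close>

lemma smooth_taylor:
  fixes q :: "'a::euclidean_space \<Rightarrow> real"
  assumes "smooth q"
  obtains C where "0 \<le> C" "\<And>p k. norm p \<le> R \<Longrightarrow> norm k \<le> 1 \<Longrightarrow> \<bar>q (p + k) - q p - grad q p \<bullet> k\<bar> \<le> C * (norm k)\<^sup>2"
proof -
  let ?B = "cball 0 (R + 1) :: 'a set"
  have "\<exists>G. 0 \<le> G \<and> (\<forall>x\<in>?B. \<forall>y\<in>?B. \<bar>pdiff i q x - pdiff i q y\<bar> \<le> G * norm (x - y))" if "i \<in> Basis" for i
    using smooth_lipschitz_on_cball[OF smooth_pdiff[OF assms that]] by metis
  then obtain G where G: "\<And>i. i \<in> Basis \<Longrightarrow> 0 \<le> G i \<and> (\<forall>x\<in>?B. \<forall>y\<in>?B. \<bar>pdiff i q x - pdiff i q y\<bar> \<le> G i * norm (x - y))"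
    by metis
  define L where "L = (\<Sum>i\<in>Basis. G i)"
  have L0: "0 \<le> L" unfolding L_def using G by (intro sum_nonneg) auto
  have L: "norm (grad q x - grad q y) \<le> L * norm (x - y)" if "x \<in> ?B" "y \<in> ?B" for x y
    unfolding L_def sum_distrib_right
    using G that by (intro order_trans[OF norm_le_l1] sum_mono) (auto simp: grad_inner inner_diff_left)
  have "norm (q (p + k) - q p - grad q p \<bullet> ((p + k) - p)) \<le> norm ((p + k) - p) * (L * norm k)"
    if pk: "norm p \<le> R" "norm k \<le> 1" for p k
  proof (rule differentiable_bound_linearization[where S = "closed_segment p (p + k)" and f' = "\<lambda>x h. grad q x \<bullet> h"])
    show "p + t *\<^sub>R (p + k - p) \<in> closed_segment p (p + k)" if "t \<in> {0..1}" for t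
      using that by (auto simp: closed_segment_def algebra_simps intro!: exI[of _ t])
    show "(q has_derivative (\<lambda>h. grad q x \<bullet> h)) (at x within closed_segment p (p + k))" for x
      using smooth_has_derivative[OF assms] has_derivative_at_withinI by blast
    show "onorm ((\<bullet>) (grad q x) - (\<bullet>) (grad q p)) \<le> L * norm k" if "x \<in> closed_segment p (p + k)" for x
    proof (rule onorm_le)
      fix h :: 'a
      have n: "norm (x - p) \<le> norm k" using that segment_bound1[of x p "p + k"] by simp
      then have "x \<in> ?B" "p \<in> ?B" using pk norm_triangle_ineq2[of x p] by auto
      then have "norm (grad q x - grad q p) \<le> L * norm k"
        using L[of x p] L0 n by (meson mult_left_mono order_trans)
      then have "norm (grad q x - grad q p) * norm h \<le> L * norm k * norm h" by (intro mult_right_mono) auto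
      then show "norm (((\<bullet>) (grad q x) - (\<bullet>) (grad q p)) h) \<le> L * norm k * norm h"
        using Cauchy_Schwarz_ineq2[of "grad q x - grad q p" h] by (simp add: inner_diff_left)
    qed
  qed simp
  then show ?thesis using L0 by (intro that[of L]) (auto simp: power2_eq_square mult_ac)
qed

text \<open>Covers two kinds of moving integrals: a smooth kernel acting on an integrable function,
  and the integral of a smooth function over translates of a bounded set, where the weight is an
  indicator.\<close>

locale weight =
  fixes w :: "'a::euclidean_space \<Rightarrow> real" and S :: "'a set"
  assumes w: "integrable lborel w" and S: "bounded S" and vanish: "\<And>x. x \<notin> S \<Longrightarrow> w x = 0"
begin

lemma kernel_integrable:
  assumes "smooth q"
  shows "integrable lborel (\<lambda>y. q (c0 *\<^sub>R y + p) * w y)"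
proof -
  have c: "continuous_on A (\<lambda>y. q (c0 *\<^sub>R y + p))" for A
    by (rule continuous_on_compose2[OF smooth_continuous[OF assms, of UNIV]]) (auto intro!: continuous_intros)
  have "bounded ((\<lambda>y. q (c0 *\<^sub>R y + p)) ` closure S)"
    using S by (intro compact_imp_bounded compact_continuous_image c) (simp add: compact_closure)
  then obtain B where B: "\<And>y. y \<in> closure S \<Longrightarrow> \<bar>q (c0 *\<^sub>R y + p)\<bar> \<le> B" by (auto simp: bounded_iff)
  show ?thesis
  proof (rule Bochner_Integration.integrable_bound)
    show "integrable lborel (\<lambda>y. B * \<bar>w y\<bar>)" using w by simp
    show "(\<lambda>y. q (c0 *\<^sub>R y + p) * w y) \<in> borel_measurable lborel"
      using borel_measurable_continuous_onI[OF c] borel_measurable_integrable[OF w] by measurable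
    have "\<bar>q (c0 *\<^sub>R y + p)\<bar> * \<bar>w y\<bar> \<le> \<bar>B * \<bar>w y\<bar>\<bar>" for y
    proof (cases "y \<in> S")
      case True
      then have "\<bar>q (c0 *\<^sub>R y + p)\<bar> * \<bar>w y\<bar> \<le> B * \<bar>w y\<bar>"
        using B closure_subset by (intro mult_right_mono) auto
      then show ?thesis by linarith
    qed (simp add: vanish)
    then show "AE y in lborel. norm (q (c0 *\<^sub>R y + p) * w y) \<le> norm (B * \<bar>w y\<bar>)" by (simp add: abs_mult)
  qed
qed

text \<open>Differentiation under the integral: the uniform Taylor remainder integrates to a
  multiple of the squared increment.\<close>

lemma kernel_derivative:
  assumes q: "smooth q"
  shows "((\<lambda>x. \<integral>y. q (c0 *\<^sub>R y + (c1 *\<^sub>R x + b)) * w y \<partial>lborel) has_derivative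
      (\<lambda>h. \<Sum>i\<in>Basis. (h \<bullet> i) * (c1 * (\<integral>y. pdiff i q (c0 *\<^sub>R y + (c1 *\<^sub>R x + b)) * w y \<partial>lborel)))) (at x)"
    (is "(?F has_derivative ?L) _")
  unfolding has_derivative_at
proof (intro conjI)
  show "bounded_linear ?L"
    by (intro bounded_linear_sum bounded_linear_mult_left[THEN bounded_linear_compose] bounded_linear_inner_left)
  let ?p = "\<lambda>y. c0 *\<^sub>R y + (c1 *\<^sub>R x + b)"
  have "bounded (?p ` closure S)"
    using S by (intro compact_imp_bounded compact_continuous_image continuous_intros) (simp add: compact_closure)
  then obtain R where R: "\<And>y. y \<in> S \<Longrightarrow> norm (?p y) \<le> R" unfolding bounded_iff using closure_subset by blast
  obtain C where C: "0 \<le> C" "\<And>p k. norm p \<le> R \<Longrightarrow> norm k \<le> 1 \<Longrightarrow> \<bar>q (p + k) - q p - grad q p \<bullet> k\<bar> \<le> C * (norm k)\<^sup>2"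
    using smooth_taylor[OF q] by blast
  define W where "W = (\<integral>y. \<bar>w y\<bar> \<partial>lborel)"
  have bound: "norm (?F (x + h) - ?F x - ?L h) \<le> C * c1\<^sup>2 * W * (norm h)\<^sup>2" if h: "norm (c1 *\<^sub>R h) \<le> 1" for h
  proof -
    have i1: "integrable lborel (\<lambda>y. q (?p y + c1 *\<^sub>R h) * w y)" "integrable lborel (\<lambda>y. q (?p y) * w y)"
      using kernel_integrable[OF q] by (auto simp: add.assoc)
    have i2: "integrable lborel (\<lambda>y. pdiff i q (?p y) * w y)" if "i \<in> Basis" for i
      using kernel_integrable[OF smooth_pdiff[OF q that]] .
    have gr: "grad q z \<bullet> (c1 *\<^sub>R h) = (\<Sum>i\<in>Basis. (h \<bullet> i) * (c1 * pdiff i q z))" for z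
      by (simp add: grad_def inner_sum_left inner_commute[of h] sum_distrib_left mult_ac)
    have i3: "integrable lborel (\<lambda>y. grad q (?p y) \<bullet> (c1 *\<^sub>R h) * w y)"
      unfolding gr sum_distrib_right using i2 by (simp add: mult.assoc)
    have L: "?L h = (\<integral>y. grad q (?p y) \<bullet> (c1 *\<^sub>R h) * w y \<partial>lborel)"
      unfolding gr sum_distrib_right using i2 by (subst Bochner_Integration.integral_sum) (simp_all add: mult.assoc)
    let ?D = "\<lambda>y. q (?p y + c1 *\<^sub>R h) * w y - q (?p y) * w y - grad q (?p y) \<bullet> (c1 *\<^sub>R h) * w y"
    have "?F (x + h) - ?F x - ?L h = (\<integral>y. ?D y \<partial>lborel)"
      unfolding L using i1 i3 by (simp add: scaleR_add_right add_ac)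
    moreover have "norm (\<integral>y. ?D y \<partial>lborel) \<le> (\<integral>y. (C * (norm (c1 *\<^sub>R h))\<^sup>2) * \<bar>w y\<bar> \<partial>lborel)"
    proof (rule Bochner_Integration.integral_norm_bound_integral)
      fix y
      have "norm (?D y) = \<bar>q (?p y + c1 *\<^sub>R h) - q (?p y) - grad q (?p y) \<bullet> (c1 *\<^sub>R h)\<bar> * \<bar>w y\<bar>"
        by (simp add: left_diff_distrib flip: abs_mult)
      also have "\<dots> \<le> (C * (norm (c1 *\<^sub>R h))\<^sup>2) * \<bar>w y\<bar>"
        using C(2)[OF R h, of y] by (cases "y \<in> S") (auto simp: vanish intro!: mult_right_mono)
      finally show "norm (?D y) \<le> (C * (norm (c1 *\<^sub>R h))\<^sup>2) * \<bar>w y\<bar>" .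
    qed (use i1 i3 w in auto)
    moreover have "(\<integral>y. (C * (norm (c1 *\<^sub>R h))\<^sup>2) * \<bar>w y\<bar> \<partial>lborel) = C * c1\<^sup>2 * W * (norm h)\<^sup>2"
      unfolding W_def by (subst integral_mult_right_zero) (simp add: power_mult_distrib)
    ultimately show ?thesis by metis
  qed
  show "(\<lambda>h. norm (?F (x + h) - ?F x - ?L h) / norm h) \<midarrow>0\<rightarrow> 0"
  proof (rule Lim_null_comparison)
    have b: "norm (norm (?F (x + h) - ?F x - ?L h) / norm h) \<le> C * c1\<^sup>2 * W * norm h" if "norm (c1 *\<^sub>R h) \<le> 1" for h
      using bound[OF that] by (cases "h = 0") (auto simp: field_simps power2_eq_square)
    have "((\<lambda>h :: 'a. norm (c1 *\<^sub>R h)) \<longlongrightarrow> norm (c1 *\<^sub>R (0 :: 'a))) (at 0)" by (intro tendsto_intros)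
    then have "\<forall>\<^sub>F h in at 0. norm (c1 *\<^sub>R (h :: 'a)) < 1" by (rule order_tendstoD) simp
    then show "\<forall>\<^sub>F h in at 0. norm (norm (?F (x + h) - ?F x - ?L h) / norm h) \<le> C * c1\<^sup>2 * W * norm h"
      by eventually_elim (rule b, simp)
    show "(\<lambda>h. C * c1\<^sup>2 * W * norm h) \<midarrow>0\<rightarrow> 0"
      by (rule tendsto_eq_intros | simp)+
  qed
qed

lemma
  assumes q: "smooth q"
  shows smooth_kernel: "smooth (\<lambda>x. \<integral>y. q (c0 *\<^sub>R y + (c1 *\<^sub>R x + b)) * w y \<partial>lborel)"
    and pdiff_kernel: "i \<in> Basis \<Longrightarrow> pdiff i (\<lambda>x. \<integral>y. q (c0 *\<^sub>R y + (c1 *\<^sub>R x + b)) * w y \<partial>lborel) x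
      = c1 * (\<integral>y. pdiff i q (c0 *\<^sub>R y + (c1 *\<^sub>R x + b)) * w y \<partial>lborel)"
proof -
  let ?I = "\<lambda>q x. \<integral>y. q (c0 *\<^sub>R y + (c1 *\<^sub>R x + b)) * w y \<partial>lborel"
  have P: "pdiff i (?I q) x = c1 * ?I (pdiff i q) x" if "smooth q" "i \<in> Basis" for q i x
    using that(2) by (subst pdiff_eq[OF kernel_derivative[OF that(1)]])
      (simp add: inner_Basis if_distrib[of "\<lambda>t. t * _"] sum.delta cong: if_cong)
  show "i \<in> Basis \<Longrightarrow> pdiff i (?I q) x = c1 * ?I (pdiff i q) x" by (rule P[OF q])
  show "smooth (?I q)"
  proof (rule smoothI[where S = "{?I q |q. smooth q}"])
    show "?I q \<in> {?I q |q. smooth q}" using q by auto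
    fix f and x :: 'a assume "f \<in> {?I q |q. smooth q}"
    then show "f differentiable (at x)"
      using kernel_derivative unfolding differentiable_def by blast
  next
    fix f and i :: 'a assume "f \<in> {?I q |q. smooth q}" and i: "i \<in> Basis"
    then obtain q where f: "f = ?I q" "smooth q" by auto
    have "pdiff i f = ?I (\<lambda>x. c1 * pdiff i q x)" unfolding f(1) by (rule ext, subst P[OF f(2) i]) (simp add: mult.assoc)
    then show "pdiff i f \<in> {?I q |q. smooth q}"
      by (intro CollectI exI[of _ "\<lambda>x. c1 * pdiff i q x"] conjI smooth_cmult smooth_pdiff f i)
  qed
qed

end

text \<open>With a weight equal to one near the support, the moving integral is locally constant.\<close>

lemma integral_pdiff_test_fun:
  fixes \<phi> :: "'a::euclidean_space \<Rightarrow> real"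
  assumes "test_fun D \<phi>" "i \<in> Basis"
  shows "(\<integral>x. pdiff i \<phi> x \<partial>lborel) = 0"
proof -
  obtain K where K: "compact K" "\<And>x. x \<notin> K \<Longrightarrow> \<phi> x = 0" using assms by (auto simp: test_fun_def)
  obtain R where R: "\<And>x. x \<in> K \<Longrightarrow> norm x \<le> R"
    using compact_imp_bounded[OF K(1)] by (auto simp: bounded_iff)
  have sm: "smooth \<phi>" using assms(1) by (rule test_fun_smooth)
  have tK: "test_fun K \<phi>" using K sm by (auto simp: test_fun_def)
  \<comment> \<open>The radius \<open>R + 1\<close> keeps the support of \<open>\<phi>\<close>
    inside the ball under translations shorter than one, so \<open>?F\<close> is constant near the
    origin.\<close>
  let ?w = "indicator (cball 0 (R + 1)) :: 'a \<Rightarrow> real"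
  interpret weight ?w "cball 0 (R + 1)"
    by unfold_locales (auto simp: indicator_def intro!: integrable_real_indicator emeasure_compact_finite)
  let ?F = "\<lambda>x. \<integral>y. \<phi> (1 *\<^sub>R y + (1 *\<^sub>R x + 0)) * ?w y \<partial>lborel"
  have F: "?F x = (\<integral>y. \<phi> y \<partial>lborel)" if "x \<in> ball 0 1" for x
  proof -
    have "\<phi> (y + x) * ?w y = \<phi> (x + y)" for y
    proof (cases "y + x \<in> K")
      case True
      then have "norm y \<le> R + 1" using R[OF True] norm_triangle_ineq4[of "y + x" x] that by simp
      then show ?thesis by (simp add: add.commute)
    qed (simp add: K(2) add.commute)
    then have "?F x = (\<integral>y. \<phi> (x + y) \<partial>lborel)" by simp
    also have "\<dots> = (\<integral>y. \<phi> y \<partial>distr lborel borel ((+) x))"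
      using smooth_measurable[OF sm] by (subst integral_distr) auto
    finally show ?thesis by (simp add: lborel_distr_plus)
  qed
  have "(?F has_derivative (\<lambda>_. 0)) (at 0)"
    by (rule has_derivative_transform_within_open[OF has_derivative_const[where c = "\<integral>y. \<phi> y \<partial>lborel"], where s = "ball 0 1"])
      (rule open_ball, simp, rule F[symmetric])
  then have "0 = (\<integral>y. pdiff i \<phi> y * ?w y \<partial>lborel)"
    using pdiff_kernel[OF sm assms(2), of 1 1 0 0] pdiff_eq by fastforce
  moreover have "pdiff i \<phi> y * ?w y = pdiff i \<phi> y" for y
    using test_fun_eq_0[OF test_fun_pdiff[OF tK assms(2)], of y] R[of y] by (cases "y \<in> K") auto
  ultimately show ?thesis by simp
qed

section \<open>Weak derivatives\<close>

text \<open>Since \<open>weak_deriv\<close> is an arbitrary choice, this relation allows any square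
  integrable representative to be named explicitly.\<close>

definition weakly :: "'a::euclidean_space set \<Rightarrow> 'a multiset \<Rightarrow> ('a \<Rightarrow> real) \<Rightarrow> ('a \<Rightarrow> real) \<Rightarrow> bool" where
  "weakly D A u g \<longleftrightarrow> sqi_on D g \<and> is_weak_deriv D A u g"

lemma weakly_sqi: "weakly D A u g \<Longrightarrow> sqi_on D g"
  by (simp add: weakly_def)

lemma weakly_unique:
  assumes D: "open D" and g: "weakly D A u g" and h: "weakly D A u h"
  shows "AE x in lebesgue_on D. g x = h x"
proof -
  have "AE x in lebesgue_on D. g x - h x = 0"
  proof (rule fundamental_lemma[OF D])
    show "sqi_on D (\<lambda>x. g x - h x)" using g h by (intro sqi_diff weakly_sqi)
    fix \<phi> :: "'a \<Rightarrow> real" assume \<phi>: "test_fun D \<phi>"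
    obtain xs where "mset xs = A" using ex_mset by blast
    then have "inner_on D u (foldr pdiff xs \<phi>) = (-1) ^ size A * inner_on D g \<phi>"
      "inner_on D u (foldr pdiff xs \<phi>) = (-1) ^ size A * inner_on D h \<phi>"
      using g h \<phi> unfolding weakly_def is_weak_deriv_def by blast+
    then have "(-1) ^ size A * inner_on D g \<phi> = (-1) ^ size A * inner_on D h \<phi>"
      by simp
    then show "inner_on D (\<lambda>x. g x - h x) \<phi> = 0"
      using g h by (simp add: l2_inner_diff_left weakly_sqi test_fun_sqi[OF \<phi> open_sets_lebesgue[OF D]])
  qed
  then show ?thesis by simp
qed

lemma weakly_weak_deriv: "weakly D A u g \<Longrightarrow> weakly D A u (weak_deriv D A u)"
  unfolding weakly_def weak_deriv_def sq_integrable_eq_sqi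
  using someI[of "\<lambda>g. sqi_on D g \<and> is_weak_deriv D A u g" g] by blast

lemma weak_deriv_AE: "open D \<Longrightarrow> weakly D A u g \<Longrightarrow> AE x in lebesgue_on D. weak_deriv D A u x = g x"
  by (blast intro: weakly_unique weakly_weak_deriv)

lemma sobolev_iff: "u \<in> sobolev m D \<longleftrightarrow> sqi_on D u \<and> (\<forall>A\<in>multi_indices m. \<exists>g. weakly D A u g)"
  by (simp add: sobolev_def weakly_def sq_integrable_eq_sqi)

lemma sobolev_weakly: "u \<in> sobolev m D \<Longrightarrow> A \<in> multi_indices m \<Longrightarrow> weakly D A u (weak_deriv D A u)"
  using sobolev_iff weakly_weak_deriv by blast

text \<open>The norm is built on chosen representatives; uniqueness almost everywhere allows it to
  be computed from any others, in particular from restrictions of derivatives taken on a larger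
  domain.\<close>

lemma sobolev_norm_eq:
  assumes "open D" "\<And>A. A \<in> multi_indices m \<Longrightarrow> weakly D A u (g A)"
  shows "sobolev_norm m D u = sqrt (\<Sum>A\<in>multi_indices m. (norm_on D (g A))\<^sup>2)"
proof -
  have "norm_on D (weak_deriv D A u) = norm_on D (g A)" if "A \<in> multi_indices m" for A
    using assms(2)[OF that] weak_deriv_AE[OF assms(1)]
    by (intro l2_norm_cong_AE) (auto intro: weakly_sqi weakly_weak_deriv)
  then show ?thesis by (simp add: sobolev_norm_def)
qed

lemma weakly_comb:
  assumes D: "open D" and uv: "sqi_on D u" "sqi_on D v"
    and A: "set_mset A \<subseteq> Basis" and gh: "weakly D A u g" "weakly D A v h"
  shows "weakly D A (\<lambda>x. u x + c * v x) (\<lambda>x. g x + c * h x)"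
proof -
  note gh' = gh[THEN weakly_sqi]
  have "inner_on D (\<lambda>x. u x + c * v x) (foldr pdiff is \<phi>)
      = (-1) ^ size A * inner_on D (\<lambda>x. g x + c * h x) \<phi>"
    if t: "test_fun D \<phi>" "mset is = A" for \<phi> "is"
  proof -
    have "set is \<subseteq> Basis" using A t(2) by (metis set_mset_mset)
    then have s: "sqi_on D \<phi>" "sqi_on D (foldr pdiff is \<phi>)"
      using test_fun_sqi open_sets_lebesgue[OF D] t(1) test_fun_foldr_pdiff by blast+
    have "inner_on D w (foldr pdiff is \<phi>) = (-1) ^ size A * inner_on D z \<phi>"
      if "weakly D A w z" for w z
      using that t unfolding weakly_def is_weak_deriv_def by blast
    from this[OF gh(1)] this[OF gh(2)] show ?thesis
      using l2_inner_comb[OF uv s(2), of c] l2_inner_comb[OF gh' s(1), of c]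
      by (simp add: algebra_simps)
  qed
  then show ?thesis
    using sqi_comb[OF gh', of c] unfolding weakly_def is_weak_deriv_def by simp
qed

lemma weakly_subset:
  assumes "T \<subseteq> D" "open T" "open D" "set_mset A \<subseteq> Basis" "weakly D A u g"
  shows "weakly T A u g"
  unfolding weakly_def is_weak_deriv_def
proof (intro conjI allI impI)
  note TD = open_sets_lebesgue[OF assms(2)] open_sets_lebesgue[OF assms(3)]
  show "sqi_on T g"
    by (rule sqi_subset[OF assms(1) TD weakly_sqi[OF assms(5)]])
  fix \<phi> "is" assume t: "test_fun T \<phi> \<and> mset is = A"
  then have "set is \<subseteq> Basis" using assms(4) by (metis set_mset_mset)
  then have "test_fun T (foldr pdiff is \<phi>)" using t test_fun_foldr_pdiff by blast
  then have "inner_on T w (foldr pdiff is \<phi>) = inner_on D w (foldr pdiff is \<phi>)" for w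
    using test_fun_eq_0 by (intro l2_inner_test[OF assms(1) TD]) blast
  moreover have "inner_on T w \<phi> = inner_on D w \<phi>" for w
    using t test_fun_eq_0 by (intro l2_inner_test[OF assms(1) TD]) blast
  ultimately show "inner_on T u (foldr pdiff is \<phi>) = (- 1) ^ size A * inner_on T g \<phi>"
    using assms(5) t test_fun_mono[OF _ assms(1)] unfolding weakly_def is_weak_deriv_def by simp
qed

lemma weakly_empty: "sqi_on D u \<Longrightarrow> weakly D {#} u u"
  by (simp add: weakly_def is_weak_deriv_def)

lemma weakly_first_iff:
  "weakly D {#i#} u g \<longleftrightarrow> sqi_on D g \<and>
     (\<forall>\<phi>. test_fun D \<phi> \<longrightarrow> inner_on D u (pdiff i \<phi>) = - inner_on D g \<phi>)"
proof -
  have "mset is = {#i#} \<longleftrightarrow> is = [i]" for "is" :: "'a list" by (auto simp: mset_single_iff)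
  then show ?thesis by (auto simp: weakly_def is_weak_deriv_def)
qed

text \<open>Holds by the product rule, since the derivative of the test function
  \<open>\<phi> x * q x\<close> integrates to zero.\<close>

lemma weakly_smooth:
  fixes \<phi> :: "'a::euclidean_space \<Rightarrow> real"
  assumes D: "open D" "bounded D" and \<phi>: "smooth \<phi>" and i: "i \<in> Basis"
  shows "weakly D {#i#} \<phi> (pdiff i \<phi>)"
  unfolding weakly_first_iff
proof (intro conjI allI impI)
  note DL = open_sets_lebesgue[OF D(1)]
  show "sqi_on D (pdiff i \<phi>)"
    by (intro smooth_sqi smooth_pdiff D DL \<phi> i)
  fix q :: "'a \<Rightarrow> real" assume q: "test_fun D q"
  note t = test_fun_mult[OF test_fun_pdiff[OF q i] \<phi>] test_fun_mult[OF q smooth_pdiff[OF \<phi> i]]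
  have on_D: "inner_on D f g = (\<integral>x. f x * g x \<partial>lborel)"
    if t: "test_fun D g" and f: "smooth f" for f g :: "'a \<Rightarrow> real"
  proof -
    have "(\<lambda>x. indicator D x *\<^sub>R (f x * g x)) = (\<lambda>x. f x * g x)"
      using test_fun_eq_0[OF t] by (auto simp: indicator_def fun_eq_iff)
    moreover have "(\<lambda>x. f x * g x) \<in> borel_measurable borel"
      using smooth_measurable[OF f] smooth_measurable[OF test_fun_smooth[OF t]] by measurable
    ultimately show ?thesis
      using DL by (simp add: l2_inner_def integral_restrict_space integral_completion del: real_scaleR_def)
  qed
  have "0 = (\<integral>x. pdiff i (\<lambda>x. \<phi> x * q x) x \<partial>lborel)"
    by (rule integral_pdiff_test_fun[OF test_fun_mult[OF q \<phi>] i, symmetric])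
  also have "\<dots> = (\<integral>x. pdiff i \<phi> x * q x + \<phi> x * pdiff i q x \<partial>lborel)"
    using \<phi> test_fun_smooth[OF q] by (simp add: pdiff_mult smooth_differentiable)
  also have "\<dots> = (\<integral>x. pdiff i \<phi> x * q x \<partial>lborel) + (\<integral>x. \<phi> x * pdiff i q x \<partial>lborel)"
    using t[THEN test_fun_integrable] by (intro Bochner_Integration.integral_add) auto
  finally show "inner_on D \<phi> (pdiff i q) = - inner_on D (pdiff i \<phi>) q"
    using on_D[OF test_fun_pdiff[OF q i] \<phi>] on_D[OF q smooth_pdiff[OF \<phi> i]] by simp
qed

lemma multi_indices_1: "multi_indices 1 = insert {#} ((\<lambda>i. {#i#}) ` (Basis :: 'a::euclidean_space set))"
proof (intro set_eqI iffI)
  fix A :: "'a multiset" assume "A \<in> multi_indices 1"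
  then have "set_mset A \<subseteq> Basis" "A = {#} \<or> size A = 1"
    using nonempty_has_size[of A] by (auto simp: multi_indices_def)
  then show "A \<in> insert {#} ((\<lambda>i. {#i#}) ` Basis)"
    using size_1_singleton_mset[of A] by auto
qed (auto simp: multi_indices_def)

lemma sum_multi_indices_1:
  "(\<Sum>A\<in>multi_indices 1. f A) = f {#} + (\<Sum>i\<in>(Basis :: 'a::euclidean_space set). f {#i#})"
  unfolding multi_indices_1
  by (subst sum.insert) (auto simp: sum.reindex inj_on_def)

lemma sobolev_1I:
  assumes "sqi_on D u" "\<And>i. i \<in> Basis \<Longrightarrow> weakly D {#i#} u (g i)"
  shows "u \<in> sobolev 1 D"
  unfolding sobolev_iff multi_indices_1 using assms weakly_empty by blast

lemma sobolev_norm_1: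
  assumes D: "open D" and u: "sqi_on D u" and g: "\<And>i. i \<in> Basis \<Longrightarrow> weakly D {#i#} u (g i)"
  shows "sobolev_norm 1 D u = sqrt ((norm_on D u)\<^sup>2 + (\<Sum>i\<in>Basis. (norm_on D (g i))\<^sup>2))"
proof -
  have "weakly D A u (if A = {#} then u else g (THE i. A = {#i#}))" if "A \<in> multi_indices 1" for A :: "'a multiset"
    using that u g by (auto simp: multi_indices_1 weakly_empty simp del: One_nat_def)
  from sobolev_norm_eq[OF D this, of 1] show ?thesis
    unfolding sum_multi_indices_1 by (simp del: One_nat_def)
qed

lemma sobolev_norm_1_diff:
  assumes D: "open D" "bounded D" and u: "sqi_on D u" and g: "\<And>i. i \<in> Basis \<Longrightarrow> weakly D {#i#} u (g i)"
    and \<phi>: "smooth \<phi>"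
  shows "sobolev_norm 1 D (\<lambda>x. u x - \<phi> x) = sqrt ((norm_on D (\<lambda>x. u x - \<phi> x))\<^sup>2 +
      (\<Sum>i\<in>Basis. (norm_on D (\<lambda>x. g i x - pdiff i \<phi> x))\<^sup>2))"
proof (rule sobolev_norm_1[OF D(1)])
  note s = smooth_sqi[OF \<phi> D(2) open_sets_lebesgue[OF D(1)]]
  show "sqi_on D (\<lambda>x. u x - \<phi> x)" using u s by (rule sqi_diff)
  show "weakly D {#i#} (\<lambda>x. u x - \<phi> x) (\<lambda>x. g i x - pdiff i \<phi> x)" if "i \<in> Basis" for i
    using weakly_comb[OF D(1) u s _ g[OF that] weakly_smooth[OF D \<phi> that], of "-1"] that by simp
qed

lemma sobolev_norm_1_tendsto:
  assumes D: "open D" "bounded D" and u: "sqi_on D u" and g: "\<And>i. i \<in> Basis \<Longrightarrow> weakly D {#i#} u (g i)"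
    and \<phi>: "\<And>n. smooth (\<phi> n)"
  shows "(\<lambda>n. sobolev_norm 1 D (\<lambda>x. u x - \<phi> n x)) \<longlonglongrightarrow> 0 \<longleftrightarrow>
     (\<lambda>n. norm_on D (\<lambda>x. u x - \<phi> n x)) \<longlonglongrightarrow> 0 \<and>
     (\<forall>i\<in>Basis. (\<lambda>n. norm_on D (\<lambda>x. g i x - pdiff i (\<phi> n) x)) \<longlonglongrightarrow> 0)"
    (is "?l \<longleftrightarrow> ?r")
proof -
  let ?s = "\<lambda>n. sobolev_norm 1 D (\<lambda>x. u x - \<phi> n x)"
  have e: "?s n = sqrt ((norm_on D (\<lambda>x. u x - \<phi> n x))\<^sup>2 +
      (\<Sum>i\<in>Basis. (norm_on D (\<lambda>x. g i x - pdiff i (\<phi> n) x))\<^sup>2))" for n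
    by (rule sobolev_norm_1_diff[OF D u g \<phi>])
  show ?thesis
  proof
  assume l: ?l
  show ?r
  proof (intro conjI ballI)
    show "(\<lambda>n. norm_on D (\<lambda>x. u x - \<phi> n x)) \<longlonglongrightarrow> 0"
    proof (rule tendsto_sandwich[OF _ _ tendsto_const l])
      have "norm_on D (\<lambda>x. u x - \<phi> n x) \<le> ?s n" for n
        unfolding e by (intro real_le_rsqrt) (simp add: sum_nonneg)
      then show "\<forall>\<^sub>F n in sequentially. norm_on D (\<lambda>x. u x - \<phi> n x) \<le> ?s n"
        by (intro always_eventually allI)
    qed (simp add: l2_norm_nonneg)
    fix i :: 'a assume i: "i \<in> Basis"
    show "(\<lambda>n. norm_on D (\<lambda>x. g i x - pdiff i (\<phi> n) x)) \<longlonglongrightarrow> 0"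
    proof (rule tendsto_sandwich[OF _ _ tendsto_const l])
      have "(norm_on D (\<lambda>x. g i x - pdiff i (\<phi> n) x))\<^sup>2 \<le>
         (\<Sum>i\<in>Basis. (norm_on D (\<lambda>x. g i x - pdiff i (\<phi> n) x))\<^sup>2)" for n
        using i by (intro member_le_sum) auto
      then have "norm_on D (\<lambda>x. g i x - pdiff i (\<phi> n) x) \<le> ?s n" for n
        unfolding e by (intro real_le_rsqrt) (simp add: add_increasing)
      then show "\<forall>\<^sub>F n in sequentially. norm_on D (\<lambda>x. g i x - pdiff i (\<phi> n) x) \<le> ?s n"
        by (intro always_eventually allI)
    qed (simp add: l2_norm_nonneg)
  qed
next
  assume ?r
  then have "(\<lambda>n. sqrt ((norm_on D (\<lambda>x. u x - \<phi> n x))\<^sup>2 +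
      (\<Sum>i\<in>Basis. (norm_on D (\<lambda>x. g i x - pdiff i (\<phi> n) x))\<^sup>2))) \<longlonglongrightarrow> sqrt (0\<^sup>2 + (\<Sum>i\<in>(Basis :: 'a set). 0\<^sup>2))"
    by (intro tendsto_intros) auto
  then show ?l unfolding e by simp
  qed
qed

text \<open>Second derivatives in L2 allow the weak equation, tested with test functions, to be
  integrated by parts once more; the fundamental lemma turns the result into an identity of
  functions.\<close>

lemma poisson_solution_strong:
  fixes u f :: "'a::euclidean_space \<Rightarrow> real"
  assumes D: "open D" "bounded D" and u: "poisson_solution D f u" "u \<in> sobolev 2 D" and f: "sqi_on D f"
  shows "AE x in lebesgue_on D. (\<Sum>i\<in>Basis. weak_deriv D {#i, i#} u x) = - f x"
proof -
  note DL = open_sets_lebesgue[OF D(1)]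
  let ?g = "\<lambda>x. (\<Sum>i\<in>Basis. weak_deriv D {#i, i#} u x)"
  have w2: "weakly D {#i, i#} u (weak_deriv D {#i, i#} u)" and w1: "weakly D {#i#} u (weak_deriv D {#i#} u)"
    if "i \<in> Basis" for i
    using that u(2) by (auto intro!: sobolev_weakly[of _ 2] simp: multi_indices_def)
  have sg: "sqi_on D ?g"
    by (intro sqi_sum weakly_sqi[OF w2])
  have "AE x in lebesgue_on D. ?g x - (- f x) = 0"
  proof (rule fundamental_lemma[OF D(1)])
    show "sqi_on D (\<lambda>x. ?g x - (- f x))" using sg sqi_scaleR[OF f, of "-1"] by (intro sqi_diff) auto
    fix \<phi> :: "'a \<Rightarrow> real" assume \<phi>: "test_fun D \<phi>"
    note sm = test_fun_smooth[OF \<phi>]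
    note s = test_fun_sqi[OF \<phi> DL]
    have p: "weakly D {#i#} \<phi> (pdiff i \<phi>)" if "i \<in> Basis" for i
      by (rule weakly_smooth[OF D sm that])
    have "sobolev_norm 1 D (\<lambda>x. \<phi> x - \<phi> x) = 0"
      using sobolev_norm_1_diff[OF D s p sm] by (simp add: l2_norm_def l2_inner_def)
    \<comment> \<open>A test function is its own approximating sequence.\<close>
    then have "\<phi> \<in> sobolev0 D"
      unfolding sobolev0_def using sobolev_1I[OF s p] \<phi> by (auto intro!: exI[of _ "\<lambda>_. \<phi>"])
    then have weak: "inner_on D (weak_grad D u) (weak_grad D \<phi>) = inner_on D f \<phi>"
      using u(1) by (auto simp: poisson_solution_def)
    have gr: "weak_grad D u x \<bullet> weak_grad D \<phi> x = (\<Sum>i\<in>Basis. weak_deriv D {#i#} u x * weak_deriv D {#i#} \<phi> x)" for x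
      by (subst euclidean_inner, intro sum.cong refl)
        (simp add: weak_grad_def inner_sum_left inner_Basis if_distrib sum.delta cong: if_cong)
    have "inner_on D (weak_grad D u) (weak_grad D \<phi>)
        = (\<Sum>i\<in>Basis. inner_on D (weak_deriv D {#i#} u) (weak_deriv D {#i#} \<phi>))"
      unfolding l2_inner_def gr using w1 weakly_weak_deriv[OF p]
      by (subst Bochner_Integration.integral_sum) (auto intro!: sqi_mult weakly_sqi)
    also have "\<dots> = (\<Sum>i\<in>Basis. - inner_on D (weak_deriv D {#i, i#} u) \<phi>)"
    proof (rule sum.cong[OF refl])
      fix i :: 'a assume i: "i \<in> Basis"
      have "inner_on D (weak_deriv D {#i#} u) (weak_deriv D {#i#} \<phi>) = inner_on D (weak_deriv D {#i#} u) (pdiff i \<phi>)"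
        using i w1 p weak_deriv_AE[OF D(1) p] by (intro l2_inner_cong_AE) (auto intro!: weakly_sqi weakly_weak_deriv)
      also have "\<dots> = - inner_on D u (foldr pdiff [i, i] \<phi>)"
        using w1[OF i] test_fun_pdiff[OF \<phi> i] unfolding weakly_first_iff by simp
      also have "inner_on D u (foldr pdiff [i, i] \<phi>) = (- 1) ^ 2 * inner_on D (weak_deriv D {#i, i#} u) \<phi>"
      proof -
        have "inner_on D u (foldr pdiff is \<phi>) = (- 1) ^ size {#i, i#} * inner_on D (weak_deriv D {#i, i#} u) \<phi>"
          if "mset is = {#i, i#}" for "is"
          using w2[OF i] \<phi> that unfolding weakly_def is_weak_deriv_def by blast
        from this[of "[i, i]"] show ?thesis by simp
      qed
      finally show "inner_on D (weak_deriv D {#i#} u) (weak_deriv D {#i#} \<phi>) = - inner_on D (weak_deriv D {#i, i#} u) \<phi>"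
        by simp
    qed
    also have "\<dots> = - inner_on D ?g \<phi>"
      unfolding l2_inner_def using w2 s
      by (simp add: sum_distrib_right sum_negf, subst Bochner_Integration.integral_sum) (auto intro!: sqi_mult weakly_sqi)
    finally show "inner_on D (\<lambda>x. ?g x - (- f x)) \<phi> = 0"
      using weak l2_inner_comb[OF sg f s, of 1] by simp
  qed
  then show ?thesis by eventually_elim simp
qed

text \<open>The list \<open>[i, j]\<close> applies \<open>pdiff j\<close> first, so
  \<open>pdiff j \<phi>\<close> serves as test function for the first derivative. Components of the
  gradient thereby become H^1 functions with known derivatives.\<close>

lemma weakly_second:
  assumes "open D" "i \<in> Basis" "j \<in> Basis" "weakly D {#i#} u v" "weakly D {#i, j#} u g"
  shows "weakly D {#j#} v g"
  unfolding weakly_first_iff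
proof (intro conjI allI impI)
  show "sqi_on D g" using assms(5) by (rule weakly_sqi)
  fix \<phi> :: "'a \<Rightarrow> real" assume \<phi>: "test_fun D \<phi>"
  have "inner_on D u (foldr pdiff is \<phi>) = (- 1) ^ size {#i, j#} * inner_on D g \<phi>"
    if "mset is = {#i, j#}" for "is"
    using assms(5) \<phi> that unfolding weakly_def is_weak_deriv_def by blast
  from this[of "[i, j]"] have "inner_on D u (foldr pdiff [i, j] \<phi>) = inner_on D g \<phi>"
    by simp
  moreover have "inner_on D u (pdiff i (pdiff j \<phi>)) = - inner_on D v (pdiff j \<phi>)"
    using assms(4) test_fun_pdiff[OF \<phi> assms(3)] unfolding weakly_first_iff by blast
  ultimately show "inner_on D v (pdiff j \<phi>) = - inner_on D g \<phi>" by simp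
qed

section \<open>Mollification and density of smooth functions\<close>

lemma ex_mollifier:
  "\<exists>\<eta> :: 'a::euclidean_space \<Rightarrow> real. test_fun (ball 0 1) \<eta> \<and> (\<forall>x. 0 \<le> \<eta> x) \<and> (\<integral>x. \<eta> x \<partial>lborel) = 1"
proof -
  \<comment> \<open>With this half-width the l1 norm on the box stays below one, so the box lies in
    the unit ball.\<close>
  define e where "e = 1 / (real DIM('a) + 1)"
  have e0: "0 < e" by (simp add: e_def)
  let ?b = "box_bump (- (e *\<^sub>R One)) (e *\<^sub>R One) :: 'a \<Rightarrow> real"
  have "cbox (- (e *\<^sub>R One)) (e *\<^sub>R One) \<subseteq> ball (0 :: 'a) 1"
  proof
    fix x :: 'a assume "x \<in> cbox (- (e *\<^sub>R One)) (e *\<^sub>R One)"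
    then have "\<bar>x \<bullet> i\<bar> \<le> e" if "i \<in> Basis" for i using that by (force simp: mem_box)
    then have "norm x \<le> (\<Sum>i\<in>(Basis :: 'a set). e)" by (intro order_trans[OF norm_le_l1] sum_mono) auto
    also have "\<dots> < 1" by (simp add: e_def field_simps)
    finally show "x \<in> ball 0 1" by simp
  qed
  then have t: "test_fun (ball 0 1) ?b" by (rule test_fun_box_bump)
  note int = test_fun_integrable[OF t]
  have "(\<integral>x. ?b x \<partial>lborel) \<noteq> 0"
  proof
    assume "(\<integral>x. ?b x \<partial>lborel) = 0"
    then have "AE x in lborel. ?b x = 0"
      using integral_nonneg_eq_0_iff_AE[OF int] box_bump_nonneg by blast
    then have "AE x in lborel. x \<notin> box (- (e *\<^sub>R One)) (e *\<^sub>R One :: 'a)"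
    proof eventually_elim
      case (elim x)
      then show ?case using box_bump_pos[of x "- (e *\<^sub>R One)" "e *\<^sub>R One"] by force
    qed
    then have "emeasure lborel (box (- (e *\<^sub>R One)) (e *\<^sub>R One :: 'a)) = 0"
      by (subst (asm) AE_iff_measurable[OF _ refl]) auto
    moreover have "emeasure lborel (box (- (e *\<^sub>R One)) (e *\<^sub>R One :: 'a)) = ennreal (\<Prod>i\<in>(Basis :: 'a set). 2 * e)"
      using e0 by (subst emeasure_lborel_box)
        (simp_all add: inner_minus_left, intro arg_cong[of _ _ ennreal] prod.cong, simp_all add: inner_add_left)
    ultimately show False using e0 by simp
  qed
  moreover have "0 \<le> (\<integral>x. ?b x \<partial>lborel)" by (intro Bochner_Integration.integral_nonneg) (simp add: box_bump_nonneg)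
  ultimately have pos: "0 < (\<integral>x. ?b x \<partial>lborel)" by simp
  show ?thesis
    using pos test_fun_cmult[OF t, of "1 / (\<integral>x. ?b x \<partial>lborel)"] box_bump_nonneg int
    by (intro exI[of _ "\<lambda>x. 1 / (\<integral>x. ?b x \<partial>lborel) * ?b x"]) (auto intro!: divide_nonneg_pos)
qed

lemma nn_integral_lborel_affine:
  fixes f :: "'a::euclidean_space \<Rightarrow> ennreal"
  assumes [measurable]: "f \<in> borel_measurable borel" and c: "c \<noteq> 0"
  shows "(\<integral>\<^sup>+x. f x \<partial>lborel) = ennreal (\<bar>c\<bar> ^ DIM('a)) * (\<integral>\<^sup>+x. f (c *\<^sub>R x + b) \<partial>lborel)"
  by (subst lborel_affine[OF c, of b])
    (simp add: nn_integral_density nn_integral_distr nn_integral_cmult add.commute ennreal_power)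

lemma l2_norm_nn_integral:
  fixes f :: "'a::euclidean_space \<Rightarrow> real"
  assumes "sqi_on D f" "D \<in> sets borel" "f \<in> borel_measurable borel"
  shows "ennreal ((norm_on D f)\<^sup>2) = (\<integral>\<^sup>+x. indicator D x * ennreal ((f x)\<^sup>2) \<partial>lborel)"
proof -
  have "ennreal ((norm_on D f)\<^sup>2) = (\<integral>\<^sup>+x. ennreal ((f x)\<^sup>2) * indicator D x \<partial>lebesgue)"
    unfolding l2_norm_nn[OF assms(1)]
    using assms(2) by (subst nn_integral_restrict_space) (auto simp: sets_completionI_sets)
  then show ?thesis
    by (simp add: nn_integral_completion mult.commute)
qed

text \<open>Two approximations cost \<open>e / 2\<close> each: truncation of \<open>w\<close> at a
  level \<open>N\<close>, and continuous functions that converge almost everywhere to the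
  truncation.\<close>

lemma continuous_l2_dense:
  fixes w :: "'a::euclidean_space \<Rightarrow> real"
  assumes D: "D \<in> lmeasurable" and w: "sqi_on D w" and e: "0 < e"
  shows "\<exists>g. continuous_on UNIV g \<and> bounded (range g) \<and> norm_on D (\<lambda>x. w x - g x) < e"
proof -
  have DL: "D \<in> sets lebesgue" using D by blast
  interpret finite_measure "lebesgue_on D" using D by (rule finite_measure_lebesgue_on)
  define T where "T n x = max (- real n) (min (real n) x)" for n and x :: real
  have Tc: "continuous_on UNIV (T n)" for n unfolding T_def by (intro continuous_intros)
  have Tb: "\<bar>T n x\<bar> \<le> real n" for n x by (auto simp: T_def)
  have wm: "w \<in> borel_measurable (lebesgue_on D)" using w by (rule sqi_measurable)
  have Tw: "(\<lambda>x. T n (w x)) \<in> borel_measurable (lebesgue_on D)" for n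
    by (rule measurable_compose[OF wm borel_measurable_continuous_onI[OF Tc]])
  have "(\<lambda>n. norm_on D (\<lambda>x. w x - T n (w x))) \<longlonglongrightarrow> 0"
  proof (rule l2_dominated[OF borel_measurable_diff[OF wm Tw] w], rule AE_I2, rule tendsto_eventually)
    show "\<forall>\<^sub>F n in sequentially. w x - T n (w x) = 0" for x
      using eventually_ge_at_top[of "nat \<lceil>\<bar>w x\<bar>\<rceil>"] by eventually_elim (auto simp: T_def)
  qed (auto simp: T_def)
  then have "\<forall>\<^sub>F n in sequentially. norm_on D (\<lambda>x. w x - T n (w x)) < e / 2"
    using e by (intro order_tendstoD) auto
  then obtain N where N: "norm_on D (\<lambda>x. w x - T N (w x)) < e / 2"
    by (auto simp: eventually_sequentially)
  have "(\<lambda>x. T N (w x)) measurable_on D"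
    by (subst measurable_on_iff_borel_measurable[OF DL]) (rule Tw)
  then obtain Z G where Z: "negligible Z" and G: "\<And>n. continuous_on UNIV (G n)"
      "\<And>x. x \<notin> Z \<Longrightarrow> (\<lambda>n. G n x) \<longlonglongrightarrow> (if x \<in> D then T N (w x) else 0)"
    unfolding measurable_on_def by blast
  \<comment> \<open>Truncating the approximants again keeps them uniformly bounded and does not move
    their limit, because truncation is continuous and idempotent.\<close>
  define g where "g n x = T N (G n x)" for n x
  have gc: "continuous_on UNIV (g n)" for n
    unfolding g_def by (rule continuous_on_compose2[OF Tc G(1)]) auto
  have gm: "g n \<in> borel_measurable (lebesgue_on D)" for n
    by (intro borel_measurable_lebesgue_on borel_measurable_continuous_onI gc)
  have "(\<lambda>n. norm_on D (\<lambda>x. T N (w x) - g n x)) \<longlonglongrightarrow> 0"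
  proof (rule l2_dominated[OF borel_measurable_diff[OF Tw gm]])
    show "sqi_on D (\<lambda>_. 2 * real N)" by (simp add: sqi_def)
    have "AE x in lebesgue. x \<notin> Z" using Z AE_not_in negligible_iff_null_sets by blast
    then have "AE x in lebesgue_on D. x \<notin> Z"
      using DL by (simp add: AE_restrict_space_iff) (auto elim: eventually_mono)
    then show "AE x in lebesgue_on D. (\<lambda>n. T N (w x) - g n x) \<longlonglongrightarrow> 0"
    proof (rule AE_mp, intro AE_I2 impI)
      fix x assume "x \<in> space (lebesgue_on D)" "x \<notin> Z"
      then have "(\<lambda>n. G n x) \<longlonglongrightarrow> T N (w x)" using G(2)[of x] by simp
      then have "(\<lambda>n. g n x) \<longlonglongrightarrow> T N (T N (w x))"
        unfolding g_def by (rule continuous_on_tendsto_compose[OF Tc]) auto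
      moreover have "T N (T N (w x)) = T N (w x)" by (auto simp: T_def)
      ultimately show "(\<lambda>n. T N (w x) - g n x) \<longlonglongrightarrow> 0" by (simp add: LIM_zero tendsto_const tendsto_diff[of _ "T N (w x)" _ _ "T N (w x)", simplified])
    qed
    show "\<bar>T N (w x) - g n x\<bar> \<le> \<bar>2 * real N\<bar>" for n x
      using Tb[of N "w x"] Tb[of N "G n x"] unfolding g_def by linarith
  qed
  then have "\<forall>\<^sub>F n in sequentially. norm_on D (\<lambda>x. T N (w x) - g n x) < e / 2"
    using e by (intro order_tendstoD) auto
  then obtain M where M: "norm_on D (\<lambda>x. T N (w x) - g M x) < e / 2"
    by (auto simp: eventually_sequentially)
  have "sqi_on D (\<lambda>x. T N (w x))" "sqi_on D (g M)"
    using Tb by (auto intro!: sqi_bounded[OF finite_measure_axioms, where C = "real N"] Tw gm simp: g_def)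
  then have "norm_on D (\<lambda>x. w x - g M x) < e"
    using l2_triangle_between[OF w] N M by fastforce
  moreover have "bounded (range (g M))"
    unfolding bounded_iff using Tb by (auto simp: g_def)
  ultimately show ?thesis using gc by blast
qed

section \<open>Mollification towards an interior point of a convex set\<close>

locale mollifier =
  fixes \<Omega> :: "'a::euclidean_space set" and a :: 'a and r :: real and \<eta> :: "'a \<Rightarrow> real"
  assumes \<Omega>: "open \<Omega>" "convex \<Omega>" "bounded \<Omega>"
    and r: "0 < r" "ball a r \<subseteq> \<Omega>"
    and \<eta>: "test_fun (ball 0 1) \<eta>" "\<And>x. 0 \<le> \<eta> x" "(\<integral>x. \<eta> x \<partial>lborel) = 1"
begin

definition sc :: "real \<Rightarrow> real" where "sc t = 1 / (t * r)"

text \<open>Averages over the ball of radius \<open>t * r\<close> around \<open>(1 - t) x + t a\<close>, which for \<open>x\<close> in the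
  convex set lies inside the set: contracting towards \<open>a\<close> avoids any extension across the boundary.\<close>

definition ker :: "real \<Rightarrow> 'a \<Rightarrow> 'a \<Rightarrow> real" where
  "ker t x y = sc t ^ DIM('a) * \<eta> (sc t *\<^sub>R y + ((- (sc t * (1 - t))) *\<^sub>R x + (- (sc t * t)) *\<^sub>R a))"

definition moll :: "real \<Rightarrow> ('a \<Rightarrow> real) \<Rightarrow> 'a \<Rightarrow> real" where
  "moll t w x = (\<integral>y. ker t x y * w y \<partial>lborel)"

lemma eta_measurable [measurable]: "\<eta> \<in> borel_measurable borel"
  using \<eta>(1) by (intro smooth_measurable test_fun_smooth)

lemma sc_pos: "0 < t \<Longrightarrow> 0 < sc t"
  using r by (simp add: sc_def)

lemma ker_nonneg: "0 < t \<Longrightarrow> 0 \<le> ker t x y"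
  unfolding ker_def using sc_pos[of t] \<eta>(2) by simp

lemma ker_measurable [measurable]: "ker t x \<in> borel_measurable borel"
  unfolding ker_def[abs_def] by measurable

text \<open>The argument of \<open>\<eta>\<close> in the kernel is the z that solves y = (1 - t) x +
  t (a + r z). For z in the unit ball this exhibits \<open>y\<close> as a convex combination of
  \<open>x\<close> and a point of the inner ball.\<close>

lemma ker_argument:
  assumes "0 < t"
  shows "y = (1 - t) *\<^sub>R x + t *\<^sub>R (a + r *\<^sub>R (sc t *\<^sub>R y + ((- (sc t * (1 - t))) *\<^sub>R x + (- (sc t * t)) *\<^sub>R a)))"
proof -
  have "t * r * sc t = 1" using assms r by (simp add: sc_def)
  then have e: "t * (r * (sc t * s)) = s" "t * (r * sc t) = 1" for s by (simp_all flip: mult.assoc)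
  show ?thesis by (simp add: e scaleR_add_right scaleR_right_diff_distrib scaleR_left_diff_distrib)
qed

lemma ker_support:
  assumes t: "0 < t" "t < 1" and x: "x \<in> \<Omega>" and k: "ker t x y \<noteq> 0"
  obtains z where "z \<in> ball 0 1" "y = (1 - t) *\<^sub>R x + t *\<^sub>R (a + r *\<^sub>R z)"
proof -
  let ?z = "sc t *\<^sub>R y + ((- (sc t * (1 - t))) *\<^sub>R x + (- (sc t * t)) *\<^sub>R a)"
  have "?z \<in> ball 0 1" using k test_fun_eq_0[OF \<eta>(1)] unfolding ker_def by fastforce
  then show ?thesis using ker_argument[OF t(1)] by (rule that)
qed

lemma ball_point: "z \<in> ball 0 1 \<Longrightarrow> a + r *\<^sub>R z \<in> \<Omega>"
  using r by (auto intro!: subsetD[OF r(2)] simp: dist_norm)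

lemma ker_support_in: "0 < t \<Longrightarrow> t < 1 \<Longrightarrow> x \<in> \<Omega> \<Longrightarrow> ker t x y \<noteq> 0 \<Longrightarrow> y \<in> \<Omega>"
  using ker_support[of t x y] convexD[OF \<Omega>(2) _ ball_point, of x _ "1 - t" t] by force

lemma ker_support_near:
  assumes "0 < t" "t < 1" "x \<in> \<Omega>" "ker t x y \<noteq> 0" and R: "\<And>x. x \<in> \<Omega> \<Longrightarrow> norm x \<le> R"
  shows "norm (y - x) \<le> t * (2 * R)"
proof -
  obtain z where z: "z \<in> ball 0 1" "y = (1 - t) *\<^sub>R x + t *\<^sub>R (a + r *\<^sub>R z)"
    using ker_support[OF assms(1-4)] .
  then have "y - x = t *\<^sub>R ((a + r *\<^sub>R z) - x)" by (simp add: algebra_simps)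
  moreover have "norm ((a + r *\<^sub>R z) - x) \<le> 2 * R"
    using R[OF ball_point[OF z(1)]] R[OF assms(3)] norm_triangle_ineq4[of "a + r *\<^sub>R z" x] by linarith
  ultimately show ?thesis using assms(1) by (simp add: mult_left_mono)
qed

lemma nn_integral_eta: "(\<integral>\<^sup>+x. ennreal (\<eta> x) \<partial>lborel) = 1"
  using \<eta> test_fun_integrable[OF \<eta>(1)] by (subst nn_integral_eq_integral) auto

lemma ker_mass:
  assumes "0 < t" shows "(\<integral>\<^sup>+y. ennreal (ker t x y) \<partial>lborel) = 1"
proof -
  let ?b = "(- (sc t * (1 - t))) *\<^sub>R x + (- (sc t * t)) *\<^sub>R a"
  have "(\<integral>\<^sup>+y. ennreal (ker t x y) \<partial>lborel) = (\<integral>\<^sup>+y. ennreal (sc t ^ DIM('a)) * ennreal (\<eta> (sc t *\<^sub>R y + ?b)) \<partial>lborel)"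
    unfolding ker_def using sc_pos[OF assms] \<eta>(2) by (intro nn_integral_cong ennreal_mult) auto
  also have "\<dots> = ennreal (\<bar>sc t\<bar> ^ DIM('a)) * (\<integral>\<^sup>+y. ennreal (\<eta> (sc t *\<^sub>R y + ?b)) \<partial>lborel)"
    using sc_pos[OF assms] by (subst nn_integral_cmult) auto
  also have "\<dots> = 1"
    using nn_integral_lborel_affine[of "\<lambda>x. ennreal (\<eta> x)" "sc t" ?b] sc_pos[OF assms] nn_integral_eta by simp
  finally show ?thesis .
qed

text \<open>As a function of \<open>x\<close> the kernel has the scale \<open>sc t\<close> times
  \<open>1 - t\<close>, so its mass is the inverse of \<open>1 - t\<close> to the power of the
  dimension. The restriction on \<open>t\<close> bounds this uniformly.\<close>

lemma ker_mass_left: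
  assumes "0 < t" "t \<le> 1 / 2" shows "(\<integral>\<^sup>+x. ennreal (ker t x y) \<partial>lborel) \<le> ennreal (2 ^ DIM('a))"
proof -
  let ?c = "- (sc t * (1 - t))" and ?b = "sc t *\<^sub>R y + (- (sc t * t)) *\<^sub>R a"
  let ?I = "\<integral>\<^sup>+x. ennreal (\<eta> (?c *\<^sub>R x + ?b)) \<partial>lborel"
  have "(\<integral>\<^sup>+x. ennreal (ker t x y) \<partial>lborel) = (\<integral>\<^sup>+x. ennreal (sc t ^ DIM('a)) * ennreal (\<eta> (?c *\<^sub>R x + ?b)) \<partial>lborel)"
  proof (intro nn_integral_cong)
    fix x
    have "ker t x y = sc t ^ DIM('a) * \<eta> (?c *\<^sub>R x + ?b)" unfolding ker_def by (simp only: add_ac)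
    then show "ennreal (ker t x y) = ennreal (sc t ^ DIM('a)) * ennreal (\<eta> (?c *\<^sub>R x + ?b))"
      using sc_pos[OF assms(1)] \<eta>(2) by (simp add: ennreal_mult)
  qed
  also have "\<dots> = ennreal (sc t ^ DIM('a)) * ?I"
    using sc_pos[OF assms(1)] by (subst nn_integral_cmult) auto
  also have "\<dots> \<le> ennreal (2 ^ DIM('a) * \<bar>?c\<bar> ^ DIM('a)) * ?I"
  proof (intro mult_right_mono ennreal_leI)
    have "sc t \<le> 2 * \<bar>?c\<bar>" using sc_pos[OF assms(1)] assms by (simp add: abs_mult)
    then show "sc t ^ DIM('a) \<le> 2 ^ DIM('a) * \<bar>?c\<bar> ^ DIM('a)"
      unfolding power_mult_distrib[symmetric] using sc_pos[OF assms(1)] by (intro power_mono) auto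
  qed simp
  also have "\<dots> = ennreal (2 ^ DIM('a)) * (ennreal (\<bar>?c\<bar> ^ DIM('a)) * ?I)"
    by (simp add: ennreal_mult mult.assoc)
  also have "ennreal (\<bar>?c\<bar> ^ DIM('a)) * ?I = 1"
    using nn_integral_lborel_affine[of "\<lambda>x. ennreal (\<eta> x)" ?c ?b] sc_pos[OF assms(1)] assms(2) nn_integral_eta by auto
  finally show ?thesis by simp
qed

text \<open>Cauchy-Schwarz with the kernel split into two square roots, one of which has unit norm
  because the kernel has unit mass in \<open>y\<close>. An infinite right-hand side is set apart so
  that the other factor is square integrable.\<close>

lemma moll_sq:
  assumes t: "0 < t" and [measurable]: "w \<in> borel_measurable borel"
  shows "ennreal ((moll t w x)\<^sup>2) \<le> (\<integral>\<^sup>+y. ennreal (ker t x y) * ennreal ((w y)\<^sup>2) \<partial>lborel)" (is "_ \<le> ?I")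
proof (cases "?I = \<infinity>")
  case False
  let ?s = "\<lambda>y. sqrt (ker t x y)"
  note k0 = ker_nonneg[OF t]
  have e: "?I = (\<integral>\<^sup>+y. ennreal ((?s y * w y)\<^sup>2) \<partial>lborel)"
    by (simp add: power_mult_distrib k0 ennreal_mult)
  have s1: "sqi lborel ?s"
    unfolding sqi_def using ker_mass[OF t, of x]
    by (auto simp: k0 integrable_iff_bounded abs_of_nonneg)
  have s2: "sqi lborel (\<lambda>y. ?s y * w y)"
    unfolding sqi_def using False[unfolded e]
    by (auto simp: integrable_iff_bounded less_top power2_eq_square)
  have "moll t w x = l2_inner lborel ?s (\<lambda>y. ?s y * w y)"
    unfolding moll_def l2_inner_def using k0 by (intro Bochner_Integration.integral_cong) (auto simp flip: mult.assoc)
  then have "\<bar>moll t w x\<bar> \<le> l2_norm lborel ?s * l2_norm lborel (\<lambda>y. ?s y * w y)"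
    using l2_cauchy_schwarz[OF s1 s2] by simp
  moreover have "l2_norm lborel ?s = 1"
  proof -
    have "(l2_norm lborel ?s)\<^sup>2 = 1" using ker_mass[OF t, of x] l2_norm_nn[OF s1] k0 by simp
    then show ?thesis using l2_norm_nonneg[of lborel ?s] by (simp add: power2_eq_1_iff)
  qed
  ultimately have "(moll t w x)\<^sup>2 \<le> (l2_norm lborel (\<lambda>y. ?s y * w y))\<^sup>2"
    using abs_le_square_iff l2_norm_nonneg by (metis abs_of_nonneg mult_1)
  then show ?thesis unfolding e l2_norm_nn[OF s2, symmetric] by (rule ennreal_leI)
qed simp

text \<open>Schur's test: the pointwise bound is integrated in \<open>x\<close>, and exchanging the
  integrals brings in the mass of the kernel in its other variable.\<close>

lemma moll_bound:
  assumes t: "0 < t" "t \<le> 1 / 2" and [measurable]: "w \<in> borel_measurable borel"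
  shows "(\<integral>\<^sup>+x. ennreal ((moll t w x)\<^sup>2) \<partial>lborel) \<le> ennreal (2 ^ DIM('a)) * (\<integral>\<^sup>+y. ennreal ((w y)\<^sup>2) \<partial>lborel)"
proof -
  have "(\<integral>\<^sup>+x. ennreal ((moll t w x)\<^sup>2) \<partial>lborel)
      \<le> (\<integral>\<^sup>+x. \<integral>\<^sup>+y. ennreal (ker t x y) * ennreal ((w y)\<^sup>2) \<partial>lborel \<partial>lborel)"
    by (intro nn_integral_mono moll_sq t) measurable
  also have "\<dots> = (\<integral>\<^sup>+y. \<integral>\<^sup>+x. ennreal (ker t x y) * ennreal ((w y)\<^sup>2) \<partial>lborel \<partial>lborel)"
  proof (rule lborel_pair.Fubini'[symmetric])
    have "(\<lambda>p. ker t (fst p) (snd p)) \<in> borel_measurable (lborel \<Otimes>\<^sub>M lborel)"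
      unfolding ker_def by measurable
    then have "(\<lambda>p. ennreal (ker t (fst p) (snd p)) * ennreal ((w (snd p))\<^sup>2)) \<in> borel_measurable (lborel \<Otimes>\<^sub>M lborel)"
      by measurable
    then show "(\<lambda>(x, y). ennreal (ker t x y) * ennreal ((w y)\<^sup>2)) \<in> borel_measurable (lborel \<Otimes>\<^sub>M lborel)"
      by (simp add: split_def)
  qed
  also have "\<dots> \<le> (\<integral>\<^sup>+y. ennreal (2 ^ DIM('a)) * ennreal ((w y)\<^sup>2) \<partial>lborel)"
  proof (intro nn_integral_mono)
    fix y
    have [measurable]: "(\<lambda>x. ker t x y) \<in> borel_measurable borel" unfolding ker_def by measurable
    have "(\<integral>\<^sup>+x. ennreal (ker t x y) * ennreal ((w y)\<^sup>2) \<partial>lborel) = (\<integral>\<^sup>+x. ennreal (ker t x y) \<partial>lborel) * ennreal ((w y)\<^sup>2)"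
      by (rule nn_integral_multc) measurable
    also have "\<dots> \<le> ennreal (2 ^ DIM('a)) * ennreal ((w y)\<^sup>2)"
      by (intro mult_right_mono ker_mass_left t) simp
    finally show "(\<integral>\<^sup>+x. ennreal (ker t x y) * ennreal ((w y)\<^sup>2) \<partial>lborel) \<le> ennreal (2 ^ DIM('a)) * ennreal ((w y)\<^sup>2)" .
  qed
  also have "\<dots> = ennreal (2 ^ DIM('a)) * (\<integral>\<^sup>+y. ennreal ((w y)\<^sup>2) \<partial>lborel)"
    by (rule nn_integral_cmult) measurable
  finally show ?thesis .
qed

lemma \<Omega>_finite: "finite_measure (lebesgue_on \<Omega>)" "\<Omega> \<in> lmeasurable" "\<Omega> \<in> sets lebesgue" "\<Omega> \<in> sets borel"
  using \<Omega> lmeasurable_open[OF \<Omega>(3,1)] finite_measure_lebesgue_on open_sets_lebesgue by auto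

text \<open>A function on \<open>\<Omega>\<close> is represented by a Borel function vanishing outside of it.\<close>

definition admissible :: "('a \<Rightarrow> real) \<Rightarrow> bool" where
  "admissible w \<longleftrightarrow> w \<in> borel_measurable borel \<and> (\<forall>x. x \<notin> \<Omega> \<longrightarrow> w x = 0) \<and> sqi_on \<Omega> w"

lemma admissible_integral:
  assumes "F \<in> borel_measurable borel" "\<And>x. x \<notin> \<Omega> \<Longrightarrow> F x = 0"
  shows "(\<integral>x. F x \<partial>lebesgue_on \<Omega>) = (\<integral>x. (F x :: real) \<partial>lborel)"
    and "integrable (lebesgue_on \<Omega>) F \<longleftrightarrow> integrable lborel F"
proof -
  have e: "(\<lambda>x. indicator \<Omega> x *\<^sub>R F x) = F" using assms(2) by (auto simp: indicator_def fun_eq_iff)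
  show "(\<integral>x. F x \<partial>lebesgue_on \<Omega>) = (\<integral>x. F x \<partial>lborel)"
    using assms(1) \<Omega>_finite e by (simp add: integral_restrict_space integral_completion del: real_scaleR_def)
  show "integrable (lebesgue_on \<Omega>) F \<longleftrightarrow> integrable lborel F"
    using assms(1) \<Omega>_finite e by (simp add: integrable_restrict_space integrable_completion del: real_scaleR_def)
qed

lemma admissible_integrable: "admissible w \<Longrightarrow> integrable lborel w"
  using admissible_integral(2)[of w] sqi_integrable[OF \<Omega>_finite(1)] by (auto simp: admissible_def)

lemma moll_eq: "moll t w x = (\<integral>y. sc t ^ DIM('a) * \<eta> (sc t *\<^sub>R y + ((- (sc t * (1 - t))) *\<^sub>R x + (- (sc t * t)) *\<^sub>R a)) * w y \<partial>lborel)"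
  by (simp add: moll_def ker_def)

lemma admissible_weight: "admissible w \<Longrightarrow> weight w \<Omega>"
  by (intro weight.intro admissible_integrable \<Omega>(3)) (auto simp: admissible_def)

lemma kernel_smooth: "smooth (\<lambda>x. sc t ^ DIM('a) * \<eta> x)"
  using smooth_cmult test_fun_smooth[OF \<eta>(1)] by blast

lemma moll_smooth: "admissible w \<Longrightarrow> smooth (moll t w)"
  unfolding moll_eq[abs_def] by (rule weight.smooth_kernel[OF admissible_weight kernel_smooth])

lemma moll_sqi: "admissible w \<Longrightarrow> sqi_on \<Omega> (moll t w)"
  by (intro smooth_sqi moll_smooth \<Omega> \<Omega>_finite)

lemma moll_l2_bound:
  assumes t: "0 < t" "t \<le> 1 / 2" and w: "admissible w"
  shows "norm_on \<Omega> (moll t w) \<le> 2 ^ DIM('a) * norm_on \<Omega> w"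
proof -
  have [measurable]: "w \<in> borel_measurable borel" using w by (simp add: admissible_def)
  have [measurable]: "moll t w \<in> borel_measurable borel" by (intro smooth_measurable moll_smooth w)
  have "ennreal ((norm_on \<Omega> (moll t w))\<^sup>2) \<le> (\<integral>\<^sup>+x. ennreal ((moll t w x)\<^sup>2) \<partial>lborel)"
    by (subst l2_norm_nn_integral) (auto simp: moll_sqi w \<Omega>_finite indicator_def intro!: nn_integral_mono)
  also have "\<dots> \<le> ennreal (2 ^ DIM('a)) * (\<integral>\<^sup>+y. ennreal ((w y)\<^sup>2) \<partial>lborel)"
    by (intro moll_bound t) measurable
  also have "(\<integral>\<^sup>+y. ennreal ((w y)\<^sup>2) \<partial>lborel) = ennreal ((norm_on \<Omega> w)\<^sup>2)"
    using w by (subst l2_norm_nn_integral) (auto simp: admissible_def \<Omega>_finite indicator_def intro!: nn_integral_cong)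
  finally have "(norm_on \<Omega> (moll t w))\<^sup>2 \<le> 2 ^ DIM('a) * (norm_on \<Omega> w)\<^sup>2"
    by (simp flip: ennreal_mult)
  also have "\<dots> \<le> (2 ^ DIM('a))\<^sup>2 * (norm_on \<Omega> w)\<^sup>2"
    by (intro mult_right_mono) (simp_all add: power2_eq_square)
  finally show ?thesis
    by (metis l2_norm_nonneg mult_nonneg_nonneg power2_le_imp_le power_mult_distrib zero_le_numeral zero_le_power)
qed

lemma admissible_cut:
  assumes "g \<in> borel_measurable borel" "sqi_on \<Omega> g"
  shows "admissible (\<lambda>x. indicator \<Omega> x * g x)"
proof -
  have "sqi_on \<Omega> (\<lambda>x. indicator \<Omega> x * g x)"
    using assms(2) by (subst sqi_cong[of _ _ g]) auto
  then show ?thesis using assms(1) \<Omega>_finite(4) by (auto simp: admissible_def)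
qed

lemma admissible_diff: "admissible v \<Longrightarrow> admissible w \<Longrightarrow> admissible (\<lambda>x. v x - w x)"
  by (auto simp: admissible_def intro: sqi_diff)

lemma ker_integrable: "0 < t \<Longrightarrow> integrable lborel (ker t x)"
  using ker_mass[of t x] ker_nonneg[of t x] by (auto simp: integrable_iff_bounded)

lemma ker_integral: "0 < t \<Longrightarrow> (\<integral>y. ker t x y \<partial>lborel) = 1"
  using ker_mass[of t x] ker_nonneg[of t x] by (subst integral_eq_nn_integral) auto

lemma ker_times_integrable:
  assumes "admissible w" shows "integrable lborel (\<lambda>y. ker t x y * w y)"
  unfolding ker_def using weight.kernel_integrable[OF admissible_weight[OF assms] kernel_smooth] by blast

lemma moll_diff:
  assumes "admissible v" "admissible w"
  shows "moll t (\<lambda>x. v x - w x) x = moll t v x - moll t w x"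
  unfolding moll_def using ker_times_integrable[OF assms(1)] ker_times_integrable[OF assms(2)]
  by (simp add: right_diff_distrib)

lemma moll_continuous_close:
  assumes g: "continuous_on UNIV g" "sqi_on \<Omega> g" and e: "0 < e"
  shows "\<exists>t0>0. \<forall>t. 0 < t \<and> t < t0 \<longrightarrow> (\<forall>x\<in>\<Omega>. \<bar>moll t (\<lambda>x. indicator \<Omega> x * g x) x - g x\<bar> \<le> e)"
proof -
  obtain R where R: "0 < R" "\<And>x. x \<in> \<Omega> \<Longrightarrow> norm x \<le> R" using \<Omega>(3) by (auto simp: bounded_pos)
  have "uniformly_continuous_on (closure \<Omega>) g"
    using g(1) \<Omega>(3) by (intro compact_uniformly_continuous) (auto intro: continuous_on_subset)
  then obtain d where d: "0 < d" "\<And>x y. x \<in> \<Omega> \<Longrightarrow> y \<in> \<Omega> \<Longrightarrow> dist y x < d \<Longrightarrow> dist (g y) (g x) < e"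
    using e closure_subset unfolding uniformly_continuous_on_def by (metis subsetD)
  \<comment> \<open>A kernel centred at \<open>x\<close> reaches at most \<open>t * (2 * R)\<close>
    away from \<open>x\<close>, which is below \<open>d\<close> for \<open>t < t0\<close>.\<close>
  define t0 where "t0 = min 1 (d / (2 * R))"
  have gm: "g \<in> borel_measurable borel" using g(1) by (rule borel_measurable_continuous_onI)
  note adm = admissible_cut[OF gm g(2)]
  have "\<bar>moll t (\<lambda>x. indicator \<Omega> x * g x) x - g x\<bar> \<le> e" if t: "0 < t" "t < t0" and x: "x \<in> \<Omega>" for t x
  proof -
    have t1: "t < 1" "t * (2 * R) < d" using t R(1) by (auto simp: t0_def field_simps)
    have "moll t (\<lambda>x. indicator \<Omega> x * g x) x - g x
        = (\<integral>y. ker t x y * (indicator \<Omega> y * g y) \<partial>lborel) - (\<integral>y. ker t x y * g x \<partial>lborel)"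
      using ker_integral[OF t(1), of x] by (simp add: moll_def)
    also have "\<dots> = (\<integral>y. ker t x y * (indicator \<Omega> y * g y) - ker t x y * g x \<partial>lborel)"
      using ker_times_integrable[OF adm] ker_integrable[OF t(1)] by simp
    also have "\<bar>\<dots>\<bar> \<le> (\<integral>y. ker t x y * e \<partial>lborel)"
    proof (rule Bochner_Integration.integral_abs_bound_integral)
      show "\<bar>ker t x y * (indicator \<Omega> y * g y) - ker t x y * g x\<bar> \<le> ker t x y * e" for y
      proof (cases "ker t x y = 0")
        case False
        note y = ker_support_in[OF t(1) t1(1) x False]
        have "dist y x < d" using ker_support_near[OF t(1) t1(1) x False R(2)] t1(2) by (simp add: dist_norm)
        then have "\<bar>g y - g x\<bar> \<le> e" using d(2)[OF x y] by (simp add: dist_real_def)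
        moreover have "ker t x y * (indicator \<Omega> y * g y) - ker t x y * g x = ker t x y * (g y - g x)"
          using y by (simp add: right_diff_distrib)
        ultimately show ?thesis using ker_nonneg[OF t(1), of x y] by (simp add: abs_mult mult_left_mono)
      qed simp
    qed (use ker_times_integrable[OF adm] ker_integrable[OF t(1)] in auto)
    also have "\<dots> = e" using ker_integral[OF t(1), of x] by simp
    finally show ?thesis .
  qed
  moreover have "0 < t0" using d R by (simp add: t0_def)
  ultimately show ?thesis by blast
qed

lemma moll_tendsto:
  assumes w: "admissible w" and t: "t \<longlonglongrightarrow> 0" "\<And>n. 0 < t n"
  shows "(\<lambda>n. norm_on \<Omega> (\<lambda>x. w x - moll (t n) w x)) \<longlonglongrightarrow> 0"
proof (rule LIMSEQ_I)
  fix e :: real assume e: "0 < e"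
  \<comment> \<open>Sum of three error contributions in units of \<open>d\<close>: 1 for
    approximating \<open>w\<close>, the measure plus 1 for the uniform error of the continuous
    function, and 2 to the dimension for mollifying the difference.\<close>
  define M where "M = 2 + 2 ^ DIM('a) + (measure lebesgue \<Omega>)"
  have M: "0 < M" by (simp add: M_def add_pos_nonneg)
  define d where "d = e / (2 * M)"
  have d: "0 < d" using e M by (simp add: d_def)
  have wm: "w \<in> borel_measurable borel" and ws: "sqi_on \<Omega> w"
    using w by (auto simp: admissible_def)
  obtain g where g: "continuous_on UNIV g" "bounded (range g)" "norm_on \<Omega> (\<lambda>x. w x - g x) < d"
    using continuous_l2_dense[OF \<Omega>_finite(2) ws d] by blast
  have gm: "g \<in> borel_measurable borel" using g(1) by (rule borel_measurable_continuous_onI)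
  obtain B where "\<And>x. norm (g x) \<le> B" using g(2) by (auto simp: bounded_iff)
  then have gs: "sqi_on \<Omega> g"
    by (intro sqi_bounded[OF \<Omega>_finite(1), where C = B] borel_measurable_lebesgue_on gm)
  let ?g = "\<lambda>x. indicator \<Omega> x * g x"
  note adm = admissible_cut[OF gm gs]
  have gs': "sqi_on \<Omega> ?g" using adm by (simp add: admissible_def)
  have wg: "norm_on \<Omega> (\<lambda>x. w x - ?g x) < d"
    using g(3) by (subst l2_norm_cong[of _ _ "\<lambda>x. w x - g x"]) auto
  obtain t0 where t0: "0 < t0" "\<And>s. 0 < s \<Longrightarrow> s < t0 \<Longrightarrow> \<forall>x\<in>\<Omega>. \<bar>moll s ?g x - g x\<bar> \<le> d"
    using moll_continuous_close[OF g(1) gs d] by blast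
  have "\<forall>\<^sub>F n in sequentially. t n < min t0 (1 / 2)"
    using t(1) t0(1) by (intro order_tendstoD) auto
  then obtain N where N: "\<And>n. n \<ge> N \<Longrightarrow> t n < min t0 (1 / 2)" by (auto simp: eventually_sequentially)
  have "norm (norm_on \<Omega> (\<lambda>x. w x - moll (t n) w x) - 0) < e" if n: "n \<ge> N" for n
  proof -
    let ?s = "t n"
    have s: "0 < ?s" "?s < t0" "?s \<le> 1 / 2" using N[OF n] t(2) by auto
    have b1: "norm_on \<Omega> (\<lambda>x. ?g x - moll ?s ?g x) \<le> d * measure lebesgue \<Omega> + d"
    proof -
      have c: "\<bar>?g x - moll ?s ?g x\<bar> \<le> d" if "x \<in> \<Omega>" for x
        using t0(2)[OF s(1,2)] that by (auto simp: abs_minus_commute)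
      have "inner_on \<Omega> (\<lambda>x. ?g x - moll ?s ?g x) (\<lambda>x. ?g x - moll ?s ?g x) \<le> (\<integral>x. d * d \<partial>lebesgue_on \<Omega>)"
        unfolding l2_inner_def
      proof (rule integral_mono)
        show "integrable (lebesgue_on \<Omega>) (\<lambda>x. (?g x - moll ?s ?g x) \<bullet> (?g x - moll ?s ?g x))"
          using gs' moll_sqi[OF adm] by (intro sqi_inner sqi_diff)
        show "integrable (lebesgue_on \<Omega>) (\<lambda>x. d * d)"
          using finite_measure.integrable_const[OF \<Omega>_finite(1)] .
        fix x assume "x \<in> space (lebesgue_on \<Omega>)"
        then have "\<bar>?g x - moll ?s ?g x\<bar> * \<bar>?g x - moll ?s ?g x\<bar> \<le> d * d"
          using c d by (intro mult_mono) auto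
        then show "(?g x - moll ?s ?g x) \<bullet> (?g x - moll ?s ?g x) \<le> d * d" by (simp only: inner_real_def abs_mult_self_eq)
      qed
      also have "\<dots> = d * d * measure lebesgue \<Omega>" using \<Omega>_finite(3) by (simp add: measure_restrict_space mult.commute)
      \<comment> \<open>A crude bound that avoids the square root of the measure.\<close>
      also have "\<dots> \<le> (d * measure lebesgue \<Omega> + d)\<^sup>2"
        using d by (simp add: power2_eq_square algebra_simps)
      finally show ?thesis
        unfolding l2_norm_def by (rule real_le_lsqrt[rotated]) (use d in simp)
    qed
    have b2: "norm_on \<Omega> (\<lambda>x. moll ?s ?g x - moll ?s w x) \<le> 2 ^ DIM('a) * d"
    proof -
      have "norm_on \<Omega> (\<lambda>x. moll ?s w x - moll ?s ?g x)
          = norm_on \<Omega> (moll ?s (\<lambda>x. w x - ?g x))"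
        by (subst moll_diff[OF w adm, THEN ext]) simp
      also have "\<dots> \<le> 2 ^ DIM('a) * norm_on \<Omega> (\<lambda>x. w x - ?g x)"
        by (intro moll_l2_bound s admissible_diff w adm)
      also have "\<dots> \<le> 2 ^ DIM('a) * d" using wg by (intro mult_left_mono) auto
      finally show ?thesis by (subst l2_norm_minus_commute)
    qed
    have "norm_on \<Omega> (\<lambda>x. w x - moll ?s w x) \<le>
        norm_on \<Omega> (\<lambda>x. w x - ?g x) + (norm_on \<Omega> (\<lambda>x. ?g x - moll ?s ?g x)
        + norm_on \<Omega> (\<lambda>x. moll ?s ?g x - moll ?s w x))"
      using l2_triangle_between[OF ws gs' moll_sqi[OF w, of ?s]]
        l2_triangle_between[OF gs' moll_sqi[OF adm, of ?s] moll_sqi[OF w, of ?s]] by linarith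
    also have "\<dots> \<le> d + (d * measure lebesgue \<Omega> + d + 2 ^ DIM('a) * d)"
      using wg b1 b2 by linarith
    also have "\<dots> = d * M" by (simp add: M_def algebra_simps)
    also have "\<dots> < e" using e M by (simp add: d_def)
    finally show ?thesis by (simp add: l2_norm_nonneg)
  qed
  then show "\<exists>N. \<forall>n\<ge>N. norm (norm_on \<Omega> (\<lambda>x. w x - moll (t n) w x) - 0) < e" by blast
qed

lemma ker_test_fun:
  assumes t: "0 < t" "t < 1" and x: "x \<in> \<Omega>"
  shows "test_fun \<Omega> (ker t x)"
proof -
  let ?b = "(- (sc t * (1 - t))) *\<^sub>R x + (- (sc t * t)) *\<^sub>R a"
  obtain K where K: "compact K" "K \<subseteq> ball 0 1" "\<And>x. x \<notin> K \<Longrightarrow> \<eta> x = 0"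
    using \<eta>(1) by (auto simp: test_fun_def)
  let ?K = "(\<lambda>z. (1 - t) *\<^sub>R x + t *\<^sub>R (a + r *\<^sub>R z)) ` K"
  have "compact ?K" by (intro compact_continuous_image K continuous_intros)
  moreover have "?K \<subseteq> \<Omega>"
    using K(2) t x by (auto intro!: convexD[OF \<Omega>(2)] ball_point)
  moreover have "ker t x y = 0" if "y \<notin> ?K" for y
  proof (rule ccontr)
    assume "ker t x y \<noteq> 0"
    then have "sc t *\<^sub>R y + ?b \<in> K" using K(3) unfolding ker_def by fastforce
    then show False using that ker_argument[OF t(1), of y x] by blast
  qed
  moreover have "smooth (ker t x)"
    unfolding ker_def[abs_def] by (intro smooth_cmult smooth_affine test_fun_smooth[OF \<eta>(1)])
  ultimately show ?thesis unfolding test_fun_def by blast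
qed

text \<open>The kernel depends on \<open>x\<close> and \<open>y\<close> through one affine argument,
  so its derivative in \<open>x\<close> is \<open>-(1 - t)\<close> times that in \<open>y\<close>;
  the weak derivative absorbs the sign. The kernel is a legitimate test function because its support
  stays inside the convex set.\<close>

lemma pdiff_moll:
  assumes t: "0 < t" "t < 1" and x: "x \<in> \<Omega>" and i: "i \<in> Basis"
    and v: "admissible v" "admissible v'" "weakly \<Omega> {#i#} v v'"
  shows "pdiff i (moll t v) x = (1 - t) * moll t v' x"
proof -
  let ?b = "(- (sc t * (1 - t))) *\<^sub>R x + (- (sc t * t)) *\<^sub>R a"
  note tf = ker_test_fun[OF t x]
  have on_\<Omega>: "inner_on \<Omega> w p = (\<integral>y. p y * w y \<partial>lborel)"
    if "admissible w" "smooth p" for w p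
  proof -
    have "(\<lambda>y. p y * w y) \<in> borel_measurable borel"
      using that smooth_measurable[OF that(2)] by (auto simp: admissible_def)
    moreover have "p y * w y = 0" if "y \<notin> \<Omega>" for y using that \<open>admissible w\<close> by (simp add: admissible_def)
    ultimately show ?thesis by (simp add: l2_inner_def admissible_integral(1) mult.commute)
  qed
  have "pdiff i (\<lambda>x. sc t ^ DIM('a) * \<eta> x) z = sc t ^ DIM('a) * pdiff i \<eta> z" for z
    using \<eta>(1) by (simp add: pdiff_cmult smooth_differentiable test_fun_smooth)
  then have "pdiff i (moll t v) x = (- (sc t * (1 - t))) * (\<integral>y. sc t ^ DIM('a) * pdiff i \<eta> (sc t *\<^sub>R y + ?b) * v y \<partial>lborel)"
    unfolding moll_eq[abs_def]
    by (subst weight.pdiff_kernel[OF admissible_weight[OF v(1)] kernel_smooth i]) simp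
  also have "\<dots> = - (1 - t) * (\<integral>y. pdiff i (ker t x) y * v y \<partial>lborel)"
  proof -
    have "pdiff i (ker t x) y = sc t * (sc t ^ DIM('a) * pdiff i \<eta> (sc t *\<^sub>R y + ?b))" for y
      unfolding ker_def[abs_def] using test_fun_smooth[OF \<eta>(1)]
      by (subst pdiff_cmult) (simp_all add: smooth_affine pdiff_affine smooth_differentiable)
    then have eq: "(\<integral>y. pdiff i (ker t x) y * v y \<partial>lborel)
        = sc t * (\<integral>y. sc t ^ DIM('a) * pdiff i \<eta> (sc t *\<^sub>R y + ?b) * v y \<partial>lborel)"
      by (simp only: mult.assoc integral_mult_right_zero)
    have "- (p * q) * I = - q * (p * I)" for p q I :: real by simp
    then show ?thesis unfolding eq .
  qed
  also have "(\<integral>y. pdiff i (ker t x) y * v y \<partial>lborel) = inner_on \<Omega> v (pdiff i (ker t x))"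
    using on_\<Omega>[OF v(1) smooth_pdiff[OF test_fun_smooth[OF tf] i]] by simp
  also have "\<dots> = - inner_on \<Omega> v' (ker t x)"
    using v(3) tf unfolding weakly_first_iff by blast
  also have "inner_on \<Omega> v' (ker t x) = moll t v' x"
    using on_\<Omega>[OF v(2) test_fun_smooth[OF tf]] by (simp add: moll_def)
  finally show ?thesis by (simp add: algebra_simps)
qed

lemma admissible_version:
  assumes "sqi_on \<Omega> u"
  obtains w where "admissible w" "AE x in lebesgue_on \<Omega>. u x = w x"
proof -
  have "(\<lambda>x. indicator \<Omega> x * u x) \<in> borel_measurable lebesgue"
    using sqi_measurable[OF assms] \<Omega>_finite(3) by (simp add: borel_measurable_restrict_space_iff)
  then obtain f where f: "f \<in> borel_measurable lborel" "AE x in lborel. indicator \<Omega> x * u x = f x"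
    using completion_ex_borel_measurable_real by blast
  have "AE x in lebesgue. indicator \<Omega> x * u x = f x" using f(2) by (rule AE_completion)
  then have "AE x in lebesgue. x \<in> \<Omega> \<longrightarrow> u x = f x" by eventually_elim auto
  then have ae: "AE x in lebesgue_on \<Omega>. u x = f x" using \<Omega>_finite(3) by (simp add: AE_restrict_space_iff)
  have fb: "f \<in> borel_measurable borel" using f(1) by simp
  have fs: "sqi_on \<Omega> f"
    by (rule sqi_cong_AE[OF assms borel_measurable_lebesgue_on[OF fb] ae])
  show ?thesis
  proof (rule that[OF admissible_cut[OF fb fs]])
    show "AE x in lebesgue_on \<Omega>. u x = indicator \<Omega> x * f x"
      using ae AE_space by eventually_elim auto
  qed
qed

lemma smooth_dense:
  assumes u: "sqi_on \<Omega> u" and g: "\<And>i. i \<in> Basis \<Longrightarrow> weakly \<Omega> {#i#} u (g i)"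
  shows "\<exists>\<phi> :: nat \<Rightarrow> 'a \<Rightarrow> real. (\<forall>n. smooth (\<phi> n)) \<and> (\<lambda>n. sobolev_norm 1 \<Omega> (\<lambda>x. u x - \<phi> n x)) \<longlonglongrightarrow> 0"
proof -
  obtain v where v: "admissible v" "AE x in lebesgue_on \<Omega>. u x = v x" using admissible_version[OF u] .
  have "\<exists>w. admissible w \<and> (AE x in lebesgue_on \<Omega>. g i x = w x)" if "i \<in> Basis" for i
    using admissible_version[OF weakly_sqi[OF g[OF that]]] by blast
  then obtain v' where v': "\<And>i. i \<in> Basis \<Longrightarrow> admissible (v' i) \<and> (AE x in lebesgue_on \<Omega>. g i x = v' i x)"
    by metis
  have s: "sqi_on \<Omega> v" "\<And>i. i \<in> Basis \<Longrightarrow> sqi_on \<Omega> (v' i)"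
    using v v' by (auto simp: admissible_def)
  have wv: "weakly \<Omega> {#i#} v (v' i)" if i: "i \<in> Basis" for i
    unfolding weakly_first_iff
  proof (intro conjI allI impI)
    show "sqi_on \<Omega> (v' i)" using s i by blast
    fix \<phi> :: "'a \<Rightarrow> real" assume \<phi>: "test_fun \<Omega> \<phi>"
    note t = test_fun_sqi[OF \<phi> \<Omega>_finite(3)] test_fun_sqi[OF test_fun_pdiff[OF \<phi> i] \<Omega>_finite(3)]
    have "inner_on \<Omega> v (pdiff i \<phi>) = inner_on \<Omega> u (pdiff i \<phi>)"
      using v(2) by (intro l2_inner_cong_AE s u t) (auto elim: eventually_mono)
    also have "\<dots> = - inner_on \<Omega> (g i) \<phi>"
      using g[OF i] \<phi> unfolding weakly_first_iff by blast
    also have "inner_on \<Omega> (g i) \<phi> = inner_on \<Omega> (v' i) \<phi>"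
      using v' i by (intro l2_inner_cong_AE s t weakly_sqi[OF g]) auto
    finally show "inner_on \<Omega> v (pdiff i \<phi>) = - inner_on \<Omega> (v' i) \<phi>" .
  qed
  \<comment> \<open>The shift by two keeps \<open>t n\<close> at most one half, as the L2 bound of
    the mollification requires.\<close>
  define t where "t n = 1 / real (Suc (Suc n))" for n
  have t: "t \<longlonglongrightarrow> 0" "\<And>n. 0 < t n" "\<And>n. t n \<le> 1 / 2" "\<And>n. t n < 1"
    using LIMSEQ_ignore_initial_segment[OF lim_inverse_n', of 2] by (auto simp: t_def[abs_def])
  define \<phi> where "\<phi> n = moll (t n) v" for n
  have sm: "smooth (\<phi> n)" for n unfolding \<phi>_def by (rule moll_smooth[OF v(1)])
  have "(\<lambda>n. sobolev_norm 1 \<Omega> (\<lambda>x. u x - \<phi> n x)) \<longlonglongrightarrow> 0"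
    unfolding sobolev_norm_1_tendsto[OF \<Omega>(1,3) u g sm]
  proof (subst sobolev_norm_1_tendsto[OF \<Omega>(1,3) u g sm], assumption, intro conjI ballI)
    have "norm_on \<Omega> (\<lambda>x. u x - \<phi> n x) = norm_on \<Omega> (\<lambda>x. v x - moll (t n) v x)" for n
      unfolding \<phi>_def using v(2) by (intro l2_norm_cong_AE sqi_diff u s moll_sqi v(1)) (auto elim: eventually_mono)
    then show "(\<lambda>n. norm_on \<Omega> (\<lambda>x. u x - \<phi> n x)) \<longlonglongrightarrow> 0"
      using moll_tendsto[OF v(1) t(1,2)] by simp
    fix i :: 'a assume i: "i \<in> Basis"
    note a' = v'[OF i, THEN conjunct1]
    let ?m = "\<lambda>n. moll (t n) (v' i)" and ?N = "norm_on \<Omega>"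
    let ?d = "\<lambda>n x. g i x - pdiff i (\<phi> n) x" and ?e = "\<lambda>n x. v' i x - ?m n x"
    \<comment> \<open>The derivative of the mollification carries the factor \<open>1 - t n\<close>;
      the error thus splits into the mollification error of the weak derivative and a remainder of
      size \<open>t n\<close>.\<close>
    have e: "?N (?d n)
        = ?N (\<lambda>x. ?e n x + t n *\<^sub>R ?m n x)" for n
    proof (rule l2_norm_cong_AE)
      show "sqi_on \<Omega> (?d n)"
        by (intro sqi_diff weakly_sqi[OF g] i smooth_sqi smooth_pdiff sm \<Omega> \<Omega>_finite)
      show "sqi_on \<Omega> (\<lambda>x. ?e n x + t n *\<^sub>R ?m n x)"
        by (intro sqi_comb sqi_diff s i moll_sqi a')
      have "AE x in lebesgue_on \<Omega>. g i x = v' i x" using v'[OF i] by blast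
      then show "AE x in lebesgue_on \<Omega>. ?d n x = ?e n x + t n *\<^sub>R ?m n x"
        using AE_space
      proof eventually_elim
        case (elim x)
        then have "pdiff i (\<phi> n) x = (1 - t n) * ?m n x"
          unfolding \<phi>_def by (intro pdiff_moll t i v(1) a' wv) auto
        then show ?case using elim by (simp add: algebra_simps)
      qed
    qed
    show "(\<lambda>n. ?N (?d n)) \<longlonglongrightarrow> 0"
    proof (rule tendsto_sandwich[OF _ _ tendsto_const])
      show "\<forall>\<^sub>F n in sequentially. 0 \<le> ?N (?d n)"
        by (simp add: l2_norm_nonneg)
      have "?N (\<lambda>x. ?e n x + t n *\<^sub>R ?m n x)
          \<le> ?N (?e n) + t n * (2 ^ DIM('a) * ?N (v' i))" for n
      proof -
        have "?N (\<lambda>x. ?e n x + t n *\<^sub>R ?m n x)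
            \<le> ?N (?e n) + \<bar>t n\<bar> * ?N (?m n)"
          unfolding l2_norm_def
          by (rule semi_inner.triangle[OF semi_inner_l2]) (auto intro!: sqi_diff s i moll_sqi a')
        moreover have "\<bar>t n\<bar> * ?N (?m n) \<le> t n * (2 ^ DIM('a) * ?N (v' i))"
          using t(2)[of n] moll_l2_bound[OF t(2,3) a'] by (simp add: mult_left_mono)
        ultimately show ?thesis by linarith
      qed
      then show "\<forall>\<^sub>F n in sequentially. ?N (?d n)
          \<le> ?N (?e n) + t n * (2 ^ DIM('a) * ?N (v' i))"
        unfolding e by simp
      show "(\<lambda>n. ?N (?e n) + t n * (2 ^ DIM('a) * ?N (v' i))) \<longlonglongrightarrow> 0"
        using tendsto_add[OF moll_tendsto[OF a' t(1,2)] tendsto_mult_left_zero[OF t(1)]] by simp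
    qed
  qed
  then show ?thesis using sm by blast
qed

end

theorem sobolev_1_smooth_dense:
  fixes D :: "'a::euclidean_space set"
  assumes D: "open D" "convex D" "bounded D" "D \<noteq> {}" and u: "u \<in> sobolev 1 D"
  shows "\<exists>\<phi> :: nat \<Rightarrow> 'a \<Rightarrow> real. (\<forall>n. smooth (\<phi> n)) \<and> (\<lambda>n. sobolev_norm 1 D (\<lambda>x. u x - \<phi> n x)) \<longlonglongrightarrow> 0"
proof -
  obtain \<eta> :: "'a \<Rightarrow> real" where \<eta>: "test_fun (ball 0 1) \<eta>" "\<And>x. 0 \<le> \<eta> x" "(\<integral>x. \<eta> x \<partial>lborel) = 1"
    using ex_mollifier by blast
  obtain a r where "0 < r" "ball a r \<subseteq> D" using D(1,4) openE by (metis ex_in_conv)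
  then interpret mollifier D a r \<eta> by unfold_locales (use D \<eta> in auto)
  have "weakly D {#i#} u (weak_deriv D {#i#} u)" if "i \<in> Basis" for i
    using that by (intro sobolev_weakly[OF u]) (simp add: multi_indices_1 del: One_nat_def)
  moreover have "sqi_on D u" using u by (simp add: sobolev_iff)
  ultimately show ?thesis by (intro smooth_dense)
qed

section \<open>Volume scaling of rank-one perturbations of the identity\<close>

text \<open>The shear that carries a right prism over a face to an oblique one has this form. The
  determinant formula enters as an assumption and is discharged by expansion in dimensions two and
  three.\<close>

lemma rank_one_measure_cart:
  fixes n q :: "(real, 'n::{finite,wellorder}) vec"
  assumes det: "\<And>n q :: (real, 'n) vec. det (matrix (\<lambda>z. z + (n \<bullet> z) *\<^sub>R q)) = 1 + n \<bullet> q" and c: "1 + n \<bullet> q \<noteq> 0"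
  shows "lborel = density (distr lborel borel (\<lambda>z. z + (n \<bullet> z) *\<^sub>R q)) (\<lambda>_. ennreal \<bar>1 + n \<bullet> q\<bar>)"
proof (rule lborel_eqI)
  \<comment> \<open>Sherman-Morrison: with this multiple of \<open>q\<close> the map
    \<open>?g\<close> is the inverse of \<open>?f\<close>.\<close>
  let ?q = "(- 1 / (1 + n \<bullet> q)) *\<^sub>R q"
  let ?f = "\<lambda>z. z + (n \<bullet> z) *\<^sub>R q" and ?g = "\<lambda>z. z + (n \<bullet> z) *\<^sub>R ?q"
  fix l u :: "(real, 'n) vec" assume le: "\<And>b. b \<in> Basis \<Longrightarrow> l \<bullet> b \<le> u \<bullet> b"
  have q: "1 + n \<bullet> ?q = 1 / (1 + n \<bullet> q)" using c by (simp add: field_simps)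
  have "n \<bullet> ?g z = (n \<bullet> z) * (1 + n \<bullet> ?q)" "n \<bullet> ?f z = (n \<bullet> z) * (1 + n \<bullet> q)" for z
    by (simp_all only: inner_add_right inner_scaleR_right distrib_left mult_1_right)
  then have fg: "?f (?g z) = z" "?g (?f z) = z" for z unfolding q using c by simp_all
  have S: "?f -` box l u = ?g ` box l u"
  proof (intro set_eqI iffI)
    fix z assume "z \<in> ?f -` box l u"
    then show "z \<in> ?g ` box l u" by (intro image_eqI[where x = "?f z"] fg(2)[symmetric]) (rule vimageD)
  next
    fix z assume "z \<in> ?g ` box l u"
    then obtain y where "z = ?g y" "y \<in> box l u" by blast
    then show "z \<in> ?f -` box l u" by (simp only: vimage_eq fg)
  qed
  have lin: "linear ?g" by (rule linearI) (simp_all only: inner_add_right inner_scaleR_right scaleR_add_left scaleR_add_right add_ac scaleR_scaleR distrib_right mult.assoc)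
  have Sm: "?g ` box l u \<in> lmeasurable" by (rule measurable_linear_image[OF lin lmeasurable_box])
  have m: "measure lebesgue (?g ` box l u) = \<bar>1 / (1 + n \<bullet> q)\<bar> * measure lebesgue (box l u)"
    using measure_linear_image[OF lin lmeasurable_box, of l u] unfolding det q .
  have cont: "continuous_on UNIV ?f" by (intro continuous_intros)
  then have "?f -` box l u \<in> sets borel" by (intro borel_open open_vimage) auto
  then have "emeasure lborel (?f -` box l u) = ennreal (measure lebesgue (?g ` box l u))"
    using emeasure_eq_measure2[OF Sm] unfolding S by (simp add: fmeasurable_def)
  then have "emeasure (density (distr lborel borel ?f) (\<lambda>_. ennreal \<bar>1 + n \<bullet> q\<bar>)) (box l u)
      = ennreal \<bar>1 + n \<bullet> q\<bar> * ennreal (measure lebesgue (?g ` box l u))"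
    using cont by (simp add: emeasure_density_const emeasure_distr borel_measurable_continuous_onI)
  also have "\<dots> = ennreal (measure lebesgue (box l u))"
    unfolding m using c by (subst ennreal_mult[symmetric]) (auto simp flip: mult.assoc abs_mult)
  also have "\<dots> = ennreal (\<Prod>b\<in>Basis. (u - l) \<bullet> b)"
    using le by (simp add: measure_lborel_box)
  finally show "emeasure (density (distr lborel borel ?f) (\<lambda>_. ennreal \<bar>1 + n \<bullet> q\<bar>)) (box l u)
      = ennreal (\<Prod>b\<in>Basis. (u - l) \<bullet> b)" .
qed simp

lemma det_rank_one_2: "det (matrix (\<lambda>z :: real ^ 2. z + (n \<bullet> z) *\<^sub>R q)) = 1 + n \<bullet> q"
  by (simp add: det_2 matrix_def axis_def inner_vec_def sum_2 algebra_simps)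

lemma det_rank_one_3: "det (matrix (\<lambda>z :: real ^ 3. z + (n \<bullet> z) *\<^sub>R q)) = 1 + n \<bullet> q"
  by (simp add: det_3 matrix_def axis_def inner_vec_def sum_3 algebra_simps)

text \<open>\<open>K\<close> is the coordinate isometry from the Cartesian space. It preserves the
  measure of boxes, hence Lebesgue measure, and it intertwines the two shears.\<close>

lemma rank_one_measure_transfer:
  fixes e :: "'n::{finite,wellorder} \<Rightarrow> 'a::euclidean_space" and n q :: 'a
  assumes e: "bij_betw e UNIV Basis"
    and det: "\<And>n q :: (real, 'n) vec. det (matrix (\<lambda>z. z + (n \<bullet> z) *\<^sub>R q)) = 1 + n \<bullet> q"
    and c: "1 + n \<bullet> q \<noteq> 0"
  shows "lborel = density (distr lborel borel (\<lambda>z. z + (n \<bullet> z) *\<^sub>R q)) (\<lambda>_. ennreal \<bar>1 + n \<bullet> q\<bar>)"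
proof -
  define J :: "'a \<Rightarrow> (real, 'n) vec" where "J x = (\<chi> i. x \<bullet> e i)" for x
  define K :: "(real, 'n) vec \<Rightarrow> 'a" where "K y = (\<Sum>i\<in>UNIV. (y $ i) *\<^sub>R e i)" for y
  have eB: "e i \<in> Basis" for i using e by (auto simp: bij_betw_def)
  have einj: "e i = e j \<longleftrightarrow> i = j" for i j using e by (auto simp: bij_betw_def inj_on_def)
  have eid: "e i \<bullet> e j = (if i = j then 1 else 0)" for i j using eB by (simp add: inner_Basis einj)
  have Ke: "K y \<bullet> e i = y $ i" for y i
    unfolding K_def inner_sum_left by (simp add: eid if_distrib sum.delta cong: if_cong)
  have KJ: "K (J x) = x" for x
  proof (rule euclidean_eqI)
    fix k :: 'a assume "k \<in> Basis"
    then obtain i where "k = e i" using e by (auto simp: bij_betw_def)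
    then show "K (J x) \<bullet> k = x \<bullet> k" by (simp add: Ke) (simp add: J_def)
  qed
  have JK: "J (K y) = y" for y by (simp add: vec_eq_iff J_def Ke)
  have inner_J: "J x \<bullet> J y = x \<bullet> y" for x y
    unfolding inner_vec_def J_def
    by (subst euclidean_inner[of x y]) (simp add: sum.reindex_bij_betw[OF e, of "\<lambda>i. (x \<bullet> i) * (y \<bullet> i)"])
  have inner_K: "n \<bullet> K y = J n \<bullet> y" for y by (metis inner_J JK)
  have K_cont: "continuous_on UNIV K" unfolding K_def[abs_def] by (intro continuous_intros)
  then have [measurable]: "K \<in> borel_measurable borel" by (rule borel_measurable_continuous_onI)
  have lK: "lborel = distr lborel borel K"
  proof (rule lborel_eqI)
    fix l u :: 'a assume le: "\<And>b. b \<in> Basis \<Longrightarrow> l \<bullet> b \<le> u \<bullet> b"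
    have in_box: "y \<in> box (J l) (J u) \<longleftrightarrow> (\<forall>i. l \<bullet> e i < y $ i \<and> y $ i < u \<bullet> e i)" for y
      by (simp add: J_def mem_box_cart)
    have "K -` box l u = box (J l) (J u)"
    proof (intro set_eqI)
      fix y
      have "y \<in> K -` box l u \<longleftrightarrow> (\<forall>b\<in>e ` UNIV. l \<bullet> b < K y \<bullet> b \<and> K y \<bullet> b < u \<bullet> b)"
        using e by (simp add: mem_box bij_betw_def)
      then show "y \<in> K -` box l u \<longleftrightarrow> y \<in> box (J l) (J u)" by (simp add: Ke in_box)
    qed
    then have "emeasure (distr lborel borel K) (box l u) = emeasure lborel (box (J l) (J u))"
      by (simp add: emeasure_distr)
    also have "\<dots> = ennreal (\<Prod>b\<in>Basis. (J u - J l) \<bullet> b)"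
      using le eB by (intro emeasure_lborel_box) (auto simp: Basis_vec_def J_def inner_axis)
    also have "(\<Prod>b\<in>Basis. (J u - J l) \<bullet> b) = (\<Prod>i\<in>UNIV. (J u - J l) \<bullet> axis i 1)"
    proof -
      have B: "Basis = (\<lambda>i. axis i 1 :: (real, 'n) vec) ` UNIV" by (auto simp: Basis_vec_def)
      have "inj (\<lambda>i. axis i 1 :: (real, 'n) vec)" by (auto simp: inj_on_def axis_eq_axis)
      then show ?thesis unfolding B by (subst prod.reindex) (simp_all add: comp_def)
    qed
    also have "\<dots> = (\<Prod>i\<in>UNIV. (u - l) \<bullet> e i)"
      by (simp add: inner_axis J_def inner_diff_left)
    also have "\<dots> = (\<Prod>b\<in>Basis. (u - l) \<bullet> b)"
      by (rule prod.reindex_bij_betw[OF e])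
    finally show "emeasure (distr lborel borel K) (box l u) = ennreal (\<Prod>b\<in>Basis. (u - l) \<bullet> b)" .
  qed simp
  let ?L = "\<lambda>z. z + (n \<bullet> z) *\<^sub>R q" and ?L' = "\<lambda>z. z + (J n \<bullet> z) *\<^sub>R J q"
  have [measurable]: "?L \<in> borel_measurable borel" "?L' \<in> borel_measurable borel" by measurable
  have c': "1 + J n \<bullet> J q = 1 + n \<bullet> q" by (simp add: inner_J)
  have K_lin: "K (y + s *\<^sub>R z) = K y + s *\<^sub>R K z" for y z s
    by (simp add: K_def scaleR_add_left sum.distrib scaleR_sum_right)
  have comm: "?L (K y) = K (?L' y)" for y by (simp add: K_lin KJ inner_K)
  have "distr lborel borel ?L = distr (distr lborel borel K) borel ?L" by (simp flip: lK)
  also have "\<dots> = distr (distr lborel borel ?L') borel K"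
    by (subst (1 2) distr_distr) (auto simp: comp_def comm)
  finally have "density (distr lborel borel ?L) (\<lambda>_. ennreal \<bar>1 + n \<bullet> q\<bar>)
      = distr (density (distr lborel borel ?L') (\<lambda>_. ennreal \<bar>1 + n \<bullet> q\<bar>)) borel K"
    by (simp add: density_distr)
  also have "\<dots> = distr lborel borel K"
    using rank_one_measure_cart[OF det, of "J n" "J q"] c by (simp add: c')
  finally show ?thesis by (simp flip: lK)
qed

lemma rank_one_measure:
  fixes n q :: "'a::euclidean_space"
  assumes "DIM('a) = 2 \<or> DIM('a) = 3" and c: "1 + n \<bullet> q \<noteq> 0"
  shows "lborel = density (distr lborel borel (\<lambda>z. z + (n \<bullet> z) *\<^sub>R q)) (\<lambda>_. ennreal \<bar>1 + n \<bullet> q\<bar>)"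
  using assms(1)
proof
  assume "DIM('a) = 2"
  then obtain e :: "2 \<Rightarrow> 'a" where "bij_betw e UNIV Basis"
    using finite_same_card_bij[of "UNIV :: 2 set" "Basis :: 'a set"] by auto
  then show ?thesis by (rule rank_one_measure_transfer[OF _ det_rank_one_2 c])
next
  assume "DIM('a) = 3"
  then obtain e :: "3 \<Rightarrow> 'a" where "bij_betw e UNIV Basis"
    using finite_same_card_bij[of "UNIV :: 3 set" "Basis :: 'a set"] by auto
  then show ?thesis by (rule rank_one_measure_transfer[OF _ det_rank_one_3 c])
qed

lemma rank_one_integral:
  fixes n q :: "'a::euclidean_space" and f :: "'a \<Rightarrow> real"
  assumes "DIM('a) = 2 \<or> DIM('a) = 3" "1 + n \<bullet> q \<noteq> 0" and [measurable]: "f \<in> borel_measurable borel"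
  shows "(\<integral>z. f z \<partial>lborel) = \<bar>1 + n \<bullet> q\<bar> * (\<integral>z. f (z + (n \<bullet> z + \<beta>) *\<^sub>R q) \<partial>lborel)"
proof -
  have "(\<integral>z. f z \<partial>lborel) = (\<integral>z. f z \<partial>distr lborel borel ((+) (\<beta> *\<^sub>R q)))" by (simp add: lborel_distr_plus)
  also have "\<dots> = (\<integral>z. f (\<beta> *\<^sub>R q + z) \<partial>lborel)" by (subst integral_distr) auto
  also have "\<dots> = \<bar>1 + n \<bullet> q\<bar> * (\<integral>z. f (z + (n \<bullet> z + \<beta>) *\<^sub>R q) \<partial>lborel)"
    by (subst rank_one_measure[OF assms(1,2)]) (simp add: integral_density integral_distr scaleR_add_left add_ac)
  finally show ?thesis .
qed

section \<open>Planar faces\<close>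

locale face =
  fixes F :: "'a::euclidean_space set"
  assumes planar: "planar_face F" and bounded: "bounded F"
begin

definition N :: 'a where "N = unit_normal F"
definition b :: real where "b = N \<bullet> (SOME x. x \<in> F)"
definition height :: "'a \<Rightarrow> real" where "height z = N \<bullet> z - b"
definition foot :: "'a \<Rightarrow> 'a" where "foot z = z - height z *\<^sub>R N"
definition prism :: "'a set" where "prism = {z. foot z \<in> F \<and> 0 \<le> height z \<and> height z \<le> 1}"

lemma nonempty: "F \<noteq> {}" and open_closure: "F = rel_interior (closure F)"
  using planar by (auto simp: planar_face_def)

lemma ex_hyperplane: "\<exists>a c. a \<noteq> 0 \<and> affine hull F = {x. a \<bullet> x = c}"
  using planar aff_dim_eq_hyperplane[of F] by (auto simp: planar_face_def)

lemma normal_exists: "norm N = 1 \<and> (\<forall>x\<in>F. \<forall>y\<in>F. N \<bullet> (x - y) = 0)"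
  unfolding N_def unit_normal_def
proof (rule someI_ex)
  obtain a c where a: "a \<noteq> 0" "affine hull F = {x. a \<bullet> x = c}" using ex_hyperplane by blast
  then have "a \<bullet> x = c" if "x \<in> F" for x using that hull_inc by fastforce
  then have "\<forall>x\<in>F. \<forall>y\<in>F. (a /\<^sub>R norm a) \<bullet> (x - y) = 0" by (simp add: inner_diff_right)
  moreover have "norm (a /\<^sub>R norm a) = 1" using a(1) by simp
  ultimately show "\<exists>n. norm n = 1 \<and> (\<forall>x\<in>F. \<forall>y\<in>F. n \<bullet> (x - y) = 0)" by blast
qed

lemma norm_N [simp]: "norm N = 1"
  using normal_exists by blast

lemma inner_N [simp]: "N \<bullet> N = 1"
  using norm_N unfolding norm_eq_1 .

lemma b_eq: "x \<in> F \<Longrightarrow> N \<bullet> x = b"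
  using normal_exists nonempty unfolding b_def by (metis inner_diff_right right_minus_eq some_in_eq)

lemma hyperplane: "affine hull F = {x. N \<bullet> x = b}"
proof (rule affine_dim_equal)
  show "affine {x. N \<bullet> x = b}" by (rule affine_hyperplane)
  show "affine hull F \<subseteq> {x. N \<bullet> x = b}"
    using b_eq by (intro hull_minimal affine_hyperplane) auto
  have "N \<noteq> 0" using norm_N by force
  then show "aff_dim (affine hull F) = aff_dim {x. N \<bullet> x = b}"
    using planar by (simp add: aff_dim_hyperplane planar_face_def)
qed (use nonempty in auto)

text \<open>The affine hull of the face is a full hyperplane, so the tangential part
  \<open>?w\<close> of \<open>a\<close> is a direction along which \<open>a\<close> is constant;
  this makes \<open>?w\<close> orthogonal to itself.\<close>

lemma orthogonal_parallel:
  assumes "\<And>x y. x \<in> F \<Longrightarrow> y \<in> F \<Longrightarrow> a \<bullet> (x - y) = 0"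
  shows "a = (a \<bullet> N) *\<^sub>R N"
proof -
  obtain x0 where x0: "x0 \<in> F" using nonempty by blast
  have "a \<bullet> x = a \<bullet> x0" if "x \<in> F" for x using assms[OF that x0] by (simp add: inner_diff_right)
  then have "affine hull F \<subseteq> {x. a \<bullet> x = a \<bullet> x0}"
    by (intro hull_minimal affine_hyperplane) auto
  then have H: "a \<bullet> x = a \<bullet> x0" if "N \<bullet> x = b" for x using that hyperplane by blast
  let ?w = "a - (a \<bullet> N) *\<^sub>R N"
  have w: "N \<bullet> ?w = 0" by (simp add: inner_diff_right inner_commute)
  then have "a \<bullet> (x0 + ?w) = a \<bullet> x0" using b_eq[OF x0] by (intro H) (simp add: inner_add_right)
  then have "a \<bullet> ?w = 0" by (simp add: inner_add_right)
  then have "?w \<bullet> ?w = 0" using w by (simp add: inner_diff_left)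
  then show ?thesis by (metis inner_eq_zero_iff right_minus_eq)
qed

lemma rel_open:
  assumes "x \<in> F" obtains e where "0 < e" "\<And>y. N \<bullet> y = b \<Longrightarrow> norm (y - x) < e \<Longrightarrow> y \<in> F"
proof -
  have "x \<in> rel_interior (closure F)" using assms open_closure by simp
  then obtain e where e: "e > 0" "ball x e \<inter> affine hull (closure F) \<subseteq> closure F"
    by (auto simp: mem_rel_interior_ball)
  have "y \<in> F" if "N \<bullet> y = b" "norm (y - x) < e" for y
  proof -
    have "y \<in> ball x e" using that(2) by (simp add: dist_norm norm_minus_commute)
    then have "ball y (e - dist x y) \<subseteq> ball x e" "0 < e - dist x y"
      by (auto simp: ball_subset_ball_iff dist_commute)
    moreover have "y \<in> affine hull (closure F)" using that(1) by (simp add: hyperplane)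
    ultimately have "y \<in> rel_interior (closure F)"
      using e(2) \<open>y \<in> ball x e\<close> unfolding mem_rel_interior_ball by blast
    then show ?thesis using open_closure by simp
  qed
  then show ?thesis using e(1) that by blast
qed

lemma N_foot: "N \<bullet> foot z = b"
  by (simp add: foot_def height_def inner_diff_right)

lemma foot_height: "foot z + height z *\<^sub>R N = z"
  by (simp add: foot_def)

lemma height_shift: "N \<bullet> x = b \<Longrightarrow> height (x + t *\<^sub>R v) = t * (N \<bullet> v)"
  by (simp add: height_def inner_add_right)

lemma foot_shift: "N \<bullet> x = b \<Longrightarrow> foot (x + t *\<^sub>R N) = x"
  by (simp add: foot_def height_shift)

lemma prism_eq: "{x + t *\<^sub>R unit_normal F |x t. x \<in> F \<and> 0 \<le> t \<and> t \<le> 1} = prism"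
proof (intro set_eqI iffI)
  fix z assume "z \<in> {x + t *\<^sub>R unit_normal F |x t. x \<in> F \<and> 0 \<le> t \<and> t \<le> 1}"
  then obtain x t where "z = x + t *\<^sub>R N" "x \<in> F" "0 \<le> t" "t \<le> 1" by (auto simp: N_def)
  then show "z \<in> prism" by (simp add: prism_def foot_shift height_shift b_eq)
next
  fix z assume "z \<in> prism"
  then show "z \<in> {x + t *\<^sub>R unit_normal F |x t. x \<in> F \<and> 0 \<le> t \<and> t \<le> 1}"
    using foot_height[of z] by (auto simp: prism_def simp flip: N_def intro!: exI[of _ "foot z"] exI[of _ "height z"])
qed

lemma closest_point_eq: "closest_point (affine hull F) = foot"
proof
  fix z
  show "closest_point (affine hull F) z = foot z"
  proof (rule closest_point_unique[symmetric])
    show "convex (affine hull F)" by (simp add: affine_imp_convex)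
    show "foot z \<in> affine hull F" by (simp add: hyperplane N_foot)
    show "\<forall>y\<in>affine hull F. dist z (foot z) \<le> dist z y"
    proof
      fix y assume "y \<in> affine hull F"
      then have "height z = N \<bullet> (z - y)" by (simp add: hyperplane height_def inner_diff_right)
      then have "\<bar>height z\<bar> \<le> norm (z - y)" using Cauchy_Schwarz_ineq2[of N "z - y"] by simp
      then show "dist z (foot z) \<le> dist z y" by (simp add: dist_norm foot_def)
    qed
  qed simp
qed

lemma foot_continuous: "continuous_on S foot" "continuous_on S height"
  unfolding foot_def[abs_def] height_def[abs_def] by (intro continuous_intros)+

lemma foot_measurable [measurable]: "foot \<in> borel_measurable borel" "height \<in> borel_measurable borel"
  by (intro borel_measurable_continuous_onI foot_continuous)+

lemma F_borel [measurable]: "F \<in> sets borel"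
proof -
  have "openin (top_of_set (affine hull closure F)) (rel_interior (closure F))"
    by (rule openin_rel_interior)
  then obtain U where "open U" "F = affine hull F \<inter> U"
    unfolding openin_open open_closure[symmetric] by auto
  moreover have "affine hull F \<in> sets borel" by (intro borel_closed closed_affine_hull)
  ultimately show ?thesis by (metis borel_open sets.Int)
qed

lemma prism_borel [measurable]: "prism \<in> sets borel"
  unfolding prism_def by measurable

lemma prism_bounded: "bounded prism"
proof -
  obtain R where R: "\<And>x. x \<in> F \<Longrightarrow> norm x \<le> R" using bounded by (auto simp: bounded_iff)
  have "norm z \<le> R + 1" if "z \<in> prism" for z
  proof -
    have "norm z \<le> norm (foot z) + norm (height z *\<^sub>R N)" using norm_triangle_ineq[of "foot z" "height z *\<^sub>R N"] by (simp add: foot_height)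
    then show ?thesis using that R[of "foot z"] by (simp add: prism_def)
  qed
  then show ?thesis by (auto simp: bounded_iff)
qed

lemma prism_lmeasurable: "prism \<in> lmeasurable" "prism \<in> sets lebesgue"
  using prism_bounded prism_borel by (auto intro!: bounded_set_imp_lmeasurable sets_completionI_sets)

lemma face_measure_eq: "face_measure F = distr (lebesgue_on prism) (restrict_space borel F) foot"
  by (simp add: face_measure_def prism_eq closest_point_eq)

lemma foot_measurable_face: "foot \<in> measurable (lebesgue_on prism) (restrict_space borel F)"
proof (rule measurable_restrict_space2)
  show "foot \<in> borel_measurable (lebesgue_on prism)" by (rule borel_measurable_lebesgue_on) measurable
  show "foot \<in> space (lebesgue_on prism) \<rightarrow> F" by (auto simp: prism_def)
qed

lemma space_face [simp]: "space (face_measure F) = F" and sets_face: "sets (face_measure F) = sets (restrict_space borel F)"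
  by (simp_all add: face_measure_eq space_restrict_space)

lemma finite_face: "finite_measure (face_measure F)"
  unfolding face_measure_eq
  using finite_measure_lebesgue_on[OF prism_lmeasurable(1)] foot_measurable_face by (rule finite_measure.finite_measure_distr)

lemma face_measurable: "f \<in> borel_measurable borel \<Longrightarrow> f \<in> borel_measurable (face_measure F)"
  using measurable_restrict_space1 by (subst measurable_cong_sets[OF sets_face refl]) blast

lemma face_integral:
  fixes f :: "'a \<Rightarrow> real"
  assumes "f \<in> borel_measurable (face_measure F)"
  shows "(\<integral>x. f x \<partial>face_measure F) = (\<integral>z. f (foot z) \<partial>lebesgue_on prism)"
proof -
  have "f \<in> borel_measurable (restrict_space borel F)"
    using assms by (subst (asm) measurable_cong_sets[OF sets_face refl])
  then show ?thesis unfolding face_measure_eq by (rule integral_distr[OF foot_measurable_face])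
qed

lemma continuous_face_sqi:
  fixes f :: "'a \<Rightarrow> 'b::euclidean_space"
  assumes "continuous_on UNIV f" shows "face_sqi F f"
proof -
  have "Topological_Spaces.compact (closure F)" using bounded by simp
  then have "Elementary_Metric_Spaces.bounded (f ` closure F)"
    using assms by (intro compact_imp_bounded compact_continuous_image) (auto intro: continuous_on_subset)
  then obtain C where C: "\<And>x. x \<in> closure F \<Longrightarrow> norm (f x) \<le> C" by (auto simp: bounded_iff)
  show ?thesis
    using C closure_subset assms by (intro sqi_bounded[OF finite_face, where C = C] face_measurable borel_measurable_continuous_onI) auto
qed

text \<open>A nonzero value at one face point persists on a relative neighbourhood, and the part of
  the prism above it contains a nonempty open set, which is not null.\<close>

lemma continuous_zero_on_face:
  fixes f :: "'a \<Rightarrow> real"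
  assumes f: "continuous_on UNIV f" and ae: "AE x in face_measure F. f x = 0" and x: "x \<in> F"
  shows "f x = 0"
proof (rule ccontr)
  assume nz: "f x \<noteq> 0"
  have "AE z in lebesgue_on prism. f (foot z) = 0"
    using ae unfolding face_measure_eq by (rule AE_distrD[OF foot_measurable_face])
  then have ae': "AE z in lebesgue. z \<in> prism \<longrightarrow> f (foot z) = 0"
    using prism_lmeasurable by (simp add: AE_restrict_space_iff)
  let ?U = "{z. f (foot z) \<noteq> 0} \<inter> {z. 0 < height z} \<inter> {z. height z < 1}"
  have cf: "continuous_on UNIV (\<lambda>z. f (foot z))" by (rule continuous_on_compose2[OF f foot_continuous(1)]) auto
  have "open ?U"
    using cf foot_continuous[of UNIV] by (intro open_Int open_Collect_neq open_Collect_less continuous_intros) auto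
  obtain e where e: "0 < e" "\<And>y. N \<bullet> y = b \<Longrightarrow> norm (y - x) < e \<Longrightarrow> y \<in> F" using rel_open[OF x] by blast
  let ?V = "?U \<inter> {z. norm (foot z - x) < e}"
  have "open {z. norm (foot z - x) < e}"
    using foot_continuous[of UNIV] by (intro open_Collect_less continuous_intros) auto
  with \<open>open ?U\<close> have "open ?V" by (rule open_Int)
  moreover have "x + (1/2) *\<^sub>R N \<in> ?V"
    using nz e(1) b_eq[OF x] by (simp add: foot_shift height_shift)
  ultimately have "\<not> negligible ?V" using open_not_negligible by blast
  moreover have "AE z in lebesgue. z \<notin> ?V"
    using ae'
  proof eventually_elim
    case (elim z)
    then show ?case using e(2)[OF N_foot, of z] by (auto simp: prism_def)
  qed
  then have "negligible ?V"
    unfolding negligible_iff_null_sets using open_sets_lebesgue[OF \<open>open ?V\<close>] by (subst AE_iff_null_sets)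
  ultimately show False by blast
qed

text \<open>The face may be nonconvex, but its closure is a finite union of polytopes. The cylinder
  over each polytope is convex, so its frontier is null, and these frontiers contain the cylinder
  over the relative boundary.\<close>

lemma negligible_ridge_cylinder: "negligible {z. foot z \<in> closure F - F}"
proof -
  obtain \<P> where P: "finite \<P>" "\<And>P. P \<in> \<P> \<Longrightarrow> polytope P" "closure F = \<Union>\<P>"
    using planar by (auto simp: planar_face_def)
  have "{z. foot z \<in> closure F - F} \<subseteq> (\<Union>P\<in>\<P>. frontier {z. foot z \<in> P})"
  proof
    fix z assume "z \<in> {z. foot z \<in> closure F - F}"
    then obtain P where P': "P \<in> \<P>" "foot z \<in> P" and nF: "foot z \<notin> F" using P(3) by auto
    have "z \<notin> interior {z. foot z \<in> P}"
    proof
      assume "z \<in> interior {z. foot z \<in> P}"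
      then obtain e where e: "0 < e" "ball z e \<subseteq> {z. foot z \<in> P}" by (auto simp: mem_interior)
      have "ball (foot z) e \<inter> affine hull (closure F) \<subseteq> closure F"
      proof
        fix y assume y: "y \<in> ball (foot z) e \<inter> affine hull (closure F)"
        then have Ny: "N \<bullet> y = b" by (simp add: hyperplane)
        have "dist z (y + height z *\<^sub>R N) = dist (foot z) y"
          by (simp add: dist_norm foot_def algebra_simps)
        then have "y + height z *\<^sub>R N \<in> ball z e" using y by (simp add: dist_commute)
        then have "foot (y + height z *\<^sub>R N) \<in> P" using e(2) by blast
        then show "y \<in> closure F" using P' P(3) Ny by (auto simp: foot_shift)
      qed
      then have "foot z \<in> rel_interior (closure F)"
        using e(1) P' P(3) unfolding mem_rel_interior_ball by auto
      then show False using nF open_closure by simp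
    qed
    then show "z \<in> (\<Union>P\<in>\<P>. frontier {z. foot z \<in> P})"
      using P' closure_subset[of "{z. foot z \<in> P}"] by (auto simp: frontier_def)
  qed
  moreover have "negligible (\<Union>P\<in>\<P>. frontier {z. foot z \<in> P})"
  proof (intro negligible_Union, use P(1) in simp)
    fix S assume "S \<in> (\<lambda>P. frontier {z. foot z \<in> P}) ` \<P>"
    then obtain P where S: "P \<in> \<P>" "S = frontier {z. foot z \<in> P}" by auto
    have "convex P" using P(2)[OF S(1)] polytope_imp_convex by blast
    moreover have "foot (s *\<^sub>R x + t *\<^sub>R y) = s *\<^sub>R foot x + t *\<^sub>R foot y" if "s + t = 1" for s t x y
    proof -
      have "b = (s + t) * b" using that by simp
      then have "height (s *\<^sub>R x + t *\<^sub>R y) = s * height x + t * height y"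
        by (simp add: height_def inner_add_right algebra_simps)
      then show ?thesis by (simp add: foot_def algebra_simps)
    qed
    ultimately have "convex {z. foot z \<in> P}" by (auto simp: convex_def)
    then show "negligible S" unfolding S(2) by (rule negligible_convex_frontier)
  qed
  ultimately show ?thesis using negligible_subset by blast
qed

lemma negligible_hyperplane': "negligible {z. N \<bullet> z = b}"
  using norm_N by (intro negligible_hyperplane) force

text \<open>If \<open>v\<close> is tangential, everything stays in the hyperplane; otherwise the set
  lies in the image of the straight cylinder under an affine map.\<close>

lemma negligible_ridge_sweep: "negligible {x + t *\<^sub>R v |x t. x \<in> closure F - F}"
proof -
  have cl: "N \<bullet> x = b" if "x \<in> closure F" for x
  proof -
    have "closure F \<subseteq> affine hull F" by (rule closure_affine_hull)
    then show ?thesis using that hyperplane by blast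
  qed
  show ?thesis
  proof (cases "N \<bullet> v = 0")
    case True
    have "{x + t *\<^sub>R v |x t. x \<in> closure F - F} \<subseteq> {z. N \<bullet> z = b}"
      using True cl by (auto simp: inner_add_right)
    then show ?thesis using negligible_hyperplane' negligible_subset by blast
  next
    case False
    let ?L = "\<lambda>z. foot z + height z *\<^sub>R v"
    have "?L differentiable_on S" for S
      unfolding foot_def height_def differentiable_on_def differentiable_def
      by (intro ballI exI derivative_eq_intros | rule refl)+
    then have "negligible (?L ` {z. foot z \<in> closure F - F})"
      by (intro negligible_differentiable_image_negligible negligible_ridge_cylinder) auto
    moreover have "{x + t *\<^sub>R v |x t. x \<in> closure F - F} \<subseteq> ?L ` {z. foot z \<in> closure F - F}"
    proof
      fix z assume "z \<in> {x + t *\<^sub>R v |x t. x \<in> closure F - F}"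
      then obtain x t where z: "z = x + t *\<^sub>R v" "x \<in> closure F - F" by blast
      then have "?L (x + t *\<^sub>R N) = z" "foot (x + t *\<^sub>R N) = x"
        using cl by (auto simp: foot_shift height_shift)
      then show "z \<in> ?L ` {z. foot z \<in> closure F - F}" using z(2) by (metis (mono_tags, lifting) image_eqI mem_Collect_eq)
    qed
    ultimately show ?thesis by (rule negligible_subset)
  qed
qed

text \<open>The map sending \<open>z\<close> to \<open>foot z + height z *\<^sub>R v\<close> carries
  the prism onto the swept region; it is a rank-one shear with direction \<open>v - N\<close> and
  Jacobian \<open>\<bar>N \<bullet> v\<bar>\<close>.\<close>

lemma sweep_integral:
  fixes u :: "'a \<Rightarrow> real"
  assumes d: "DIM('a) = 2 \<or> DIM('a) = 3" and v: "N \<bullet> v \<noteq> 0" and u: "u \<in> borel_measurable borel"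
  shows "{x + t *\<^sub>R v |x t. x \<in> F \<and> 0 \<le> t \<and> t \<le> 1} \<in> sets borel"
    and "(\<integral>z. indicator {x + t *\<^sub>R v |x t. x \<in> F \<and> 0 \<le> t \<and> t \<le> 1} z * u z \<partial>lborel)
      = \<bar>N \<bullet> v\<bar> * (\<integral>z. u (foot z + height z *\<^sub>R v) \<partial>lebesgue_on prism)"
proof -
  let ?S = "{x + t *\<^sub>R v |x t. x \<in> F \<and> 0 \<le> t \<and> t \<le> 1}"
  let ?t = "\<lambda>z. height z / (N \<bullet> v)"
  have "?S = {z. z - ?t z *\<^sub>R v \<in> F \<and> 0 \<le> ?t z \<and> ?t z \<le> 1}"
  proof (intro set_eqI iffI)
    fix z assume "z \<in> ?S"
    then obtain x t where z: "z = x + t *\<^sub>R v" "x \<in> F" "0 \<le> t" "t \<le> 1" by blast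
    then have "?t z = t" using v by (simp add: height_shift b_eq)
    then show "z \<in> {z. z - ?t z *\<^sub>R v \<in> F \<and> 0 \<le> ?t z \<and> ?t z \<le> 1}" using z by simp
  next
    fix z assume "z \<in> {z. z - ?t z *\<^sub>R v \<in> F \<and> 0 \<le> ?t z \<and> ?t z \<le> 1}"
    then show "z \<in> ?S" by (auto intro!: exI[of _ "z - ?t z *\<^sub>R v"] exI[of _ "?t z"])
  qed
  moreover have "{z. z - ?t z *\<^sub>R v \<in> F \<and> 0 \<le> ?t z \<and> ?t z \<le> 1} \<in> sets borel" by measurable
  ultimately show Sb: "?S \<in> sets borel" by simp
  have c: "1 + N \<bullet> (v - N) = N \<bullet> v" by (simp add: inner_diff_right)
  have L: "z + (N \<bullet> z + - b) *\<^sub>R (v - N) = foot z + height z *\<^sub>R v" for z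
    by (simp add: foot_def height_def algebra_simps)
  have iff: "foot z + height z *\<^sub>R v \<in> ?S \<longleftrightarrow> z \<in> prism" for z
  proof
    assume "foot z + height z *\<^sub>R v \<in> ?S"
    then obtain x t where e: "foot z + height z *\<^sub>R v = x + t *\<^sub>R v" and x: "x \<in> F" "0 \<le> t" "t \<le> 1" by blast
    have "height z * (N \<bullet> v) = t * (N \<bullet> v)"
      using arg_cong[OF e, of height] x by (simp add: height_shift N_foot b_eq)
    then have "height z = t" using v by simp
    then show "z \<in> prism" using e x by (simp add: prism_def)
  qed (auto simp: prism_def)
  have "(\<integral>z. indicator ?S z * u z \<partial>lborel) = \<bar>N \<bullet> v\<bar> * (\<integral>z. indicator ?S (foot z + height z *\<^sub>R v) * u (foot z + height z *\<^sub>R v) \<partial>lborel)"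
    using rank_one_integral[OF d, of N "v - N" "\<lambda>z. indicator ?S z * u z" "- b"] v Sb u unfolding c L by simp
  also have "(\<lambda>z. indicator ?S (foot z + height z *\<^sub>R v) * u (foot z + height z *\<^sub>R v)) = (\<lambda>z. indicator prism z *\<^sub>R u (foot z + height z *\<^sub>R v))"
    by (simp only: indicator_def iff real_scaleR_def)
  also have "(\<integral>z. indicator prism z *\<^sub>R u (foot z + height z *\<^sub>R v) \<partial>lborel) = (\<integral>z. u (foot z + height z *\<^sub>R v) \<partial>lebesgue_on prism)"
    using prism_lmeasurable u by (subst integral_restrict_space) (auto simp: integral_completion)
  finally show "(\<integral>z. indicator ?S z * u z \<partial>lborel) = \<bar>N \<bullet> v\<bar> * (\<integral>z. u (foot z + height z *\<^sub>R v) \<partial>lebesgue_on prism)" .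
qed

end

section \<open>Outward normals and directions that enter a convex set\<close>

context face
begin

text \<open>A supporting hyperplane at one point of the face must contain the whole face, because a
  relatively open set cannot otherwise stay on one side of it. Strictness on \<open>T\<close> comes
  with supporting at a point outside the relative interior.\<close>

lemma outward_unique_exists:
  assumes T: "open T" "convex T" "T \<noteq> {}" and FT: "F \<subseteq> frontier T"
  shows "\<exists>n. norm n = 1 \<and> (\<forall>x\<in>F. \<forall>y\<in>T. n \<bullet> (y - x) < 0) \<and> (n = N \<or> n = - N) \<and>
    (\<forall>m. norm m = 1 \<and> (\<forall>x\<in>F. \<forall>y\<in>T. m \<bullet> (y - x) \<le> 0) \<longrightarrow> m = n)"
proof -
  obtain x0 where x0: "x0 \<in> F" using nonempty by blast
  have FC: "F \<subseteq> closure T" and "x0 \<notin> T"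
    using FT x0 T(1) by (auto simp: frontier_def interior_open)
  moreover have "rel_interior (closure T) = T"
    using T by (simp add: convex_rel_interior_closure rel_interior_open)
  ultimately obtain a where a: "a \<noteq> 0" "\<And>y. y \<in> closure T \<Longrightarrow> a \<bullet> x0 \<le> a \<bullet> y"
      "\<And>y. y \<in> T \<Longrightarrow> a \<bullet> x0 < a \<bullet> y"
    using supporting_hyperplane_rel_boundary[of "closure T" x0] T(2) x0 by (metis convex_closure subsetD)
  have const: "a \<bullet> x = a \<bullet> x0" if x: "x \<in> F" for x
  proof -
    obtain e where e: "0 < e" "\<And>y. N \<bullet> y = b \<Longrightarrow> norm (y - x0) < e \<Longrightarrow> y \<in> F" using rel_open[OF x0] by blast
    \<comment> \<open>Small enough that moving from \<open>x0\<close> away from \<open>x\<close>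
      stays in the face. The functional \<open>a\<close> is minimal at \<open>x0\<close>, so it
      cannot decrease along this move, which bounds its value at \<open>x\<close> from
      above.\<close>
    define s where "s = e / (2 * (norm (x - x0) + 1))"
    have s: "0 < s" using e(1) by (simp add: s_def add_nonneg_pos)
    let ?y = "x0 + s *\<^sub>R (x0 - x)"
    have "N \<bullet> ?y = b" using b_eq[OF x] b_eq[OF x0] by (simp add: inner_add_right inner_diff_right)
    moreover have "norm (?y - x0) < e"
    proof -
      have "norm (?y - x0) = s * norm (x - x0)" using s by (simp add: norm_minus_commute)
      also have "\<dots> \<le> s * (norm (x - x0) + 1)" using s by simp
      also have "\<dots> = e / 2" by (simp add: s_def field_simps add_nonneg_eq_0_iff)
      finally show ?thesis using e(1) by simp
    qed
    ultimately have "a \<bullet> x0 \<le> a \<bullet> ?y" using e(2) FC a(2) by blast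
    then have "0 \<le> s * (a \<bullet> x0 - a \<bullet> x)" by (simp add: inner_add_right inner_diff_right)
    then have "a \<bullet> x \<le> a \<bullet> x0" using s by (simp add: zero_le_mult_iff)
    then show ?thesis using a(2) FC x by (meson antisym subsetD)
  qed
  have par: "m = N \<or> m = - N" if m: "norm m = 1" "\<And>x y. x \<in> F \<Longrightarrow> y \<in> T \<Longrightarrow> m \<bullet> (y - x) \<le> 0" for m
  proof -
    have "m \<bullet> (y - x) \<le> 0" if "x \<in> F" "y \<in> F" for x y
    proof -
      have "closed {y. m \<bullet> (y - x) \<le> 0}" by (intro closed_Collect_le continuous_intros)
      then have "closure T \<subseteq> {y. m \<bullet> (y - x) \<le> 0}" using m(2) that by (intro closure_minimal) auto
      then show ?thesis using that FC by blast
    qed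
    then have "m \<bullet> (x - y) = 0" if "x \<in> F" "y \<in> F" for x y
      using that by (metis antisym inner_minus_right minus_diff_eq neg_le_0_iff_le)
    then have m_eq: "m = (m \<bullet> N) *\<^sub>R N" by (rule orthogonal_parallel)
    then have "\<bar>m \<bullet> N\<bar> = 1" using m(1) by (metis norm_N norm_scaleR mult.right_neutral)
    then have "m \<bullet> N = 1 \<or> m \<bullet> N = -1" by linarith
    then show ?thesis using m_eq by (metis scaleR_minus_left scaleR_one)
  qed
  define n where "n = - (a /\<^sub>R norm a)"
  have n1: "norm n = 1" using a(1) by (simp add: n_def)
  have n2: "n \<bullet> (y - x) < 0" if "x \<in> F" "y \<in> T" for x y
  proof -
    have "0 < a \<bullet> (y - x)" using a(3)[OF that(2)] const[OF that(1)] by (simp add: inner_diff_right)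
    then show ?thesis using a(1) by (simp add: n_def)
  qed
  have n3: "n = N \<or> n = - N" using par[OF n1] n2 less_imp_le by blast
  have "m = n" if m: "norm m = 1" "\<forall>x\<in>F. \<forall>y\<in>T. m \<bullet> (y - x) \<le> 0" for m
  proof (rule ccontr)
    assume "m \<noteq> n"
    moreover have "m = N \<or> m = - N" using par m by blast
    ultimately have "m = - n" using n3 by auto
    obtain y where "y \<in> T" using T(3) by blast
    then have "m \<bullet> (y - x0) \<le> 0" "n \<bullet> (y - x0) < 0" using m(2) n2 x0 by auto
    then show False using \<open>m = - n\<close> by simp
  qed
  then show ?thesis using n1 n2 n3 by blast
qed

lemma outward:
  assumes "open T" "convex T" "T \<noteq> {}" "F \<subseteq> frontier T"
  shows "norm (outward_normal T F) = 1"
    and "\<And>x y. x \<in> F \<Longrightarrow> y \<in> T \<Longrightarrow> outward_normal T F \<bullet> (y - x) < 0"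
    and "outward_normal T F = N \<or> outward_normal T F = - N"
proof -
  obtain n where n: "norm n = 1" "\<forall>x\<in>F. \<forall>y\<in>T. n \<bullet> (y - x) < 0" "n = N \<or> n = - N"
    "\<And>m. norm m = 1 \<and> (\<forall>x\<in>F. \<forall>y\<in>T. m \<bullet> (y - x) \<le> 0) \<Longrightarrow> m = n"
    using outward_unique_exists[OF assms] by blast
  have "outward_normal T F = n"
    unfolding outward_normal_def using n(1,2,4) less_imp_le by (intro the_equality) blast+
  then show "norm (outward_normal T F) = 1" "outward_normal T F = N \<or> outward_normal T F = - N"
    "\<And>x y. x \<in> F \<Longrightarrow> y \<in> T \<Longrightarrow> outward_normal T F \<bullet> (y - x) < 0"
    using n by auto
qed

text \<open>The point \<open>x + t *\<^sub>R w\<close> is a convex combination of a point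
  \<open>y\<close> of \<open>T\<close> and a face point \<open>?p\<close> close to \<open>x\<close>,
  hence interior to the convex set.\<close>

lemma enter:
  assumes T: "open T" "convex T" "T \<noteq> {}" "F \<subseteq> frontier T" and x: "x \<in> F" and w: "outward_normal T F \<bullet> w < 0"
  shows "\<exists>e>0. \<forall>t. 0 < t \<and> t < e \<longrightarrow> x + t *\<^sub>R w \<in> T"
proof -
  let ?n = "outward_normal T F"
  note out = outward[OF T]
  obtain y where y: "y \<in> T" using T(3) by blast
  have m: "?n \<bullet> (y - x) < 0" using out(2)[OF x y] .
  \<comment> \<open>Chosen so that \<open>q\<close>, what remains of \<open>w\<close> after removing
    a multiple of \<open>y - x\<close>, is tangential to the face.\<close>
  define s where "s = (?n \<bullet> w) / (?n \<bullet> (y - x))"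
  have s: "0 < s" using m w by (simp add: s_def divide_neg_neg)
  define q where "q = w - s *\<^sub>R (y - x)"
  have "?n \<bullet> q = ?n \<bullet> w - s * (?n \<bullet> (y - x))" unfolding q_def by (simp only: inner_diff_right[of ?n w] inner_scaleR_right)
  then have "?n \<bullet> q = 0" using m by (simp add: s_def)
  then have q: "N \<bullet> q = 0" using out(3) by auto
  obtain e where e: "0 < e" "\<And>y. N \<bullet> y = b \<Longrightarrow> norm (y - x) < e \<Longrightarrow> y \<in> F" using rel_open[OF x] by blast
  \<comment> \<open>The first bound gives \<open>t * s < 1 / 2\<close>, so \<open>?c\<close> is at
    most \<open>2 * t\<close>; the second then keeps \<open>?p\<close> within distance
    \<open>e\<close> of \<open>x\<close>, that is, within the face.\<close>
  define d where "d = min (1 / (2 * s)) (e / (2 * (norm q + 1)))"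
  have d: "0 < d" using s e(1) by (simp add: d_def add_nonneg_pos)
  have "x + t *\<^sub>R w \<in> T" if t: "0 < t" "t < d" for t
  proof -
    have ts: "t * s < 1 / 2" using t s by (simp add: d_def field_simps)
    have ts0: "0 < t * s" using t s by simp
    let ?c = "t / (1 - t * s)"
    let ?p = "x + ?c *\<^sub>R q"
    have c: "0 < ?c" "?c \<le> 2 * t" using t ts by (auto simp: field_simps)
    have "norm (?c *\<^sub>R q) = ?c * norm q" using c(1) by (simp only: norm_scaleR abs_of_pos)
    also have "\<dots> \<le> 2 * t * (norm q + 1)" using c t by (intro mult_mono) auto
    also have "\<dots> < e"
    proof -
      have "t < e / (2 * (norm q + 1))" using t by (simp add: d_def)
      moreover have "0 < 2 * (norm q + 1)" by (simp add: add_nonneg_pos)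
      ultimately have "t * (2 * (norm q + 1)) < e" by (simp only: pos_less_divide_eq)
      then show ?thesis by (simp add: mult_ac)
    qed
    finally have "?p \<in> F" using q b_eq[OF x] by (intro e(2)) (auto simp: inner_add_right)
    then have pc: "?p \<in> closure T" using T(4) by (auto simp: frontier_def)
    have pT: "?p \<notin> T" using \<open>?p \<in> F\<close> T(1,4) by (auto simp: frontier_def interior_open)
    have "(1 - t * s) *\<^sub>R ?p + (t * s) *\<^sub>R y = x + t *\<^sub>R w"
    proof -
      have "(1 - t * s) *\<^sub>R ?p = (1 - t * s) *\<^sub>R x + t *\<^sub>R q"
        using ts by (simp add: scaleR_add_right)
      then show ?thesis by (simp add: q_def algebra_simps)
    qed
    then have "x + t *\<^sub>R w \<in> open_segment y ?p"
      using ts ts0 y pT by (auto simp: in_segment intro!: exI[of _ "1 - t * s"] simp: add.commute)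
    then show ?thesis
      using in_interior_closure_convex_segment[OF T(2) _ pc, of y] y T(1) by (auto simp: interior_open)
  qed
  then show ?thesis using d by blast
qed

end

section \<open>The divergence theorem on a convex polytope\<close>

lemma bounded_borel_integrable:
  fixes u :: "'a::euclidean_space \<Rightarrow> real"
  assumes "bounded S" "S \<in> sets borel" "continuous_on UNIV u"
  shows "integrable lborel (\<lambda>z. indicator S z * u z)"
proof -
  obtain R where "\<forall>x\<in>S. norm x \<le> R" using assms(1) unfolding bounded_iff by blast
  then have R: "S \<subseteq> cball 0 R" by auto
  have "integrable lborel (\<lambda>z. indicator (cball 0 R) z *\<^sub>R u z)"
    by (intro borel_integrable_compact continuous_on_subset[OF assms(3)]) auto
  then have "integrable lborel (\<lambda>z. indicator S z *\<^sub>R (indicator (cball 0 R) z *\<^sub>R u z))"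
    by (rule integrable_mult_indicator[rotated]) (simp add: assms(2))
  also have "(\<lambda>z. indicator S z *\<^sub>R (indicator (cball 0 R) z *\<^sub>R u z)) = (\<lambda>z. indicator S z * u z)"
    using R by (auto simp: indicator_def fun_eq_iff)
  finally show ?thesis .
qed

text \<open>The open faces in \<open>Fs\<close> cover the boundary only up to relative boundaries of
  faces from \<open>\<G>\<close>. On a mesh \<open>\<G>\<close> is the whole skeleton, since the
  covering condition does not say whose closure contains a given ridge point.\<close>

locale element =
  fixes T :: "'a::euclidean_space set" and Fs \<G> :: "'a set set"
  assumes dim: "DIM('a) = 2 \<or> DIM('a) = 3"
    and T: "open T" "convex T" "bounded T" "T \<noteq> {}"
    and Fs: "finite Fs" "\<And>F. F \<in> Fs \<Longrightarrow> planar_face F" "\<And>F. F \<in> Fs \<Longrightarrow> F \<subseteq> frontier T" "pairwise disjnt Fs"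
    and \<G>: "finite \<G>" "\<And>G. G \<in> \<G> \<Longrightarrow> face G"
    and cover: "frontier T \<subseteq> \<Union>Fs \<union> (\<Union>G\<in>\<G>. closure G - G)"
begin

abbreviation nrm :: "'a set \<Rightarrow> 'a" where "nrm F \<equiv> outward_normal T F"

lemma faceI: "F \<in> Fs \<Longrightarrow> face F"
  using Fs(2,3) bounded_subset[OF bounded_closure[OF T(3)], of F]
  by unfold_locales (auto simp: frontier_def)

lemma nrm_cases: "F \<in> Fs \<Longrightarrow> nrm F = face.N F \<or> nrm F = - face.N F"
  using face.outward(3)[OF faceI T(1,2,4) Fs(3)] .

lemma norm_nrm: "F \<in> Fs \<Longrightarrow> norm (nrm F) = 1"
  using face.outward(1)[OF faceI T(1,2,4) Fs(3)] .

lemma nrm_neg: "F \<in> Fs \<Longrightarrow> x \<in> F \<Longrightarrow> y \<in> T \<Longrightarrow> nrm F \<bullet> (y - x) < 0"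
  using face.outward(2)[OF faceI T(1,2,4) Fs(3)] .

definition sweep :: "'a \<Rightarrow> 'a set \<Rightarrow> 'a set" where
  "sweep v F = {x + t *\<^sub>R v |x t. x \<in> F \<and> 0 \<le> t \<and> t \<le> 1}"

text \<open>A null set outside of which the segment from \<open>z\<close> to \<open>z - v\<close>
  crosses the boundary only transversally, at points of open faces, and has its end points off the
  boundary.\<close>

definition bad :: "'a \<Rightarrow> 'a set" where
  "bad v = (\<Union>G\<in>\<G>. {x + t *\<^sub>R v |x t. x \<in> closure G - G}) \<union>
     (\<Union>F\<in>{F \<in> Fs. nrm F \<bullet> v = 0}. {z. face.N F \<bullet> z = face.b F}) \<union> frontier T \<union> (+) v ` frontier T"

lemma negligible_bad: "negligible (bad v)"
proof -
  have "negligible (\<Union>G\<in>\<G>. {x + t *\<^sub>R v |x t. x \<in> closure G - G})"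
    using \<G> face.negligible_ridge_sweep by (intro negligible_Union) auto
  moreover have "negligible (\<Union>F\<in>{F \<in> Fs. nrm F \<bullet> v = 0}. {z. face.N F \<bullet> z = face.b F})"
    using Fs(1) face.negligible_hyperplane'[OF faceI] by (intro negligible_Union) auto
  moreover have "negligible (frontier T)" using T(2) by (rule negligible_convex_frontier)
  moreover from this have "negligible ((+) v ` frontier T)" by (rule negligible_translation)
  ultimately show ?thesis unfolding bad_def by (intro negligible_Un)
qed

lemma in_sweep: "z \<in> sweep v F \<longleftrightarrow> (\<exists>t. 0 \<le> t \<and> t \<le> 1 \<and> z - t *\<^sub>R v \<in> F)"
proof
  assume "\<exists>t. 0 \<le> t \<and> t \<le> 1 \<and> z - t *\<^sub>R v \<in> F"
  then obtain t where "0 \<le> t" "t \<le> 1" "z - t *\<^sub>R v \<in> F" by blast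
  then show "z \<in> sweep v F" unfolding sweep_def by (intro CollectI exI[of _ "z - t *\<^sub>R v"] exI[of _ t]) simp
qed (auto simp: sweep_def)

text \<open>The path \<open>z - s *\<^sub>R v\<close> runs against \<open>v\<close>, so a positive
  product of \<open>v\<close> with the outward normal means entry. Since \<open>T\<close> lies on
  one side of the face plane, no earlier point of the path is in \<open>T\<close>.\<close>

lemma entering:
  assumes F: "F \<in> Fs" "0 < nrm F \<bullet> v" "z - t *\<^sub>R v \<in> F"
  shows "\<exists>e>0. \<forall>s. t < s \<and> s < t + e \<longrightarrow> z - s *\<^sub>R v \<in> T" and "\<And>s. s \<le> t \<Longrightarrow> z - s *\<^sub>R v \<notin> T"
proof -
  have "nrm F \<bullet> (- v) < 0" using F(2) by simp
  then obtain e where e: "0 < e" "\<And>r. 0 < r \<and> r < e \<Longrightarrow> (z - t *\<^sub>R v) + r *\<^sub>R (- v) \<in> T"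
    using face.enter[OF faceI[OF F(1)] T(1,2,4) Fs(3)[OF F(1)] F(3)] by blast
  have "z - s *\<^sub>R v \<in> T" if "t < s" "s < t + e" for s
    using e(2)[of "s - t"] that by (simp add: algebra_simps)
  then show "\<exists>e>0. \<forall>s. t < s \<and> s < t + e \<longrightarrow> z - s *\<^sub>R v \<in> T" using e(1) by blast
  fix s assume s: "s \<le> t"
  show "z - s *\<^sub>R v \<notin> T"
  proof
    assume "z - s *\<^sub>R v \<in> T"
    then have "nrm F \<bullet> ((z - s *\<^sub>R v) - (z - t *\<^sub>R v)) < 0" by (rule nrm_neg[OF F(1,3)])
    then have "(t - s) * (nrm F \<bullet> v) < 0" by (simp add: inner_diff_right algebra_simps)
    then show False using s F(2) by (simp add: mult_less_0_iff)
  qed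
qed

text \<open>Reversing the segment, from \<open>z\<close> and \<open>v\<close> to
  \<open>z - v\<close> and \<open>- v\<close>, exchanges entries and exits; this symmetry reduces
  statements about exits to statements about entries.\<close>

lemma bad_flip: assumes "z \<notin> bad v" shows "z - v \<notin> bad (- v)"
proof
  assume "z - v \<in> bad (- v)"
  then consider G x t where "G \<in> \<G>" "x \<in> closure G - G" "z - v = x + t *\<^sub>R (- v)"
    | F where "F \<in> Fs" "nrm F \<bullet> v = 0" "face.N F \<bullet> (z - v) = face.b F" | "z - v \<in> frontier T" | "z \<in> frontier T"
    unfolding bad_def by auto
  then have "z \<in> bad v"
  proof cases
    case 1
    then have "z = x + (1 - t) *\<^sub>R v" by (simp add: algebra_simps)
    then show ?thesis unfolding bad_def using 1(1,2) by blast
  next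
    case 2
    then have "face.N F \<bullet> v = 0" using nrm_cases by fastforce
    then show ?thesis unfolding bad_def using 2 by (auto simp: inner_diff_right)
  next
    case 3
    then have "z \<in> (+) v ` frontier T" by (intro image_eqI[of _ _ "z - v"]) simp_all
    then show ?thesis unfolding bad_def by blast
  qed (simp add: bad_def)
  then show False using assms by blast
qed

lemma sweep_flip: "z - v \<in> sweep (- v) F \<longleftrightarrow> z \<in> sweep v F"
proof -
  have "(\<exists>t. 0 \<le> t \<and> t \<le> 1 \<and> (z - v) - t *\<^sub>R (- v) \<in> F) \<longleftrightarrow> (\<exists>t. 0 \<le> t \<and> t \<le> 1 \<and> z - t *\<^sub>R v \<in> F)" (is "?l \<longleftrightarrow> ?r")
  proof
    assume ?l
    then obtain t where "0 \<le> t" "t \<le> 1" "(z - v) - t *\<^sub>R (- v) \<in> F" by blast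
    then show ?r by (intro exI[of _ "1 - t"]) (simp add: algebra_simps)
  next
    assume ?r
    then obtain t where "0 \<le> t" "t \<le> 1" "z - t *\<^sub>R v \<in> F" by blast
    then show ?l by (intro exI[of _ "1 - t"]) (simp add: algebra_simps)
  qed
  then show ?thesis unfolding in_sweep .
qed

section \<open>Counting the boundary crossings of a segment\<close>

lemma crossing:
  assumes z: "z \<notin> bad v" and "z - s0 *\<^sub>R v \<in> T" "z - s1 *\<^sub>R v \<notin> T"
  shows "\<exists>s F. s \<in> closed_segment s0 s1 \<and> F \<in> Fs \<and> z - s *\<^sub>R v \<in> F \<and> nrm F \<bullet> v \<noteq> 0"
proof -
  let ?S = "(\<lambda>s. z - s *\<^sub>R v) ` closed_segment s0 s1"
  have "connected ?S" by (intro connected_continuous_image continuous_intros connected_segment)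
  moreover have "?S \<inter> T \<noteq> {}" "?S - T \<noteq> {}" using assms(2,3) by auto
  ultimately have "?S \<inter> frontier T \<noteq> {}" by (rule connected_Int_frontier)
  then obtain s where s: "s \<in> closed_segment s0 s1" "z - s *\<^sub>R v \<in> frontier T" by blast
  have "z - s *\<^sub>R v \<notin> closure G - G" if "G \<in> \<G>" for G
  proof
    assume "z - s *\<^sub>R v \<in> closure G - G"
    then have "z \<in> {x + t *\<^sub>R v |x t. x \<in> closure G - G}"
      by (intro CollectI exI[of _ "z - s *\<^sub>R v"] exI[of _ s]) simp
    then show False using z that unfolding bad_def by blast
  qed
  then obtain F where F: "F \<in> Fs" "z - s *\<^sub>R v \<in> F" using cover s(2) by blast
  have "nrm F \<bullet> v \<noteq> 0"
  proof
    assume nv: "nrm F \<bullet> v = 0"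
    then have "face.N F \<bullet> v = 0" using nrm_cases[OF F(1)] by auto
    then have "face.N F \<bullet> z = face.b F"
      using face.b_eq[OF faceI[OF F(1)] F(2)] by (simp add: inner_diff_right)
    then show False using z F(1) nv unfolding bad_def by blast
  qed
  then show ?thesis using s F by blast
qed

definition enters :: "'a \<Rightarrow> 'a \<Rightarrow> bool" where
  "enters z v \<longleftrightarrow> (\<exists>F\<in>Fs. 0 < nrm F \<bullet> v \<and> z \<in> sweep v F)"

text \<open>Convexity permits at most one entry: just after an earlier entry the path is inside,
  although it must be outside up to a later one. Two faces entered at the same parameter would
  intersect.\<close>

lemma card_enters: "card {F \<in> Fs. 0 < nrm F \<bullet> v \<and> z \<in> sweep v F} = of_bool (enters z v)" (is "card ?P = _")
proof (cases "enters z v")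
  case True
  then obtain F t where F: "F \<in> Fs" "0 < nrm F \<bullet> v" "z \<in> sweep v F" "z - t *\<^sub>R v \<in> F" unfolding enters_def in_sweep by blast
  have "F' = F" if F': "F' \<in> ?P" for F'
  proof -
    obtain t' where t': "z - t' *\<^sub>R v \<in> F'" using F' in_sweep by blast
    have le: "\<not> r < r'" if G: "G \<in> Fs" "0 < nrm G \<bullet> v" "z - r *\<^sub>R v \<in> G" "G' \<in> Fs" "0 < nrm G' \<bullet> v" "z - r' *\<^sub>R v \<in> G'" for r r' G G'
    proof
      assume rr: "r < r'"
      obtain e where e: "0 < e" "\<forall>s. r < s \<and> s < r + e \<longrightarrow> z - s *\<^sub>R v \<in> T" using entering(1)[OF G(1-3)] by blast
      let ?s = "min r' (r + e / 2)"
      have "z - ?s *\<^sub>R v \<in> T" using e rr by (intro e(2)[rule_format]) auto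
      then show False using entering(2)[OF G(4-6), of ?s] by auto
    qed
    have "t = t'" using le[of F t F' t'] le[of F' t' F t] F F' t' by fastforce
    then show ?thesis using Fs(4) F F' t' unfolding pairwise_def disjnt_def by blast
  qed
  then have "?P = {F}" using F by blast
  then show ?thesis using True by simp
next
  case False
  then have e: "?P = {}" unfolding enters_def by blast
  show ?thesis unfolding e using False by simp
qed

lemma enters_outside: "enters z v \<Longrightarrow> z \<notin> T"
  using entering(2)[of _ v z _ 0] unfolding enters_def in_sweep by auto

lemma exit_after:
  assumes z: "z \<notin> bad v" and s: "s0 \<le> s1" "z - s0 *\<^sub>R v \<in> T" "z - s1 *\<^sub>R v \<notin> T"
  shows "\<exists>s F. s0 \<le> s \<and> s \<le> s1 \<and> F \<in> Fs \<and> z - s *\<^sub>R v \<in> F \<and> nrm F \<bullet> v < 0"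
proof -
  obtain s F where F: "s \<in> closed_segment s0 s1" "F \<in> Fs" "z - s *\<^sub>R v \<in> F" "nrm F \<bullet> v \<noteq> 0"
    using crossing[OF z s(2,3)] by blast
  then have "s0 \<le> s" "s \<le> s1" using s(1) by (auto simp: closed_segment_eq_real_ivl)
  moreover have "\<not> 0 < nrm F \<bullet> v" using entering(2)[OF F(2) _ F(3) \<open>s0 \<le> s\<close>] s(2) by blast
  ultimately show ?thesis using F by (metis linorder_neqE_linordered_idom)
qed

lemma exit_enters: "0 \<le> s \<Longrightarrow> s \<le> 1 \<Longrightarrow> F \<in> Fs \<Longrightarrow> z - s *\<^sub>R v \<in> F \<Longrightarrow> nrm F \<bullet> v < 0 \<Longrightarrow> enters (z - v) (- v)"
  unfolding enters_def sweep_flip unfolding in_sweep by (intro bexI[of _ F] conjI exI[of _ s]) auto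

lemma enters_inside:
  assumes "z \<notin> bad v" "z \<in> T" "z - v \<notin> T" shows "enters (z - v) (- v)"
  using exit_after[OF assms(1), of 0 1] assms(2,3) exit_enters by auto

lemma enters_both:
  assumes z: "z \<notin> bad v" "z - v \<notin> T" and en: "enters z v" shows "enters (z - v) (- v)"
proof -
  obtain F t where F: "F \<in> Fs" "0 \<le> t" "t \<le> 1" "0 < nrm F \<bullet> v" "z - t *\<^sub>R v \<in> F"
    using en unfolding enters_def in_sweep by blast
  have "z - v \<notin> frontier T"
  proof
    assume "z - v \<in> frontier T"
    then have "z \<in> (+) v ` frontier T" by (intro image_eqI[of _ _ "z - v"]) simp_all
    then show False using z by (simp add: bad_def)
  qed
  then have "t \<noteq> 1" using F Fs(3)[OF F(1)] by auto
  obtain e where e: "0 < e" "\<forall>s. t < s \<and> s < t + e \<longrightarrow> z - s *\<^sub>R v \<in> T" using entering(1)[OF F(1,4,5)] by blast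
  \<comment> \<open>A parameter just after the entry at \<open>t\<close> and before the end of the
    segment; from there the path has to leave again.\<close>
  let ?s = "min ((t + 1) / 2) (t + e / 2)"
  have zs: "z - ?s *\<^sub>R v \<in> T" using e F(3) \<open>t \<noteq> 1\<close> by (intro e(2)[rule_format]) (auto simp: min_def)
  have s1: "?s \<le> 1" "0 \<le> ?s" using F(2,3) e(1) by (auto simp: min_def)
  have "z - 1 *\<^sub>R v \<notin> T" using z(2) by simp
  then obtain s F' where s: "?s \<le> s" "s \<le> 1" "F' \<in> Fs" "z - s *\<^sub>R v \<in> F'" "nrm F' \<bullet> v < 0"
    using exit_after[OF z(1) s1(1) zs] by blast
  show ?thesis by (rule exit_enters[OF order_trans[OF s1(2) s(1)] s(2-5)])
qed

text \<open>Entries minus exits along the segment equal the change of the indicator. Both counts are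
  at most one, so the claim reduces to whether the two end points are inside.\<close>

lemma crossing_identity:
  assumes z: "z \<notin> bad v"
  shows "indicator T (z - v) - indicator T z = (\<Sum>F\<in>Fs. sgn (nrm F \<bullet> v) * (indicator (sweep v F) z :: real))"
proof -
  let ?P = "\<lambda>z v. {F \<in> Fs. 0 < nrm F \<bullet> v \<and> z \<in> sweep v F}"
  have "(\<Sum>F\<in>Fs. sgn (nrm F \<bullet> v) * (indicator (sweep v F) z :: real))
      = (\<Sum>F\<in>Fs. of_bool (0 < nrm F \<bullet> v \<and> z \<in> sweep v F) - of_bool (0 < nrm F \<bullet> (- v) \<and> z - v \<in> sweep (- v) F))"
    by (intro sum.cong) (auto simp: sgn_if indicator_def sweep_flip)
  also have "\<dots> = real (card (?P z v)) - real (card (?P (z - v) (- v)))"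
    using Fs(1) by (simp add: sum_subtractf Int_def of_bool_def sum.If_cases)
  also have "\<dots> = of_bool (enters z v) - of_bool (enters (z - v) (- v))" unfolding card_enters by simp
  also have "\<dots> = of_bool (enters z v \<and> \<not> enters (z - v) (- v)) - of_bool (enters (z - v) (- v) \<and> \<not> enters z v)"
    by (simp add: of_bool_def)
  also have "enters z v \<and> \<not> enters (z - v) (- v) \<longleftrightarrow> z - v \<in> T \<and> z \<notin> T"
    using enters_outside[of z v] enters_outside[of "z - v" "- v"] enters_both[OF z] enters_inside[OF bad_flip[OF z]] by force
  also have "enters (z - v) (- v) \<and> \<not> enters z v \<longleftrightarrow> z \<in> T \<and> z - v \<notin> T"
    using enters_outside[of z v] enters_outside[of "z - v" "- v"] enters_inside[OF z] enters_both[OF bad_flip[OF z]] by force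
  finally show ?thesis by (auto simp: indicator_def)
qed

text \<open>Integrates the crossing identity against \<open>u\<close>: the left side compares the
  element with its translate, each right-hand term is an integral over an oblique prism. The
  identity is exact for every \<open>v\<close>.\<close>

lemma flux_difference:
  fixes u :: "'a \<Rightarrow> real"
  assumes u: "continuous_on UNIV u"
  shows "(\<integral>x. u (x + v) - u x \<partial>lebesgue_on T)
    = (\<Sum>F\<in>Fs. (nrm F \<bullet> v) * (\<integral>z. u (face.foot F z + face.height F z *\<^sub>R v) \<partial>lebesgue_on (face.prism F)))"
proof -
  have [measurable]: "u \<in> borel_measurable borel" "T \<in> sets borel"
    using u T(1) by (auto intro: borel_measurable_continuous_onI)
  have TL: "T \<in> sets lebesgue" using T(1) by (rule open_sets_lebesgue)
  have shift: "continuous_on UNIV (\<lambda>x. u (x + v))" by (rule continuous_on_compose2[OF u]) (auto intro!: continuous_intros)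
  have i0: "integrable lborel (\<lambda>z. indicator T z * u z)" "integrable lborel (\<lambda>z. indicator T z * u (z + v))"
    using bounded_borel_integrable[OF T(3) _ u] bounded_borel_integrable[OF T(3) _ shift] T(1) by auto
  have iv: "integrable lborel (\<lambda>z. indicator T (z - v) * u z)"
    and ev: "(\<integral>z. indicator T (z - v) * u z \<partial>lborel) = (\<integral>z. indicator T z * u (z + v) \<partial>lborel)"
  proof -
    have "integrable (distr lborel borel ((+) v)) (\<lambda>z. indicator T (z - v) * u z)"
      by (subst integrable_distr_eq) (use i0(2) in \<open>auto simp: add.commute\<close>)
    then show "integrable lborel (\<lambda>z. indicator T (z - v) * u z)" by (simp add: lborel_distr_plus)
    have "(\<integral>z. indicator T (z - v) * u z \<partial>lborel) = (\<integral>z. indicator T (z - v) * u z \<partial>distr lborel borel ((+) v))"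
      by (simp add: lborel_distr_plus)
    also have "\<dots> = (\<integral>z. indicator T z * u (z + v) \<partial>lborel)"
      by (subst integral_distr) (auto simp: add.commute)
    finally show "(\<integral>z. indicator T (z - v) * u z \<partial>lborel) = (\<integral>z. indicator T z * u (z + v) \<partial>lborel)" .
  qed
  let ?S = "\<lambda>F z. indicator (sweep v F) z * u z"
  have sw: "integrable lborel (\<lambda>z. sgn (nrm F \<bullet> v) * ?S F z) \<and>
      (\<integral>z. sgn (nrm F \<bullet> v) * ?S F z \<partial>lborel) = (nrm F \<bullet> v) * (\<integral>z. u (face.foot F z + face.height F z *\<^sub>R v) \<partial>lebesgue_on (face.prism F))"
    if F: "F \<in> Fs" for F
  proof (cases "nrm F \<bullet> v = 0")
    case False
    interpret face F using F by (rule faceI)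
    have Nv: "N \<bullet> v \<noteq> 0" and sg: "sgn (nrm F \<bullet> v) * \<bar>N \<bullet> v\<bar> = nrm F \<bullet> v"
      using False nrm_cases[OF F] by (auto simp: sgn_if abs_if)
    have "sweep v F \<in> sets borel" unfolding sweep_def by (rule sweep_integral(1)[OF dim Nv]) measurable
    moreover have "Elementary_Metric_Spaces.bounded (sweep v F)"
    proof -
      obtain R where R: "\<And>x. x \<in> F \<Longrightarrow> norm x \<le> R" using bounded by (auto simp: bounded_iff)
      have "norm (x + t *\<^sub>R v) \<le> R + norm v" if "x \<in> F" "0 \<le> t" "t \<le> 1" for x t
      proof -
        have "norm (t *\<^sub>R v) \<le> 1 * norm v"
          unfolding norm_scaleR using that by (intro mult_right_mono) auto
        then show ?thesis using R[OF that(1)] norm_triangle_ineq[of x "t *\<^sub>R v"] by linarith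
      qed
      then show ?thesis unfolding sweep_def bounded_iff by blast
    qed
    ultimately have "integrable lborel (?S F)" using u by (intro bounded_borel_integrable)
    then have i: "integrable lborel (\<lambda>z. sgn (nrm F \<bullet> v) * ?S F z)" by (rule integrable_mult_right)
    have e: "(\<integral>z. ?S F z \<partial>lborel) = \<bar>N \<bullet> v\<bar> * (\<integral>z. u (foot z + height z *\<^sub>R v) \<partial>lebesgue_on prism)"
      unfolding sweep_def by (rule sweep_integral(2)[OF dim Nv]) measurable
    have 1: "(\<integral>z. sgn (nrm F \<bullet> v) * ?S F z \<partial>lborel) = sgn (nrm F \<bullet> v) * (\<integral>z. ?S F z \<partial>lborel)"
      by (rule integral_mult_right_zero)
    have 2: "sgn (nrm F \<bullet> v) * (\<integral>z. ?S F z \<partial>lborel) = (nrm F \<bullet> v) * (\<integral>z. u (foot z + height z *\<^sub>R v) \<partial>lebesgue_on prism)"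
      unfolding e mult.assoc[symmetric] sg ..
    show ?thesis using i unfolding 1 2 by (rule conjI) (rule refl)
  qed simp
  have "(\<integral>x. u (x + v) - u x \<partial>lebesgue_on T) = (\<integral>z. indicator T z * u (z + v) - indicator T z * u z \<partial>lborel)"
    using TL by (simp add: integral_restrict_space integral_completion right_diff_distrib)
  also have "\<dots> = (\<integral>z. indicator T (z - v) * u z - indicator T z * u z \<partial>lborel)"
    using i0 iv ev by simp
  also have "\<dots> = (\<integral>z. (\<Sum>F\<in>Fs. sgn (nrm F \<bullet> v) * ?S F z) \<partial>lborel)"
  proof (rule integral_cong_AE)
    have "AE z in lebesgue. z \<notin> bad v" using negligible_bad AE_not_in negligible_iff_null_sets by blast
    then have "AE z in lborel. z \<notin> bad v" by (simp add: AE_completion_iff)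
    then show "AE z in lborel. indicator T (z - v) * u z - indicator T z * u z = (\<Sum>F\<in>Fs. sgn (nrm F \<bullet> v) * ?S F z)"
    proof eventually_elim
      case (elim z)
      have "indicator T (z - v) * u z - indicator T z * u z = (indicator T (z - v) - indicator T z) * u z"
        by (simp add: left_diff_distrib)
      then show ?case unfolding crossing_identity[OF elim] by (simp add: sum_distrib_right mult.assoc)
    qed
    show "(\<lambda>z. \<Sum>F\<in>Fs. sgn (nrm F \<bullet> v) * ?S F z) \<in> borel_measurable lborel"
      using sw by (intro borel_measurable_sum borel_measurable_integrable) blast
  qed measurable
  also have "\<dots> = (\<Sum>F\<in>Fs. (nrm F \<bullet> v) * (\<integral>z. u (face.foot F z + face.height F z *\<^sub>R v) \<partial>lebesgue_on (face.prism F)))"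
    using sw by (subst Bochner_Integration.integral_sum) auto
  finally show ?thesis .
qed

text \<open>The derivative of \<open>flux_difference\<close> along
  \<open>\<epsilon> n *\<^sub>R v\<close> as \<open>\<epsilon> n\<close> tends to zero. On the left
  a moving integral over the element is differentiated; on the right the swept regions collapse onto
  the faces.\<close>

theorem divergence:
  assumes u: "smooth u"
  shows "(\<integral>x. grad u x \<bullet> v \<partial>lebesgue_on T) = (\<Sum>F\<in>Fs. (nrm F \<bullet> v) * (\<integral>x. u x \<partial>face_measure F))"
proof -
  define \<epsilon> where "\<epsilon> n = 1 / real (Suc n)" for n
  have \<epsilon>: "\<epsilon> \<longlonglongrightarrow> 0" "\<And>n. 0 < \<epsilon> n" "\<And>n. \<epsilon> n \<le> 1"
    using LIMSEQ_ignore_initial_segment[OF lim_inverse_n', of 1] by (auto simp: \<epsilon>_def[abs_def])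
  have c: "continuous_on UNIV u" using u by (rule smooth_continuous)
  have TL: "T \<in> sets lebesgue" using T(1) by (rule open_sets_lebesgue)
  have "(\<lambda>n. \<integral>x. (u (x + \<epsilon> n *\<^sub>R v) - u x) / \<epsilon> n \<partial>lebesgue_on T) \<longlonglongrightarrow> (\<integral>x. grad u x \<bullet> v \<partial>lebesgue_on T)"
  proof -
    interpret weight "indicator T" T
      using T(1,3) lmeasurable_open[OF T(3,1)]
      by unfold_locales (auto simp: fmeasurable_def intro!: integrable_real_indicator)
    let ?F = "\<lambda>x. \<integral>y. u (1 *\<^sub>R y + (1 *\<^sub>R x + 0)) * indicator T y \<partial>lborel"
    have on_T: "(\<integral>x. f x \<partial>lebesgue_on T) = (\<integral>x. f x * indicator T x \<partial>lborel)" if "f \<in> borel_measurable borel" for f :: "'a \<Rightarrow> real"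
      using that TL T(1) by (simp add: integral_restrict_space integral_completion mult.commute)
    have int: "integrable lborel (\<lambda>y. q (y + x) * indicator T y)" if "smooth q" for q x
      using kernel_integrable[OF that, of 1 x] by simp
    have "(\<integral>x. (u (x + \<epsilon> n *\<^sub>R v) - u x) / \<epsilon> n \<partial>lebesgue_on T) = (?F (0 + \<epsilon> n *\<^sub>R v) - ?F 0) / \<epsilon> n" for n
      using smooth_measurable[OF u] int[OF u, of "\<epsilon> n *\<^sub>R v"] int[OF u, of 0]
      by (subst on_T) (simp_all add: left_diff_distrib diff_divide_distrib)
    moreover have "grad ?F 0 \<bullet> v = (\<integral>x. grad u x \<bullet> v \<partial>lebesgue_on T)"
    proof -
      have "grad ?F 0 \<bullet> v = (\<Sum>i\<in>Basis. (\<integral>y. pdiff i u y * indicator T y \<partial>lborel) * (v \<bullet> i))"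
        by (subst euclidean_inner) (simp add: grad_inner pdiff_kernel[OF u, of _ 1 1 0 0, simplified])
      also have "\<dots> = (\<integral>y. (\<Sum>i\<in>Basis. pdiff i u y * indicator T y * (v \<bullet> i)) \<partial>lborel)"
        using int[OF smooth_pdiff[OF u], of _ 0] by (subst Bochner_Integration.integral_sum) auto
      also have "(\<lambda>y. \<Sum>i\<in>Basis. pdiff i u y * indicator T y * (v \<bullet> i)) = (\<lambda>y. (grad u y \<bullet> v) * indicator T y)"
        unfolding euclidean_inner[of "grad u _" v] sum_distrib_right
        by (intro ext sum.cong refl) (simp only: grad_inner mult_ac)
      also have "(\<integral>y. (grad u y \<bullet> v) * indicator T y \<partial>lborel) = (\<integral>x. grad u x \<bullet> v \<partial>lebesgue_on T)"
        by (intro on_T[symmetric] borel_measurable_continuous_onI continuous_intros smooth_continuous_grad u)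
      finally show ?thesis .
    qed
    moreover have "(\<lambda>n. (?F (0 + \<epsilon> n *\<^sub>R v) - ?F 0) / \<epsilon> n) \<longlonglongrightarrow> grad ?F 0 \<bullet> v"
      by (rule smooth_directional[OF smooth_kernel[OF u] \<epsilon>(1)]) (rule less_imp_neq[OF \<epsilon>(2), symmetric])
    ultimately show ?thesis by (simp only:)
  qed
  moreover have "(\<integral>x. (u (x + \<epsilon> n *\<^sub>R v) - u x) / \<epsilon> n \<partial>lebesgue_on T)
     = (\<Sum>F\<in>Fs. (nrm F \<bullet> v) * (\<integral>z. u (face.foot F z + face.height F z *\<^sub>R (\<epsilon> n *\<^sub>R v)) \<partial>lebesgue_on (face.prism F)))" for n
    using flux_difference[OF c, of "\<epsilon> n *\<^sub>R v"] \<epsilon>(2)[of n]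
    by (simp add: mult.assoc flip: sum_distrib_left)
  moreover have "(\<lambda>n. \<Sum>F\<in>Fs. (nrm F \<bullet> v) * (\<integral>z. u (face.foot F z + face.height F z *\<^sub>R (\<epsilon> n *\<^sub>R v)) \<partial>lebesgue_on (face.prism F)))
      \<longlonglongrightarrow> (\<Sum>F\<in>Fs. (nrm F \<bullet> v) * (\<integral>x. u x \<partial>face_measure F))"
  proof (intro tendsto_sum tendsto_mult tendsto_const)
    fix F assume F: "F \<in> Fs"
    interpret face F using F by (rule faceI)
    obtain R where R: "\<And>x. x \<in> F \<Longrightarrow> norm x \<le> R" using bounded by (auto simp: bounded_iff)
    have "Elementary_Metric_Spaces.bounded (u ` cball 0 (R + norm v))"
      by (intro compact_imp_bounded compact_continuous_image continuous_on_subset[OF c]) auto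
    then obtain B where B: "\<And>x. x \<in> cball 0 (R + norm v) \<Longrightarrow> norm (u x) \<le> B"
      unfolding bounded_iff by blast
    have pm: "(\<lambda>z. u (foot z + height z *\<^sub>R w)) \<in> borel_measurable (lebesgue_on prism)" for w
      by (intro borel_measurable_lebesgue_on borel_measurable_continuous_onI continuous_on_compose2[OF c] continuous_intros foot_continuous) auto
    \<comment> \<open>In the limit the integrand depends on the foot point only, so the integral
      over the prism of height one becomes the surface integral.\<close>
    have "(\<lambda>n. \<integral>z. u (foot z + height z *\<^sub>R (\<epsilon> n *\<^sub>R v)) \<partial>lebesgue_on prism) \<longlonglongrightarrow> (\<integral>z. u (foot z + height z *\<^sub>R (0 *\<^sub>R v)) \<partial>lebesgue_on prism)"
    proof (rule integral_dominated_convergence[where w = "\<lambda>_. B"])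
      show "integrable (lebesgue_on prism) (\<lambda>_. B)"
        using finite_measure.integrable_const[OF finite_measure_lebesgue_on[OF prism_lmeasurable(1)]] .
      show "AE z in lebesgue_on prism. (\<lambda>n. u (foot z + height z *\<^sub>R (\<epsilon> n *\<^sub>R v))) \<longlonglongrightarrow> u (foot z + height z *\<^sub>R (0 *\<^sub>R v))"
        by (intro AE_I2 continuous_on_tendsto_compose[OF c] tendsto_intros \<epsilon>(1)) auto
      show "AE z in lebesgue_on prism. norm (u (foot z + height z *\<^sub>R (\<epsilon> n *\<^sub>R v))) \<le> B" for n
      proof (rule AE_I2, rule B)
        fix z assume "z \<in> space (lebesgue_on prism)"
        then have z: "foot z \<in> F" "0 \<le> height z" "height z \<le> 1" by (auto simp: prism_def)
        have "\<bar>height z\<bar> * (\<bar>\<epsilon> n\<bar> * norm v) \<le> 1 * (1 * norm v)"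
          using z \<epsilon>(2,3)[of n] by (intro mult_mono) auto
        then have "norm (height z *\<^sub>R (\<epsilon> n *\<^sub>R v)) \<le> norm v" by (simp add: abs_mult mult.assoc)
        then show "foot z + height z *\<^sub>R (\<epsilon> n *\<^sub>R v) \<in> cball 0 (R + norm v)"
          using R[OF z(1)] norm_triangle_ineq[of "foot z" "height z *\<^sub>R (\<epsilon> n *\<^sub>R v)"] by simp
      qed
    qed (rule pm)+
    then show "(\<lambda>n. \<integral>z. u (foot z + height z *\<^sub>R (\<epsilon> n *\<^sub>R v)) \<partial>lebesgue_on prism) \<longlonglongrightarrow> (\<integral>x. u x \<partial>face_measure F)"
      using smooth_measurable[OF u] by (subst face_integral) (auto intro: face_measurable)
  qed
  ultimately show ?thesis using LIMSEQ_unique by auto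
qed

end

section \<open>Mesh geometry\<close>

locale mesh =
  fixes \<rho> :: real and \<Omega> :: "'a::euclidean_space set" and Th Fh :: "'a set set"
  assumes dim: "DIM('a) = 2 \<or> DIM('a) = 3"
    and \<Omega>_polytope: "open_convex_polytope \<Omega>"
    and \<rho>: "0 < \<rho>"
    and mesh: "regular_convex_mesh \<rho> \<Omega> Th Fh"
begin

lemma \<Omega>: "open \<Omega>" "convex \<Omega>" "bounded \<Omega>" "\<Omega> \<noteq> {}"
  using \<Omega>_polytope polytope_imp_bounded bounded_subset[OF _ closure_subset]
  by (auto simp: open_convex_polytope_def)

lemma Th: "finite Th" "\<And>T. T \<in> Th \<Longrightarrow> open T" "\<And>T. T \<in> Th \<Longrightarrow> convex T"
    "\<And>T. T \<in> Th \<Longrightarrow> bounded T" "\<And>T. T \<in> Th \<Longrightarrow> T \<noteq> {}" "pairwise disjnt Th"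
    "(\<Union>T\<in>Th. closure T) = closure \<Omega>"
  using mesh polytope_imp_bounded bounded_subset[OF _ closure_subset]
  by (auto simp: open_convex_polytope_def regular_convex_mesh_def)

lemma Fh: "finite Fh" "\<And>F. F \<in> Fh \<Longrightarrow> planar_face F" "pairwise disjnt Fh"
    "(\<Union>F\<in>Fh. closure F) = (\<Union>T\<in>Th. frontier T)"
    "\<And>F. F \<in> Fh \<Longrightarrow> (\<exists>T1\<in>Th. \<exists>T2\<in>Th. T1 \<noteq> T2 \<and> F \<subseteq> frontier T1 \<inter> frontier T2) \<or>
              (\<exists>T\<in>Th. F \<subseteq> frontier T \<inter> frontier \<Omega>)"
  using mesh by (auto simp: regular_convex_mesh_def)

lemma T_disjoint: "T \<in> Th \<Longrightarrow> T' \<in> Th \<Longrightarrow> x \<in> T \<Longrightarrow> x \<in> T' \<Longrightarrow> T = T'"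
  using Th(6) by (auto simp: pairwise_def disjnt_def)

lemma T_subset: assumes "T \<in> Th" shows "T \<subseteq> \<Omega>"
proof -
  have "T \<subseteq> closure \<Omega>" using assms closure_subset[of T] Th(7) by blast
  then have "T \<subseteq> interior (closure \<Omega>)" using Th(2)[OF assms] by (simp add: interior_maximal)
  then show ?thesis using \<Omega> by (simp add: convex_interior_closure interior_open)
qed

lemma F_frontier: "F \<in> Fh \<Longrightarrow> \<exists>T\<in>Th. F \<subseteq> frontier T"
  using Fh(5) by blast

lemma face_Fh: assumes "F \<in> Fh" shows "face F"
proof
  show "planar_face F" using Fh(2)[OF assms] .
  obtain T where "T \<in> Th" "F \<subseteq> frontier T" using F_frontier[OF assms] by blast
  then show "bounded F" using bounded_subset[OF bounded_closure[OF Th(4)]] by (auto simp: frontier_def)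
qed

lemma segment_in:
  assumes "T \<in> Th" "x \<in> closure T" "y \<in> T" "0 < t" "t \<le> 1"
  shows "x + t *\<^sub>R (y - x) \<in> T"
proof -
  have "x - t *\<^sub>R (x - y) \<in> interior T"
    using assms Th(2,3)[OF assms(1)]
    by (intro mem_interior_closure_convex_shrink) (auto simp: interior_open) 
  then have "x - t *\<^sub>R (x - y) \<in> T" using interior_subset by blast
  then show ?thesis by (simp add: algebra_simps)
qed

lemma normal_at:
  assumes "F \<in> Fh" "T \<in> Th" "F \<subseteq> frontier T"
  shows "outward_normal T F = face.N F \<or> outward_normal T F = - face.N F"
    "x \<in> F \<Longrightarrow> y \<in> T \<Longrightarrow> outward_normal T F \<bullet> (y - x) < 0"
    "x \<in> F \<Longrightarrow> outward_normal T F \<bullet> w < 0 \<Longrightarrow> \<exists>e>0. \<forall>t. 0 < t \<and> t < e \<longrightarrow> x + t *\<^sub>R w \<in> T"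
  using face.outward[OF face_Fh[OF assms(1)] Th(2,3,5)[OF assms(2)] assms(3)]
    face.enter[OF face_Fh[OF assms(1)] Th(2,3,5)[OF assms(2)] assms(3)] by blast+

text \<open>An element touching a face point and having a point strictly on the inner side of the face of
  another element would overlap with that element.\<close>

lemma no_overlap:
  assumes F: "F \<in> Fh" "T \<in> Th" "F \<subseteq> frontier T" and x: "x \<in> F"
    and T': "T' \<in> Th" "T' \<noteq> T" "x \<in> closure T'" "y \<in> T'"
  shows "\<not> outward_normal T F \<bullet> (y - x) < 0"
proof
  assume "outward_normal T F \<bullet> (y - x) < 0"
  then obtain e where e: "0 < e" "\<And>t. 0 < t \<and> t < e \<Longrightarrow> x + t *\<^sub>R (y - x) \<in> T"
    using normal_at(3)[OF F x] by blast
  let ?t = "min 1 (e / 2)"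
  have "x + ?t *\<^sub>R (y - x) \<in> T" using e by auto
  moreover have "x + ?t *\<^sub>R (y - x) \<in> T'" using e by (intro segment_in T') auto
  ultimately show False using T_disjoint F(2) T' by blast
qed

lemma opposite_normals:
  assumes F: "F \<in> Fh" "T \<in> Th" "F \<subseteq> frontier T" and T': "T' \<in> Th" "T' \<noteq> T" "F \<subseteq> frontier T'"
  shows "outward_normal T' F = - outward_normal T F"
proof (rule ccontr)
  assume "outward_normal T' F \<noteq> - outward_normal T F"
  then have "outward_normal T' F = outward_normal T F"
    using normal_at(1)[OF F] normal_at(1)[OF F(1) T'(1,3)] by auto
  moreover obtain x where x: "x \<in> F" using face.nonempty[OF face_Fh[OF F(1)]] by blast
  moreover obtain y where y: "y \<in> T'" using Th(5)[OF T'(1)] by blast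
  moreover have "x \<in> closure T'" using x T'(3) by (auto simp: frontier_def)
  ultimately show False
    using no_overlap[OF F x T'(1,2)] normal_at(2)[OF F(1) T'(1,3) x y] by auto
qed

lemma exists_off_plane:
  assumes "F \<in> Fh" "T \<in> Th" shows "\<exists>y\<in>T. face.N F \<bullet> (y - x) \<noteq> 0"
proof -
  interpret face F using assms(1) by (rule face_Fh)
  obtain y where y: "y \<in> T" using Th(5)[OF assms(2)] by blast
  then obtain e where e: "0 < e" "cball y e \<subseteq> T" using Th(2)[OF assms(2)] open_contains_cball by blast
  then have "y + e *\<^sub>R N \<in> T" by (auto intro!: subsetD[OF e(2)] simp: dist_norm)
  moreover have "N \<bullet> (y + e *\<^sub>R N - x) = N \<bullet> (y - x) + e" by (simp add: inner_diff_right inner_add_right)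
  ultimately show ?thesis using y e(1) by (metis add_cancel_right_left less_irrefl)
qed

text \<open>The outward normals of the two neighbours are opposite, so a point off the face plane is
  on the inner side of one of them; a third element containing such a point would overlap with that
  neighbour.\<close>

lemma third_element:
  assumes F: "F \<in> Fh" and T1: "T1 \<in> Th" "F \<subseteq> frontier T1" and T2: "T2 \<in> Th" "F \<subseteq> frontier T2" "T1 \<noteq> T2"
    and T: "T \<in> Th" "x \<in> F" "x \<in> closure T"
  shows "T = T1 \<or> T = T2"
proof (rule ccontr)
  assume "\<not> (T = T1 \<or> T = T2)"
  obtain y where y: "y \<in> T" "face.N F \<bullet> (y - x) \<noteq> 0" using exists_off_plane[OF F T(1)] by blast
  then have "outward_normal T1 F \<bullet> (y - x) \<noteq> 0" using normal_at(1)[OF F T1] by auto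
  moreover have "\<not> outward_normal T1 F \<bullet> (y - x) < 0" "\<not> outward_normal T2 F \<bullet> (y - x) < 0"
    using no_overlap[OF F T1 T(2) T(1) _ T(3) y(1)] no_overlap[OF F T2(1,2) T(2) T(1) _ T(3) y(1)]
      \<open>\<not> (T = T1 \<or> T = T2)\<close> by blast+
  moreover have "outward_normal T2 F = - outward_normal T1 F"
    using opposite_normals[OF F T1 T2(1) _ T2(2)] T2(3) by blast
  ultimately show False by auto
qed

text \<open>On a boundary face the normal of the adjacent element agrees with that of the domain,
  and every element lies on the inner side of the latter.\<close>

lemma boundary_element:
  assumes F: "F \<in> Fh" and T1: "T1 \<in> Th" "F \<subseteq> frontier T1" and b: "F \<subseteq> frontier \<Omega>"
    and T: "T \<in> Th" "x \<in> F" "x \<in> closure T"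
  shows "T = T1"
proof (rule ccontr)
  assume ne: "T \<noteq> T1"
  interpret face F using F by (rule face_Fh)
  note out = outward[OF \<Omega>(1,2,4) b]
  have "outward_normal T1 F = outward_normal \<Omega> F"
  proof (rule ccontr)
    assume "outward_normal T1 F \<noteq> outward_normal \<Omega> F"
    then have e: "outward_normal T1 F = - outward_normal \<Omega> F" using out(3) normal_at(1)[OF F T1] by auto
    obtain z where "z \<in> T1" using Th(5)[OF T1(1)] by blast
    then have "outward_normal T1 F \<bullet> (z - x) < 0" "outward_normal \<Omega> F \<bullet> (z - x) < 0"
      using normal_at(2)[OF F T1 T(2)] out(2)[OF T(2)] T_subset[OF T1(1)] by blast+
    then show False unfolding e by simp
  qed
  moreover obtain y where y: "y \<in> T" using Th(5)[OF T(1)] by blast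
  then have "outward_normal \<Omega> F \<bullet> (y - x) < 0" using out(2)[OF T(2)] T_subset[OF T(1)] by blast
  ultimately show False using no_overlap[OF F T1 T(2) T(1) ne T(3) y] by simp
qed

text \<open>An element that touches a face at one of its points must be a neighbour of that face.
  This yields the covering condition of \<open>element\<close>.\<close>

lemma face_whole:
  assumes "F \<in> Fh" "T \<in> Th" "x \<in> F" "x \<in> frontier T"
  shows "F \<subseteq> frontier T"
proof -
  have x: "x \<in> closure T" using assms(4) by (simp add: frontier_def)
  from Fh(5)[OF assms(1)] show ?thesis
  proof
    assume "\<exists>T1\<in>Th. \<exists>T2\<in>Th. T1 \<noteq> T2 \<and> F \<subseteq> frontier T1 \<inter> frontier T2"
    then show ?thesis using third_element[OF assms(1) _ _ _ _ _ assms(2,3) x] by blast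
  next
    assume "\<exists>T\<in>Th. F \<subseteq> frontier T \<inter> frontier \<Omega>"
    then show ?thesis using boundary_element[OF assms(1) _ _ _ assms(2,3) x] by blast
  qed
qed

lemma element: assumes T: "T \<in> Th" shows "element T (faces_of Fh T) Fh"
proof
  show "DIM('a) = 2 \<or> DIM('a) = 3" by (rule dim)
  show "open T" "convex T" "bounded T" "T \<noteq> {}" using Th T by auto
  show "finite (faces_of Fh T)" "finite Fh" using Fh(1) by (auto simp: faces_of_def)
  show "planar_face F" "F \<subseteq> frontier T" if "F \<in> faces_of Fh T" for F
    using that Fh(2) by (auto simp: faces_of_def)
  show "pairwise disjnt (faces_of Fh T)"
    using Fh(3) by (rule pairwise_subset) (auto simp: faces_of_def)
  show "planar_face G" "bounded G" if "G \<in> Fh" for G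
    using face.planar face.bounded face_Fh[OF that] by auto
  show "frontier T \<subseteq> \<Union>(faces_of Fh T) \<union> (\<Union>G\<in>Fh. closure G - G)"
  proof
    fix x assume x: "x \<in> frontier T"
    then obtain F where F: "F \<in> Fh" "x \<in> closure F" using Fh(4) T by blast
    show "x \<in> \<Union>(faces_of Fh T) \<union> (\<Union>G\<in>Fh. closure G - G)"
    proof (cases "x \<in> F")
      case True
      then have "F \<in> faces_of Fh T" using face_whole[OF F(1) T True x] F(1) by (simp add: faces_of_def)
      then show ?thesis using True by blast
    qed (use F in blast)
  qed
qed

lemma interior_face_pair:
  assumes "F \<in> Fh" "\<not> F \<subseteq> frontier \<Omega>"
  shows "\<exists>T1 T2. T1 \<noteq> T2 \<and> {T \<in> Th. F \<subseteq> frontier T} = {T1, T2} \<and> outward_normal T2 F = - outward_normal T1 F"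
proof -
  obtain T1 T2 where T12: "T1 \<in> Th" "F \<subseteq> frontier T1" "T2 \<in> Th" "F \<subseteq> frontier T2" "T1 \<noteq> T2"
    using Fh(5)[OF assms(1)] assms(2) by blast
  obtain x where x: "x \<in> F" using face.nonempty[OF face_Fh[OF assms(1)]] by blast
  have "T = T1 \<or> T = T2" if "T \<in> Th" "F \<subseteq> frontier T" for T
    using third_element[OF assms(1) T12 that(1) x] that x by (auto simp: frontier_def)
  then have "{T \<in> Th. F \<subseteq> frontier T} = {T1, T2}" using T12 by blast
  then show ?thesis using T12 opposite_normals[OF assms(1) T12(1,2,3) _ T12(4)] by blast
qed

lemma normal_sum:
  assumes "F \<in> Fh" "\<not> F \<subseteq> frontier \<Omega>"
  shows "(\<Sum>T\<in>{T \<in> Th. F \<subseteq> frontier T}. outward_normal T F) = 0"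
proof -
  obtain T1 T2 where T12: "T1 \<noteq> T2" "{T \<in> Th. F \<subseteq> frontier T} = {T1, T2}"
      "outward_normal T2 F = - outward_normal T1 F"
    using interior_face_pair[OF assms] by blast
  show ?thesis unfolding T12(2) using T12(1,3) by simp
qed

lemma diameter_pos: assumes "T \<in> Th" shows "0 < diameter T"
proof -
  obtain x where "x \<in> T" using Th(5)[OF assms] by blast
  then obtain e where e: "0 < e" "cball x e \<subseteq> T" using Th(2)[OF assms] open_contains_cball by blast
  obtain i :: 'a where i: "i \<in> Basis" using nonempty_Basis by blast
  have "x + e *\<^sub>R i \<in> T" "x \<in> T" using e i by (auto intro!: subsetD[OF e(2)] simp: dist_norm)
  then have "dist (x + e *\<^sub>R i) x \<le> diameter T" using Th(4)[OF assms] by (intro diameter_bounded_bound)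
  then show ?thesis using e(1) i by (simp add: dist_norm)
qed

lemma diameter_le: "T \<in> Th \<Longrightarrow> diameter T \<le> mesh_size Th"
  unfolding mesh_size_def using Th(1) by (intro Max_ge) auto

text \<open>A simplex of the submesh inside \<open>T\<close> has inradius at least
  \<open>\<rho>\<close> times its diameter, and that diameter is at least \<open>\<rho>\<close>
  times the one of \<open>T\<close>. The factor one half is there because the inradius is defined as
  a supremum.\<close>

lemma inball: assumes T: "T \<in> Th" shows "\<exists>a. ball a (\<rho>\<^sup>2 * diameter T / 2) \<subseteq> T"
proof -
  obtain \<S> where S: "regular_submesh \<rho> \<Omega> Th Fh \<S>" using mesh by (auto simp: regular_convex_mesh_def)
  then have fin: "finite \<S>" and cov: "\<Union>\<S> = closure \<Omega>" and un: "\<And>S. S \<in> \<S> \<Longrightarrow> \<exists>!T. T \<in> Th \<and> interior S \<subseteq> T"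
    and spx: "\<And>S. S \<in> \<S> \<Longrightarrow> int DIM('a) simplex S"
    and r1: "\<And>S. S \<in> \<S> \<Longrightarrow> \<rho> * diameter S \<le> inradius S"
    and r2: "\<And>S T. S \<in> \<S> \<Longrightarrow> T \<in> Th \<Longrightarrow> interior S \<subseteq> T \<Longrightarrow> \<rho> * diameter T \<le> diameter S"
    by (auto simp: regular_submesh_def triangulation_def)
  \<comment> \<open>Otherwise the open set \<open>T\<close> would lie in the union of the simplex
    boundaries, a null set.\<close>
  have "\<exists>S\<in>\<S>. interior S \<inter> T \<noteq> {}"
  proof (rule ccontr)
    assume no: "\<not> (\<exists>S\<in>\<S>. interior S \<inter> T \<noteq> {})"
    have "negligible (\<Union>S\<in>\<S>. frontier S)"
      using fin spx by (intro negligible_Union) (auto intro: negligible_convex_frontier convex_simplex)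
    moreover have "T \<subseteq> (\<Union>S\<in>\<S>. frontier S)"
    proof
      fix x assume x: "x \<in> T"
      then have "x \<in> closure \<Omega>" using T_subset[OF T] closure_subset by blast
      then obtain s where "s \<in> \<S>" "x \<in> s" using cov by blast
      then show "x \<in> (\<Union>S\<in>\<S>. frontier S)" using x no closure_subset by (fastforce simp: frontier_def)
    qed
    ultimately have "negligible T" by (rule negligible_subset)
    then show False using Th(2,5)[OF T] open_not_negligible by blast
  qed
  then obtain s where s: "s \<in> \<S>" "interior s \<inter> T \<noteq> {}" by blast
  obtain T' where T': "T' \<in> Th" "interior s \<subseteq> T'" using un[OF s(1)] by blast
  then have "T' = T" using s(2) T_disjoint[OF T'(1) T] by blast
  then have sT: "interior s \<subseteq> T" using T' by simp
  let ?r = "\<rho>\<^sup>2 * diameter T"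
  have "\<rho> * (\<rho> * diameter T) \<le> \<rho> * diameter s" using r2[OF s(1) T sT] \<rho> by (intro mult_left_mono) auto
  then have ir: "?r \<le> inradius s" using r1[OF s(1)] by (simp add: power2_eq_square mult.assoc)
  have "?r / 2 < Sup {r. \<exists>x. ball x r \<subseteq> s}"
    using ir diameter_pos[OF T] \<rho> by (simp add: inradius_def) (smt (verit) mult_pos_pos zero_less_power)
  moreover have "{r. \<exists>x. ball x r \<subseteq> s} \<noteq> {}" by (auto intro!: exI[of _ 0])
  ultimately obtain r x where r: "?r / 2 < r" "ball x r \<subseteq> s"
    using less_cSupD[of "{r. \<exists>x. ball x r \<subseteq> s}" "?r / 2"] by blast
  then have "ball x r \<subseteq> interior s" by (simp add: interior_maximal)
  then have "ball x (?r / 2) \<subseteq> T" using r(1) sT by (meson less_imp_le order_trans subset_ball)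
  then show ?thesis by blast
qed

lemma sum_over_elements:
  fixes g :: "'a \<Rightarrow> real"
  assumes "integrable (lebesgue_on \<Omega>) g" "\<And>x. 0 \<le> g x"
  shows "(\<Sum>T\<in>Th. \<integral>x. g x \<partial>lebesgue_on T) \<le> (\<integral>x. g x \<partial>lebesgue_on \<Omega>)"
proof -
  note OL = open_sets_lebesgue[OF \<Omega>(1)] and TL = open_sets_lebesgue[OF Th(2)]
  have i: "integrable lebesgue (\<lambda>x. indicator \<Omega> x * g x)"
    using assms(1) OL by (simp add: integrable_restrict_space)
  have iT: "integrable lebesgue (\<lambda>x. indicator T x * g x)" if "T \<in> Th" for T
  proof -
    have "integrable lebesgue (\<lambda>x. indicator T x *\<^sub>R (indicator \<Omega> x * g x))"
      using i TL[OF that] by (rule integrable_mult_indicator[rotated])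
    also have "(\<lambda>x. indicator T x *\<^sub>R (indicator \<Omega> x * g x)) = (\<lambda>x. indicator T x * g x)"
      using T_subset[OF that] by (auto simp: indicator_def fun_eq_iff)
    finally show ?thesis .
  qed
  have "(\<Sum>T\<in>Th. \<integral>x. g x \<partial>lebesgue_on T) = (\<Sum>T\<in>Th. \<integral>x. indicator T x * g x \<partial>lebesgue)"
    using TL by (intro sum.cong) (auto simp: integral_restrict_space)
  also have "\<dots> = (\<integral>x. (\<Sum>T\<in>Th. indicator T x * g x) \<partial>lebesgue)"
    using iT by (subst Bochner_Integration.integral_sum) auto
  also have "\<dots> \<le> (\<integral>x. indicator \<Omega> x * g x \<partial>lebesgue)"
  proof (rule integral_mono)
    show "integrable lebesgue (\<lambda>x. \<Sum>T\<in>Th. indicator T x * g x)" using iT by auto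
    fix x
    show "(\<Sum>T\<in>Th. indicator T x * g x) \<le> indicator \<Omega> x * g x"
    proof (cases "\<exists>T\<in>Th. x \<in> T")
      case True
      then obtain T where T: "T \<in> Th" "x \<in> T" by blast
      have "(\<Sum>T'\<in>Th. indicator T' x * g x) = (\<Sum>T'\<in>Th. if T' = T then g x else 0)"
        using T T_disjoint by (intro sum.cong) (auto simp: indicator_def)
      then show ?thesis using T Th(1) T_subset by (auto simp: indicator_def)
    next
      case False
      then have "(\<Sum>T'\<in>Th. indicator T' x * g x) = 0" by (intro sum.neutral) auto
      then show ?thesis using assms(2) by (simp add: indicator_def)
    qed
  qed (rule i)
  also have "\<dots> = (\<integral>x. g x \<partial>lebesgue_on \<Omega>)" using OL by (simp add: integral_restrict_space)
  finally show ?thesis .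
qed

lemma broken_inner:
  assumes f: "sqi_on \<Omega> f" and v: "\<And>T. T \<in> Th \<Longrightarrow> smooth (v T)"
  shows "inner_on \<Omega> f (broken_fun Th v) = (\<Sum>T\<in>Th. inner_on T f (v T))"
proof -
  note OL = open_sets_lebesgue[OF \<Omega>(1)] and TL = open_sets_lebesgue[OF Th(2)]
  have iT: "integrable lebesgue (\<lambda>x. indicator T x * (f x * v T x))" if T: "T \<in> Th" for T
  proof -
    have "integrable (lebesgue_on T) (\<lambda>x. f x * v T x)"
      by (rule sqi_mult[OF sqi_subset[OF T_subset[OF T] TL[OF T] OL f] smooth_sqi[OF v[OF T] Th(4)[OF T] TL[OF T]]])
    then show ?thesis using TL[OF T] by (simp add: integrable_restrict_space)
  qed
  have e: "indicator \<Omega> x * (f x * broken_fun Th v x) = (\<Sum>T\<in>Th. indicator T x * (f x * v T x))" for x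
  proof -
    have "indicator \<Omega> x * (f x * broken_fun Th v x) = (\<Sum>T\<in>Th. indicator \<Omega> x * (f x * (indicator T x * v T x)))"
      by (simp add: broken_fun_def sum_distrib_left)
    also have "\<dots> = (\<Sum>T\<in>Th. indicator T x * (f x * v T x))"
      using T_subset by (intro sum.cong) (auto simp: indicator_def)
    finally show ?thesis .
  qed
  have "inner_on \<Omega> f (broken_fun Th v) = (\<integral>x. (\<Sum>T\<in>Th. indicator T x * (f x * v T x)) \<partial>lebesgue)"
    using OL by (simp add: l2_inner_def integral_restrict_space e)
  also have "\<dots> = (\<Sum>T\<in>Th. \<integral>x. indicator T x * (f x * v T x) \<partial>lebesgue)"
    using iT by (subst Bochner_Integration.integral_sum) auto
  also have "\<dots> = (\<Sum>T\<in>Th. inner_on T f (v T))"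
    using TL by (intro sum.cong) (auto simp: l2_inner_def integral_restrict_space)
  finally show ?thesis .
qed

end

section \<open>Square-integrable functions on faces\<close>

definition fsqi :: "'a::euclidean_space set set \<Rightarrow> ('a \<Rightarrow> real) \<Rightarrow> bool" where
  "fsqi Fs g \<longleftrightarrow> (\<forall>F\<in>Fs. face_sqi F g)"

lemma fsqi_comb: "fsqi Fs f \<Longrightarrow> fsqi Fs g \<Longrightarrow> fsqi Fs (\<lambda>x. f x + c * g x)"
  unfolding fsqi_def using sqi_comb[of _ f g c] by simp

lemma fsqi_diff: "fsqi Fs f \<Longrightarrow> fsqi Fs g \<Longrightarrow> fsqi Fs (\<lambda>x. f x - g x)"
  by (simp add: fsqi_def sqi_diff)

lemma faces_inner_comb:
  assumes "fsqi Fs u" "fsqi Fs v" "fsqi Fs w"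
  shows "faces_inner Fs (\<lambda>x. u x + c * v x) w = faces_inner Fs u w + c * faces_inner Fs v w"
proof -
  have "face_inner F (\<lambda>x. u x + c * v x) w = face_inner F u w + c * face_inner F v w"
    if "F \<in> Fs" for F
    using assms that l2_inner_comb[of "face_measure F" u v w c] by (simp add: fsqi_def)
  then show ?thesis by (simp add: faces_inner_def sum.distrib sum_distrib_left)
qed

lemma faces_inner_commute: "faces_inner Fs u v = faces_inner Fs v u"
  by (simp add: faces_inner_def l2_inner_commute)

lemma faces_inner_nonneg: "0 \<le> faces_inner Fs u u"
  by (simp add: faces_inner_def l2_inner_nonneg sum_nonneg)

lemma semi_inner_faces: "semi_inner {g. fsqi Fs g} (\<lambda>u c v x. u x + c * v x) (faces_inner Fs)"
  by unfold_locales (auto simp: fsqi_comb faces_inner_comb faces_inner_nonneg intro: faces_inner_commute)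

lemma faces_norm_nonneg: "0 \<le> faces_norm Fs u"
  by (simp add: faces_norm_def faces_inner_nonneg)

lemma faces_norm_sq: "(faces_norm Fs u)\<^sup>2 = faces_inner Fs u u"
  by (simp add: faces_norm_def faces_inner_nonneg)

lemma faces_cauchy_schwarz: "fsqi Fs u \<Longrightarrow> fsqi Fs v \<Longrightarrow> \<bar>faces_inner Fs u v\<bar> \<le> faces_norm Fs u * faces_norm Fs v"
  unfolding faces_norm_def by (rule semi_inner.cauchy_schwarz[OF semi_inner_faces]) auto

lemma faces_triangle: "fsqi Fs u \<Longrightarrow> fsqi Fs v \<Longrightarrow> faces_norm Fs (\<lambda>x. u x + v x) \<le> faces_norm Fs u + faces_norm Fs v"
  using semi_inner.triangle[OF semi_inner_faces, of u Fs v 1] by (simp add: faces_norm_def)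

lemma faces_triangle_diff: "fsqi Fs u \<Longrightarrow> fsqi Fs v \<Longrightarrow> faces_norm Fs (\<lambda>x. u x - v x) \<le> faces_norm Fs u + faces_norm Fs v"
  using semi_inner.triangle[OF semi_inner_faces, of u Fs v "-1"] by (simp add: faces_norm_def)

lemma faces_norm_minus_commute: "faces_norm Fs (\<lambda>x. u x - v x) = faces_norm Fs (\<lambda>x. v x - u x)"
proof -
  have "(u x - v x) * (u x - v x) = (v x - u x) * (v x - u x)" for x by (simp add: algebra_simps)
  then show ?thesis by (simp add: faces_norm_def faces_inner_def l2_inner_def)
qed

lemma faces_triangle_between:
  assumes "fsqi Fs u" "fsqi Fs v" "fsqi Fs w"
  shows "faces_norm Fs (\<lambda>x. u x - w x) \<le> faces_norm Fs (\<lambda>x. u x - v x) + faces_norm Fs (\<lambda>x. v x - w x)"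
  using faces_triangle[OF fsqi_diff[OF assms(1,2)] fsqi_diff[OF assms(2,3)]] by simp

lemma face_norm_le:
  assumes "finite Fs" "F \<in> Fs" shows "face_norm F u \<le> faces_norm Fs u"
proof -
  have "face_inner F u u \<le> faces_inner Fs u u"
    unfolding faces_inner_def using assms by (intro member_le_sum) (auto simp: l2_inner_nonneg)
  then show ?thesis unfolding l2_norm_def faces_norm_def by simp
qed

lemma faces_norm_mono:
  assumes "finite Gs" "Fs \<subseteq> Gs" shows "faces_norm Fs u \<le> faces_norm Gs u"
  unfolding faces_norm_def faces_inner_def
  using assms by (intro real_sqrt_le_mono sum_mono2) (auto simp: l2_inner_nonneg)

lemma faces_norm_tendsto:
  assumes "finite Fs"
  shows "(\<lambda>n. faces_norm Fs (u n)) \<longlonglongrightarrow> 0 \<longleftrightarrow> (\<forall>F\<in>Fs. (\<lambda>n. face_norm F (u n)) \<longlonglongrightarrow> 0)"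
proof
  assume l: "(\<lambda>n. faces_norm Fs (u n)) \<longlonglongrightarrow> 0"
  show "\<forall>F\<in>Fs. (\<lambda>n. face_norm F (u n)) \<longlonglongrightarrow> 0"
  proof
    fix F assume "F \<in> Fs"
    then have "face_norm F (u n) \<le> faces_norm Fs (u n)" for n by (intro face_norm_le assms)
    then show "(\<lambda>n. face_norm F (u n)) \<longlonglongrightarrow> 0"
      by (intro tendsto_sandwich[OF _ _ tendsto_const l]) (auto simp: l2_norm_nonneg)
  qed
next
  assume "\<forall>F\<in>Fs. (\<lambda>n. face_norm F (u n)) \<longlonglongrightarrow> 0"
  then have "(\<lambda>n. sqrt (\<Sum>F\<in>Fs. (face_norm F (u n))\<^sup>2)) \<longlonglongrightarrow> sqrt (\<Sum>F\<in>Fs. 0\<^sup>2)"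
    by (intro tendsto_intros) auto
  then show "(\<lambda>n. faces_norm Fs (u n)) \<longlonglongrightarrow> 0"
    by (simp add: faces_norm_def faces_inner_def l2_norm_sq)
qed

text \<open>The Riesz--Fischer argument: a subsequence with summable increments converges almost
  everywhere, and Fatou's lemma identifies its limit as the limit in the mean.\<close>

lemma l2_complete:
  fixes p :: "nat \<Rightarrow> 'a \<Rightarrow> real"
  assumes M: "finite_measure M" and p: "\<And>n. sqi M (p n)"
    and C: "\<And>e. 0 < e \<Longrightarrow> \<exists>N. \<forall>m\<ge>N. \<forall>n\<ge>N. l2_norm M (\<lambda>x. p m x - p n x) < e"
  shows "\<exists>g. sqi M g \<and> (\<lambda>n. l2_norm M (\<lambda>x. g x - p n x)) \<longlonglongrightarrow> 0"
proof -
  interpret finite_measure M by fact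
  have pm [measurable]: "p n \<in> borel_measurable M" for n using p by (rule sqi_measurable)
  obtain N where N: "\<And>e m n. 0 < e \<Longrightarrow> m \<ge> N e \<Longrightarrow> n \<ge> N e \<Longrightarrow> l2_norm M (\<lambda>x. p m x - p n x) < e"
    using C by metis
  \<comment> \<open>Strictly increasing indices beyond the Cauchy threshold for
    \<open>(1/2) ^ j\<close>, so that the increments are summable.\<close>
  define r where "r = rec_nat (N 1) (\<lambda>j rj. max (Suc rj) (N ((1/2) ^ Suc j)))"
  have rN: "r j \<ge> N ((1/2) ^ j)" for j by (cases j) (auto simp: r_def)
  have "strict_mono r" by (rule strict_monoI_Suc) (simp add: r_def less_max_iff_disj)
  define s where "s j = p (r j)" for j
  have s: "sqi M (s j)" for j unfolding s_def by (rule p)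
  have sm [measurable]: "s j \<in> borel_measurable M" for j unfolding s_def by measurable
  have step: "l2_norm M (\<lambda>x. s (Suc j) x - s j x) < (1/2) ^ j" for j
  proof -
    have "r (Suc j) \<ge> r j" using \<open>strict_mono r\<close> by (simp add: strict_mono_less_eq)
    then show ?thesis unfolding s_def using rN[of j] by (intro N) auto
  qed
  have one: "sqi M (\<lambda>_. 1 :: real)" by (simp add: sqi_def)
  \<comment> \<open>Cauchy-Schwarz with the constant one turns mean-square increments into
    integrable ones; finiteness of the measure enters here.\<close>
  have L1: "(\<integral>\<^sup>+x. ennreal \<bar>s (Suc j) x - s j x\<bar> \<partial>M) \<le> ennreal (l2_norm M (\<lambda>_. 1 :: real) * (1/2) ^ j)" for j
  proof -
    let ?d = "\<lambda>x. \<bar>s (Suc j) x - s j x\<bar>"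
    have d: "sqi M (\<lambda>x. s (Suc j) x - s j x)" by (intro sqi_diff s)
    have d': "sqi M ?d" using d by (auto simp: sqi_def)
    have "(\<integral>\<^sup>+x. ennreal (?d x) \<partial>M) = ennreal (\<integral>x. ?d x \<partial>M)"
      using sqi_integrable[OF M d'] by (intro nn_integral_eq_integral) auto
    also have "(\<integral>x. ?d x \<partial>M) = l2_inner M (\<lambda>_. 1 :: real) ?d" by (simp add: l2_inner_def)
    also have "\<dots> \<le> l2_norm M (\<lambda>_. 1 :: real) * l2_norm M ?d"
      using l2_cauchy_schwarz[OF one d'] by simp
    also have "l2_norm M ?d = l2_norm M (\<lambda>x. s (Suc j) x - s j x)" by (simp add: l2_norm_def l2_inner_def)
    also have "l2_norm M (\<lambda>_. 1 :: real) * \<dots> \<le> l2_norm M (\<lambda>_. 1 :: real) * (1/2) ^ j"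
      using step[of j] by (intro mult_left_mono) (auto simp: l2_norm_nonneg)
    finally show ?thesis by (simp add: ennreal_leI)
  qed
  have "(\<integral>\<^sup>+x. (\<Sum>j. ennreal \<bar>s (Suc j) x - s j x\<bar>) \<partial>M) = (\<Sum>j. \<integral>\<^sup>+x. ennreal \<bar>s (Suc j) x - s j x\<bar> \<partial>M)"
    by (rule nn_integral_suminf) measurable
  also have "\<dots> \<le> (\<Sum>j. ennreal (l2_norm M (\<lambda>_. 1 :: real) * (1/2) ^ j))"
    by (intro suminf_le L1) auto
  also have "\<dots> = ennreal (\<Sum>j. l2_norm M (\<lambda>_. 1 :: real) * (1/2) ^ j)"
    by (intro suminf_ennreal2 summable_mult summable_geometric) (auto simp: l2_norm_nonneg)
  also have "\<dots> < \<infinity>" by simp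
  finally have "(\<integral>\<^sup>+x. (\<Sum>j. ennreal \<bar>s (Suc j) x - s j x\<bar>) \<partial>M) \<noteq> \<infinity>" by simp
  then have "AE x in M. (\<Sum>j. ennreal \<bar>s (Suc j) x - s j x\<bar>) \<noteq> \<infinity>"
    by (intro nn_integral_PInf_AE) measurable
  then have conv: "AE x in M. convergent (\<lambda>j. s j x)"
  proof eventually_elim
    case (elim x)
    then have "summable (\<lambda>j. \<bar>s (Suc j) x - s j x\<bar>)" by (intro summable_suminf_not_top) auto
    then have "summable (\<lambda>j. s (Suc j) x - s j x)" by (rule summable_rabs_cancel)
    then have "convergent (\<lambda>n. \<Sum>j<n. s (Suc j) x - s j x)" by (simp add: summable_iff_convergent)
    then have "convergent (\<lambda>n. s n x - s 0 x)" unfolding sum_lessThan_telescope[of "\<lambda>j. s j x"] .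
    then have "convergent (\<lambda>n. (s n x - s 0 x) + s 0 x)" by (intro convergent_add convergent_const)
    then show ?case by simp
  qed
  \<comment> \<open>Where the sequence diverges, which is a null set, \<open>lim\<close> has an
    unspecified value.\<close>
  define g where "g x = lim (\<lambda>j. s j x)" for x
  have gm [measurable]: "g \<in> borel_measurable M" unfolding g_def[abs_def] by measurable
  have bound: "(\<integral>\<^sup>+x. ennreal ((g x - p n x)\<^sup>2) \<partial>M) \<le> ennreal (e\<^sup>2)" if e: "0 < e" and n: "n \<ge> N e" for e n
  proof -
    have "(\<integral>\<^sup>+x. ennreal ((g x - p n x)\<^sup>2) \<partial>M) = (\<integral>\<^sup>+x. liminf (\<lambda>j. ennreal ((s j x - p n x)\<^sup>2)) \<partial>M)"
    proof (rule nn_integral_cong_AE)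
      show "AE x in M. ennreal ((g x - p n x)\<^sup>2) = liminf (\<lambda>j. ennreal ((s j x - p n x)\<^sup>2))"
        using conv
      proof eventually_elim
        case (elim x)
        then have "(\<lambda>j. s j x) \<longlonglongrightarrow> g x" unfolding g_def by (simp add: convergent_LIMSEQ_iff)
        then have "(\<lambda>j. ennreal ((s j x - p n x)\<^sup>2)) \<longlonglongrightarrow> ennreal ((g x - p n x)\<^sup>2)"
          by (intro tendsto_ennrealI tendsto_intros)
        then show ?case by (rule lim_imp_Liminf[OF sequentially_bot, symmetric])
      qed
    qed
    also have "\<dots> \<le> liminf (\<lambda>j. \<integral>\<^sup>+x. ennreal ((s j x - p n x)\<^sup>2) \<partial>M)"
      by (rule nn_integral_liminf) measurable
    also have "\<dots> \<le> ennreal (e\<^sup>2)"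
    proof -
      have "(\<integral>\<^sup>+x. ennreal ((s j x - p n x)\<^sup>2) \<partial>M) \<le> ennreal (e\<^sup>2)" if j: "j \<ge> N e" for j
      proof -
        have "r j \<ge> N e" using j seq_suble[OF \<open>strict_mono r\<close>, of j] by linarith
        then have lt: "l2_norm M (\<lambda>x. s j x - p n x) < e" unfolding s_def by (intro N e n)
        show ?thesis
          unfolding l2_norm_nn[OF sqi_diff[OF s p], symmetric]
          using lt by (intro ennreal_leI power_mono) (auto simp: l2_norm_nonneg)
      qed
      then have "\<forall>\<^sub>F j in sequentially. (\<integral>\<^sup>+x. ennreal ((s j x - p n x)\<^sup>2) \<partial>M) \<le> ennreal (e\<^sup>2)"
        by (auto simp: eventually_sequentially)
      then have "liminf (\<lambda>j. \<integral>\<^sup>+x. ennreal ((s j x - p n x)\<^sup>2) \<partial>M) \<le> liminf (\<lambda>j::nat. ennreal (e\<^sup>2))"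
        by (rule Liminf_mono)
      then show ?thesis by (simp add: Liminf_const)
    qed
    finally show ?thesis .
  qed
  have gd: "sqi M (\<lambda>x. g x - p n x) \<and> l2_norm M (\<lambda>x. g x - p n x) \<le> e" if e: "0 < e" and n: "n \<ge> N e" for e n
  proof -
    have "(\<integral>\<^sup>+x. ennreal ((g x - p n x)\<^sup>2) \<partial>M) < \<infinity>" using bound[OF e n] by (auto intro: le_less_trans)
    then have d: "sqi M (\<lambda>x. g x - p n x)"
      by (auto simp: sqi_def integrable_iff_bounded power2_eq_square)
    have "(l2_norm M (\<lambda>x. g x - p n x))\<^sup>2 \<le> e\<^sup>2"
      using bound[OF e n] unfolding l2_norm_nn[OF d, symmetric] by simp
    then have "l2_norm M (\<lambda>x. g x - p n x) \<le> e" by (rule power2_le_imp_le) (use e in simp)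
    then show ?thesis using d by blast
  qed
  have "sqi M (\<lambda>x. (g x - p (N 1) x) + p (N 1) x)" using gd[of 1 "N 1"] p by (intro sqi_add) auto
  moreover have "(\<lambda>n. l2_norm M (\<lambda>x. g x - p n x)) \<longlonglongrightarrow> 0"
  proof (rule LIMSEQ_I)
    fix e :: real assume e: "0 < e"
    have "norm (l2_norm M (\<lambda>x. g x - p n x) - 0) < e" if "n \<ge> N (e / 2)" for n
      using gd[of "e / 2" n] e that l2_norm_nonneg[of M "\<lambda>x. g x - p n x"] by simp
    then show "\<exists>N. \<forall>n\<ge>N. norm (l2_norm M (\<lambda>x. g x - p n x) - 0) < e" by blast
  qed
  ultimately show ?thesis by auto
qed

section \<open>Green's formula and traces on an element\<close>

context element
begin

lemma TL: "T \<in> sets lebesgue"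
  using T(1) by (rule open_sets_lebesgue)

lemma finite_T: "finite_measure (lebesgue_on T)"
  using lmeasurable_open[OF T(3,1)] finite_measure_lebesgue_on by blast

lemma continuous_fsqi: "continuous_on UNIV f \<Longrightarrow> fsqi Fs f"
  unfolding fsqi_def using face.continuous_face_sqi[OF faceI] by blast

lemma smooth_fsqi: "smooth f \<Longrightarrow> fsqi Fs f"
  by (intro continuous_fsqi smooth_continuous)

lemma smooth_T: "smooth f \<Longrightarrow> sqi_on T f"
  by (intro smooth_sqi T TL)

lemma fsqi_face: "fsqi Fs g \<Longrightarrow> F \<in> Fs \<Longrightarrow> face_sqi F g"
  by (simp add: fsqi_def)

lemma green:
  assumes "smooth p" "smooth q" "i \<in> Basis"
  shows "inner_on T (pdiff i p) q + inner_on T p (pdiff i q)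
    = (\<Sum>F\<in>Fs. (nrm F \<bullet> i) * face_inner F p q)"
proof -
  have "(\<integral>x. grad (\<lambda>x. p x * q x) x \<bullet> i \<partial>lebesgue_on T) = (\<integral>x. pdiff i p x * q x + p x * pdiff i q x \<partial>lebesgue_on T)"
    using assms by (simp add: grad_inner pdiff_mult smooth_differentiable)
  also have "\<dots> = (\<integral>x. pdiff i p x * q x \<partial>lebesgue_on T) + (\<integral>x. p x * pdiff i q x \<partial>lebesgue_on T)"
    using assms by (intro Bochner_Integration.integral_add sqi_mult smooth_T smooth_pdiff) 
  finally show ?thesis
    using divergence[OF smooth_mult[OF assms(1,2)], of i] by (simp add: l2_inner_def)
qed

lemma trace_limit:
  assumes tr: "is_trace T Fs v g" and v: "sqi_on T v" and w: "\<And>i. i \<in> Basis \<Longrightarrow> weakly T {#i#} v (w i)"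
  obtains \<phi> where "\<And>n. smooth (\<phi> n)"
    "(\<lambda>n. norm_on T (\<lambda>x. v x - \<phi> n x)) \<longlonglongrightarrow> 0"
    "\<And>i. i \<in> Basis \<Longrightarrow> (\<lambda>n. norm_on T (\<lambda>x. w i x - pdiff i (\<phi> n) x)) \<longlonglongrightarrow> 0"
    "(\<lambda>n. faces_norm Fs (\<lambda>x. g x - \<phi> n x)) \<longlonglongrightarrow> 0"
proof -
  obtain \<phi> :: "nat \<Rightarrow> 'a \<Rightarrow> real" where \<phi>: "\<And>n. smooth (\<phi> n)" "(\<lambda>n. sobolev_norm 1 T (\<lambda>x. v x - \<phi> n x)) \<longlonglongrightarrow> 0"
    "(\<lambda>n. faces_norm Fs (\<lambda>x. g x - \<phi> n x)) \<longlonglongrightarrow> 0"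
    using tr unfolding is_trace_def by blast
  have "(\<lambda>n. norm_on T (\<lambda>x. v x - \<phi> n x)) \<longlonglongrightarrow> 0 \<and>
     (\<forall>i\<in>Basis. (\<lambda>n. norm_on T (\<lambda>x. w i x - pdiff i (\<phi> n) x)) \<longlonglongrightarrow> 0)"
    by (rule sobolev_norm_1_tendsto[OF T(1,3) v w \<phi>(1), THEN iffD1]) (auto simp: \<phi>(2)[unfolded One_nat_def])
  then show ?thesis using \<phi> by (intro that[of \<phi>]) auto
qed

lemma trace_fsqi: "is_trace T Fs v g \<Longrightarrow> fsqi Fs g"
  by (simp add: is_trace_def fsqi_def sq_integrable_eq_sqi)

text \<open>Green's formula for smooth functions, passed to the limit along the sequence that
  defines the trace: the volume terms converge by the H^1 norm, the face terms by the face
  norm.\<close>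

lemma green_trace:
  assumes tr: "is_trace T Fs v g" and v: "sqi_on T v" and w: "\<And>i. i \<in> Basis \<Longrightarrow> weakly T {#i#} v (w i)"
    and q: "smooth q" and i: "i \<in> Basis"
  shows "inner_on T (w i) q + inner_on T v (pdiff i q)
    = (\<Sum>F\<in>Fs. (nrm F \<bullet> i) * face_inner F g q)"
proof -
  obtain \<phi> where \<phi>: "\<And>n. smooth (\<phi> n)"
    "(\<lambda>n. norm_on T (\<lambda>x. v x - \<phi> n x)) \<longlonglongrightarrow> 0"
    "\<And>i. i \<in> Basis \<Longrightarrow> (\<lambda>n. norm_on T (\<lambda>x. w i x - pdiff i (\<phi> n) x)) \<longlonglongrightarrow> 0"
    "(\<lambda>n. faces_norm Fs (\<lambda>x. g x - \<phi> n x)) \<longlonglongrightarrow> 0"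
    using trace_limit[OF tr v w] by blast
  have "(\<lambda>n. inner_on T (pdiff i (\<phi> n)) q + inner_on T (\<phi> n) (pdiff i q))
    \<longlonglongrightarrow> inner_on T (w i) q + inner_on T v (pdiff i q)"
    by (intro tendsto_add l2_inner_continuous \<phi> v weakly_sqi[OF w] i smooth_T smooth_pdiff q)
  moreover have "(\<lambda>n. \<Sum>F\<in>Fs. (nrm F \<bullet> i) * face_inner F (\<phi> n) q)
    \<longlonglongrightarrow> (\<Sum>F\<in>Fs. (nrm F \<bullet> i) * face_inner F g q)"
    using \<phi>(4) unfolding faces_norm_tendsto[OF Fs(1)]
    by (intro tendsto_sum tendsto_mult tendsto_const l2_inner_continuous) (auto intro!: fsqi_face[OF trace_fsqi[OF tr]] fsqi_face[OF smooth_fsqi] \<phi>(1) q)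
  ultimately show ?thesis unfolding green[OF \<phi>(1) q i] by (rule LIMSEQ_unique)
qed

text \<open>The ball contains \<open>a + s *\<^sub>R nrm F\<close> for every nonnegative
  \<open>s\<close> below \<open>r\<close>, and that point lies strictly behind the face plane. This
  positivity lets the radial field control the whole boundary.\<close>

lemma support_height:
  assumes "ball a r \<subseteq> T" "F \<in> Fs" "x \<in> F" "0 < r"
  shows "r \<le> nrm F \<bullet> (x - a)"
proof (rule dense_le)
  fix s assume "s < r"
  show "s \<le> nrm F \<bullet> (x - a)"
  proof (cases "0 \<le> s")
    case True
    then have "a + s *\<^sub>R nrm F \<in> T"
      using \<open>s < r\<close> norm_nrm[OF assms(2)] by (intro subsetD[OF assms(1)]) (simp add: dist_norm)
    then have "nrm F \<bullet> (a + s *\<^sub>R nrm F - x) < 0" using nrm_neg assms by blast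
    moreover have "nrm F \<bullet> nrm F = 1" using norm_nrm[OF assms(2)] unfolding norm_eq_1 .
    ultimately show ?thesis by (simp add: inner_diff_right inner_add_right)
  next
    case False
    have "a \<in> T" using assms by auto
    then have "nrm F \<bullet> (a - x) < 0" using nrm_neg assms by blast
    then show ?thesis using False by (simp add: inner_diff_right)
  qed
qed

text \<open>The divergence theorem for the field \<open>x - a\<close> times \<open>u\<close>,
  applied to one Cartesian component at a time.\<close>

lemma radial_divergence:
  assumes u: "smooth u"
  shows "(\<integral>x. real DIM('a) * u x + (x - a) \<bullet> grad u x \<partial>lebesgue_on T)
    = (\<Sum>F\<in>Fs. \<integral>x. (nrm F \<bullet> (x - a)) * u x \<partial>face_measure F)"
proof -
  have co: "smooth (\<lambda>x. (x - a) \<bullet> i)" for i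
    by (simp add: inner_diff_left smooth_diff smooth_inner_const smooth_const)
  have pco: "pdiff j (\<lambda>x. (x - a) \<bullet> i) x = j \<bullet> i" for i j x
    by (simp add: inner_diff_left pdiff_diff pdiff_inner_const smooth_differentiable smooth_inner_const smooth_const)
  have sm: "smooth (\<lambda>x. ((x - a) \<bullet> i) * u x)" for i by (intro smooth_mult co u)
  have iT: "integrable (lebesgue_on T) f" if "smooth f" for f
    by (intro sqi_integrable[OF finite_T] smooth_T that)
  have iF: "integrable (face_measure F) f" if "F \<in> Fs" "smooth f" for F f
    by (intro sqi_integrable[OF face.finite_face[OF faceI[OF that(1)]]] fsqi_face[OF smooth_fsqi] that)
  have "(\<integral>x. real DIM('a) * u x + (x - a) \<bullet> grad u x \<partial>lebesgue_on T)
      = (\<integral>x. (\<Sum>i\<in>Basis. pdiff i (\<lambda>x. ((x - a) \<bullet> i) * u x) x) \<partial>lebesgue_on T)"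
  proof (rule Bochner_Integration.integral_cong[OF refl])
    fix x
    have "(\<Sum>i\<in>Basis. pdiff i (\<lambda>x. ((x - a) \<bullet> i) * u x) x) = (\<Sum>i\<in>Basis. u x + ((x - a) \<bullet> i) * (grad u x \<bullet> i))"
      using co u by (intro sum.cong) (simp_all add: pdiff_mult smooth_differentiable pco grad_inner)
    also have "\<dots> = real DIM('a) * u x + (x - a) \<bullet> grad u x"
      unfolding euclidean_inner[of "x - a" "grad u x"] by (simp add: sum.distrib)
    finally show "real DIM('a) * u x + (x - a) \<bullet> grad u x = (\<Sum>i\<in>Basis. pdiff i (\<lambda>x. ((x - a) \<bullet> i) * u x) x)" by simp
  qed
  also have "\<dots> = (\<Sum>i\<in>Basis. \<integral>x. pdiff i (\<lambda>x. ((x - a) \<bullet> i) * u x) x \<partial>lebesgue_on T)"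
    by (rule Bochner_Integration.integral_sum) (intro iT smooth_pdiff sm)
  also have "\<dots> = (\<Sum>i\<in>Basis. \<Sum>F\<in>Fs. (nrm F \<bullet> i) * (\<integral>x. ((x - a) \<bullet> i) * u x \<partial>face_measure F))"
    unfolding divergence[OF sm, symmetric] by (intro sum.cong refl) (simp add: grad_inner)
  also have "\<dots> = (\<Sum>F\<in>Fs. \<Sum>i\<in>Basis. \<integral>x. (nrm F \<bullet> i) * (((x - a) \<bullet> i) * u x) \<partial>face_measure F)"
    by (subst sum.swap) simp
  also have "\<dots> = (\<Sum>F\<in>Fs. \<integral>x. (\<Sum>i\<in>Basis. (nrm F \<bullet> i) * (((x - a) \<bullet> i) * u x)) \<partial>face_measure F)"
    by (intro sum.cong refl Bochner_Integration.integral_sum[symmetric]) (intro integrable_mult_right iF sm)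
  also have "\<dots> = (\<Sum>F\<in>Fs. \<integral>x. (nrm F \<bullet> (x - a)) * u x \<partial>face_measure F)"
    unfolding euclidean_inner[of "nrm _" "_ - a"] by (simp add: sum_distrib_right mult.assoc)
  finally show ?thesis .
qed

lemma boundary_le_radial:
  assumes r: "0 < r" "ball a r \<subseteq> T" and u: "smooth u" "\<And>x. 0 \<le> u x"
  shows "r * (\<Sum>F\<in>Fs. \<integral>x. u x \<partial>face_measure F) \<le> (\<Sum>F\<in>Fs. \<integral>x. (nrm F \<bullet> (x - a)) * u x \<partial>face_measure F)"
  unfolding sum_distrib_left
proof (rule sum_mono)
  fix F assume F: "F \<in> Fs"
  interpret f: face F using F by (rule faceI)
  have lin: "smooth (\<lambda>x. nrm F \<bullet> (x - a))"
    using smooth_linear[of "nrm F" "- (nrm F \<bullet> a)"] by (simp add: inner_diff_right)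
  have i: "integrable (face_measure F) h" if "smooth h" for h
    by (intro sqi_integrable[OF f.finite_face] fsqi_face[OF smooth_fsqi] that F)
  have "r * (\<integral>x. u x \<partial>face_measure F) = (\<integral>x. r * u x \<partial>face_measure F)" by simp
  also have "\<dots> \<le> (\<integral>x. (nrm F \<bullet> (x - a)) * u x \<partial>face_measure F)"
  proof (rule integral_mono)
    fix x assume "x \<in> space (face_measure F)"
    then show "r * u x \<le> (nrm F \<bullet> (x - a)) * u x"
      using support_height[OF r(2) F _ r(1)] u(2) by (intro mult_right_mono) auto
  qed (intro i smooth_mult lin u smooth_const)+
  finally show "r * (\<integral>x. u x \<partial>face_measure F) \<le> (\<integral>x. (nrm F \<bullet> (x - a)) * u x \<partial>face_measure F)" .
qed

text \<open>Radial divergence applied to the square of \<open>\<phi>\<close>. The constant may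
  depend on the element, because the inequality only serves existence and uniqueness of traces and
  never enters the error bound.\<close>

lemma trace_inequality:
  "\<exists>C\<ge>0. \<forall>\<phi>. smooth \<phi> \<longrightarrow> faces_norm Fs \<phi> \<le> C * (norm_on T \<phi> + (\<Sum>i\<in>Basis. norm_on T (pdiff i \<phi>)))"
proof -
  obtain a where a: "a \<in> T" using T(4) by blast
  then obtain r where r: "0 < r" "ball a r \<subseteq> T" using T(1) openE by blast
  obtain R where R: "0 < R" "\<And>x. x \<in> T \<Longrightarrow> norm x \<le> R" using T(3) by (auto simp: bounded_pos)
  define C where "C = (real DIM('a) + 4 * R) / r"
  have C: "0 \<le> C" using r R by (simp add: C_def)
  have "faces_norm Fs \<phi> \<le> sqrt C * (norm_on T \<phi> + (\<Sum>i\<in>Basis. norm_on T (pdiff i \<phi>)))"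
    if \<phi>: "smooth \<phi>" for \<phi>
  proof -
    let ?n = "norm_on T \<phi>" and ?g = "\<lambda>i. norm_on T (pdiff i \<phi>)"
    let ?G = "\<Sum>i\<in>Basis. ?g i"
    have G0: "0 \<le> ?G" by (intro sum_nonneg l2_norm_nonneg)
    have sm2: "smooth (\<lambda>x. \<phi> x * \<phi> x)" using \<phi> by (intro smooth_mult)
    have lin: "smooth (\<lambda>x. (x - a) \<bullet> i)" for i
      by (simp add: inner_diff_left smooth_diff smooth_inner_const smooth_const)
    have iT: "integrable (lebesgue_on T) f" if "smooth f" for f
      by (intro sqi_integrable[OF finite_T] smooth_T that)
    have "r * (faces_norm Fs \<phi>)\<^sup>2 = r * (\<Sum>F\<in>Fs. \<integral>x. \<phi> x * \<phi> x \<partial>face_measure F)"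
      by (simp add: faces_norm_sq faces_inner_def l2_inner_def)
    also have "\<dots> \<le> (\<integral>x. real DIM('a) * (\<phi> x * \<phi> x) + (x - a) \<bullet> grad (\<lambda>x. \<phi> x * \<phi> x) x \<partial>lebesgue_on T)"
      unfolding radial_divergence[OF sm2] by (intro boundary_le_radial r sm2) (use r in auto)
    also have "\<dots> = (\<integral>x. real DIM('a) * (\<phi> x * \<phi> x) + (\<Sum>i\<in>Basis. 2 * (\<phi> x * (((x - a) \<bullet> i) * pdiff i \<phi> x))) \<partial>lebesgue_on T)"
    proof (rule Bochner_Integration.integral_cong[OF refl])
      fix x
      have "(x - a) \<bullet> grad (\<lambda>x. \<phi> x * \<phi> x) x = (\<Sum>i\<in>Basis. ((x - a) \<bullet> i) * (pdiff i \<phi> x * \<phi> x + \<phi> x * pdiff i \<phi> x))"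
        using \<phi> by (subst euclidean_inner) (simp add: grad_inner pdiff_mult smooth_differentiable)
      then show "real DIM('a) * (\<phi> x * \<phi> x) + (x - a) \<bullet> grad (\<lambda>x. \<phi> x * \<phi> x) x
          = real DIM('a) * (\<phi> x * \<phi> x) + (\<Sum>i\<in>Basis. 2 * (\<phi> x * (((x - a) \<bullet> i) * pdiff i \<phi> x)))"
        by (simp add: algebra_simps)
    qed
    also have "\<dots> = real DIM('a) * ?n\<^sup>2 + (\<Sum>i\<in>Basis. 2 * inner_on T \<phi> (\<lambda>x. ((x - a) \<bullet> i) * pdiff i \<phi> x))"
      unfolding l2_norm_sq l2_inner_def
      by (subst Bochner_Integration.integral_add, (intro iT smooth_mult smooth_const \<phi> smooth_sum lin smooth_pdiff; simp)+)
         (subst Bochner_Integration.integral_sum, (intro iT smooth_mult smooth_const \<phi> lin smooth_pdiff; simp)+, simp)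
    also have "\<dots> \<le> real DIM('a) * ?n\<^sup>2 + (\<Sum>i\<in>Basis. 2 * (?n * (2 * R * ?g i)))"
    proof (intro add_left_mono sum_mono mult_left_mono)
      fix i :: 'a assume i: "i \<in> Basis"
      have "inner_on T \<phi> (\<lambda>x. ((x - a) \<bullet> i) * pdiff i \<phi> x) \<le> ?n * norm_on T (\<lambda>x. ((x - a) \<bullet> i) * pdiff i \<phi> x)"
        using l2_cauchy_schwarz[OF smooth_T smooth_T, of \<phi> "\<lambda>x. ((x - a) \<bullet> i) * pdiff i \<phi> x"] \<phi> lin smooth_pdiff[OF \<phi> i] smooth_mult by fastforce
      also have "norm_on T (\<lambda>x. ((x - a) \<bullet> i) * pdiff i \<phi> x) \<le> 2 * R * ?g i"
      proof -
        have "inner_on T (\<lambda>x. ((x - a) \<bullet> i) * pdiff i \<phi> x) (\<lambda>x. ((x - a) \<bullet> i) * pdiff i \<phi> x)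
            \<le> (\<integral>x. (2 * R)\<^sup>2 * (pdiff i \<phi> x * pdiff i \<phi> x) \<partial>lebesgue_on T)"
          unfolding l2_inner_def
        proof (rule integral_mono)
          fix x assume "x \<in> space (lebesgue_on T)"
          then have "x \<in> T" using TL by (simp add: space_restrict_space)
          then have "norm (x - a) \<le> 2 * R" using R(2)[of x] R(2)[OF a] norm_triangle_ineq4[of x a] by linarith
          then have "\<bar>(x - a) \<bullet> i\<bar> \<le> 2 * R" using Basis_le_norm[OF i, of "x - a"] by linarith
          then have "((x - a) \<bullet> i)\<^sup>2 \<le> (2 * R)\<^sup>2" using R(1) by (metis abs_ge_zero power2_abs power_mono)
          then have "((x - a) \<bullet> i)\<^sup>2 * (pdiff i \<phi> x * pdiff i \<phi> x) \<le> (2 * R)\<^sup>2 * (pdiff i \<phi> x * pdiff i \<phi> x)"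
            by (intro mult_right_mono) auto
          then show "(((x - a) \<bullet> i) * pdiff i \<phi> x) \<bullet> (((x - a) \<bullet> i) * pdiff i \<phi> x) \<le> (2 * R)\<^sup>2 * (pdiff i \<phi> x * pdiff i \<phi> x)"
            by (simp add: power2_eq_square mult_ac)
        qed (unfold inner_real_def, (intro iT smooth_mult lin smooth_pdiff \<phi> i smooth_const)+)
        also have "\<dots> = (2 * R * ?g i)\<^sup>2"
          by (simp add: power_mult_distrib l2_norm_sq l2_inner_def)
        finally have "(norm_on T (\<lambda>x. ((x - a) \<bullet> i) * pdiff i \<phi> x))\<^sup>2 \<le> (2 * R * ?g i)\<^sup>2"
          by (simp add: l2_norm_sq)
        then show ?thesis by (rule power2_le_imp_le) (use R(1) in \<open>simp add: l2_norm_nonneg\<close>)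
      qed
      finally show "inner_on T \<phi> (\<lambda>x. ((x - a) \<bullet> i) * pdiff i \<phi> x) \<le> ?n * (2 * R * ?g i)"
        by (simp add: mult_left_mono l2_norm_nonneg)
    qed simp
    also have "\<dots> = real DIM('a) * ?n\<^sup>2 + 4 * R * (?n * ?G)"
      by (simp add: sum_distrib_left mult_ac)
    also have "\<dots> \<le> (real DIM('a) + 4 * R) * (?n + ?G)\<^sup>2"
    proof -
      have "?n\<^sup>2 \<le> (?n + ?G)\<^sup>2" using G0 by (intro power_mono) (auto simp: l2_norm_nonneg)
      moreover have "?n * ?G \<le> (?n + ?G)\<^sup>2"
        using G0 l2_norm_nonneg[of "lebesgue_on T" \<phi>] by (simp add: power2_sum)
      ultimately have "real DIM('a) * ?n\<^sup>2 \<le> real DIM('a) * (?n + ?G)\<^sup>2" "4 * R * (?n * ?G) \<le> 4 * R * (?n + ?G)\<^sup>2"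
        using R(1) by (auto intro!: mult_left_mono)
      then show ?thesis unfolding distrib_right by (rule add_mono)
    qed
    finally have "(faces_norm Fs \<phi>)\<^sup>2 \<le> C * (?n + ?G)\<^sup>2"
      using r(1) by (simp add: C_def field_simps)
    also have "\<dots> = (sqrt C * (?n + ?G))\<^sup>2" using C by (simp add: power_mult_distrib)
    finally show ?thesis
      by (rule power2_le_imp_le) (use C G0 in \<open>simp add: l2_norm_nonneg\<close>)
  qed
  then show ?thesis using C by (intro exI[of _ "sqrt C"]) auto
qed

text \<open>One bound with two uses: for a single sequence it shows that the face restrictions are
  Cauchy, for two sequences it shows that they share their limit.\<close>

lemma trace_difference:
  assumes v: "sqi_on T v" and w: "\<And>i. i \<in> Basis \<Longrightarrow> sqi_on T (w i)"
  shows "\<exists>C\<ge>0. \<forall>\<phi> u. smooth \<phi> \<longrightarrow> smooth u \<longrightarrow> faces_norm Fs (\<lambda>x. \<phi> x - u x) \<le>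
    C * ((norm_on T (\<lambda>x. v x - \<phi> x) + (\<Sum>i\<in>Basis. norm_on T (\<lambda>x. w i x - pdiff i \<phi> x))) +
         (norm_on T (\<lambda>x. v x - u x) + (\<Sum>i\<in>Basis. norm_on T (\<lambda>x. w i x - pdiff i u x))))"
proof -
  let ?N = "norm_on T"
  obtain C where C: "0 \<le> C" "\<And>\<phi>. smooth \<phi> \<Longrightarrow> faces_norm Fs \<phi> \<le> C * (?N \<phi> + (\<Sum>i\<in>Basis. ?N (pdiff i \<phi>)))"
    using trace_inequality by blast
  have tri: "?N (\<lambda>x. p x - p' x) \<le> ?N (\<lambda>x. z x - p x) + ?N (\<lambda>x. z x - p' x)"
    if "sqi_on T z" "sqi_on T p" "sqi_on T p'" for z p p' :: "'a \<Rightarrow> real"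
    using l2_triangle_between[OF that(2,1,3)] l2_norm_minus_commute[of "lebesgue_on T" p z] by linarith
  have "faces_norm Fs (\<lambda>x. \<phi> x - u x) \<le> C * ((?N (\<lambda>x. v x - \<phi> x) + (\<Sum>i\<in>Basis. ?N (\<lambda>x. w i x - pdiff i \<phi> x))) +
         (?N (\<lambda>x. v x - u x) + (\<Sum>i\<in>Basis. ?N (\<lambda>x. w i x - pdiff i u x))))"
    if \<phi>: "smooth \<phi>" and u: "smooth u" for \<phi> u
  proof -
    have "?N (pdiff i (\<lambda>x. \<phi> x - u x)) \<le> ?N (\<lambda>x. w i x - pdiff i \<phi> x) + ?N (\<lambda>x. w i x - pdiff i u x)" if i: "i \<in> Basis" for i
    proof -
      have "pdiff i (\<lambda>x. \<phi> x - u x) = (\<lambda>x. pdiff i \<phi> x - pdiff i u x)"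
        using \<phi> u by (auto simp: pdiff_diff)
      then show ?thesis using tri[OF w[OF i] smooth_T[OF smooth_pdiff[OF \<phi> i]] smooth_T[OF smooth_pdiff[OF u i]]] by simp
    qed
    then have "(\<Sum>i\<in>Basis. ?N (pdiff i (\<lambda>x. \<phi> x - u x))) \<le> (\<Sum>i\<in>Basis. ?N (\<lambda>x. w i x - pdiff i \<phi> x) + ?N (\<lambda>x. w i x - pdiff i u x))"
      by (rule sum_mono)
    with tri[OF v smooth_T[OF \<phi>] smooth_T[OF u]] have "C * (?N (\<lambda>x. \<phi> x - u x) + (\<Sum>i\<in>Basis. ?N (pdiff i (\<lambda>x. \<phi> x - u x))))
      \<le> C * ((?N (\<lambda>x. v x - \<phi> x) + (\<Sum>i\<in>Basis. ?N (\<lambda>x. w i x - pdiff i \<phi> x))) +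
         (?N (\<lambda>x. v x - u x) + (\<Sum>i\<in>Basis. ?N (\<lambda>x. w i x - pdiff i u x))))"
      unfolding sum.distrib by (intro mult_left_mono C(1)) linarith
    then show ?thesis using C(2)[OF smooth_diff[OF \<phi> u]] by linarith
  qed
  then show ?thesis using C(1) by blast
qed

lemma trace_unique:
  assumes tr: "is_trace T Fs v g" "is_trace T Fs v g'" and v: "sqi_on T v" and w: "\<And>i. i \<in> Basis \<Longrightarrow> weakly T {#i#} v (w i)"
  shows "faces_norm Fs (\<lambda>x. g x - g' x) = 0"
proof -
  let ?N = "norm_on T"
  obtain \<phi> where \<phi>: "\<And>n. smooth (\<phi> n)" "(\<lambda>n. ?N (\<lambda>x. v x - \<phi> n x)) \<longlonglongrightarrow> 0"
    "\<And>i. i \<in> Basis \<Longrightarrow> (\<lambda>n. ?N (\<lambda>x. w i x - pdiff i (\<phi> n) x)) \<longlonglongrightarrow> 0"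
    "(\<lambda>n. faces_norm Fs (\<lambda>x. g x - \<phi> n x)) \<longlonglongrightarrow> 0"
    using trace_limit[OF tr(1) v w] by blast
  obtain u where u: "\<And>n. smooth (u n)" "(\<lambda>n. ?N (\<lambda>x. v x - u n x)) \<longlonglongrightarrow> 0"
    "\<And>i. i \<in> Basis \<Longrightarrow> (\<lambda>n. ?N (\<lambda>x. w i x - pdiff i (u n) x)) \<longlonglongrightarrow> 0"
    "(\<lambda>n. faces_norm Fs (\<lambda>x. g' x - u n x)) \<longlonglongrightarrow> 0"
    using trace_limit[OF tr(2) v w] by blast
  define d where "d f = ?N (\<lambda>x. v x - f x) + (\<Sum>i\<in>Basis. ?N (\<lambda>x. w i x - pdiff i f x))" for f
  obtain C where C: "0 \<le> C" "\<And>\<phi> u. smooth \<phi> \<Longrightarrow> smooth u \<Longrightarrow> faces_norm Fs (\<lambda>x. \<phi> x - u x) \<le> C * (d \<phi> + d u)"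
    using trace_difference[where w = w, OF v weakly_sqi[OF w]] unfolding d_def by force
  define b where "b n = faces_norm Fs (\<lambda>x. g x - \<phi> n x) + (C * (d (\<phi> n) + d (u n)) + faces_norm Fs (\<lambda>x. g' x - u n x))" for n
  have "faces_norm Fs (\<lambda>x. g x - g' x) \<le> b n" for n
  proof -
    note s = trace_fsqi[OF tr(1)] trace_fsqi[OF tr(2)] smooth_fsqi[OF \<phi>(1)] smooth_fsqi[OF u(1)]
    show ?thesis
      unfolding b_def using faces_triangle_between[OF s(1) s(3) s(2), of n] faces_triangle_between[OF s(3) s(4) s(2), of n n]
        faces_norm_minus_commute[of Fs g' "u n"] C(2)[OF \<phi>(1) u(1), of n n] by linarith
  qed
  moreover have "b \<longlonglongrightarrow> 0 + (C * ((0 + (\<Sum>i\<in>(Basis :: 'a set). 0)) + (0 + (\<Sum>i\<in>(Basis :: 'a set). 0))) + 0)"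
    unfolding b_def d_def by (intro tendsto_add tendsto_mult tendsto_const tendsto_sum \<phi> u)
  ultimately have "faces_norm Fs (\<lambda>x. g x - g' x) \<le> 0"
    by (intro tendsto_lowerbound[of b]) auto
  then show ?thesis using faces_norm_nonneg[of Fs "\<lambda>x. g x - g' x"] by simp
qed

text \<open>\<open>trace_on\<close> is an arbitrary trace; by uniqueness up to norm zero it may be
  replaced by any trace at hand.\<close>

lemma trace_on_norm:
  assumes tr: "is_trace T Fs v g" and v: "sqi_on T v" and w: "\<And>i. i \<in> Basis \<Longrightarrow> weakly T {#i#} v (w i)"
    and p: "fsqi Fs p"
  shows "faces_norm Fs (\<lambda>x. trace_on T Fs v x - p x) = faces_norm Fs (\<lambda>x. g x - p x)"
proof -
  have t: "is_trace T Fs v (trace_on T Fs v)"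
    unfolding trace_on_def by (rule someI[of "is_trace T Fs v", OF tr])
  have s: "fsqi Fs g" "fsqi Fs (trace_on T Fs v)" using trace_fsqi tr t by blast+
  show ?thesis
    using faces_triangle_between[OF s(1) s(2) p] faces_triangle_between[OF s(2) s(1) p]
      trace_unique[OF tr t v w] trace_unique[OF t tr v w] by linarith
qed

lemma smooth_trace:
  assumes p: "smooth p" shows "is_trace T Fs p p"
proof -
  have "sobolev_norm 1 T (\<lambda>x. p x - p x) = 0"
    using sobolev_norm_1_diff[OF T(1,3) smooth_T[OF p] weakly_smooth[OF T(1,3) p] p]
    by (simp add: l2_norm_def l2_inner_def)
  moreover have "faces_norm Fs (\<lambda>x. p x - p x) = 0" by (simp add: faces_norm_def faces_inner_def l2_inner_def)
  ultimately show ?thesis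
    unfolding is_trace_def sq_integrable_eq_sqi using smooth_fsqi[OF p] p
    by (auto simp: fsqi_def intro!: exI[of _ "\<lambda>_. p"])
qed

end

section \<open>Traces on the mesh\<close>

lemma l2_norm_subset:
  fixes f :: "'a::euclidean_space \<Rightarrow> 'b::euclidean_space"
  assumes T: "T \<subseteq> D" "T \<in> sets lebesgue" "D \<in> sets lebesgue" and f: "sqi_on D f"
  shows "norm_on T f \<le> norm_on D f"
proof -
  have i: "integrable lebesgue (\<lambda>x. indicator T x *\<^sub>R (f x \<bullet> f x))" "integrable lebesgue (\<lambda>x. indicator D x *\<^sub>R (f x \<bullet> f x))"
    using sqi_subset[OF T f] f T by (simp_all add: sqi_def integrable_restrict_space)
  have "(\<integral>x. f x \<bullet> f x \<partial>lebesgue_on T) \<le> (\<integral>x. f x \<bullet> f x \<partial>lebesgue_on D)"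
    using T integral_mono[OF i] by (force simp: integral_restrict_space indicator_def)
  then show ?thesis by (simp add: l2_norm_def l2_inner_def)
qed

context mesh
begin

lemma \<Omega>L: "\<Omega> \<in> sets lebesgue"
  using \<Omega>(1) by (rule open_sets_lebesgue)

lemma TL: "T \<in> Th \<Longrightarrow> T \<in> sets lebesgue"
  using Th(2) by (rule open_sets_lebesgue)

lemma sqi_T: "sqi_on \<Omega> f \<Longrightarrow> T \<in> Th \<Longrightarrow> sqi_on T f"
  using sqi_subset[OF T_subset TL \<Omega>L] .

lemma weakly_T: "weakly \<Omega> A v g \<Longrightarrow> T \<in> Th \<Longrightarrow> set_mset A \<subseteq> Basis \<Longrightarrow> weakly T A v g"
  using weakly_subset[OF T_subset Th(2) \<Omega>(1)] .

lemma sobolev_tendsto_restrict: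
  assumes v: "v \<in> sobolev 1 \<Omega>" and T: "T \<in> Th" and \<phi>: "\<And>n. smooth (\<phi> n)"
    and lim: "(\<lambda>n. sobolev_norm 1 \<Omega> (\<lambda>x. v x - \<phi> n x)) \<longlonglongrightarrow> 0"
  shows "(\<lambda>n. sobolev_norm 1 T (\<lambda>x. v x - \<phi> n x)) \<longlonglongrightarrow> 0"
    and "(\<lambda>n. norm_on T (\<lambda>x. v x - \<phi> n x)) \<longlonglongrightarrow> 0"
    and "\<And>i. i \<in> Basis \<Longrightarrow> (\<lambda>n. norm_on T (\<lambda>x. weak_deriv \<Omega> {#i#} v x - pdiff i (\<phi> n) x)) \<longlonglongrightarrow> 0"
proof -
  have vs: "sqi_on \<Omega> v" using v by (simp add: sobolev_iff)
  have w: "weakly \<Omega> {#i#} v (weak_deriv \<Omega> {#i#} v)" if "i \<in> Basis" for i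
    using sobolev_weakly[OF v] that by (auto simp: multi_indices_def)
  have wT: "weakly T {#i#} v (weak_deriv \<Omega> {#i#} v)" if "i \<in> Basis" for i
    using weakly_T[OF w[OF that] T] that by simp
  have sq: "(\<lambda>n. norm_on T (\<lambda>x. z x - u n x)) \<longlonglongrightarrow> 0"
    if "(\<lambda>n. norm_on \<Omega> (\<lambda>x. z x - u n x)) \<longlonglongrightarrow> 0" "sqi_on \<Omega> z" "\<And>n. smooth (u n)" for z u
  proof (rule tendsto_sandwich[OF _ _ tendsto_const that(1)])
    show "\<forall>\<^sub>F n in sequentially. norm_on T (\<lambda>x. z x - u n x) \<le> norm_on \<Omega> (\<lambda>x. z x - u n x)"
      by (intro always_eventually allI l2_norm_subset T_subset[OF T] TL[OF T] \<Omega>L sqi_diff that smooth_sqi \<Omega>)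
  qed (simp add: l2_norm_nonneg)
  have "(\<lambda>n. norm_on \<Omega> (\<lambda>x. v x - \<phi> n x)) \<longlonglongrightarrow> 0 \<and>
     (\<forall>i\<in>Basis. (\<lambda>n. norm_on \<Omega> (\<lambda>x. weak_deriv \<Omega> {#i#} v x - pdiff i (\<phi> n) x)) \<longlonglongrightarrow> 0)"
    by (rule sobolev_norm_1_tendsto[OF \<Omega>(1,3) vs w \<phi>, THEN iffD1]) (auto simp: lim[unfolded One_nat_def])
  then have a: "(\<lambda>n. norm_on T (\<lambda>x. v x - \<phi> n x)) \<longlonglongrightarrow> 0 \<and>
     (\<forall>i\<in>Basis. (\<lambda>n. norm_on T (\<lambda>x. weak_deriv \<Omega> {#i#} v x - pdiff i (\<phi> n) x)) \<longlonglongrightarrow> 0)"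
    by (intro conjI ballI sq vs \<phi> smooth_pdiff weakly_sqi[OF w]) auto
  show "(\<lambda>n. sobolev_norm 1 T (\<lambda>x. v x - \<phi> n x)) \<longlonglongrightarrow> 0"
    by (rule sobolev_norm_1_tendsto[OF Th(2,4)[OF T] sqi_T[OF vs T] wT \<phi>, THEN iffD2]) (use a in auto)
  show "(\<lambda>n. norm_on T (\<lambda>x. v x - \<phi> n x)) \<longlonglongrightarrow> 0"
    "\<And>i. i \<in> Basis \<Longrightarrow> (\<lambda>n. norm_on T (\<lambda>x. weak_deriv \<Omega> {#i#} v x - pdiff i (\<phi> n) x)) \<longlonglongrightarrow> 0"
    using a by blast+
qed

text \<open>An H^1-convergent sequence is Cauchy on the face by the trace inequality of an adjacent
  element, and the L2 space of the face is complete.\<close>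

lemma face_limit:
  assumes v: "v \<in> sobolev 1 \<Omega>" and F: "F \<in> Fh" and \<phi>: "\<And>n. smooth (\<phi> n)"
    and lim: "(\<lambda>n. sobolev_norm 1 \<Omega> (\<lambda>x. v x - \<phi> n x)) \<longlonglongrightarrow> 0"
  shows "\<exists>g. face_sqi F g \<and> (\<lambda>n. face_norm F (\<lambda>x. g x - \<phi> n x)) \<longlonglongrightarrow> 0"
proof -
  obtain T where T: "T \<in> Th" "F \<subseteq> frontier T" using F_frontier[OF F] by blast
  interpret e: element T "faces_of Fh T" Fh using element[OF T(1)] .
  have FT: "F \<in> faces_of Fh T" using F T(2) by (simp add: faces_of_def)
  let ?N = "norm_on T" and ?w = "\<lambda>i. weak_deriv \<Omega> {#i#} v"
  have vs: "sqi_on T v" using v sqi_T[OF _ T(1), of v] unfolding sobolev_iff by blast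
  have w: "sqi_on T (?w i)" if "i \<in> Basis" for i
    using sobolev_weakly[OF v, of "{#i#}"] that by (intro sqi_T[OF _ T(1)] weakly_sqi) (auto simp: multi_indices_def)
  define a where "a n = ?N (\<lambda>x. v x - \<phi> n x) + (\<Sum>i\<in>Basis. ?N (\<lambda>x. ?w i x - pdiff i (\<phi> n) x))" for n
  obtain C where C: "0 \<le> C" "\<And>m n. faces_norm (faces_of Fh T) (\<lambda>x. \<phi> m x - \<phi> n x) \<le> C * (a m + a n)"
    using e.trace_difference[where w = ?w, OF vs w] \<phi> unfolding a_def by force
  have "a \<longlonglongrightarrow> 0 + (\<Sum>i\<in>(Basis :: 'a set). 0)"
    unfolding a_def by (intro tendsto_add tendsto_sum sobolev_tendsto_restrict[OF v T(1) \<phi> lim])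
  then have a0: "a \<longlonglongrightarrow> 0" by simp
  show ?thesis
  proof (rule l2_complete)
    show "finite_measure (face_measure F)" using face.finite_face[OF face_Fh[OF F]] .
    show "face_sqi F (\<phi> n)" for n
      using e.smooth_fsqi[OF \<phi>] FT by (rule e.fsqi_face)
    fix \<epsilon> :: real assume \<epsilon>: "0 < \<epsilon>"
    \<comment> \<open>The \<open>+ 1\<close> covers \<open>C = 0\<close> and makes
      \<open>2 * C * \<delta>\<close> strictly smaller than \<open>\<epsilon>\<close>.\<close>
    define \<delta> where "\<delta> = \<epsilon> / (2 * C + 1)"
    have \<delta>: "0 < \<delta>" "(2 * C + 1) * \<delta> = \<epsilon>" using \<epsilon> C(1) by (simp_all add: \<delta>_def)
    then obtain N where N: "\<And>n. n \<ge> N \<Longrightarrow> \<bar>a n\<bar> < \<delta>"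
      using LIMSEQ_D[OF a0] by (metis diff_zero real_norm_def)
    have "face_norm F (\<lambda>x. \<phi> m x - \<phi> n x) < \<epsilon>" if "m \<ge> N" "n \<ge> N" for m n
    proof -
      have "face_norm F (\<lambda>x. \<phi> m x - \<phi> n x) \<le> C * (a m + a n)"
        using face_norm_le[OF e.Fs(1) FT] C(2) order_trans by blast
      also have "\<dots> \<le> C * (\<delta> + \<delta>)"
        using N[OF that(1)] N[OF that(2)] by (intro mult_left_mono C(1)) linarith
      also have "\<dots> < \<epsilon>" using \<delta> by (simp add: algebra_simps)
      finally show ?thesis .
    qed
    then show "\<exists>N. \<forall>m\<ge>N. \<forall>n\<ge>N. face_norm F (\<lambda>x. \<phi> m x - \<phi> n x) < \<epsilon>" by blast
  qed
qed

lemma skeleton_limit: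
  assumes v: "v \<in> sobolev 1 \<Omega>" and \<phi>: "\<And>n. smooth (\<phi> n)"
    and lim: "(\<lambda>n. sobolev_norm 1 \<Omega> (\<lambda>x. v x - \<phi> n x)) \<longlonglongrightarrow> 0"
  shows "\<exists>g. fsqi Fh g \<and> (\<lambda>n. faces_norm Fh (\<lambda>x. g x - \<phi> n x)) \<longlonglongrightarrow> 0"
proof -
  obtain G where G: "\<And>F. F \<in> Fh \<Longrightarrow> face_sqi F (G F)"
    "\<And>F. F \<in> Fh \<Longrightarrow> (\<lambda>n. face_norm F (\<lambda>x. G F x - \<phi> n x)) \<longlonglongrightarrow> 0"
    using face_limit[OF v _ \<phi> lim] by metis
  \<comment> \<open>The limits were found face by face; disjointness of the faces allows them to be
    glued into one function.\<close>
  define g where "g x = G (THE F. F \<in> Fh \<and> x \<in> F) x" for x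
  have eq: "G F x = g x" if "F \<in> Fh" "x \<in> F" for F x
  proof -
    have "(THE F. F \<in> Fh \<and> x \<in> F) = F"
      using that Fh(3) by (intro the_equality) (auto simp: pairwise_def disjnt_def)
    then show ?thesis by (simp add: g_def)
  qed
  have "fsqi Fh g"
    unfolding fsqi_def
  proof
    fix F assume F: "F \<in> Fh"
    have "face_sqi F (G F) \<longleftrightarrow> face_sqi F g"
      using eq[OF F] by (intro sqi_cong) (simp add: face.space_face[OF face_Fh[OF F]])
    then show "face_sqi F g" using G(1)[OF F] by blast
  qed
  moreover have "\<forall>F\<in>Fh. (\<lambda>n. face_norm F (\<lambda>x. g x - \<phi> n x)) \<longlonglongrightarrow> 0"
  proof
    fix F assume F: "F \<in> Fh"
    have "face_norm F (\<lambda>x. G F x - \<phi> n x) = face_norm F (\<lambda>x. g x - \<phi> n x)" for n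
      using eq[OF F] by (intro l2_norm_cong) (simp add: face.space_face[OF face_Fh[OF F]])
    then show "(\<lambda>n. face_norm F (\<lambda>x. g x - \<phi> n x)) \<longlonglongrightarrow> 0" using G(2)[OF F] by simp
  qed
  ultimately show ?thesis unfolding faces_norm_tendsto[OF Fh(1)] by blast
qed

lemma trace_exists:
  assumes v: "v \<in> sobolev 1 \<Omega>"
  shows "\<exists>g. is_trace \<Omega> Fh v g"
proof -
  obtain \<phi> :: "nat \<Rightarrow> 'a \<Rightarrow> real" where \<phi>: "\<And>n. smooth (\<phi> n)" "(\<lambda>n. sobolev_norm 1 \<Omega> (\<lambda>x. v x - \<phi> n x)) \<longlonglongrightarrow> 0"
    using sobolev_1_smooth_dense[OF \<Omega> v] by blast
  then obtain g where "fsqi Fh g" "(\<lambda>n. faces_norm Fh (\<lambda>x. g x - \<phi> n x)) \<longlonglongrightarrow> 0"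
    using skeleton_limit[OF v] by blast
  then show ?thesis
    unfolding is_trace_def sq_integrable_eq_sqi using \<phi> by (intro exI[of _ g] conjI exI[of _ \<phi>]) (auto simp: fsqi_def)
qed

lemma is_trace_trace_on: "v \<in> sobolev 1 \<Omega> \<Longrightarrow> is_trace \<Omega> Fh v (trace_on \<Omega> Fh v)"
  unfolding trace_on_def by (rule someI_ex[OF trace_exists])

lemma trace_restrict:
  assumes v: "v \<in> sobolev 1 \<Omega>" and g: "is_trace \<Omega> Fh v g" and T: "T \<in> Th"
  shows "is_trace T (faces_of Fh T) v g"
proof -
  obtain \<phi> :: "nat \<Rightarrow> 'a \<Rightarrow> real" where \<phi>: "\<And>n. smooth (\<phi> n)" "(\<lambda>n. sobolev_norm 1 \<Omega> (\<lambda>x. v x - \<phi> n x)) \<longlonglongrightarrow> 0"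
    "(\<lambda>n. faces_norm Fh (\<lambda>x. g x - \<phi> n x)) \<longlonglongrightarrow> 0" and gs: "\<forall>F\<in>Fh. sq_integrable (face_measure F) g"
    using g unfolding is_trace_def by blast
  have "(\<lambda>n. faces_norm (faces_of Fh T) (\<lambda>x. g x - \<phi> n x)) \<longlonglongrightarrow> 0"
  proof (rule tendsto_sandwich[OF _ _ tendsto_const \<phi>(3)])
    show "\<forall>\<^sub>F n in sequentially. faces_norm (faces_of Fh T) (\<lambda>x. g x - \<phi> n x) \<le> faces_norm Fh (\<lambda>x. g x - \<phi> n x)"
      by (intro always_eventually allI faces_norm_mono Fh(1)) (auto simp: faces_of_def)
  qed (simp add: faces_norm_nonneg)
  then show ?thesis
    unfolding is_trace_def using gs \<phi>(1) sobolev_tendsto_restrict(1)[OF v T \<phi>(1,2)] by (auto simp: faces_of_def)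
qed

text \<open>The trace obtained from approximation by test functions vanishes on boundary faces, and
  uniqueness on the adjacent element transfers this to the chosen \<open>trace_on\<close>.\<close>

lemma trace_boundary:
  assumes v: "v \<in> sobolev0 \<Omega>" and F: "F \<in> Fh" "F \<subseteq> frontier \<Omega>"
  shows "face_norm F (trace_on \<Omega> Fh v) = 0"
proof -
  let ?\<gamma> = "trace_on \<Omega> Fh v"
  obtain \<phi> :: "nat \<Rightarrow> 'a \<Rightarrow> real" where \<phi>: "\<And>n. test_fun \<Omega> (\<phi> n)" "(\<lambda>n. sobolev_norm 1 \<Omega> (\<lambda>x. v x - \<phi> n x)) \<longlonglongrightarrow> 0"
    and v1: "v \<in> sobolev 1 \<Omega>"
    using v unfolding sobolev0_def by blast
  have sm: "smooth (\<phi> n)" for n using \<phi>(1) by (simp add: test_fun_def)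
  obtain g where g: "fsqi Fh g" "(\<lambda>n. faces_norm Fh (\<lambda>x. g x - \<phi> n x)) \<longlonglongrightarrow> 0"
    using skeleton_limit[OF v1 sm \<phi>(2)] by blast
  have gt: "is_trace \<Omega> Fh v g"
    unfolding is_trace_def sq_integrable_eq_sqi using g sm \<phi>(2) by (intro conjI exI[of _ \<phi>]) (auto simp: fsqi_def)
  have "\<phi> n x = 0" if "x \<in> F" for n x
  proof -
    have "x \<notin> \<Omega>" using that F(2) \<Omega>(1) by (auto simp: frontier_def interior_open)
    then show ?thesis using \<phi>(1)[of n] unfolding test_fun_def by blast
  qed
  then have "face_norm F (\<lambda>x. g x - \<phi> n x) = face_norm F g" for n
    by (intro l2_norm_cong) (simp add: face.space_face[OF face_Fh[OF F(1)]])
  moreover have "(\<lambda>n. face_norm F (\<lambda>x. g x - \<phi> n x)) \<longlonglongrightarrow> 0"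
    using g(2) F(1) unfolding faces_norm_tendsto[OF Fh(1)] by blast
  ultimately have g0: "face_norm F g = 0" by (simp add: LIMSEQ_const_iff)
  obtain T where T: "T \<in> Th" "F \<subseteq> frontier T" using F_frontier[OF F(1)] by blast
  interpret e: element T "faces_of Fh T" Fh using element[OF T(1)] .
  have FT: "F \<in> faces_of Fh T" using F T(2) by (simp add: faces_of_def)
  have vs: "sqi_on T v" using v1 sqi_T[OF _ T(1), of v] unfolding sobolev_iff by blast
  have w: "weakly T {#i#} v (weak_deriv \<Omega> {#i#} v)" if "i \<in> Basis" for i
    using sobolev_weakly[OF v1, of "{#i#}"] that by (intro weakly_T[OF _ T(1)]) (auto simp: multi_indices_def)
  note \<gamma>t = is_trace_trace_on[OF v1]
  have "faces_norm (faces_of Fh T) (\<lambda>x. ?\<gamma> x - g x) = 0"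
    using e.trace_unique[OF trace_restrict[OF v1 \<gamma>t T(1)] trace_restrict[OF v1 gt T(1)] vs w] .
  then have z: "face_norm F (\<lambda>x. ?\<gamma> x - g x) = 0"
    using face_norm_le[OF e.Fs(1) FT, of "\<lambda>x. ?\<gamma> x - g x"] l2_norm_nonneg[of "face_measure F" "\<lambda>x. ?\<gamma> x - g x"] by linarith
  have s: "face_sqi F ?\<gamma>" "face_sqi F g"
    using \<gamma>t gt F(1) by (auto simp: is_trace_def sq_integrable_eq_sqi)
  show ?thesis
    using l2_triangle[OF sqi_diff[OF s] s(2)] z g0 l2_norm_nonneg[of "face_measure F" ?\<gamma>] by simp
qed

end

section \<open>Polynomial projectors\<close>

lemma semi_inner_subset:
  assumes "semi_inner V comb B" "W \<subseteq> V" "\<And>u v c. u \<in> W \<Longrightarrow> v \<in> W \<Longrightarrow> comb u c v \<in> W"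
  shows "semi_inner W comb B"
proof -
  interpret semi_inner V comb B by fact
  show ?thesis
    by unfold_locales (use assms(2,3) in \<open>auto intro: form_comb form_commute form_nonneg\<close>)
qed

lemma continuous_null:
  fixes f :: "'a::euclidean_space \<Rightarrow> 'b::euclidean_space"
  assumes T: "open T" and f: "continuous_on UNIV f" "sqi_on T f" and z: "inner_on T f f = 0"
    and x: "x \<in> T"
  shows "f x = 0"
proof -
  have "AE x in lebesgue_on T. f x = 0"
    using z l2_norm_eq_0_AE[OF f(2)] by (simp add: l2_norm_def)
  then have "AE x in lebesgue. x \<in> T \<longrightarrow> f x = 0"
    using open_sets_lebesgue[OF T] by (simp add: AE_restrict_space_iff)
  then have "negligible {x. \<not> (x \<in> T \<longrightarrow> f x = 0)}"
    by (simp add: negligible_iff_null_sets AE_iff_null_sets completion.AE_iff_null_sets)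
  moreover have "open (T \<inter> f -` (- {0}))"
    by (intro open_Int T open_vimage f) auto
  ultimately have "T \<inter> f -` (- {0}) = {}"
    using open_not_negligible negligible_subset[of "{x. \<not> (x \<in> T \<longrightarrow> f x = 0)}" "T \<inter> f -` (- {0})"] by blast
  then show ?thesis using x by blast
qed

lemma face_polys_comb: "\<mu> \<in> face_polys k Fs \<Longrightarrow> \<nu> \<in> face_polys k Fs \<Longrightarrow> (\<lambda>x. \<mu> x + c * \<nu> x) \<in> face_polys k Fs"
  unfolding face_polys_def using polys_comb by fastforce

lemma polys_face_polys: "p \<in> polys k \<Longrightarrow> p \<in> face_polys k Fs"
  by (auto simp: face_polys_def)

text \<open>Shared by the faces of one element and by the whole skeleton, so that the local and the
  global face projector obey the same lemmas.\<close>

locale face_family =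
  fixes Fs :: "'a::euclidean_space set set"
  assumes finite_family: "finite Fs" and face_member: "\<And>F. F \<in> Fs \<Longrightarrow> face F" and disjoint_family: "pairwise disjnt Fs"
begin

lemma same_face: "F \<in> Fs \<Longrightarrow> G \<in> Fs \<Longrightarrow> x \<in> F \<Longrightarrow> x \<in> G \<Longrightarrow> F = G"
  using disjoint_family by (auto simp: pairwise_def disjnt_def)

lemma face_sqi_cong: "F \<in> Fs \<Longrightarrow> (\<And>x. x \<in> F \<Longrightarrow> f x = g x) \<Longrightarrow> face_sqi F f \<longleftrightarrow> face_sqi F g"
  by (intro sqi_cong) (simp add: face.space_face[OF face_member])

lemma face_inner_cong:
  "F \<in> Fs \<Longrightarrow> (\<And>x. x \<in> F \<Longrightarrow> f x = f' x) \<Longrightarrow> (\<And>x. x \<in> F \<Longrightarrow> g x = g' x) \<Longrightarrow>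
    face_inner F f g = face_inner F f' g'"
  unfolding l2_inner_def
  by (intro Bochner_Integration.integral_cong) (simp_all add: face.space_face[OF face_member])

lemma faces_inner_cong:
  assumes "\<And>F x. F \<in> Fs \<Longrightarrow> x \<in> F \<Longrightarrow> f x = f' x" "\<And>F x. F \<in> Fs \<Longrightarrow> x \<in> F \<Longrightarrow> g x = g' x"
  shows "faces_inner Fs f g = faces_inner Fs f' g'"
  unfolding faces_inner_def by (intro sum.cong refl face_inner_cong assms)

lemma faces_norm_cong:
  "(\<And>F x. F \<in> Fs \<Longrightarrow> x \<in> F \<Longrightarrow> f x = f' x) \<Longrightarrow> faces_norm Fs f = faces_norm Fs f'"
  unfolding faces_norm_def by (subst faces_inner_cong[of f f' f f']) auto

lemma polys_sqi: "F \<in> Fs \<Longrightarrow> p \<in> polys k \<Longrightarrow> face_sqi F p"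
  using face.continuous_face_sqi[OF face_member] smooth_continuous smooth_polys by blast

lemma face_polys_fsqi: assumes "\<mu> \<in> face_polys k Fs" shows "fsqi Fs \<mu>"
  unfolding fsqi_def
proof
  fix F assume F: "F \<in> Fs"
  then obtain p where "p \<in> polys k" "\<And>x. x \<in> F \<Longrightarrow> \<mu> x = p x" using assms by (auto simp: face_polys_def)
  then show "face_sqi F \<mu>" using face_sqi_cong[OF F, of \<mu> p] polys_sqi[OF F] by blast
qed

lemma face_poly_null:
  assumes "F \<in> Fs" "p \<in> polys k" "face_inner F p p = 0" "x \<in> F"
  shows "p x = 0"
proof -
  have "AE x in face_measure F. p x = 0"
    using assms(3) l2_norm_eq_0_AE[OF polys_sqi[OF assms(1,2)]] by (simp add: l2_norm_def)
  then show ?thesis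
    using face.continuous_zero_on_face[OF face_member[OF assms(1)] smooth_continuous[OF smooth_polys[OF assms(2)]] _ assms(4)] by blast
qed

lemma face_riesz:
  assumes F: "F \<in> Fs" and g: "face_sqi F g"
  shows "\<exists>p\<in>polys k. \<forall>q\<in>polys k. face_inner F p q = face_inner F g q"
proof (rule polys_riesz)
  show "semi_inner (polys k) (\<lambda>u c v x. u x + c * v x) (face_inner F)"
    by (rule semi_inner_subset[OF semi_inner_l2[where ?'b = real], unfolded real_scaleR_def]) (use polys_sqi[OF F] polys_comb in auto)
  show "face_inner F g (\<lambda>x. u x + c * v x) = face_inner F g u + c * face_inner F g v"
    if "u \<in> polys k" "v \<in> polys k" for u v c
    using that l2_inner_comb[of "face_measure F" u v g c] polys_sqi[OF F] g by (simp add: l2_inner_commute)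
  show "face_inner F g u = 0" if u: "u \<in> polys k" "face_inner F u u = 0" for u
  proof -
    have "face_inner F g u = face_inner F g (\<lambda>_. 0)"
      using face_poly_null[OF F, of u k] u by (intro face_inner_cong[OF F]) auto
    then show ?thesis by (simp add: l2_inner_def)
  qed
qed

lemma faces_proj_exists:
  assumes g: "fsqi Fs g"
  shows "\<exists>\<mu>. \<mu> \<in> face_polys k Fs \<and> (\<forall>\<nu>\<in>face_polys k Fs. faces_inner Fs \<mu> \<nu> = faces_inner Fs g \<nu>)"
proof -
  have "\<forall>F\<in>Fs. \<exists>p. p \<in> polys k \<and> (\<forall>q\<in>polys k. face_inner F p q = face_inner F g q)"
    using face_riesz g unfolding fsqi_def by blast
  then obtain P where P: "\<And>F. F \<in> Fs \<Longrightarrow> P F \<in> polys k"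
    "\<And>F q. F \<in> Fs \<Longrightarrow> q \<in> polys k \<Longrightarrow> face_inner F (P F) q = face_inner F g q"
    by (auto simp: bchoice_iff)
  define \<mu> where "\<mu> x = P (THE F. F \<in> Fs \<and> x \<in> F) x" for x
  have eq: "\<mu> x = P F x" if "F \<in> Fs" "x \<in> F" for F x
  proof -
    have "(THE F. F \<in> Fs \<and> x \<in> F) = F"
      using that same_face by (intro the_equality) auto
    then show ?thesis by (simp add: \<mu>_def)
  qed
  have "faces_inner Fs \<mu> \<nu> = faces_inner Fs g \<nu>" if \<nu>: "\<nu> \<in> face_polys k Fs" for \<nu>
    unfolding faces_inner_def
  proof (rule sum.cong[OF refl])
    fix F assume F: "F \<in> Fs"
    then obtain q where q: "q \<in> polys k" "\<And>x. x \<in> F \<Longrightarrow> \<nu> x = q x" using \<nu> by (auto simp: face_polys_def)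
    have "face_inner F \<mu> \<nu> = face_inner F (P F) q"
      using eq[OF F] q(2) by (intro face_inner_cong F)
    also have "\<dots> = face_inner F g q" by (rule P(2)[OF F q(1)])
    also have "\<dots> = face_inner F g \<nu>" using q(2) by (intro face_inner_cong F) auto
    finally show "face_inner F \<mu> \<nu> = face_inner F g \<nu>" .
  qed
  moreover have "\<mu> \<in> face_polys k Fs" using eq P(1) by (auto simp: face_polys_def intro!: bexI[of _ "P _"])
  ultimately show ?thesis by blast
qed

lemma faces_proj_face_polys: "fsqi Fs g \<Longrightarrow> faces_proj k Fs g \<in> face_polys k Fs"
  and faces_proj_inner: "fsqi Fs g \<Longrightarrow> \<nu> \<in> face_polys k Fs \<Longrightarrow> faces_inner Fs (faces_proj k Fs g) \<nu> = faces_inner Fs g \<nu>"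
  unfolding faces_proj_def using someI_ex[OF faces_proj_exists[of g k]] by blast+

lemma faces_proj_fsqi: "fsqi Fs g \<Longrightarrow> fsqi Fs (faces_proj k Fs g)"
  using face_polys_fsqi faces_proj_face_polys by blast

text \<open>A broken polynomial may vanish on all faces but one, so the projection decouples and
  acts on each face separately.\<close>

lemma faces_proj_face_inner:
  assumes g: "fsqi Fs g" and F: "F \<in> Fs" and q: "q \<in> polys k"
  shows "face_inner F (faces_proj k Fs g) q = face_inner F g q"
proof -
  define \<nu> where "\<nu> x = (if x \<in> F then q x else 0)" for x
  have \<nu>: "\<nu> \<in> face_polys k Fs"
    unfolding face_polys_def
  proof (intro CollectI ballI)
    fix G assume G: "G \<in> Fs"
    show "\<exists>p\<in>polys k. \<forall>x\<in>G. \<nu> x = p x"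
    proof (cases "G = F")
      case True
      then show ?thesis using q by (auto simp: \<nu>_def intro!: bexI[of _ q])
    next
      case False
      then have "\<nu> x = 0" if "x \<in> G" for x using same_face[OF F G] that by (auto simp: \<nu>_def)
      then show ?thesis using polys_zero by (intro bexI[of _ "\<lambda>_. 0"]) auto
    qed
  qed
  have e: "faces_inner Fs f \<nu> = face_inner F f q" for f
  proof -
    have "face_inner G f \<nu> = (if G = F then face_inner F f q else 0)" if G: "G \<in> Fs" for G
    proof (cases "G = F")
      case True
      then show ?thesis by (auto simp: \<nu>_def intro!: face_inner_cong F)
    next
      case False
      then have "face_inner G f \<nu> = face_inner G f (\<lambda>_. 0)"
        using same_face[OF F G] by (intro face_inner_cong G) (auto simp: \<nu>_def)
      then show ?thesis using False by (simp add: l2_inner_def)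
    qed
    then show ?thesis unfolding faces_inner_def using F finite_family by simp
  qed
  show ?thesis using faces_proj_inner[OF g \<nu>] unfolding e .
qed

lemma faces_proj_eqI:
  assumes g: "fsqi Fs g" and F: "F \<in> Fs" and p: "p \<in> polys k"
    and i: "\<And>q. q \<in> polys k \<Longrightarrow> face_inner F p q = face_inner F g q" and x: "x \<in> F"
  shows "faces_proj k Fs g x = p x"
proof -
  obtain p' where p': "p' \<in> polys k" "\<And>x. x \<in> F \<Longrightarrow> faces_proj k Fs g x = p' x"
    using faces_proj_face_polys[OF g, of k] F by (auto simp: face_polys_def)
  have "face_inner F p' q = face_inner F p q" if "q \<in> polys k" for q
  proof -
    have "face_inner F p' q = face_inner F (faces_proj k Fs g) q"
      using p'(2) by (intro face_inner_cong F) auto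
    then show ?thesis using faces_proj_face_inner[OF g F that] i[OF that] by simp
  qed
  then have "face_inner F (\<lambda>x. p' x - p x) (\<lambda>x. p' x - p x) = 0"
    using polys_diff[OF p'(1) p] polys_sqi[OF F] p p'(1) by (subst l2_inner_diff_left) auto
  then have "p' x - p x = 0" by (rule face_poly_null[OF F polys_diff[OF p'(1) p] _ x])
  then show ?thesis using p'(2)[OF x] by simp
qed

lemma faces_proj_comb:
  assumes "fsqi Fs f" "fsqi Fs g" "F \<in> Fs" "x \<in> F"
  shows "faces_proj k Fs (\<lambda>x. f x + c * g x) x = faces_proj k Fs f x + c * faces_proj k Fs g x"
proof -
  obtain p where p: "p \<in> polys k" "\<And>x. x \<in> F \<Longrightarrow> faces_proj k Fs f x = p x"
    using faces_proj_face_polys[OF assms(1), of k] assms(3) by (auto simp: face_polys_def)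
  obtain p' where p': "p' \<in> polys k" "\<And>x. x \<in> F \<Longrightarrow> faces_proj k Fs g x = p' x"
    using faces_proj_face_polys[OF assms(2), of k] assms(3) by (auto simp: face_polys_def)
  note s = polys_sqi[OF assms(3)]
  have "faces_proj k Fs (\<lambda>x. f x + c * g x) x = p x + c * p' x"
  proof (rule faces_proj_eqI[OF fsqi_comb[OF assms(1,2)] assms(3) polys_comb[OF p(1) p'(1)] _ assms(4)])
    fix q :: "'a \<Rightarrow> real" assume q: "q \<in> polys k"
    have "face_inner F p q = face_inner F (faces_proj k Fs f) q"
      "face_inner F p' q = face_inner F (faces_proj k Fs g) q"
      using p(2) p'(2) by (auto intro!: face_inner_cong assms(3))
    then have "face_inner F p q = face_inner F f q"
      "face_inner F p' q = face_inner F g q"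
      using faces_proj_face_inner assms q by simp_all
    then show "face_inner F (\<lambda>x. p x + c * p' x) q = face_inner F (\<lambda>x. f x + c * g x) q"
      using l2_inner_comb[OF s[OF p(1)] s[OF p'(1)] s[OF q], of c] assms(1-3)
        l2_inner_comb[of "face_measure F" f g q c] s[OF q] by (simp add: fsqi_def)
  qed
  then show ?thesis using p(2) p'(2) assms(4) by simp
qed

lemma faces_proj_id:
  assumes "\<mu> \<in> face_polys k Fs" "F \<in> Fs" "x \<in> F"
  shows "faces_proj k Fs \<mu> x = \<mu> x"
proof -
  obtain p where p: "p \<in> polys k" "\<And>x. x \<in> F \<Longrightarrow> \<mu> x = p x" using assms(1,2) by (auto simp: face_polys_def)
  have "faces_proj k Fs \<mu> x = p x"
    using p(2) by (intro faces_proj_eqI[OF face_polys_fsqi[OF assms(1)] assms(2) p(1) _ assms(3)] face_inner_cong assms(2)) auto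
  then show ?thesis using p(2) assms(3) by simp
qed

lemma faces_proj_norm:
  assumes g: "fsqi Fs g" shows "faces_norm Fs (faces_proj k Fs g) \<le> faces_norm Fs g"
proof -
  let ?n = "faces_norm Fs (faces_proj k Fs g)"
  have "?n\<^sup>2 = faces_inner Fs g (faces_proj k Fs g)"
    using faces_proj_inner[OF g faces_proj_face_polys[OF g]] by (simp add: faces_norm_sq)
  also have "\<dots> \<le> faces_norm Fs g * ?n"
    using faces_cauchy_schwarz[OF g faces_proj_fsqi[OF g]] by (simp add: abs_le_iff)
  finally have "?n * ?n \<le> faces_norm Fs g * ?n" by (simp add: power2_eq_square)
  then show ?thesis
    using faces_norm_nonneg[of Fs g] faces_norm_nonneg[of Fs "faces_proj k Fs g"] mult_right_le_imp_le by fastforce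
qed

text \<open>By this decoupling the global projector restricts to the local one; the error estimate
  is stated with the former, the local interpolant is built with the latter.\<close>

lemma faces_proj_subfamily:
  assumes g: "fsqi Fs g" and G: "Gs \<subseteq> Fs" "F \<in> Gs" "x \<in> F"
  shows "faces_proj k Gs g x = faces_proj k Fs g x"
proof -
  interpret sub: face_family Gs
    using finite_subset[OF G(1) finite_family] pairwise_subset[OF disjoint_family G(1)] face_member G(1)
    by (intro face_family.intro) auto
  have F: "F \<in> Fs" using G by blast
  obtain p where p: "p \<in> polys k" "\<And>x. x \<in> F \<Longrightarrow> faces_proj k Fs g x = p x"
    using faces_proj_face_polys[OF g, of k] F by (auto simp: face_polys_def)
  have "face_inner F p q = face_inner F g q" if "q \<in> polys k" for q
  proof -
    have "face_inner F p q = face_inner F (faces_proj k Fs g) q"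
      using p(2) by (intro face_inner_cong F) auto
    then show ?thesis using faces_proj_face_inner[OF g F that] by simp
  qed
  moreover have "fsqi Gs g" using g G(1) by (auto simp: fsqi_def)
  ultimately show ?thesis using sub.faces_proj_eqI[OF _ G(2) p(1) _ G(3)] p(2)[OF G(3)] by simp
qed

end

sublocale element \<subseteq> fam: face_family Fs
  using Fs(1,4) faceI by (intro face_family.intro)

context element
begin

abbreviation L where "L \<equiv> lebesgue_on T"

lemma polys_sqi_T: "p \<in> polys k \<Longrightarrow> sqi L p"
  by (intro smooth_T smooth_polys)

lemma continuous_sqi_T:
  fixes f :: "'a \<Rightarrow> 'b::euclidean_space"
  assumes f: "continuous_on UNIV f" shows "sqi L f"
proof -
  have "compact (closure T)" using T(3) by (simp add: compact_closure)
  then have "bounded (f ` closure T)"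
    using f by (intro compact_imp_bounded compact_continuous_image) (auto intro: continuous_on_subset)
  then obtain C where C: "\<And>x. x \<in> closure T \<Longrightarrow> norm (f x) \<le> C" unfolding bounded_iff by blast
  show ?thesis
  proof (rule sqi_bounded[OF finite_T])
    show "f \<in> borel_measurable L"
      using f by (intro borel_measurable_lebesgue_on borel_measurable_continuous_onI)
    show "norm (f x) \<le> C" if "x \<in> space L" for x
      using C[of x] that closure_subset by (auto simp: space_restrict_space)
  qed
qed

lemma vec_polys_sqi: "s \<in> vec_polys k \<Longrightarrow> sqi L s"
  by (intro continuous_sqi_T vec_polys_continuous)

lemma poly_null: assumes "p \<in> polys k" "l2_inner L p p = 0" shows "p = (\<lambda>_. 0)"
proof -
  obtain a where a: "a \<in> T" using T(4) by blast
  show ?thesis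
    using continuous_null[OF T(1) smooth_continuous[OF smooth_polys[OF assms(1)]] polys_sqi_T[OF assms(1)] assms(2)]
    by (intro polys_zero_on_open[OF assms(1) T(1) a])
qed

lemma vec_poly_null: assumes "s \<in> vec_polys k" "l2_inner L s s = 0" shows "s = (\<lambda>_. 0)"
proof -
  obtain a where a: "a \<in> T" using T(4) by blast
  have "s x = 0" if "x \<in> T" for x
    using continuous_null[OF T(1) vec_polys_continuous[OF assms(1)] vec_polys_sqi[OF assms(1)] assms(2) that] .
  then have "(\<lambda>x. s x \<bullet> i) = (\<lambda>_. 0)" if "i \<in> Basis" for i
    using polys_zero_on_open[OF vec_polys_component[OF assms(1)] T(1) a, of i] by simp
  then show ?thesis by (auto simp: fun_eq_iff euclidean_eq_iff[where 'a = 'a])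
qed

lemma semi_inner_polys: "semi_inner (polys k) (\<lambda>u c v x. u x + c * v x) (l2_inner L)"
  by (rule semi_inner_subset[OF semi_inner_l2, of "polys k" L, unfolded real_scaleR_def]) (auto intro: polys_sqi_T polys_comb)

lemma elem_proj_ex:
  assumes v: "sqi L v"
  shows "\<exists>!p. p \<in> polys k \<and> (\<forall>q\<in>polys k. l2_inner L p q = l2_inner L v q)"
proof -
  have l: "l2_inner L v (\<lambda>x. p x + c * q x) = l2_inner L v p + c * l2_inner L v q" if "p \<in> polys k" "q \<in> polys k" for p q c
    using that l2_inner_comb[of L p q v c] polys_sqi_T v by (simp add: l2_inner_commute)
  have "\<exists>p\<in>polys k. \<forall>q\<in>polys k. l2_inner L p q = l2_inner L v q"
    by (rule polys_riesz[OF semi_inner_polys l]) (assumption | drule (1) poly_null, simp add: l2_inner_def)+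
  moreover have "p = p'" if "p \<in> polys k" "p' \<in> polys k" "\<forall>q\<in>polys k. l2_inner L p q = l2_inner L v q"
    "\<forall>q\<in>polys k. l2_inner L p' q = l2_inner L v q" for p p'
  proof -
    have "l2_inner L (\<lambda>x. p x - p' x) (\<lambda>x. p x - p' x) = 0"
      using that polys_diff[OF that(1,2)] by (subst l2_inner_diff_left) (auto intro: polys_sqi_T)
    from poly_null[OF polys_diff[OF that(1,2)] this] show ?thesis by (simp add: fun_eq_iff)
  qed
  ultimately show ?thesis by blast
qed

lemma elem_proj_polys: "sqi L v \<Longrightarrow> elem_proj k T v \<in> polys k"
  and elem_proj_inner: "sqi L v \<Longrightarrow> q \<in> polys k \<Longrightarrow> l2_inner L (elem_proj k T v) q = l2_inner L v q"
  unfolding elem_proj_def using theI'[OF elem_proj_ex[of v k]] by blast+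

lemma elem_proj_eqI:
  "sqi L v \<Longrightarrow> p \<in> polys k \<Longrightarrow> (\<And>q. q \<in> polys k \<Longrightarrow> l2_inner L p q = l2_inner L v q) \<Longrightarrow> elem_proj k T v = p"
  unfolding elem_proj_def using elem_proj_ex[of v k] by (intro the1_equality) auto

lemma elem_proj_id: "p \<in> polys k \<Longrightarrow> elem_proj k T p = p"
  by (intro elem_proj_eqI polys_sqi_T) auto

lemma elem_proj_comb:
  assumes "sqi L u" "sqi L v"
  shows "elem_proj k T (\<lambda>x. u x + c * v x) = (\<lambda>x. elem_proj k T u x + c * elem_proj k T v x)"
proof (rule elem_proj_eqI)
  show "sqi L (\<lambda>x. u x + c * v x)" using sqi_comb[OF assms, of c] by simp
  show "(\<lambda>x. elem_proj k T u x + c * elem_proj k T v x) \<in> polys k" by (intro polys_comb elem_proj_polys assms)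
  fix q :: "'a \<Rightarrow> real" assume q: "q \<in> polys k"
  have s: "sqi L (elem_proj k T u)" "sqi L (elem_proj k T v)" by (rule polys_sqi_T[OF elem_proj_polys], fact)+
  show "l2_inner L (\<lambda>x. elem_proj k T u x + c * elem_proj k T v x) q = l2_inner L (\<lambda>x. u x + c * v x) q"
    using l2_inner_comb[OF s polys_sqi_T[OF q], of c] l2_inner_comb[OF assms polys_sqi_T[OF q], of c]
    by (simp add: elem_proj_inner[OF assms(1) q] elem_proj_inner[OF assms(2) q])
qed

lemma inner_grad: "smooth p \<Longrightarrow> smooth q \<Longrightarrow> l2_inner L (grad p) (grad q) = (\<Sum>i\<in>Basis. l2_inner L (pdiff i p) (pdiff i q))"
  unfolding l2_inner_def
  by (subst euclidean_inner, subst Bochner_Integration.integral_sum)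
     (auto simp: grad_inner intro!: sqi_mult smooth_T smooth_pdiff)

lemma grad_null:
  assumes p: "p \<in> polys k" and z: "l2_inner L (grad p) (grad p) = 0"
  shows "\<exists>c. p = (\<lambda>_. c)"
proof -
  obtain a where a: "a \<in> T" using T(4) by blast
  note sm = smooth_polys[OF p]
  have g: "grad p x = 0" if "x \<in> T" for x
    using continuous_null[OF T(1) smooth_continuous_grad[OF sm] continuous_sqi_T[OF smooth_continuous_grad[OF sm]] z that] .
  have "p x = p a" if x: "x \<in> T" for x
  proof (rule has_derivative_zero_unique[OF T(2) _ x a])
    fix y assume "y \<in> T"
    then show "(p has_derivative (\<lambda>h. 0)) (at y within T)"
      using smooth_has_derivative[OF sm, of y] g by (auto intro: has_derivative_at_withinI)
  qed
  then have "(\<lambda>x. p x - p a) = (\<lambda>_. 0)"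
    by (intro polys_zero_on_open[OF polys_diff[OF p const_polys] T(1) a]) simp
  then show ?thesis by (intro exI[of _ "p a"]) (simp add: fun_eq_iff)
qed

end

section \<open>The local operators\<close>

text \<open>The operation \<open>comb\<close> of \<open>semi_inner\<close> for pairs of a cell and a
  face function; one operation with a scalar stands for sums and multiples alike.\<close>

definition pcomb :: "('a \<Rightarrow> real) \<times> ('a \<Rightarrow> real) \<Rightarrow> real \<Rightarrow> ('a \<Rightarrow> real) \<times> ('a \<Rightarrow> real) \<Rightarrow> ('a \<Rightarrow> real) \<times> ('a \<Rightarrow> real)" where
  "pcomb u c v = (\<lambda>x. fst u x + c * fst v x, \<lambda>x. snd u x + c * snd v x)"

definition vdiv :: "('a::euclidean_space \<Rightarrow> 'a) \<Rightarrow> 'a \<Rightarrow> real" where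
  "vdiv s x = (\<Sum>i\<in>Basis. pdiff i (\<lambda>x. s x \<bullet> i) x)"

lemma vdiv_polys: "s \<in> vec_polys k \<Longrightarrow> vdiv s \<in> polys (k - 1)"
  unfolding vdiv_def[abs_def] by (intro polys_sum pdiff_polys vec_polys_component)

lemma vec_polys_sum: 
  assumes "\<And>i. i \<in> Basis \<Longrightarrow> p i \<in> polys k"
  shows "(\<lambda>x. \<Sum>i\<in>Basis. p i x *\<^sub>R i) \<in> vec_polys k"
  using assms by (simp add: vec_polys_def inner_sum_left inner_Basis if_distrib sum.delta cong: if_cong)

context element
begin

text \<open>The face part ranges over all square integrable functions, because the bilinear forms
  see it through face integrals alone.\<close>

definition dofs :: "nat \<Rightarrow> (('a \<Rightarrow> real) \<times> ('a \<Rightarrow> real)) set" where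
  "dofs k = {v. fst v \<in> polys k \<and> fsqi Fs (snd v)}"

lemma pcomb_dofs: "u \<in> dofs k \<Longrightarrow> v \<in> dofs k \<Longrightarrow> pcomb u c v \<in> dofs k"
  by (simp add: dofs_def pcomb_def polys_comb fsqi_comb)

lemma dofs_face: "u \<in> dofs k \<Longrightarrow> F \<in> Fs \<Longrightarrow> face_sqi F (snd u)"
  by (simp add: dofs_def fsqi_def)

lemma inner_vec:
  assumes "\<And>i. i \<in> Basis \<Longrightarrow> sqi L (\<lambda>x. G x \<bullet> i)" "s \<in> vec_polys k"
  shows "l2_inner L G s = (\<Sum>i\<in>Basis. l2_inner L (\<lambda>x. G x \<bullet> i) (\<lambda>x. s x \<bullet> i))"
  unfolding l2_inner_def
  by (subst euclidean_inner, subst Bochner_Integration.integral_sum)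
     (auto intro!: sqi_mult assms(1) polys_sqi_T[OF vec_polys_component[OF assms(2)]])

lemma flux_components:
  assumes g: "fsqi Fs g" and F: "F \<in> Fs" and s: "s \<in> vec_polys k"
  shows "face_inner F g (\<lambda>x. s x \<bullet> nrm F) = (\<Sum>i\<in>Basis. (nrm F \<bullet> i) * face_inner F g (\<lambda>x. s x \<bullet> i))"
proof -
  have "face_inner F g (\<lambda>x. s x \<bullet> nrm F) = (\<integral>x. (\<Sum>i\<in>Basis. (nrm F \<bullet> i) * (g x * (s x \<bullet> i))) \<partial>face_measure F)"
    unfolding l2_inner_def
    by (subst euclidean_inner) (simp add: sum_distrib_left mult_ac)
  also have "\<dots> = (\<Sum>i\<in>Basis. \<integral>x. (nrm F \<bullet> i) * (g x * (s x \<bullet> i)) \<partial>face_measure F)"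
    by (intro Bochner_Integration.integral_sum integrable_mult_right sqi_mult fsqi_face[OF g F] fam.polys_sqi[OF F vec_polys_component[OF s]])
  finally show ?thesis by (simp add: l2_inner_def)
qed

lemma green_vec:
  assumes tr: "is_trace T Fs v g" and v: "sqi L v" and w: "\<And>i. i \<in> Basis \<Longrightarrow> weakly T {#i#} v (w i)"
    and s: "s \<in> vec_polys k"
  shows "(\<Sum>i\<in>Basis. l2_inner L (w i) (\<lambda>x. s x \<bullet> i)) + l2_inner L v (vdiv s)
    = (\<Sum>F\<in>Fs. face_inner F g (\<lambda>x. s x \<bullet> nrm F))"
proof -
  note sm = smooth_polys[OF vec_polys_component[OF s]]
  have "l2_inner L v (vdiv s) = (\<Sum>i\<in>Basis. l2_inner L v (pdiff i (\<lambda>x. s x \<bullet> i)))"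
    unfolding l2_inner_def vdiv_def inner_real_def sum_distrib_left
    by (intro Bochner_Integration.integral_sum sqi_mult v smooth_T smooth_pdiff sm)
  then have "(\<Sum>i\<in>Basis. l2_inner L (w i) (\<lambda>x. s x \<bullet> i)) + l2_inner L v (vdiv s)
      = (\<Sum>i\<in>Basis. \<Sum>F\<in>Fs. (nrm F \<bullet> i) * face_inner F g (\<lambda>x. s x \<bullet> i))"
    using green_trace[OF tr v w sm] by (simp add: sum.distrib[symmetric])
  also have "\<dots> = (\<Sum>F\<in>Fs. \<Sum>i\<in>Basis. (nrm F \<bullet> i) * face_inner F g (\<lambda>x. s x \<bullet> i))"
    by (rule sum.swap)
  also have "\<dots> = (\<Sum>F\<in>Fs. face_inner F g (\<lambda>x. s x \<bullet> nrm F))"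
    using flux_components[OF trace_fsqi[OF tr] _ s] by simp
  finally show ?thesis .
qed

section \<open>The gradient reconstruction\<close>

definition grad_functional :: "('a \<Rightarrow> real) \<times> ('a \<Rightarrow> real) \<Rightarrow> ('a \<Rightarrow> 'a) \<Rightarrow> real" where
  "grad_functional u s = l2_inner L (grad (fst u)) s +
       (\<Sum>F\<in>Fs. face_inner F (\<lambda>x. snd u x - fst u x) (\<lambda>x. s x \<bullet> nrm F))"

text \<open>Integrated by parts, the functional sees the cell part only through moments against
  divergences and the face part only through normal moments. The projectors preserve both, which is
  why reconstruction commutes with interpolation.\<close>

lemma grad_functional_eq:
  assumes u: "u \<in> dofs k" and s: "s \<in> vec_polys j"
  shows "grad_functional u s = (\<Sum>F\<in>Fs. face_inner F (snd u) (\<lambda>x. s x \<bullet> nrm F)) - l2_inner L (fst u) (vdiv s)"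
proof -
  have p: "fst u \<in> polys k" using u by (simp add: dofs_def)
  note sm = smooth_polys[OF p]
  have "(\<Sum>i\<in>Basis. l2_inner L (pdiff i (fst u)) (\<lambda>x. s x \<bullet> i)) + l2_inner L (fst u) (vdiv s)
    = (\<Sum>F\<in>Fs. face_inner F (fst u) (\<lambda>x. s x \<bullet> nrm F))"
    by (rule green_vec[OF smooth_trace[OF sm] smooth_T[OF sm] weakly_smooth[OF T(1,3) sm] s])
  moreover have "l2_inner L (grad (fst u)) s = (\<Sum>i\<in>Basis. l2_inner L (\<lambda>x. grad (fst u) x \<bullet> i) (\<lambda>x. s x \<bullet> i))"
    by (rule inner_vec[OF _ s]) (simp add: grad_inner smooth_T smooth_pdiff sm)
  moreover have "\<dots> = (\<Sum>i\<in>Basis. l2_inner L (pdiff i (fst u)) (\<lambda>x. s x \<bullet> i))"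
    by (intro sum.cong refl) (simp add: grad_inner)
  moreover have "face_inner F (\<lambda>x. snd u x - fst u x) (\<lambda>x. s x \<bullet> nrm F) =
    face_inner F (snd u) (\<lambda>x. s x \<bullet> nrm F) - face_inner F (fst u) (\<lambda>x. s x \<bullet> nrm F)" if "F \<in> Fs" for F
    by (intro l2_inner_diff_left dofs_face[OF u that] fam.polys_sqi[OF that p] fam.polys_sqi[OF that vec_polys_component[OF s]])
  ultimately show ?thesis by (simp add: grad_functional_def sum_subtractf)
qed

lemma grad_functional_comb_right:
  assumes u: "u \<in> dofs k" and s: "\<sigma> \<in> vec_polys j" "s \<in> vec_polys j"
  shows "grad_functional u (\<lambda>x. \<sigma> x + c *\<^sub>R s x) = grad_functional u \<sigma> + c * grad_functional u s"
proof -
  have p: "fst u \<in> polys k" using u by (simp add: dofs_def)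
  have g: "sqi L (grad (fst u))"
    by (intro continuous_sqi_T smooth_continuous_grad smooth_polys[OF p])
  have "l2_inner L (grad (fst u)) (\<lambda>x. \<sigma> x + c *\<^sub>R s x) = l2_inner L (grad (fst u)) \<sigma> + c * l2_inner L (grad (fst u)) s"
    using l2_inner_comb[OF vec_polys_sqi[OF s(1)] vec_polys_sqi[OF s(2)] g, of c] by (simp only: l2_inner_commute)
  moreover have "face_inner F (\<lambda>x. snd u x - fst u x) (\<lambda>x. (\<sigma> x + c *\<^sub>R s x) \<bullet> nrm F) =
    face_inner F (\<lambda>x. snd u x - fst u x) (\<lambda>x. \<sigma> x \<bullet> nrm F) + c * face_inner F (\<lambda>x. snd u x - fst u x) (\<lambda>x. s x \<bullet> nrm F)"
    if F: "F \<in> Fs" for F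
    using l2_inner_comb[OF fam.polys_sqi[OF F vec_polys_component[OF s(1)]] fam.polys_sqi[OF F vec_polys_component[OF s(2)]]
        sqi_diff[OF dofs_face[OF u F] fam.polys_sqi[OF F p]], of "nrm F" c "nrm F"]
    by (simp add: l2_inner_commute[of _ "\<lambda>x. snd u x - fst u x"] inner_add_left)
  ultimately show ?thesis
    by (simp add: grad_functional_def sum.distrib sum_distrib_left algebra_simps)
qed

lemma grad_functional_comb_left:
  assumes u: "u \<in> dofs k" "v \<in> dofs k" and s: "s \<in> vec_polys j"
  shows "grad_functional (pcomb u c v) s = grad_functional u s + c * grad_functional v s"
proof -
  have p: "fst u \<in> polys k" "fst v \<in> polys k" using u by (auto simp: dofs_def)
  have "l2_inner L (\<lambda>x. fst u x + c * fst v x) (vdiv s) = l2_inner L (fst u) (vdiv s) + c * l2_inner L (fst v) (vdiv s)"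
    using l2_inner_comb[OF polys_sqi_T[OF p(1)] polys_sqi_T[OF p(2)] polys_sqi_T[OF vdiv_polys[OF s]], of c] by simp
  moreover have "face_inner F (\<lambda>x. snd u x + c * snd v x) (\<lambda>x. s x \<bullet> nrm F) =
      face_inner F (snd u) (\<lambda>x. s x \<bullet> nrm F) + c * face_inner F (snd v) (\<lambda>x. s x \<bullet> nrm F)" if F: "F \<in> Fs" for F
    using l2_inner_comb[OF dofs_face[OF u(1) F] dofs_face[OF u(2) F] fam.polys_sqi[OF F vec_polys_component[OF s]], of c] by simp
  ultimately show ?thesis
    unfolding grad_functional_eq[OF pcomb_dofs[OF u] s] grad_functional_eq[OF u(1) s] grad_functional_eq[OF u(2) s]
    by (simp add: pcomb_def sum.distrib sum_distrib_left algebra_simps)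
qed

text \<open>The scalar Riesz lemma is applied to each Cartesian component, and the components are
  reassembled into \<open>G\<close>.\<close>

lemma grad_rec_ex:
  assumes u: "u \<in> dofs k"
  shows "\<exists>!G. G \<in> vec_polys j \<and> (\<forall>s\<in>vec_polys j. l2_inner L G s = grad_functional u s)"
proof -
  have "\<exists>p\<in>polys j. \<forall>q\<in>polys j. l2_inner L p q = grad_functional u (\<lambda>x. q x *\<^sub>R i)" if i: "i \<in> Basis" for i
  proof (rule polys_riesz[OF semi_inner_polys])
    have v: "(\<lambda>x. p x *\<^sub>R i) \<in> vec_polys j" if "p \<in> polys j" for p
      using that i by (auto simp: vec_polys_def inner_Basis polys_zero)
    show "grad_functional u (\<lambda>x. (p x + c * q x) *\<^sub>R i) = grad_functional u (\<lambda>x. p x *\<^sub>R i) + c * grad_functional u (\<lambda>x. q x *\<^sub>R i)"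
      if "p \<in> polys j" "q \<in> polys j" for p q c
      using grad_functional_comb_right[OF u v v, of p q c] that by (simp add: scaleR_left_distrib)
    show "grad_functional u (\<lambda>x. p x *\<^sub>R i) = 0" if "p \<in> polys j" "l2_inner L p p = 0" for p
      using poly_null[OF that] by (simp add: grad_functional_def l2_inner_def)
  qed
  then obtain P where P: "\<And>i. i \<in> Basis \<Longrightarrow> P i \<in> polys j"
    "\<And>i q. i \<in> Basis \<Longrightarrow> q \<in> polys j \<Longrightarrow> l2_inner L (P i) q = grad_functional u (\<lambda>x. q x *\<^sub>R i)" by metis
  define G where "G x = (\<Sum>i\<in>Basis. P i x *\<^sub>R i)" for x
  have G: "G \<in> vec_polys j" unfolding G_def by (rule vec_polys_sum[OF P(1)])
  have "l2_inner L G s = grad_functional u s" if s: "s \<in> vec_polys j" for s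
  proof -
    have "(\<lambda>x. \<Sum>i\<in>I. (s x \<bullet> i) *\<^sub>R i) \<in> vec_polys j \<and> grad_functional u (\<lambda>x. \<Sum>i\<in>I. (s x \<bullet> i) *\<^sub>R i)
        = (\<Sum>i\<in>I. grad_functional u (\<lambda>x. (s x \<bullet> i) *\<^sub>R i))" if "finite I" "I \<subseteq> Basis" for I
      using that
    proof (induction I)
      case (insert i I)
      have v: "(\<lambda>x. (s x \<bullet> i) *\<^sub>R i) \<in> vec_polys j"
        using insert s by (auto simp: vec_polys_def inner_Basis polys_zero)
      then show ?case
        using insert grad_functional_comb_right[OF u v, of "\<lambda>x. \<Sum>i\<in>I. (s x \<bullet> i) *\<^sub>R i" 1]
          vec_polys_comb[OF v, of "\<lambda>x. \<Sum>i\<in>I. (s x \<bullet> i) *\<^sub>R i" 1] by simp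
    qed (simp add: vec_polys_def polys_zero grad_functional_def l2_inner_def)
    from this[OF finite_Basis] have "(\<Sum>i\<in>Basis. grad_functional u (\<lambda>x. (s x \<bullet> i) *\<^sub>R i)) = grad_functional u s"
      by (simp add: euclidean_representation)
    moreover have "l2_inner L G s = (\<Sum>i\<in>Basis. l2_inner L (P i) (\<lambda>x. s x \<bullet> i))"
      using P(1) by (subst inner_vec[OF _ s])
        (auto simp: G_def inner_sum_left inner_Basis if_distrib sum.delta intro: polys_sqi_T cong: if_cong)
    ultimately show ?thesis using P(2) vec_polys_component[OF s] by simp
  qed
  then have "\<exists>G\<in>vec_polys j. \<forall>s\<in>vec_polys j. l2_inner L G s = grad_functional u s" using G by blast
  moreover have "G = H" if "G \<in> vec_polys j" "H \<in> vec_polys j" "\<forall>s\<in>vec_polys j. l2_inner L G s = grad_functional u s"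
    "\<forall>s\<in>vec_polys j. l2_inner L H s = grad_functional u s" for G H
  proof -
    have d: "(\<lambda>x. G x - H x) \<in> vec_polys j" using vec_polys_comb[OF that(1,2), of "-1"] by simp
    have "l2_inner L (\<lambda>x. G x - H x) (\<lambda>x. G x - H x) = 0"
      using that d by (subst l2_inner_diff_left) (auto intro: vec_polys_sqi)
    from vec_poly_null[OF d this] show ?thesis by (simp add: fun_eq_iff)
  qed
  ultimately show ?thesis by blast
qed

lemma grad_rec_def':
  "grad_rec k T Fs u = (THE G. G \<in> vec_polys k \<and> (\<forall>s\<in>vec_polys k. l2_inner L G s = grad_functional u s))"
  by (cases u) (simp add: grad_functional_def)

lemma grad_rec_vec_polys: "u \<in> dofs k \<Longrightarrow> grad_rec k T Fs u \<in> vec_polys k"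
  and grad_rec_inner: "u \<in> dofs k \<Longrightarrow> s \<in> vec_polys k \<Longrightarrow> l2_inner L (grad_rec k T Fs u) s = grad_functional u s"
  unfolding grad_rec_def' using theI'[OF grad_rec_ex[of u k k]] by blast+

lemma grad_rec_eqI:
  "u \<in> dofs k \<Longrightarrow> G \<in> vec_polys k \<Longrightarrow> (\<And>s. s \<in> vec_polys k \<Longrightarrow> l2_inner L G s = grad_functional u s) \<Longrightarrow> grad_rec k T Fs u = G"
  unfolding grad_rec_def' using grad_rec_ex[of u k k] by (intro the1_equality) auto

lemma grad_rec_sqi: "u \<in> dofs k \<Longrightarrow> sqi L (grad_rec k T Fs u)"
  using vec_polys_sqi grad_rec_vec_polys by blast

lemma grad_rec_comb:
  assumes u: "u \<in> dofs k" "v \<in> dofs k"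
  shows "grad_rec k T Fs (pcomb u c v) = (\<lambda>x. grad_rec k T Fs u x + c *\<^sub>R grad_rec k T Fs v x)"
proof (rule grad_rec_eqI[OF pcomb_dofs[OF u] vec_polys_comb[OF grad_rec_vec_polys[OF u(1)] grad_rec_vec_polys[OF u(2)]]])
  fix s :: "'a \<Rightarrow> 'a" assume s: "s \<in> vec_polys k"
  show "l2_inner L (\<lambda>x. grad_rec k T Fs u x + c *\<^sub>R grad_rec k T Fs v x) s = grad_functional (pcomb u c v) s"
    by (simp add: l2_inner_comb grad_rec_sqi u vec_polys_sqi[OF s] grad_rec_inner[OF _ s] grad_functional_comb_left[OF u s])
qed

section \<open>The potential reconstruction\<close>

lemma grad_sqi: "p \<in> polys k \<Longrightarrow> sqi L (grad p)"
  by (intro continuous_sqi_T smooth_continuous_grad smooth_polys)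

lemma semi_inner_grad: "semi_inner (polys k) (\<lambda>u c v x. u x + c * v x) (\<lambda>p q. l2_inner L (grad p) (grad q))"
proof
  fix u v w :: "'a \<Rightarrow> real" and c assume a: "u \<in> polys k" "v \<in> polys k" "w \<in> polys k"
  have e: "grad (\<lambda>x. u x + c * v x) = (\<lambda>x. grad u x + c *\<^sub>R grad v x)"
    using grad_comb[OF smooth_polys[OF a(1)] smooth_polys[OF a(2)]] by blast
  show "l2_inner L (grad (\<lambda>x. u x + c * v x)) (grad w) = l2_inner L (grad u) (grad w) + c * l2_inner L (grad v) (grad w)"
    unfolding e by (rule l2_inner_comb[OF grad_sqi[OF a(1)] grad_sqi[OF a(2)] grad_sqi[OF a(3)]])
qed (auto intro: polys_comb l2_inner_commute l2_inner_nonneg)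

lemma grad_const: "grad (\<lambda>_. c :: real) = (\<lambda>_. 0 :: 'a)"
  by (simp add: grad_def fun_eq_iff)

lemma measure_pos: "0 < measure lebesgue T"
proof -
  have "measure lebesgue T \<noteq> 0"
    using T(1,4) lmeasurable_open[OF T(3,1)] open_not_negligible[OF T(1,4)] negligible_iff_measure by blast
  then show ?thesis using measure_nonneg[of lebesgue T] by linarith
qed

lemma integral_const: "(\<integral>x. (c :: real) \<partial>L) = c * measure lebesgue T"
  using TL by (simp add: measure_restrict_space space_restrict_space)

lemma poly_integrable: "p \<in> polys k \<Longrightarrow> integrable L p"
  by (intro sqi_integrable[OF finite_T] polys_sqi_T)

lemma pot_rec_ex:
  assumes u: "u \<in> dofs k"
  shows "\<exists>!p. p \<in> polys (k+1) \<and>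
     (\<forall>w\<in>polys (k+1). l2_inner L (grad p) (grad w) = l2_inner L (grad_rec k T Fs u) (grad w)) \<and>
     (\<integral>x. p x \<partial>L) = (\<integral>x. fst u x \<partial>L)"
proof -
  let ?G = "grad_rec k T Fs u"
  have l: "l2_inner L ?G (grad (\<lambda>x. p x + c * q x)) = l2_inner L ?G (grad p) + c * l2_inner L ?G (grad q)"
    if "p \<in> polys (k+1)" "q \<in> polys (k+1)" for p q c
  proof -
    have "grad (\<lambda>x. p x + c * q x) = (\<lambda>x. grad p x + c *\<^sub>R grad q x)"
      using grad_comb[OF smooth_polys[OF that(1)] smooth_polys[OF that(2)]] by blast
    then show ?thesis
      using l2_inner_comb[OF grad_sqi[OF that(1)] grad_sqi[OF that(2)] grad_rec_sqi[OF u]] by (simp only: l2_inner_commute)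
  qed
  have "\<exists>p\<in>polys (k+1). \<forall>w\<in>polys (k+1). l2_inner L (grad p) (grad w) = l2_inner L ?G (grad w)"
  proof (rule polys_riesz[where l = "\<lambda>w. l2_inner L ?G (grad w)", OF semi_inner_grad l])
    fix w :: "'a \<Rightarrow> real" assume "w \<in> polys (k+1)" "l2_inner L (grad w) (grad w) = 0"
    then obtain c where "w = (\<lambda>_. c)" using grad_null by blast
    then show "l2_inner L ?G (grad w) = 0" by (simp add: grad_const l2_inner_def)
  qed
  then obtain p where p: "p \<in> polys (k+1)" "\<And>w. w \<in> polys (k+1) \<Longrightarrow> l2_inner L (grad p) (grad w) = l2_inner L ?G (grad w)"
    by blast
  \<comment> \<open>The gradient form determines \<open>p\<close> up to a constant, and the mean
    value condition fixes it.\<close>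
  define c where "c = ((\<integral>x. fst u x \<partial>L) - (\<integral>x. p x \<partial>L)) / measure lebesgue T"
  define p' where "p' x = p x + c * 1" for x
  have p': "p' \<in> polys (k+1)" unfolding p'_def[abs_def] by (intro polys_comb p const_polys)
  have gp: "grad p' = grad p"
    unfolding p'_def[abs_def] using grad_comb[OF smooth_polys[OF p(1)] smooth_const, of c 1] by (simp add: grad_const fun_eq_iff)
  have "(\<integral>x. p' x \<partial>L) = (\<integral>x. p x \<partial>L) + c * measure lebesgue T"
    unfolding p'_def integral_const[symmetric] using poly_integrable[OF p(1)] poly_integrable[OF const_polys] by simp
  then have ip: "(\<integral>x. p' x \<partial>L) = (\<integral>x. fst u x \<partial>L)"
    using measure_pos by (simp add: c_def)
  have uniq: "q = r" if q: "q \<in> polys (k+1)" "\<forall>w\<in>polys (k+1). l2_inner L (grad q) (grad w) = l2_inner L ?G (grad w)"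
      "(\<integral>x. q x \<partial>L) = (\<integral>x. fst u x \<partial>L)"
    and r: "r \<in> polys (k+1)" "\<forall>w\<in>polys (k+1). l2_inner L (grad r) (grad w) = l2_inner L ?G (grad w)"
      "(\<integral>x. r x \<partial>L) = (\<integral>x. fst u x \<partial>L)" for q r
  proof -
    have d: "(\<lambda>x. q x + (-1) * r x) \<in> polys (k+1)" by (rule polys_comb[OF q(1) r(1)])
    have "l2_inner L (grad (\<lambda>x. q x + (-1) * r x)) (grad (\<lambda>x. q x + (-1) * r x)) = 0"
      using semi_inner.form_comb[OF semi_inner_grad q(1) r(1) d, of "-1"] q(2) r(2) d by simp
    then obtain e where "(\<lambda>x. q x + (-1) * r x) = (\<lambda>_. e)" using grad_null[OF d] by blast
    then have e: "(\<lambda>x. q x - r x) = (\<lambda>_. e)" by simp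
    have "(\<integral>x. q x - r x \<partial>L) = 0" using q(3) r(3) poly_integrable[OF q(1)] poly_integrable[OF r(1)] by simp
    then have "e * measure lebesgue T = 0" unfolding e integral_const .
    then have "e = 0" using measure_pos by simp
    then show ?thesis using e by (simp add: fun_eq_iff)
  qed
  show ?thesis
    using p' gp p(2) ip by (intro ex1I[of _ p'] uniq) auto
qed

lemma pot_rec_def': "pot_rec k T Fs u = (THE p. p \<in> polys (k+1) \<and>
     (\<forall>w\<in>polys (k+1). l2_inner L (grad p) (grad w) = l2_inner L (grad_rec k T Fs u) (grad w)) \<and>
     (\<integral>x. p x \<partial>L) = (\<integral>x. fst u x \<partial>L))"
  by (cases u) simp

lemma pot_rec_polys: "u \<in> dofs k \<Longrightarrow> pot_rec k T Fs u \<in> polys (k+1)"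
  and pot_rec_inner: "u \<in> dofs k \<Longrightarrow> w \<in> polys (k+1) \<Longrightarrow>
    l2_inner L (grad (pot_rec k T Fs u)) (grad w) = l2_inner L (grad_rec k T Fs u) (grad w)"
  and pot_rec_integral: "u \<in> dofs k \<Longrightarrow> (\<integral>x. pot_rec k T Fs u x \<partial>L) = (\<integral>x. fst u x \<partial>L)"
  unfolding pot_rec_def' using theI'[OF pot_rec_ex[of u k]] by blast+

lemma pot_rec_eqI:
  "u \<in> dofs k \<Longrightarrow> p \<in> polys (k+1) \<Longrightarrow>
   (\<And>w. w \<in> polys (k+1) \<Longrightarrow> l2_inner L (grad p) (grad w) = l2_inner L (grad_rec k T Fs u) (grad w)) \<Longrightarrow>
   (\<integral>x. p x \<partial>L) = (\<integral>x. fst u x \<partial>L) \<Longrightarrow> pot_rec k T Fs u = p"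
  unfolding pot_rec_def' using pot_rec_ex[of u k] by (intro the1_equality) auto

lemma pot_rec_comb:
  assumes u: "u \<in> dofs k" "v \<in> dofs k"
  shows "pot_rec k T Fs (pcomb u c v) = (\<lambda>x. pot_rec k T Fs u x + c * pot_rec k T Fs v x)"
proof (rule pot_rec_eqI[OF pcomb_dofs[OF u] polys_comb[OF pot_rec_polys[OF u(1)] pot_rec_polys[OF u(2)]]])
  fix w :: "'a \<Rightarrow> real" assume w: "w \<in> polys (k+1)"
  show "l2_inner L (grad (\<lambda>x. pot_rec k T Fs u x + c * pot_rec k T Fs v x)) (grad w) = l2_inner L (grad_rec k T Fs (pcomb u c v)) (grad w)"
    using semi_inner.form_comb[OF semi_inner_grad pot_rec_polys[OF u(1)] pot_rec_polys[OF u(2)] w, of c]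
      l2_inner_comb[OF grad_rec_sqi[OF u(1)] grad_rec_sqi[OF u(2)] grad_sqi[OF w], of c]
    by (simp add: grad_rec_comb[OF u] pot_rec_inner[OF u(1) w] pot_rec_inner[OF u(2) w])
next
  have i: "integrable L (pot_rec k T Fs u)" "integrable L (pot_rec k T Fs v)" "integrable L (fst u)" "integrable L (fst v)"
    using pot_rec_polys[OF u(1)] pot_rec_polys[OF u(2)] u by (auto intro: poly_integrable simp: dofs_def)
  then show "(\<integral>x. pot_rec k T Fs u x + c * pot_rec k T Fs v x \<partial>L) = (\<integral>x. fst (pcomb u c v) x \<partial>L)"
    by (simp add: pcomb_def pot_rec_integral u)
qed

section \<open>Stabilization and the local bilinear form\<close>

definition jump :: "nat \<Rightarrow> ('a \<Rightarrow> real) \<times> ('a \<Rightarrow> real) \<Rightarrow> 'a \<Rightarrow> real" where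
  "jump k u x = delta_faces k T Fs u x - delta_elem k T Fs u x"

lemma jump_eq: "jump k u x = (snd u x - fst u x) - (faces_proj k Fs (pot_rec k T Fs u) x - elem_proj k T (pot_rec k T Fs u) x)"
  by (simp add: jump_def delta_faces_def delta_elem_def)

lemma pot_rec_fsqi: "u \<in> dofs k \<Longrightarrow> fsqi Fs (pot_rec k T Fs u)"
  using smooth_fsqi smooth_polys pot_rec_polys by blast

lemma pot_rec_sqi: "u \<in> dofs k \<Longrightarrow> sqi L (pot_rec k T Fs u)"
  using polys_sqi_T pot_rec_polys by blast

lemma jump_fsqi:
  assumes u: "u \<in> dofs k" shows "fsqi Fs (jump k u)"
proof -
  have "fsqi Fs (fst u)" "fsqi Fs (snd u)" using u smooth_fsqi smooth_polys by (auto simp: dofs_def)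
  moreover have "fsqi Fs (elem_proj k T (pot_rec k T Fs u))"
    using smooth_fsqi smooth_polys elem_proj_polys[OF pot_rec_sqi[OF u]] by blast
  ultimately show ?thesis
    unfolding jump_eq[abs_def] by (intro fsqi_diff fam.faces_proj_fsqi pot_rec_fsqi u)
qed

lemma jump_comb:
  assumes u: "u \<in> dofs k" "v \<in> dofs k" and x: "F \<in> Fs" "x \<in> F"
  shows "jump k (pcomb u c v) x = jump k u x + c * jump k v x"
  unfolding jump_eq pot_rec_comb[OF u] fam.faces_proj_comb[OF pot_rec_fsqi[OF u(1)] pot_rec_fsqi[OF u(2)] x]
    elem_proj_comb[OF pot_rec_sqi[OF u(1)] pot_rec_sqi[OF u(2)]]
  by (simp add: pcomb_def algebra_simps)

lemma diameter_nonneg: "0 \<le> diameter T"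
  using diameter_ge_0[OF T(3)] .

lemma stab_form_eq: "stab_form k T Fs u v = real k / diameter T * faces_inner Fs (jump k u) (jump k v)"
  by (simp add: stab_form_def jump_def[abs_def])

lemma semi_inner_stab: "semi_inner (dofs k) pcomb (stab_form k T Fs)"
proof
  fix u v w c assume a: "u \<in> dofs k" "v \<in> dofs k" "w \<in> dofs k"
  have "faces_inner Fs (jump k (pcomb u c v)) (jump k w) = faces_inner Fs (\<lambda>x. jump k u x + c * jump k v x) (jump k w)"
    by (intro fam.faces_inner_cong jump_comb[OF a(1,2)]) auto
  also have "\<dots> = faces_inner Fs (jump k u) (jump k w) + c * faces_inner Fs (jump k v) (jump k w)"
    by (intro faces_inner_comb jump_fsqi a)
  finally show "stab_form k T Fs (pcomb u c v) w = stab_form k T Fs u w + c * stab_form k T Fs v w"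
    by (simp add: stab_form_eq distrib_left)
next
  fix u v assume "u \<in> dofs k" "v \<in> dofs k"
  show "stab_form k T Fs u v = stab_form k T Fs v u" by (simp add: stab_form_eq faces_inner_commute)
  show "0 \<le> stab_form k T Fs u u" using diameter_nonneg by (simp add: stab_form_eq faces_inner_nonneg)
qed (auto intro: pcomb_dofs)

lemma semi_inner_local: "semi_inner (dofs k) pcomb (local_form k T Fs)"
proof -
  interpret s: semi_inner "dofs k" pcomb "stab_form k T Fs" by (rule semi_inner_stab)
  show ?thesis
  proof
    fix u v w c assume a: "u \<in> dofs k" "v \<in> dofs k" "w \<in> dofs k"
    show "local_form k T Fs (pcomb u c v) w = local_form k T Fs u w + c * local_form k T Fs v w"
      unfolding local_form_def grad_rec_comb[OF a(1,2)] s.form_comb[OF a]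
      by (simp add: l2_inner_comb grad_rec_sqi a algebra_simps)
  next
    fix u v assume a: "u \<in> dofs k" "v \<in> dofs k"
    show "local_form k T Fs u v = local_form k T Fs v u"
      by (simp add: local_form_def s.form_commute[OF a] l2_inner_commute)
    show "0 \<le> local_form k T Fs u u"
      by (simp add: local_form_def s.form_nonneg[OF a(1)] l2_inner_nonneg)
  qed (auto intro: pcomb_dofs)
qed

lemma stab_le_local: "stab_form k T Fs u u \<le> local_form k T Fs u u"
  and grad_rec_le_local: "(l2_norm L (grad_rec k T Fs u))\<^sup>2 \<le> local_form k T Fs u u"
  using diameter_nonneg
  by (simp_all add: local_form_def l2_inner_nonneg l2_norm_sq stab_form_eq faces_inner_nonneg)

section \<open>Definiteness on cell unknowns and the local lift\<close>

lemma diameter_T_pos: "0 < diameter T"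
proof -
  obtain a r where r: "0 < r" "ball a r \<subseteq> T" using T(1,4) openE by (metis all_not_in_conv)
  have "2 * r = diameter (ball a r)" using r(1) by simp
  also have "\<dots> \<le> diameter T" using r(2) T(3) by (rule diameter_subset)
  finally show ?thesis using r(1) by linarith
qed

text \<open>If the energy vanishes, the potential is constant, so on the faces the jump is
  \<open>- w\<close> and \<open>w\<close> vanishes there. Testing the reconstructed gradient with
  \<open>grad w\<close> then makes \<open>w\<close> constant.\<close>

lemma cell_definite:
  assumes k: "1 \<le> k" and w: "w \<in> polys k" and z: "local_form k T Fs (w, \<lambda>_. 0) (w, \<lambda>_. 0) = 0"
  shows "w = (\<lambda>_. 0)"
proof -
  let ?u = "(w, \<lambda>_. 0 :: real)"
  have "face_sqi F (\<lambda>_. 0 :: real)" for F :: "'a set" by (rule sqi_zero)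
  then have u: "?u \<in> dofs k" using w by (simp add: dofs_def fsqi_def)
  have "l2_inner L (grad_rec k T Fs ?u) (grad_rec k T Fs ?u) = 0" "stab_form k T Fs ?u ?u = 0"
    using z l2_inner_nonneg[of L "grad_rec k T Fs ?u"] semi_inner.form_nonneg[OF semi_inner_stab u]
    unfolding local_form_def by linarith+
  then have G0: "grad_rec k T Fs ?u = (\<lambda>_. 0)" and j0: "faces_inner Fs (jump k ?u) (jump k ?u) = 0"
    using vec_poly_null[OF grad_rec_vec_polys[OF u]] k diameter_T_pos by (simp_all add: stab_form_eq)
  have "l2_inner L (grad (pot_rec k T Fs ?u)) (grad (pot_rec k T Fs ?u)) = 0"
    unfolding pot_rec_inner[OF u pot_rec_polys[OF u]] G0 by (simp add: l2_inner_def)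
  then obtain c where c: "pot_rec k T Fs ?u = (\<lambda>_. c)" using grad_null[OF pot_rec_polys[OF u]] by blast
  have "jump k ?u x = - w x" if "F \<in> Fs" "x \<in> F" for F x
    unfolding jump_eq c elem_proj_id[OF const_polys] fam.faces_proj_id[OF polys_face_polys[OF const_polys] that] by simp
  then have "faces_inner Fs (jump k ?u) (jump k ?u) = faces_inner Fs w w"
    by (subst fam.faces_inner_cong[of "jump k ?u" "\<lambda>x. - w x" "jump k ?u" "\<lambda>x. - w x"])
       (auto simp: faces_inner_def l2_inner_def)
  then have "faces_inner Fs w w = 0" using j0 by simp
  then have "\<forall>F\<in>Fs. face_inner F w w = 0"
    unfolding faces_inner_def using Fs(1) by (subst (asm) sum_nonneg_eq_0_iff) (auto simp: l2_inner_nonneg)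
  then have w0: "w x = 0" if "F \<in> Fs" "x \<in> F" for F x
    using fam.face_poly_null[OF that(1) w _ that(2)] that(1) by blast
  have "grad_functional ?u (grad w) = 0"
    using grad_rec_inner[OF u grad_vec_polys, of w] polys_mono[OF w, of "k+1"] unfolding G0 by (simp add: l2_inner_def)
  moreover have "face_inner F (\<lambda>x. 0 - w x) (\<lambda>x. grad w x \<bullet> nrm F) = 0" if F: "F \<in> Fs" for F
    by (subst fam.face_inner_cong[OF F, of _ "\<lambda>_. 0" _ "\<lambda>x. grad w x \<bullet> nrm F"]) (auto simp: w0[OF F] l2_inner_def)
  ultimately have "l2_inner L (grad w) (grad w) = 0" by (simp add: grad_functional_def)
  then obtain e where e: "w = (\<lambda>_. e)" using grad_null[OF w] by blast
  \<comment> \<open>The identity field, admissible because \<open>1 \<le> k\<close>, has the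
    dimension as its divergence; tested with it, a constant cell function and zero face values leave
    \<open>e\<close> times dimension times volume, up to sign.\<close>
  have idv: "(\<lambda>x :: 'a. x) \<in> vec_polys k" by (simp add: vec_polys_def inner_polys[OF k])
  have "vdiv (\<lambda>x :: 'a. x) = (\<lambda>_. real DIM('a))"
    by (simp add: vdiv_def fun_eq_iff pdiff_inner_const)
  then have "e * (real DIM('a) * measure lebesgue T) = 0"
    using grad_rec_inner[OF u idv] grad_functional_eq[OF u idv] integral_const[of "e * real DIM('a)"]
    unfolding G0 by (auto simp: l2_inner_def e)
  then have "e = 0" using measure_pos by simp
  then show ?thesis using e by simp
qed

lemma dofs_cell: "w \<in> polys k \<Longrightarrow> (w, \<lambda>_. 0) \<in> dofs k"
  and dofs_face_part: "fsqi Fs \<nu> \<Longrightarrow> (\<lambda>_. 0, \<nu>) \<in> dofs k"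
  by (auto simp: dofs_def fsqi_def polys_zero intro: sqi_zero)

lemma local_lift_ex:
  assumes k: "1 \<le> k" and \<nu>: "fsqi Fs \<nu>"
  shows "\<exists>!w. w \<in> polys k \<and> (\<forall>v\<in>polys k.
     local_form k T Fs (w, \<lambda>_. 0) (v, \<lambda>_. 0) = - local_form k T Fs (\<lambda>_. 0, \<nu>) (v, \<lambda>_. 0))"
proof -
  interpret a: semi_inner "dofs k" pcomb "local_form k T Fs" by (rule semi_inner_local)
  have cell: "((\<lambda>x. p x + c * q x), \<lambda>_. 0 :: real) = pcomb (p, \<lambda>_. 0) c (q, \<lambda>_. 0)" for p q :: "'a \<Rightarrow> real" and c
    by (simp add: pcomb_def)
  note z = dofs_face_part[OF \<nu>, of k]
  have l: "- local_form k T Fs (\<lambda>_. 0, \<nu>) (\<lambda>x. p x + c * q x, \<lambda>_. 0)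
      = - local_form k T Fs (\<lambda>_. 0, \<nu>) (p, \<lambda>_. 0) + c * (- local_form k T Fs (\<lambda>_. 0, \<nu>) (q, \<lambda>_. 0))"
    if "p \<in> polys k" "q \<in> polys k" for p q c
    unfolding cell a.form_comb_right[OF dofs_cell[OF that(1)] dofs_cell[OF that(2)] z] by simp
  have B: "semi_inner (polys k) (\<lambda>u c v x. u x + c * v x) (\<lambda>p q. local_form k T Fs (p, \<lambda>_. 0) (q, \<lambda>_. 0))"
  proof
    fix u v w :: "'a \<Rightarrow> real" and c assume h: "u \<in> polys k" "v \<in> polys k" "w \<in> polys k"
    show "local_form k T Fs (\<lambda>x. u x + c * v x, \<lambda>_. 0) (w, \<lambda>_. 0)
        = local_form k T Fs (u, \<lambda>_. 0) (w, \<lambda>_. 0) + c * local_form k T Fs (v, \<lambda>_. 0) (w, \<lambda>_. 0)"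
      unfolding cell by (intro a.form_comb dofs_cell h)
  qed (auto intro: polys_comb a.form_commute a.form_nonneg dofs_cell)
  have "\<exists>w\<in>polys k. \<forall>v\<in>polys k. local_form k T Fs (w, \<lambda>_. 0) (v, \<lambda>_. 0) = - local_form k T Fs (\<lambda>_. 0, \<nu>) (v, \<lambda>_. 0)"
  proof (rule polys_riesz[where l = "\<lambda>v. - local_form k T Fs (\<lambda>_. 0, \<nu>) (v, \<lambda>_. 0)", OF B l])
    fix w :: "'a \<Rightarrow> real" assume w: "w \<in> polys k" "local_form k T Fs (w, \<lambda>_. 0) (w, \<lambda>_. 0) = 0"
    show "- local_form k T Fs (\<lambda>_. 0, \<nu>) (w, \<lambda>_. 0) = 0"
      using a.null_form[OF z dofs_cell[OF w(1)] w(2)] by simp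
  qed
  moreover have "w = w'" if w: "w \<in> polys k" "w' \<in> polys k"
    "\<forall>v\<in>polys k. local_form k T Fs (w, \<lambda>_. 0) (v, \<lambda>_. 0) = - local_form k T Fs (\<lambda>_. 0, \<nu>) (v, \<lambda>_. 0)"
    "\<forall>v\<in>polys k. local_form k T Fs (w', \<lambda>_. 0) (v, \<lambda>_. 0) = - local_form k T Fs (\<lambda>_. 0, \<nu>) (v, \<lambda>_. 0)" for w w'
  proof -
    have d: "(\<lambda>x. w x + (-1) * w' x) \<in> polys k" by (rule polys_comb[OF w(1,2)])
    have "local_form k T Fs (\<lambda>x. w x + (-1) * w' x, \<lambda>_. 0) (\<lambda>x. w x + (-1) * w' x, \<lambda>_. 0) = 0"
      using semi_inner.form_comb[OF B w(1,2) d, of "-1"] w(3,4) d by simp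
    from cell_definite[OF k d this] show ?thesis by (simp add: fun_eq_iff)
  qed
  ultimately show ?thesis by blast
qed

lemma local_lift_polys: "1 \<le> k \<Longrightarrow> fsqi Fs \<nu> \<Longrightarrow> local_lift k T Fs \<nu> \<in> polys k"
  and local_lift_form: "1 \<le> k \<Longrightarrow> fsqi Fs \<nu> \<Longrightarrow> v \<in> polys k \<Longrightarrow>
    local_form k T Fs (local_lift k T Fs \<nu>, \<lambda>_. 0) (v, \<lambda>_. 0) = - local_form k T Fs (\<lambda>_. 0, \<nu>) (v, \<lambda>_. 0)"
  unfolding local_lift_def using theI'[OF local_lift_ex[of k \<nu>]] by blast+

lemma local_lift_dofs: "1 \<le> k \<Longrightarrow> fsqi Fs \<nu> \<Longrightarrow> (local_lift k T Fs \<nu>, \<nu>) \<in> dofs k"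
  by (simp add: dofs_def local_lift_polys)

lemma local_lift_orthogonal:
  assumes k: "1 \<le> k" and \<nu>: "fsqi Fs \<nu>" and v: "v \<in> polys k"
  shows "local_form k T Fs (local_lift k T Fs \<nu>, \<nu>) (v, \<lambda>_. 0) = 0"
proof -
  interpret a: semi_inner "dofs k" pcomb "local_form k T Fs" by (rule semi_inner_local)
  have "(local_lift k T Fs \<nu>, \<nu>) = pcomb (local_lift k T Fs \<nu>, \<lambda>_. 0) 1 (\<lambda>_. 0, \<nu>)" by (simp add: pcomb_def)
  then show ?thesis
    using a.form_comb[OF dofs_cell[OF local_lift_polys[OF k \<nu>]] dofs_face_part[OF \<nu>] dofs_cell[OF v], of 1]
      local_lift_form[OF k \<nu> v] by simp
qed

text \<open>Orthogonality of the lifted pair to cell unknowns lets the cell part of the other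
  argument be exchanged freely. In the error equation the lift of the error is thus replaced by the
  difference of the two cell parts.\<close>

lemma local_lift_form_cong:
  assumes k: "1 \<le> k" and \<nu>: "fsqi Fs \<nu>" and u: "(p, \<mu>) \<in> dofs k" "(q, \<mu>) \<in> dofs k"
  shows "local_form k T Fs (p, \<mu>) (local_lift k T Fs \<nu>, \<nu>) = local_form k T Fs (q, \<mu>) (local_lift k T Fs \<nu>, \<nu>)"
proof -
  interpret a: semi_inner "dofs k" pcomb "local_form k T Fs" by (rule semi_inner_local)
  have pq: "p \<in> polys k" "q \<in> polys k" using u by (auto simp: dofs_def)
  have "(p, \<mu>) = pcomb (q, \<mu>) 1 (\<lambda>x. p x - q x, \<lambda>_. 0)" by (simp add: pcomb_def)
  then show ?thesis
    using a.form_comb[OF u(2) dofs_cell[OF polys_diff[OF pq]] local_lift_dofs[OF k \<nu>], of 1]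
      a.form_commute[OF dofs_cell[OF polys_diff[OF pq]] local_lift_dofs[OF k \<nu>]]
      local_lift_orthogonal[OF k \<nu> polys_diff[OF pq]] by simp
qed

end

section \<open>Local estimates\<close>

context element
begin

lemma norm_components:
  assumes "\<And>i. i \<in> Basis \<Longrightarrow> sqi L (\<lambda>x. G x \<bullet> i)"
  shows "(l2_norm L G)\<^sup>2 = (\<Sum>i\<in>Basis. (l2_norm L (\<lambda>x. G x \<bullet> i))\<^sup>2)"
  unfolding l2_norm_sq l2_inner_def
  by (subst euclidean_inner, subst Bochner_Integration.integral_sum) (auto intro!: sqi_mult assms)

lemma norm_grad: "smooth p \<Longrightarrow> (l2_norm L (grad p))\<^sup>2 = (\<Sum>i\<in>Basis. (l2_norm L (pdiff i p))\<^sup>2)"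
  by (subst norm_components) (auto simp: grad_inner smooth_T smooth_pdiff)

text \<open>By Euler's relation the radial derivative of \<open>d\<close> is \<open>(k+1) d\<close> up to lower
  order, which the orthogonality removes; hence the Rellich identity bounds the full gradient on
  the boundary, with a constant linear in \<open>k\<close> where an inverse inequality would give \<open>k\<^sup>2\<close>.\<close>

lemma rellich:
  assumes d: "d \<in> polys (k+1)" and orth: "\<And>z. z \<in> polys k \<Longrightarrow> l2_inner L (grad d) (grad z) = 0"
    and r: "0 < r" "ball a r \<subseteq> T"
  shows "r * (\<Sum>i\<in>Basis. (faces_norm Fs (pdiff i d))\<^sup>2) \<le> (2 * real k + real DIM('a)) * (l2_norm L (grad d))\<^sup>2"
proof -
  note sm = smooth_polys[OF d]
  note smd = smooth_pdiff[OF sm] and smdd = smooth_pdiff[OF smooth_pdiff[OF sm]]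
  define u where "u x = (\<Sum>i\<in>Basis. pdiff i d x * pdiff i d x)" for x
  have u: "smooth u" "\<And>x. 0 \<le> u x"
    unfolding u_def[abs_def] by (intro smooth_sum smooth_mult smd) (auto intro: sum_nonneg)
  have co: "smooth (\<lambda>x. (x - a) \<bullet> j)" for j
    by (simp add: inner_diff_left smooth_diff smooth_inner_const smooth_const)
  have pco: "pdiff i (\<lambda>x. (x - a) \<bullet> j) x = i \<bullet> j" for i j x
    by (simp add: inner_diff_left pdiff_diff pdiff_inner_const smooth_inner_const smooth_const)
  \<comment> \<open>The remainder in Euler's relation; its degree drops to \<open>k\<close>, so
    \<open>orth\<close> applies to it.\<close>
  define R where "R x = (x - a) \<bullet> grad d x - real (k+1) * d x" for x
  have R: "R \<in> polys k" using euler_polys[OF d, of a] by (simp add: R_def[abs_def])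
  have xg: "(x - a) \<bullet> grad p x = (\<Sum>j\<in>Basis. ((x - a) \<bullet> j) * pdiff j p x)" for p x
    by (subst euclidean_inner) (simp add: grad_inner)
  \<comment> \<open>Differentiation turns \<open>k + 1\<close> into \<open>k\<close>, because the
    derivative also falls on the coefficient \<open>x - a\<close>.\<close>
  have dR: "pdiff i R x = (x - a) \<bullet> grad (pdiff i d) x - real k * pdiff i d x" if i: "i \<in> Basis" for i x
  proof -
    have "pdiff i R x = pdiff i (\<lambda>x. \<Sum>j\<in>Basis. ((x - a) \<bullet> j) * pdiff j d x) x - pdiff i (\<lambda>x. real (k+1) * d x) x"
      unfolding R_def[abs_def] xg by (intro pdiff_diff smooth_sum smooth_mult co smd smooth_cmult sm)
    also have "pdiff i (\<lambda>x. real (k+1) * d x) x = real (k+1) * pdiff i d x"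
      by (intro pdiff_cmult smooth_differentiable sm)
    also have "pdiff i (\<lambda>x. \<Sum>j\<in>Basis. ((x - a) \<bullet> j) * pdiff j d x) x
        = (\<Sum>j\<in>Basis. (i \<bullet> j) * pdiff j d x + ((x - a) \<bullet> j) * pdiff i (pdiff j d) x)"
      by (subst pdiff_sum, intro smooth_mult co smd, assumption)
         (intro sum.cong refl, subst pdiff_mult, auto simp: pco intro!: smooth_differentiable co smd)
    also have "\<dots> = pdiff i d x + (x - a) \<bullet> grad (pdiff i d) x"
    proof -
      have "(\<Sum>j\<in>Basis. (i \<bullet> j) * pdiff j d x) = i \<bullet> grad d x"
        by (subst (2) euclidean_inner) (simp add: grad_inner)
      also have "\<dots> = pdiff i d x" using grad_inner[OF i] by (subst inner_commute)
      finally show ?thesis using i by (simp add: sum.distrib xg pdiff_polys_commute[OF d])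
    qed
    finally show ?thesis by (simp add: algebra_simps)
  qed
  have "(x - a) \<bullet> grad u x = (\<Sum>i\<in>Basis. 2 * (pdiff i d x * ((x - a) \<bullet> grad (pdiff i d) x)))" for x
  proof -
    have "(x - a) \<bullet> grad u x = (\<Sum>j\<in>Basis. ((x - a) \<bullet> j) * (\<Sum>i\<in>Basis. pdiff j (pdiff i d) x * pdiff i d x + pdiff i d x * pdiff j (pdiff i d) x))"
      unfolding xg u_def[abs_def]
      by (intro sum.cong refl, subst pdiff_sum, intro smooth_mult smd, assumption+)
         (simp add: pdiff_mult smooth_differentiable smd)
    also have "\<dots> = (\<Sum>j\<in>Basis. \<Sum>i\<in>Basis. 2 * (pdiff i d x * (((x - a) \<bullet> j) * pdiff j (pdiff i d) x)))"
      by (simp add: sum_distrib_left mult_ac)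
    also have "\<dots> = (\<Sum>i\<in>Basis. \<Sum>j\<in>Basis. 2 * (pdiff i d x * (((x - a) \<bullet> j) * pdiff j (pdiff i d) x)))"
      by (rule sum.swap)
    finally show ?thesis by (simp add: xg sum_distrib_left)
  qed
  \<comment> \<open>The radial derivative of the squared gradient becomes \<open>2 * k\<close> times
    the squared gradient plus a term with \<open>grad R\<close>, which integrates to zero by
    orthogonality.\<close>
  then have e: "real DIM('a) * u x + (x - a) \<bullet> grad u x = (2 * real k + real DIM('a)) * u x + 2 * (grad d x \<bullet> grad R x)" for x
  proof -
    assume h: "\<And>x. (x - a) \<bullet> grad u x = (\<Sum>i\<in>Basis. 2 * (pdiff i d x * ((x - a) \<bullet> grad (pdiff i d) x)))"
    have "(x - a) \<bullet> grad u x = (\<Sum>i\<in>Basis. 2 * (pdiff i d x * pdiff i R x) + 2 * real k * (pdiff i d x * pdiff i d x))"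
      unfolding h by (intro sum.cong refl) (simp add: dR algebra_simps)
    also have "\<dots> = 2 * (grad d x \<bullet> grad R x) + 2 * real k * u x"
      unfolding sum.distrib sum_distrib_left[symmetric] u_def
      by (subst euclidean_inner) (simp add: grad_inner)
    finally show ?thesis by (simp add: algebra_simps)
  qed
  have iu: "(\<integral>x. u x \<partial>L) = (l2_norm L (grad d))\<^sup>2"
    unfolding l2_norm_sq l2_inner_def u_def
    by (subst euclidean_inner) (simp add: grad_inner)
  have "r * (\<Sum>i\<in>Basis. (faces_norm Fs (pdiff i d))\<^sup>2) = r * (\<Sum>F\<in>Fs. \<integral>x. u x \<partial>face_measure F)"
  proof -
    have "(\<Sum>i\<in>Basis. (faces_norm Fs (pdiff i d))\<^sup>2) = (\<Sum>i\<in>Basis. \<Sum>F\<in>Fs. \<integral>x. pdiff i d x * pdiff i d x \<partial>face_measure F)"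
      by (simp add: faces_norm_sq faces_inner_def l2_inner_def)
    also have "\<dots> = (\<Sum>F\<in>Fs. \<Sum>i\<in>Basis. \<integral>x. pdiff i d x * pdiff i d x \<partial>face_measure F)" by (rule sum.swap)
    also have "\<dots> = (\<Sum>F\<in>Fs. \<integral>x. u x \<partial>face_measure F)"
      unfolding u_def
      by (intro sum.cong refl Bochner_Integration.integral_sum[symmetric] sqi_mult fsqi_face[OF smooth_fsqi] smd)
    finally show ?thesis by simp
  qed
  also have "\<dots> \<le> (\<integral>x. real DIM('a) * u x + (x - a) \<bullet> grad u x \<partial>L)"
    unfolding radial_divergence[OF u(1)] by (rule boundary_le_radial[OF r u])
  also have "\<dots> = (\<integral>x. (2 * real k + real DIM('a)) * u x + 2 * (grad d x \<bullet> grad R x) \<partial>L)" unfolding e ..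
  also have "\<dots> = (2 * real k + real DIM('a)) * (\<integral>x. u x \<partial>L) + 2 * l2_inner L (grad d) (grad R)"
    unfolding l2_inner_def
    by (subst Bochner_Integration.integral_add, intro integrable_mult_right sqi_integrable[OF finite_T] smooth_T u(1))
       (auto intro!: integrable_mult_right sqi_inner grad_sqi[OF d] grad_sqi[OF R])
  finally show ?thesis unfolding iu orth[OF R] by simp
qed

text \<open>Components of a unit normal are at most one in absolute value; Cauchy-Schwarz is used on
  each face and again over the faces.\<close>

lemma flux_bound:
  assumes e: "fsqi Fs e" and q: "fsqi Fs q" and i: "i \<in> Basis"
  shows "\<bar>\<Sum>F\<in>Fs. (nrm F \<bullet> i) * face_inner F e q\<bar> \<le> faces_norm Fs e * faces_norm Fs q"
proof -
  have "\<bar>\<Sum>F\<in>Fs. (nrm F \<bullet> i) * face_inner F e q\<bar> \<le> (\<Sum>F\<in>Fs. \<bar>(nrm F \<bullet> i) * face_inner F e q\<bar>)"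
    by (rule sum_abs)
  also have "\<dots> \<le> (\<Sum>F\<in>Fs. \<bar>face_norm F e\<bar> * \<bar>face_norm F q\<bar>)"
  proof (rule sum_mono)
    fix F assume F: "F \<in> Fs"
    have "\<bar>nrm F \<bullet> i\<bar> \<le> 1" using Basis_le_norm[OF i, of "nrm F"] norm_nrm[OF F] by simp
    then have "\<bar>nrm F \<bullet> i\<bar> * \<bar>face_inner F e q\<bar> \<le> 1 * (face_norm F e * face_norm F q)"
      by (intro mult_mono l2_cauchy_schwarz fsqi_face[OF e F] fsqi_face[OF q F]) auto
    then show "\<bar>(nrm F \<bullet> i) * face_inner F e q\<bar> \<le> \<bar>face_norm F e\<bar> * \<bar>face_norm F q\<bar>"
      by (simp add: abs_mult l2_norm_nonneg)
  qed
  also have "\<dots> \<le> L2_set (\<lambda>F. face_norm F e) Fs * L2_set (\<lambda>F. face_norm F q) Fs"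
    by (rule L2_set_mult_ineq)
  also have "\<dots> = faces_norm Fs e * faces_norm Fs q"
    by (simp add: L2_set_def faces_norm_def faces_inner_def l2_norm_sq)
  finally show ?thesis .
qed

end

locale approx_element = element +
  fixes k :: nat and Capp :: "nat \<Rightarrow> real"
  assumes k: "1 \<le> k" and approx: "approximation_property Capp T Fs"
begin

text \<open>Common scale of the estimates: the approximation bounds are of order \<open>t\<close>
  and \<open>t ^ 3\<close>, and the stabilization weight is the inverse square of
  \<open>t\<close>.\<close>

definition t where "t = sqrt (diameter T / real k)"

lemma t_pos: "0 < t"
  using diameter_T_pos k by (simp add: t_def)

lemma t_sq: "t\<^sup>2 = diameter T / real k"
  using diameter_T_pos k by (simp add: t_def)

text \<open>The approximation hypothesis restated for any trace and any weak derivatives of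
  \<open>v\<close> in place of the chosen ones. The absolute value appears because no sign is
  assumed for \<open>Capp\<close>.\<close>

lemma approx_first:
  assumes tr: "is_trace T Fs v g" and v: "sqi L v" and w: "\<And>i. i \<in> Basis \<Longrightarrow> weakly T {#i#} v (w i)"
  shows "faces_norm Fs (\<lambda>x. g x - elem_proj k T v x) \<le> \<bar>Capp 1\<bar> * t * sqrt (\<Sum>i\<in>Basis. (l2_norm L (w i))\<^sup>2)"
proof -
  have v1: "v \<in> sobolev 1 T" using v w by (rule sobolev_1I)
  have p: "fsqi Fs (elem_proj k T v)" using smooth_fsqi smooth_polys elem_proj_polys[OF v] by blast
  have wd: "weakly T {#i#} v (weak_deriv T {#i#} v)" if "i \<in> Basis" for i
    using weakly_weak_deriv[OF w[OF that]] .
  have c: "weak_grad T v x \<bullet> i = weak_deriv T {#i#} v x" if "i \<in> Basis" for i x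
    using that by (simp add: weak_grad_def)
  have "(l2_norm L (weak_grad T v))\<^sup>2 = (\<Sum>i\<in>Basis. (l2_norm L (weak_deriv T {#i#} v))\<^sup>2)"
    by (subst norm_components) (simp_all add: c weakly_sqi[OF wd])
  also have "\<dots> = (\<Sum>i\<in>Basis. (l2_norm L (w i))\<^sup>2)"
    using l2_norm_cong_AE[OF weakly_sqi[OF wd] weakly_sqi[OF w] weak_deriv_AE[OF T(1) w]] by simp
  finally have n: "l2_norm L (weak_grad T v) = sqrt (\<Sum>i\<in>Basis. (l2_norm L (w i))\<^sup>2)"
    using l2_norm_nonneg[of L "weak_grad T v"] by (metis real_sqrt_abs abs_of_nonneg)
  have "faces_norm Fs (\<lambda>x. g x - elem_proj k T v x) = faces_norm Fs (\<lambda>x. trace_on T Fs v x - elem_proj k T v x)"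
    using trace_on_norm[OF tr v w p] by simp
  also have "\<dots> \<le> Capp 1 * (diameter T / real k) powr (1/2) * l2_norm L (weak_grad T v)"
    using approx k v1 unfolding approximation_property_def by (auto dest!: spec[of _ k] bspec[of _ _ 1])
  also have "\<dots> = Capp 1 * t * sqrt (\<Sum>i\<in>Basis. (l2_norm L (w i))\<^sup>2)"
    using diameter_T_pos by (simp add: t_def powr_half_sqrt n)
  also have "\<dots> \<le> \<bar>Capp 1\<bar> * t * sqrt (\<Sum>i\<in>Basis. (l2_norm L (w i))\<^sup>2)"
    using t_pos by (intro mult_right_mono) (auto intro: sum_nonneg)
  finally show ?thesis .
qed

lemma approx_poly:
  assumes p: "p \<in> polys j"
  shows "faces_norm Fs (\<lambda>x. p x - elem_proj k T p x) \<le> \<bar>Capp 1\<bar> * t * l2_norm L (grad p)"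
proof -
  note sm = smooth_polys[OF p]
  have "sqrt (\<Sum>i\<in>Basis. (l2_norm L (pdiff i p))\<^sup>2) = l2_norm L (grad p)"
    by (simp add: norm_grad[OF sm, symmetric] l2_norm_nonneg)
  then show ?thesis
    using approx_first[OF smooth_trace[OF sm] smooth_T[OF sm] weakly_smooth[OF T(1,3) sm]] by simp
qed

text \<open>The case \<open>m = 2\<close>, admissible because \<open>k\<close> is at least one; the
  exponent 3/2 of diameter over \<open>k\<close> is the third power of \<open>t\<close>.\<close>

lemma approx_second:
  assumes tr: "is_trace T Fs v g" and v: "v \<in> sobolev 2 T"
  shows "faces_norm Fs (\<lambda>x. g x - elem_proj k T v x) \<le> \<bar>Capp 2\<bar> * t ^ 3 * sobolev_norm 2 T v"
proof -
  have vs: "sqi L v" using v by (simp add: sobolev_iff)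
  have w: "weakly T {#i#} v (weak_deriv T {#i#} v)" if "i \<in> Basis" for i
    using sobolev_weakly[OF v, of "{#i#}"] that by (simp add: multi_indices_def)
  have p: "fsqi Fs (elem_proj k T v)" using smooth_fsqi smooth_polys elem_proj_polys[OF vs] by blast
  have x: "0 < diameter T / real k" using diameter_T_pos k by simp
  have "(diameter T / real k) powr (3/2) = (diameter T / real k) powr (1 + 1/2)" by simp
  also have "\<dots> = t\<^sup>2 * t" unfolding powr_add t_sq using x diameter_T_pos by (simp add: powr_half_sqrt t_def)
  also have "\<dots> = t ^ 3" by (simp add: power2_eq_square power3_eq_cube)
  finally have e: "(diameter T / real k) powr (3/2) = t ^ 3" .
  have "faces_norm Fs (\<lambda>x. g x - elem_proj k T v x) = faces_norm Fs (\<lambda>x. trace_on T Fs v x - elem_proj k T v x)"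
    using trace_on_norm[OF tr vs w p] by simp
  also have "\<dots> \<le> Capp 2 * (diameter T / real k) powr (real 2 - 1/2) * sobolev_norm 2 T v"
    using approx k v unfolding approximation_property_def by (auto dest!: spec[of _ k] bspec[of _ _ 2])
  also have "\<dots> = Capp 2 * t ^ 3 * sobolev_norm 2 T v" using e by simp
  also have "\<dots> \<le> \<bar>Capp 2\<bar> * t ^ 3 * sobolev_norm 2 T v"
    using t_pos by (intro mult_right_mono) (auto simp: sobolev_norm_def intro: sum_nonneg)
  finally show ?thesis .
qed

lemma defect_bound:
  assumes v: "v \<in> dofs k"
  shows "faces_norm Fs (\<lambda>x. snd v x - fst v x) \<le> (1 + \<bar>Capp 1\<bar>) * t * sqrt (local_form k T Fs v v)"
proof -
  let ?p = "pot_rec k T Fs v" and ?A = "sqrt (local_form k T Fs v v)"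
  let ?e = "\<lambda>x. ?p x - elem_proj k T ?p x"
  note pp = pot_rec_polys[OF v]
  have P: "elem_proj k T ?p \<in> polys k" by (rule elem_proj_polys[OF pot_rec_sqi[OF v]])
  have Pf: "fsqi Fs (elem_proj k T ?p)" using P smooth_fsqi smooth_polys by blast
  have ef: "fsqi Fs ?e" by (intro fsqi_diff pot_rec_fsqi v Pf)
  \<comment> \<open>On each face the cell projection of the potential is a polynomial of degree
    \<open>k\<close>, so the face projector fixes it; what the jump does not contain is therefore
    the face projection of \<open>?e\<close>.\<close>
  have eq: "snd v x - fst v x = jump k v x + faces_proj k Fs ?e x" if "F \<in> Fs" "x \<in> F" for F x
    using fam.faces_proj_comb[OF pot_rec_fsqi[OF v] Pf that, of k "-1"] fam.faces_proj_id[OF polys_face_polys[OF P] that]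
    by (simp add: jump_eq)
  have "(faces_norm Fs (jump k v))\<^sup>2 = t\<^sup>2 * stab_form k T Fs v v"
    using diameter_T_pos k by (simp add: stab_form_eq faces_norm_sq t_sq)
  also have "\<dots> \<le> (t * ?A)\<^sup>2"
    using stab_le_local semi_inner.form_nonneg[OF semi_inner_local v] by (simp add: power_mult_distrib mult_left_mono)
  finally have j: "faces_norm Fs (jump k v) \<le> t * ?A"
    by (rule power2_le_imp_le) (use t_pos semi_inner.form_nonneg[OF semi_inner_local v] in simp)
  \<comment> \<open>Tests the definition of the potential with the potential itself.\<close>
  have "(l2_norm L (grad ?p))\<^sup>2 \<le> l2_norm L (grad_rec k T Fs v) * l2_norm L (grad ?p)"
    using pot_rec_inner[OF v pp] l2_cauchy_schwarz[OF grad_rec_sqi[OF v] grad_sqi[OF pp]] by (simp add: l2_norm_sq abs_le_iff)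
  then have "l2_norm L (grad ?p) \<le> l2_norm L (grad_rec k T Fs v)"
    using l2_norm_nonneg[of L "grad ?p"] l2_norm_nonneg[of L "grad_rec k T Fs v"]
    by (cases "l2_norm L (grad ?p) = 0") (auto simp: power2_eq_square mult_le_cancel_right)
  also have "\<dots> \<le> ?A" using grad_rec_le_local[of k v] l2_norm_nonneg by (simp add: real_le_rsqrt)
  finally have gp: "l2_norm L (grad ?p) \<le> ?A" .
  have "faces_norm Fs (\<lambda>x. snd v x - fst v x) = faces_norm Fs (\<lambda>x. jump k v x + faces_proj k Fs ?e x)"
    by (rule fam.faces_norm_cong) (rule eq)
  also have "\<dots> \<le> faces_norm Fs (jump k v) + faces_norm Fs (faces_proj k Fs ?e)"
    by (intro faces_triangle jump_fsqi v fam.faces_proj_fsqi ef)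
  also have "faces_norm Fs (faces_proj k Fs ?e) \<le> faces_norm Fs ?e" by (rule fam.faces_proj_norm[OF ef])
  also have "\<dots> \<le> \<bar>Capp 1\<bar> * t * l2_norm L (grad ?p)" by (rule approx_poly[OF pp])
  also have "\<dots> \<le> \<bar>Capp 1\<bar> * t * ?A" using gp t_pos by (intro mult_left_mono) auto
  finally show ?thesis using j by (simp add: algebra_simps)
qed

end

section \<open>Consistency of the interpolant\<close>

text \<open>The root is the Rellich constant for a ball of radius
  \<open>\<rho>\<^sup>2 * diameter T / 2\<close>, after \<open>2 * k + d\<close> is enlarged to
  \<open>(2 + d) * k\<close>; the factor \<open>d\<close> in front of it counts gradient components.
  The two summands belong to the trace error of the cell projection and to the potential
  difference.\<close>

definition stab_const :: "real \<Rightarrow> real \<Rightarrow> real \<Rightarrow> real \<Rightarrow> real" where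
  "stab_const d c1 c2 \<rho> = \<bar>c2\<bar> * (1 + \<bar>c1\<bar> * (d * sqrt (2 * (2 + d) / \<rho>\<^sup>2)))"

text \<open>The first summand is the flux term, defect bound times projection error of the gradient
  for each component; the second is the stabilization term.\<close>

definition err_const :: "real \<Rightarrow> (nat \<Rightarrow> real) \<Rightarrow> real \<Rightarrow> real" where
  "err_const D C \<rho> = D * (1 + \<bar>C 1\<bar>) * \<bar>C 1\<bar> + stab_const D (C 1) (C 2) \<rho>"

lemma err_const_nonneg: "0 \<le> D \<Longrightarrow> 0 \<le> err_const D C \<rho>"
  by (simp add: err_const_def stab_const_def)

context approx_element
begin

definition interp :: "('a \<Rightarrow> real) \<Rightarrow> ('a \<Rightarrow> real) \<Rightarrow> ('a \<Rightarrow> real) \<times> ('a \<Rightarrow> real)" where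
  "interp v g = (elem_proj k T v, faces_proj k Fs g)"

lemma interp_dofs: "sqi L v \<Longrightarrow> fsqi Fs g \<Longrightarrow> interp v g \<in> dofs k"
  by (simp add: interp_def dofs_def elem_proj_polys fam.faces_proj_fsqi)

text \<open>The divergence of \<open>s\<close> has degree below \<open>k\<close> and its normal
  component on a face has degree at most \<open>k\<close>, so neither projector is visible in the
  functional, which by Green's formula is then that of the weak gradient.\<close>

lemma grad_rec_interp:
  assumes tr: "is_trace T Fs v g" and v: "sqi L v" and w: "\<And>i. i \<in> Basis \<Longrightarrow> weakly T {#i#} v (w i)"
  shows "grad_rec k T Fs (interp v g) = (\<lambda>x. \<Sum>i\<in>Basis. elem_proj k T (w i) x *\<^sub>R i)"
proof (rule grad_rec_eqI)
  let ?G = "\<lambda>x. \<Sum>i\<in>Basis. elem_proj k T (w i) x *\<^sub>R i"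
  note gs = trace_fsqi[OF tr]
  show I: "interp v g \<in> dofs k" by (rule interp_dofs[OF v gs])
  have P: "elem_proj k T (w i) \<in> polys k" if "i \<in> Basis" for i
    by (rule elem_proj_polys[OF weakly_sqi[OF w[OF that]]])
  show "?G \<in> vec_polys k" by (rule vec_polys_sum[OF P])
  fix s :: "'a \<Rightarrow> 'a" assume s: "s \<in> vec_polys k"
  have c: "?G x \<bullet> i = elem_proj k T (w i) x" if "i \<in> Basis" for i x
    using that by simp
  have "l2_inner L ?G s = (\<Sum>i\<in>Basis. l2_inner L (elem_proj k T (w i)) (\<lambda>x. s x \<bullet> i))"
    by (subst inner_vec[OF _ s]) (simp_all add: c polys_sqi_T[OF P])
  also have "\<dots> = (\<Sum>i\<in>Basis. l2_inner L (w i) (\<lambda>x. s x \<bullet> i))"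
    by (intro sum.cong refl elem_proj_inner weakly_sqi[OF w] vec_polys_component s)
  also have "\<dots> = (\<Sum>F\<in>Fs. face_inner F g (\<lambda>x. s x \<bullet> nrm F)) - l2_inner L v (vdiv s)"
    using green_vec[OF tr v w s] by simp
  also have "\<dots> = grad_functional (interp v g) s"
    unfolding grad_functional_eq[OF I s]
    using elem_proj_inner[OF v polys_mono[OF vdiv_polys[OF s]], of k]
    by (simp add: interp_def fam.faces_proj_face_inner[OF gs _ vec_polys_component[OF s]])
  finally show "l2_inner L ?G s = grad_functional (interp v g) s" .
qed

lemma grad_rec_interp_inner:
  assumes tr: "is_trace T Fs v g" and v: "sqi L v" and w: "\<And>i. i \<in> Basis \<Longrightarrow> weakly T {#i#} v (w i)" and s: "s \<in> vec_polys k"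
  shows "l2_inner L (grad_rec k T Fs (interp v g)) s = (\<Sum>i\<in>Basis. l2_inner L (w i) (\<lambda>x. s x \<bullet> i))"
proof -
  have P: "sqi L (elem_proj k T (w i))" if "i \<in> Basis" for i
    by (rule polys_sqi_T[OF elem_proj_polys[OF weakly_sqi[OF w[OF that]]]])
  have "l2_inner L (grad_rec k T Fs (interp v g)) s = (\<Sum>i\<in>Basis. l2_inner L (elem_proj k T (w i)) (\<lambda>x. s x \<bullet> i))"
    by (subst grad_rec_interp[OF tr v w], assumption, subst inner_vec[OF _ s]) (simp_all add: P)
  also have "\<dots> = (\<Sum>i\<in>Basis. l2_inner L (w i) (\<lambda>x. s x \<bullet> i))"
    by (intro sum.cong refl elem_proj_inner weakly_sqi[OF w] vec_polys_component s)
  finally show ?thesis .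
qed

text \<open>Only the gradient of \<open>q\<close> is determined. The free constant is harmless: the
  difference of potential and \<open>q\<close> enters only through its gradient and through its
  deviation from its own cell projection.\<close>

lemma elliptic_projection:
  assumes w: "\<And>i. i \<in> Basis \<Longrightarrow> sqi L (w i)"
  shows "\<exists>q\<in>polys k. \<forall>z\<in>polys k. l2_inner L (grad q) (grad z) = (\<Sum>i\<in>Basis. l2_inner L (w i) (pdiff i z))"
proof (rule polys_riesz[where l = "\<lambda>z. \<Sum>i\<in>Basis. l2_inner L (w i) (pdiff i z)", OF semi_inner_grad])
  fix p q :: "'a \<Rightarrow> real" and c assume a: "p \<in> polys k" "q \<in> polys k"
  note sm = smooth_polys[OF a(1)] smooth_polys[OF a(2)]
  have "l2_inner L (w i) (pdiff i (\<lambda>x. p x + c * q x)) = l2_inner L (w i) (pdiff i p) + c * l2_inner L (w i) (pdiff i q)"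
    if i: "i \<in> Basis" for i
  proof -
    have "pdiff i (\<lambda>x. p x + c * q x) = (\<lambda>x. pdiff i p x + c *\<^sub>R pdiff i q x)"
      using sm by (intro ext) (simp add: pdiff_add pdiff_cmult smooth_differentiable smooth_cmult)
    then show ?thesis
      using l2_inner_comb[OF smooth_T[OF smooth_pdiff[OF sm(1) i]] smooth_T[OF smooth_pdiff[OF sm(2) i]] w[OF i]]
      by (simp only: l2_inner_commute)
  qed
  then show "(\<Sum>i\<in>Basis. l2_inner L (w i) (pdiff i (\<lambda>x. p x + c * q x)))
      = (\<Sum>i\<in>Basis. l2_inner L (w i) (pdiff i p)) + c * (\<Sum>i\<in>Basis. l2_inner L (w i) (pdiff i q))"
    by (simp add: sum.distrib sum_distrib_left)
next
  fix z :: "'a \<Rightarrow> real" assume "z \<in> polys k" "l2_inner L (grad z) (grad z) = 0"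
  then obtain c where "z = (\<lambda>_. c)" using grad_null by blast
  then show "(\<Sum>i\<in>Basis. l2_inner L (w i) (pdiff i z)) = 0" by (simp add: l2_inner_def)
qed

lemma interp_stab:
  assumes tr: "is_trace T Fs v g" and v2: "v \<in> sobolev 2 T"
    and \<rho>: "0 < \<rho>" "ball a (\<rho>\<^sup>2 * diameter T / 2) \<subseteq> T"
  shows "sqrt (stab_form k T Fs (interp v g) (interp v g)) \<le> stab_const (real DIM('a)) (Capp 1) (Capp 2) \<rho> * t\<^sup>2 * sobolev_norm 2 T v"
proof -
  let ?D = "real DIM('a)" and ?S = "sobolev_norm 2 T v" and ?I = "interp v g" and ?P = "elem_proj k T"
  define K where "K = sqrt (2 * (2 + ?D) / \<rho>\<^sup>2)"
  define w where "w i = weak_deriv T {#i#} v" for i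
  have v: "sqi L v" using v2 by (simp add: sobolev_iff)
  have w: "weakly T {#i#} v (w i)" if "i \<in> Basis" for i
    using sobolev_weakly[OF v2, of "{#i#}"] that by (simp add: multi_indices_def w_def)
  note gs = trace_fsqi[OF tr]
  have I: "?I \<in> dofs k" by (rule interp_dofs[OF v gs])
  define p where "p = pot_rec k T Fs ?I"
  have p: "p \<in> polys (k+1)" unfolding p_def by (rule pot_rec_polys[OF I])
  obtain q where q: "q \<in> polys k" "\<And>z. z \<in> polys k \<Longrightarrow> l2_inner L (grad q) (grad z) = (\<Sum>i\<in>Basis. l2_inner L (w i) (pdiff i z))"
    using elliptic_projection[of w] weakly_sqi[OF w] by blast
  have up: "z \<in> polys (k+1)" if "z \<in> polys k" for z :: "'a \<Rightarrow> real" using polys_mono[OF that] by simp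
  have pz: "l2_inner L (grad p) (grad z) = (\<Sum>i\<in>Basis. l2_inner L (w i) (pdiff i z))" if z: "z \<in> polys (k+1)" for z
    using grad_rec_interp_inner[OF tr v w grad_vec_polys[OF z]] pot_rec_inner[OF I z] by (simp add: grad_inner p_def)
  define d where "d x = p x + (-1) * q x" for x
  have d: "d \<in> polys (k+1)" unfolding d_def[abs_def] by (rule polys_comb[OF p up[OF q(1)]])
  note smd = smooth_polys[OF d]
  interpret gi: semi_inner "polys (k+1)" "\<lambda>u c v x. u x + c * v x" "\<lambda>p q. l2_inner L (grad p) (grad q)"
    by (rule semi_inner_grad)
  have dz: "l2_inner L (grad d) (grad z) = l2_inner L (grad p) (grad z) + (-1) * l2_inner L (grad q) (grad z)" if "z \<in> polys (k+1)" for z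
    unfolding d_def[abs_def] by (rule gi.form_comb[OF p up[OF q(1)] that])
  \<comment> \<open>\<open>p\<close> and \<open>q\<close> have the same gradient moments up to
    degree \<open>k\<close>; this is the orthogonality that the Rellich estimate requires.\<close>
  have orth: "l2_inner L (grad d) (grad z) = 0" if "z \<in> polys k" for z
    using dz[OF up[OF that]] pz[OF up[OF that]] q(2)[OF that] by simp
  define e where "e x = g x - ?P v x" for x
  have Pv: "?P v \<in> polys k" by (rule elem_proj_polys[OF v])
  note smP = smooth_polys[OF Pv]
  have ef: "fsqi Fs e" unfolding e_def[abs_def] by (intro fsqi_diff gs smooth_fsqi smP)
  have eb: "faces_norm Fs e \<le> \<bar>Capp 2\<bar> * t ^ 3 * ?S"
    unfolding e_def[abs_def] by (rule approx_second[OF tr v2])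
  have s: "grad d \<in> vec_polys k" by (rule grad_vec_polys[OF d])
  \<comment> \<open>Duality by two applications of Green's formula, to \<open>v\<close> and to its
    cell projection. They share the volume term with the divergence of \<open>grad d\<close>, and
    the gradient term of the projection vanishes by \<open>orth\<close>, so only the trace error
    \<open>e\<close> remains.\<close>
  have "(l2_norm L (grad d))\<^sup>2 = (\<Sum>i\<in>Basis. l2_inner L (w i) (pdiff i d))"
    using dz[OF d] pz[OF d] orth[OF q(1)] l2_inner_commute[of L "grad q" "grad d"] by (simp add: l2_norm_sq)
  also have "\<dots> = (\<Sum>F\<in>Fs. face_inner F g (\<lambda>x. grad d x \<bullet> nrm F)) - l2_inner L v (vdiv (grad d))"
    using green_vec[OF tr v w s] by (simp add: grad_inner)
  also have "l2_inner L v (vdiv (grad d)) = l2_inner L (?P v) (vdiv (grad d))"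
    using elem_proj_inner[OF v polys_mono[OF vdiv_polys[OF s]], of k] by simp
  also have "\<dots> = (\<Sum>F\<in>Fs. face_inner F (?P v) (\<lambda>x. grad d x \<bullet> nrm F))"
    using green_vec[OF smooth_trace[OF smP] smooth_T[OF smP] weakly_smooth[OF T(1,3) smP] s]
      orth[OF Pv] l2_inner_commute[of L "grad d" "grad (?P v)"] inner_grad[OF smP smd] by (simp add: grad_inner)
  also have "(\<Sum>F\<in>Fs. face_inner F g (\<lambda>x. grad d x \<bullet> nrm F)) - \<dots>
      = (\<Sum>F\<in>Fs. face_inner F e (\<lambda>x. grad d x \<bullet> nrm F))"
    unfolding sum_subtractf[symmetric] e_def[abs_def]
    by (intro sum.cong refl l2_inner_diff_left[symmetric] fsqi_face[OF gs] fsqi_face[OF smooth_fsqi[OF smP]]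
        fam.polys_sqi[OF _ vec_polys_component[OF s]])
  also have "\<dots> = (\<Sum>F\<in>Fs. \<Sum>i\<in>Basis. (nrm F \<bullet> i) * face_inner F e (pdiff i d))"
    by (intro sum.cong refl) (simp add: flux_components[OF ef _ s] grad_inner)
  also have "\<dots> = (\<Sum>i\<in>Basis. \<Sum>F\<in>Fs. (nrm F \<bullet> i) * face_inner F e (pdiff i d))"
    by (rule sum.swap)
  also have "\<dots> \<le> (\<Sum>i\<in>Basis. faces_norm Fs e * faces_norm Fs (pdiff i d))"
    using flux_bound[OF ef smooth_fsqi[OF smooth_pdiff[OF smd]]] by (intro sum_mono) (simp add: abs_le_iff)
  finally have n1: "(l2_norm L (grad d))\<^sup>2 \<le> (\<Sum>i\<in>Basis. faces_norm Fs e * faces_norm Fs (pdiff i d))" .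
  let ?n = "l2_norm L (grad d)"
  have h: "0 < diameter T" by (rule diameter_T_pos)
  have K: "0 \<le> K" by (simp add: K_def)
  have "t * faces_norm Fs (pdiff i d) \<le> K * ?n" if i: "i \<in> Basis" for i
  proof -
    have "(faces_norm Fs (pdiff i d))\<^sup>2 \<le> (\<Sum>i\<in>Basis. (faces_norm Fs (pdiff i d))\<^sup>2)"
      using i by (intro member_le_sum) auto
    then have "(\<rho>\<^sup>2 * diameter T / 2) * (faces_norm Fs (pdiff i d))\<^sup>2 \<le> (\<rho>\<^sup>2 * diameter T / 2) * (\<Sum>i\<in>Basis. (faces_norm Fs (pdiff i d))\<^sup>2)"
      using h by (intro mult_left_mono) auto
    also have "\<dots> \<le> (2 * real k + ?D) * ?n\<^sup>2"
      using h \<rho>(1) by (intro rellich[OF d orth _ \<rho>(2)]) auto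
    \<comment> \<open>Makes the bound proportional to \<open>k\<close>, which the square of
      \<open>t\<close> then cancels.\<close>
    also have "\<dots> \<le> ((2 + ?D) * real k) * ?n\<^sup>2"
    proof (rule mult_right_mono)
      have "?D * 1 \<le> ?D * real k" using k by (intro mult_left_mono) auto
      then show "2 * real k + ?D \<le> (2 + ?D) * real k" by (simp add: algebra_simps)
    qed simp
    finally have "\<rho>\<^sup>2 * diameter T * (faces_norm Fs (pdiff i d))\<^sup>2 \<le> 2 * ((2 + ?D) * real k) * ?n\<^sup>2" by simp
    then have "t\<^sup>2 * (faces_norm Fs (pdiff i d))\<^sup>2 \<le> (2 * (2 + ?D) / \<rho>\<^sup>2) * ?n\<^sup>2"
      using \<rho>(1) k unfolding t_sq by (simp add: field_simps)
    then have "(t * faces_norm Fs (pdiff i d))\<^sup>2 \<le> (K * ?n)\<^sup>2"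
      by (simp add: power_mult_distrib K_def)
    then show ?thesis by (rule power2_le_imp_le) (use K in \<open>simp add: l2_norm_nonneg\<close>)
  qed
  then have "(\<Sum>i\<in>Basis. faces_norm Fs e * (t * faces_norm Fs (pdiff i d))) \<le> (\<Sum>i\<in>(Basis :: 'a set). faces_norm Fs e * (K * ?n))"
    by (intro sum_mono mult_left_mono faces_norm_nonneg) auto
  moreover have "t * ?n\<^sup>2 \<le> (\<Sum>i\<in>Basis. faces_norm Fs e * (t * faces_norm Fs (pdiff i d)))"
    using mult_left_mono[OF n1, of t] t_pos by (simp add: sum_distrib_left mult_ac)
  \<comment> \<open>One factor of the gradient norm cancels next, which turns duality into a bound
    of \<open>t * ?n\<close> by the trace error.\<close>
  ultimately have "t * ?n * ?n \<le> ?D * K * faces_norm Fs e * ?n"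
    by (simp add: power2_eq_square mult_ac)
  then have "t * ?n \<le> ?D * K * faces_norm Fs e"
    using K l2_norm_nonneg[of L "grad d"] faces_norm_nonneg[of Fs e]
    by (cases "?n = 0") (simp_all add: mult_le_cancel_right)
  also have "\<dots> \<le> ?D * K * (\<bar>Capp 2\<bar> * t ^ 3 * ?S)" using K by (intro mult_left_mono eb) auto
  finally have nd: "t * ?n \<le> ?D * K * (\<bar>Capp 2\<bar> * t ^ 3 * ?S)" .
  let ?r = "\<lambda>x. d x - ?P d x"
  have dL: "sqi L d" and qL: "sqi L q" and pL: "sqi L p" using polys_sqi_T d q(1) p by blast+
  \<comment> \<open>The cell projector fixes \<open>q\<close>, so \<open>p\<close> and
    \<open>d\<close> have the same projection error.\<close>
  have Pp: "?P p = (\<lambda>x. ?P d x + q x)"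
  proof -
    have "p = (\<lambda>x. d x + 1 * q x)" by (simp add: d_def)
    then have "?P p = ?P (\<lambda>x. d x + 1 * q x)" by simp
    also have "\<dots> = (\<lambda>x. ?P d x + 1 * ?P q x)" by (rule elem_proj_comb[OF dL qL])
    finally show ?thesis by (simp add: elem_proj_id[OF q(1)])
  qed
  have Pd: "?P d \<in> polys k" and PP: "?P p \<in> polys k" using elem_proj_polys dL pL by blast+
  have pf: "fsqi Fs p" and Pf: "fsqi Fs (?P p)" and Pvf: "fsqi Fs (?P v)" and rf: "fsqi Fs ?r"
    using smooth_fsqi[OF smooth_polys[OF p]] smooth_fsqi[OF smooth_polys[OF PP]] smooth_fsqi[OF smP]
      smooth_fsqi[OF smooth_diff[OF smd smooth_polys[OF Pd]]] by blast+
  \<comment> \<open>The two cell projections are fixed by the face projector, so every part of the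
    jump is a face projection and the norm of the projector can be applied.\<close>
  have j: "jump k ?I x = faces_proj k Fs e x - faces_proj k Fs ?r x" if "F \<in> Fs" "x \<in> F" for F x
  proof -
    have "?r = (\<lambda>x. p x + (-1) * ?P p x)" by (simp add: Pp d_def fun_eq_iff)
    then have "faces_proj k Fs ?r x = faces_proj k Fs p x - ?P p x"
      using fam.faces_proj_comb[OF pf Pf that, of k "-1"] fam.faces_proj_id[OF polys_face_polys[OF PP] that] by simp
    moreover have "faces_proj k Fs e x = faces_proj k Fs g x - ?P v x"
      using fam.faces_proj_comb[OF gs Pvf that, of k "-1"] fam.faces_proj_id[OF polys_face_polys[OF Pv] that]
      by (simp add: e_def[abs_def])
    ultimately show ?thesis by (simp add: jump_eq p_def[symmetric]) (simp add: interp_def)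
  qed
  have "faces_norm Fs (jump k ?I) = faces_norm Fs (\<lambda>x. faces_proj k Fs e x - faces_proj k Fs ?r x)"
    by (rule fam.faces_norm_cong) (rule j)
  also have "\<dots> \<le> faces_norm Fs (faces_proj k Fs e) + faces_norm Fs (faces_proj k Fs ?r)"
    by (intro faces_triangle_diff fam.faces_proj_fsqi ef rf)
  also have "\<dots> \<le> faces_norm Fs e + faces_norm Fs ?r"
    by (intro add_mono fam.faces_proj_norm ef rf)
  also have "\<dots> \<le> \<bar>Capp 2\<bar> * t ^ 3 * ?S + \<bar>Capp 1\<bar> * t * ?n"
    by (intro add_mono eb approx_poly[OF d])
  also have "\<dots> \<le> \<bar>Capp 2\<bar> * t ^ 3 * ?S + \<bar>Capp 1\<bar> * (?D * K * (\<bar>Capp 2\<bar> * t ^ 3 * ?S))"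
    using mult_left_mono[OF nd, of "\<bar>Capp 1\<bar>"] by (simp add: mult.assoc)
  also have "\<dots> = t * (stab_const (real DIM('a)) (Capp 1) (Capp 2) \<rho> * t\<^sup>2 * ?S)"
    by (simp add: stab_const_def K_def algebra_simps power2_eq_square power3_eq_cube)
  finally have jb: "faces_norm Fs (jump k ?I) \<le> t * (stab_const (real DIM('a)) (Capp 1) (Capp 2) \<rho> * t\<^sup>2 * ?S)" .
  have "t * sqrt (stab_form k T Fs ?I ?I) = sqrt (t\<^sup>2 * stab_form k T Fs ?I ?I)"
    using t_pos by (simp add: real_sqrt_mult)
  also have "t\<^sup>2 * stab_form k T Fs ?I ?I = (faces_norm Fs (jump k ?I))\<^sup>2"
    using h k by (simp add: stab_form_eq faces_norm_sq t_sq)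
  finally have "t * sqrt (stab_form k T Fs ?I ?I) \<le> t * (stab_const (real DIM('a)) (Capp 1) (Capp 2) \<rho> * t\<^sup>2 * ?S)"
    using jb by (simp add: faces_norm_nonneg)
  then show ?thesis using t_pos by simp
qed

text \<open>The fluxes of \<open>\<gamma> i\<close> against the face unknown stay on the left,
  because they cancel only after summation over the elements. Assumption \<open>S\<close> bounds
  each row of second derivatives, and summing over the rows produces the dimension factor in the
  flux part of the constant.\<close>

lemma consistency:
  assumes tr: "is_trace T Fs v g" and v2: "v \<in> sobolev 2 T" and w: "\<And>i. i \<in> Basis \<Longrightarrow> weakly T {#i#} v (w i)"
    and z: "\<And>i j. i \<in> Basis \<Longrightarrow> j \<in> Basis \<Longrightarrow> weakly T {#j#} (w i) (z i j)"
    and \<gamma>: "\<And>i. i \<in> Basis \<Longrightarrow> is_trace T Fs (w i) (\<gamma> i)"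
    and f: "sqi L f" "AE x in L. (\<Sum>i\<in>Basis. z i i x) = - f x"
    and S: "\<And>i. i \<in> Basis \<Longrightarrow> (\<Sum>j\<in>Basis. (l2_norm L (z i j))\<^sup>2) \<le> (sobolev_norm 2 T v)\<^sup>2"
    and \<rho>: "0 < \<rho>" "ball a (\<rho>\<^sup>2 * diameter T / 2) \<subseteq> T" and u: "u \<in> dofs k"
  shows "\<bar>local_form k T Fs (interp v g) u - l2_inner L f (fst u)
      - (\<Sum>i\<in>Basis. \<Sum>F\<in>Fs. (nrm F \<bullet> i) * face_inner F (\<gamma> i) (snd u))\<bar>
    \<le> err_const (real DIM('a)) Capp \<rho> * t\<^sup>2 * sobolev_norm 2 T v * sqrt (local_form k T Fs u u)"
proof -
  let ?D = "real DIM('a)" and ?S = "sobolev_norm 2 T v" and ?I = "interp v g" and ?A = "sqrt (local_form k T Fs u u)"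
  let ?G = "grad_rec k T Fs ?I" and ?e = "\<lambda>x. snd u x - fst u x" and ?P = "\<lambda>i. elem_proj k T (w i)"
  have v: "sqi L v" using v2 by (simp add: sobolev_iff)
  have I: "?I \<in> dofs k" by (rule interp_dofs[OF v trace_fsqi[OF tr]])
  have p: "fst u \<in> polys k" and \<nu>: "fsqi Fs (snd u)" using u by (auto simp: dofs_def)
  note sm = smooth_polys[OF p]
  have pf: "fsqi Fs (fst u)" by (rule smooth_fsqi[OF sm])
  have ef: "fsqi Fs ?e" by (intro fsqi_diff \<nu> pf)
  note ws = weakly_sqi[OF w]
  have P: "?P i \<in> polys k" if "i \<in> Basis" for i by (rule elem_proj_polys[OF ws[OF that]])
  have Pf: "fsqi Fs (?P i)" if "i \<in> Basis" for i by (rule smooth_fsqi[OF smooth_polys[OF P[OF that]]])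
  have \<gamma>f: "fsqi Fs (\<gamma> i)" if "i \<in> Basis" for i by (rule trace_fsqi[OF \<gamma>[OF that]])
  have G: "?G \<in> vec_polys k" by (rule grad_rec_vec_polys[OF I])
  have Gi: "?G x \<bullet> i = ?P i x" if "i \<in> Basis" for i x
    using that by (simp add: grad_rec_interp[OF tr v w])
  have gp: "grad (fst u) \<in> vec_polys k" using grad_vec_polys[OF polys_mono[OF p]] by simp
  have i1: "l2_inner L (grad (fst u)) ?G = (\<Sum>i\<in>Basis. l2_inner L (w i) (pdiff i (fst u)))"
    using grad_rec_interp_inner[OF tr v w gp] by (simp add: l2_inner_commute[of L "grad (fst u)"] grad_inner)
  have i2: "l2_inner L (w i) (pdiff i (fst u)) = (\<Sum>F\<in>Fs. (nrm F \<bullet> i) * face_inner F (\<gamma> i) (fst u)) - l2_inner L (z i i) (fst u)"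
    if i: "i \<in> Basis" for i
    using green_trace[OF \<gamma>[OF i] ws[OF i] z[OF i] sm i] by simp
  have "(\<Sum>i\<in>Basis. l2_inner L (z i i) (fst u)) = l2_inner L (\<lambda>x. \<Sum>i\<in>Basis. z i i x) (fst u)"
    unfolding l2_inner_def inner_sum_left
    by (rule Bochner_Integration.integral_sum[symmetric]) (intro sqi_inner weakly_sqi[OF z] smooth_T[OF sm])
  also have "\<dots> = l2_inner L (\<lambda>x. - f x) (fst u)"
    by (intro l2_inner_cong_AE sqi_sum weakly_sqi[OF z] smooth_T[OF sm] f(2)) (use sqi_scaleR[OF f(1), of "-1"] in auto)
  also have "\<dots> = - l2_inner L f (fst u)" by (simp add: l2_inner_def)
  finally have i3: "(\<Sum>i\<in>Basis. l2_inner L (z i i) (fst u)) = - l2_inner L f (fst u)" .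
  have i4: "(\<Sum>F\<in>Fs. face_inner F ?e (\<lambda>x. ?G x \<bullet> nrm F)) = (\<Sum>i\<in>Basis. \<Sum>F\<in>Fs. (nrm F \<bullet> i) * face_inner F ?e (?P i))"
  proof -
    have "(\<Sum>F\<in>Fs. face_inner F ?e (\<lambda>x. ?G x \<bullet> nrm F)) = (\<Sum>F\<in>Fs. \<Sum>i\<in>Basis. (nrm F \<bullet> i) * face_inner F ?e (?P i))"
      by (intro sum.cong refl) (simp add: flux_components[OF ef _ G] Gi)
    then show ?thesis by (simp only: sum.swap[of _ Basis])
  qed
  have "l2_inner L ?G (grad_rec k T Fs u) = grad_functional u ?G"
    using grad_rec_inner[OF u G] by (simp only: l2_inner_commute)
  also have "\<dots> = l2_inner L f (fst u) + (\<Sum>i\<in>Basis. \<Sum>F\<in>Fs. (nrm F \<bullet> i) * face_inner F (\<gamma> i) (fst u))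
      + (\<Sum>i\<in>Basis. \<Sum>F\<in>Fs. (nrm F \<bullet> i) * face_inner F ?e (?P i))"
    unfolding grad_functional_def i1 i4 using i2 i3 by (simp add: sum_subtractf)
  \<comment> \<open>The cell unknown in the flux is rewritten as \<open>snd u\<close> minus
    \<open>?e\<close>; what is then tested against \<open>?e\<close> is exactly the projection error
    of the gradient.\<close>
  also have "\<dots> = l2_inner L f (fst u) + (\<Sum>i\<in>Basis. \<Sum>F\<in>Fs. (nrm F \<bullet> i) * face_inner F (\<gamma> i) (snd u))
      - (\<Sum>i\<in>Basis. \<Sum>F\<in>Fs. (nrm F \<bullet> i) * face_inner F ?e (\<lambda>x. \<gamma> i x - ?P i x))"
  proof -
    have "face_inner F ?e (\<lambda>x. \<gamma> i x - ?P i x) = face_inner F (\<gamma> i) (snd u) - face_inner F (\<gamma> i) (fst u)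
        - face_inner F ?e (?P i)" if F: "F \<in> Fs" and i: "i \<in> Basis" for F i
      using l2_inner_diff_right[OF fsqi_face[OF \<gamma>f[OF i] F] fsqi_face[OF Pf[OF i] F] fsqi_face[OF ef F]]
        l2_inner_diff_right[OF fsqi_face[OF \<nu> F] fsqi_face[OF pf F] fsqi_face[OF \<gamma>f[OF i] F]]
        l2_inner_commute[of "face_measure F" ?e "\<gamma> i"] by simp
    then show ?thesis by (simp add: right_diff_distrib sum_subtractf)
  qed
  finally have main: "local_form k T Fs ?I u - l2_inner L f (fst u)
      - (\<Sum>i\<in>Basis. \<Sum>F\<in>Fs. (nrm F \<bullet> i) * face_inner F (\<gamma> i) (snd u))
    = stab_form k T Fs ?I u - (\<Sum>i\<in>Basis. \<Sum>F\<in>Fs. (nrm F \<bullet> i) * face_inner F ?e (\<lambda>x. \<gamma> i x - ?P i x))"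
    by (simp add: local_form_def)
  have A: "0 \<le> ?A" using semi_inner.form_nonneg[OF semi_inner_local u] by simp
  have S0: "0 \<le> ?S" by (simp add: sobolev_norm_def sum_nonneg)
  have "\<bar>stab_form k T Fs ?I u\<bar> \<le> sqrt (stab_form k T Fs ?I ?I) * sqrt (stab_form k T Fs u u)"
    by (rule semi_inner.cauchy_schwarz[OF semi_inner_stab I u])
  also have "\<dots> \<le> (stab_const (real DIM('a)) (Capp 1) (Capp 2) \<rho> * t\<^sup>2 * ?S) * ?A"
    using semi_inner.form_nonneg[OF semi_inner_stab I] semi_inner.form_nonneg[OF semi_inner_stab u]
      order_trans[OF _ interp_stab[OF tr v2 \<rho>], of 0]
    by (intro mult_mono interp_stab[OF tr v2 \<rho>] real_sqrt_le_mono stab_le_local) auto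
  finally have b1: "\<bar>stab_form k T Fs ?I u\<bar> \<le> (stab_const (real DIM('a)) (Capp 1) (Capp 2) \<rho> * t\<^sup>2 * ?S) * ?A" .
  have "\<bar>\<Sum>F\<in>Fs. (nrm F \<bullet> i) * face_inner F ?e (\<lambda>x. \<gamma> i x - ?P i x)\<bar>
      \<le> ((1 + \<bar>Capp 1\<bar>) * t * ?A) * (\<bar>Capp 1\<bar> * t * ?S)" if i: "i \<in> Basis" for i
  proof -
    have "sqrt (\<Sum>j\<in>Basis. (l2_norm L (z i j))\<^sup>2) \<le> ?S"
      using S[OF i] S0 by (simp add: real_le_lsqrt)
    then have "\<bar>Capp 1\<bar> * t * sqrt (\<Sum>j\<in>Basis. (l2_norm L (z i j))\<^sup>2) \<le> \<bar>Capp 1\<bar> * t * ?S"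
      using t_pos by (intro mult_left_mono) auto
    then have "faces_norm Fs (\<lambda>x. \<gamma> i x - ?P i x) \<le> \<bar>Capp 1\<bar> * t * ?S"
      using approx_first[OF \<gamma>[OF i] ws[OF i] z[OF i]] by linarith
    then have "faces_norm Fs ?e * faces_norm Fs (\<lambda>x. \<gamma> i x - ?P i x) \<le> ((1 + \<bar>Capp 1\<bar>) * t * ?A) * (\<bar>Capp 1\<bar> * t * ?S)"
      using defect_bound[OF u] t_pos A by (intro mult_mono) (auto simp: faces_norm_nonneg)
    then show ?thesis
      using flux_bound[OF ef fsqi_diff[OF \<gamma>f[OF i] Pf[OF i]] i] by linarith
  qed
  then have "(\<Sum>i\<in>Basis. \<bar>\<Sum>F\<in>Fs. (nrm F \<bullet> i) * face_inner F ?e (\<lambda>x. \<gamma> i x - ?P i x)\<bar>)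
      \<le> (\<Sum>i\<in>(Basis :: 'a set). ((1 + \<bar>Capp 1\<bar>) * t * ?A) * (\<bar>Capp 1\<bar> * t * ?S))"
    by (rule sum_mono)
  then have b2: "\<bar>\<Sum>i\<in>Basis. \<Sum>F\<in>Fs. (nrm F \<bullet> i) * face_inner F ?e (\<lambda>x. \<gamma> i x - ?P i x)\<bar>
      \<le> ?D * (((1 + \<bar>Capp 1\<bar>) * t * ?A) * (\<bar>Capp 1\<bar> * t * ?S))"
    by (intro order_trans[OF sum_abs]) simp
  have "err_const ?D Capp \<rho> * t\<^sup>2 * ?S * ?A
      = (stab_const (real DIM('a)) (Capp 1) (Capp 2) \<rho> * t\<^sup>2 * ?S) * ?A + ?D * (((1 + \<bar>Capp 1\<bar>) * t * ?A) * (\<bar>Capp 1\<bar> * t * ?S))"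
    by (simp add: err_const_def algebra_simps power2_eq_square)
  then show ?thesis unfolding main using b1 b2 by linarith
qed

end

section \<open>The error estimate\<close>

context element
begin

text \<open>The form sees face functions only on the faces of the element, so the global face
  projection may stand in for the local one.\<close>

lemma local_form_cong_left:
  assumes "fst u = fst u'" "\<And>F x. F \<in> Fs \<Longrightarrow> x \<in> F \<Longrightarrow> snd u x = snd u' x"
  shows "local_form k T Fs u v = local_form k T Fs u' v"
proof -
  have "grad_functional u = grad_functional u'"
    unfolding grad_functional_def
    by (intro ext arg_cong2[of _ _ _ _ "(+)"] sum.cong refl fam.face_inner_cong) (simp_all add: assms)
  then have G: "grad_rec k T Fs u = grad_rec k T Fs u'" unfolding grad_rec_def' by simp
  then have p: "pot_rec k T Fs u = pot_rec k T Fs u'" unfolding pot_rec_def' assms(1) by simp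
  have "faces_inner Fs (jump k u) (jump k v) = faces_inner Fs (jump k u') (jump k v)"
    by (intro fam.faces_inner_cong) (simp_all add: jump_eq p assms)
  then show ?thesis by (simp add: local_form_def stab_form_eq G)
qed

end

context mesh
begin

sublocale sk: face_family Fh
  using Fh(1,3) face_Fh by (intro face_family.intro)

lemma mesh_size_nonneg: "0 \<le> mesh_size Th"
proof -
  have "Th \<noteq> {}"
  proof
    assume "Th = {}"
    then have "closure \<Omega> = {}" using Th(7) by simp
    then show False using \<Omega>(4) by simp
  qed
  then obtain T where "T \<in> Th" by blast
  then show ?thesis using diameter_pos[of T] diameter_le[of T] by linarith
qed

text \<open>After exchanging the sums, the outward normals of an interior face add up to zero while
  \<open>g\<close> is the same on both sides; on boundary faces \<open>\<nu>\<close> vanishes. To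
  have \<open>g\<close> single valued, traces are taken from the whole domain on the whole
  skeleton.\<close>

lemma skeleton_sum:
  assumes \<nu>: "\<And>F x. F \<in> Fh \<Longrightarrow> F \<subseteq> frontier \<Omega> \<Longrightarrow> x \<in> F \<Longrightarrow> \<nu> x = 0"
  shows "(\<Sum>T\<in>Th. \<Sum>F\<in>faces_of Fh T. (outward_normal T F \<bullet> i) * face_inner F g \<nu>) = 0"
proof -
  let ?c = "\<lambda>F. face_inner F g \<nu>"
  have "(\<Sum>T\<in>Th. \<Sum>F\<in>faces_of Fh T. (outward_normal T F \<bullet> i) * ?c F)
      = (\<Sum>F\<in>Fh. \<Sum>T | T \<in> Th \<and> F \<subseteq> frontier T. (outward_normal T F \<bullet> i) * ?c F)"
    unfolding faces_of_def using Th(1) Fh(1) by (rule sum.swap_restrict)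
  also have "\<dots> = (\<Sum>F\<in>Fh. 0)"
  proof (rule sum.cong[OF refl])
    fix F assume F: "F \<in> Fh"
    have "(\<Sum>T | T \<in> Th \<and> F \<subseteq> frontier T. (outward_normal T F \<bullet> i) * ?c F)
        = ((\<Sum>T | T \<in> Th \<and> F \<subseteq> frontier T. outward_normal T F) \<bullet> i) * ?c F"
      by (simp add: inner_sum_left sum_distrib_right)
    also have "\<dots> = 0"
    proof (cases "F \<subseteq> frontier \<Omega>")
      case True
      then have "?c F = face_inner F g (\<lambda>_. 0)"
        using \<nu>[OF F] by (intro sk.face_inner_cong F) auto
      then show ?thesis by (simp add: l2_inner_def)
    next
      case False
      then show ?thesis using normal_sum[OF F False] by simp
    qed
    finally show "(\<Sum>T | T \<in> Th \<and> F \<subseteq> frontier T. (outward_normal T F \<bullet> i) * ?c F) = 0" .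
  qed
  finally show ?thesis by simp
qed

text \<open>Restrictions of the global derivatives represent the local ones, so the local norms
  integrate the same functions over disjoint elements.\<close>

lemma sobolev_norm_sum:
  assumes v: "v \<in> sobolev m \<Omega>"
  shows "(\<Sum>T\<in>Th. (sobolev_norm m T v)\<^sup>2) \<le> (sobolev_norm m \<Omega> v)\<^sup>2"
proof -
  let ?w = "\<lambda>A. weak_deriv \<Omega> A v"
  note w = sobolev_weakly[OF v]
  have "(sobolev_norm m T v)\<^sup>2 = (\<Sum>A\<in>multi_indices m. (norm_on T (?w A))\<^sup>2)" if T: "T \<in> Th" for T
    using sobolev_norm_eq[OF Th(2)[OF T], of m v ?w] weakly_T[OF w T]
    by (simp add: multi_indices_def sum_nonneg)
  then have "(\<Sum>T\<in>Th. (sobolev_norm m T v)\<^sup>2) = (\<Sum>A\<in>multi_indices m. \<Sum>T\<in>Th. (norm_on T (?w A))\<^sup>2)"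
    by (subst sum.swap) simp
  also have "\<dots> \<le> (\<Sum>A\<in>multi_indices m. (norm_on \<Omega> (?w A))\<^sup>2)"
  proof (rule sum_mono)
    fix A :: "'a multiset" assume "A \<in> multi_indices m"
    then have "sqi_on \<Omega> (?w A)" using weakly_sqi[OF w] by blast
    then show "(\<Sum>T\<in>Th. (norm_on T (?w A))\<^sup>2) \<le> (norm_on \<Omega> (?w A))\<^sup>2"
      unfolding l2_norm_sq l2_inner_def by (intro sum_over_elements) (auto simp: sqi_def)
  qed
  also have "\<dots> = (sobolev_norm m \<Omega> v)\<^sup>2" by (simp add: sobolev_norm_def sum_nonneg)
  finally show ?thesis .
qed

lemma second_derivatives_le:
  assumes v: "v \<in> sobolev 2 \<Omega>" and T: "T \<in> Th" and i: "i \<in> Basis"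
  shows "(\<Sum>j\<in>Basis. (norm_on T (weak_deriv \<Omega> {#i, j#} v))\<^sup>2) \<le> (sobolev_norm 2 T v)\<^sup>2"
proof -
  let ?g = "\<lambda>A. (norm_on T (weak_deriv \<Omega> A v))\<^sup>2"
  have "inj_on (\<lambda>j. {#i, j#}) Basis" by (rule inj_onI) simp
  then have "(\<Sum>j\<in>Basis. ?g {#i, j#}) = (\<Sum>A\<in>(\<lambda>j. {#i, j#}) ` Basis. ?g A)"
    by (simp add: sum.reindex)
  also have "\<dots> \<le> (\<Sum>A\<in>multi_indices 2. ?g A)"
    using i by (intro sum_mono2 finite_multi_indices) (auto simp: multi_indices_def)
  also have "\<dots> = (sobolev_norm 2 T v)\<^sup>2"
    using sobolev_norm_eq[OF Th(2)[OF T], of 2 v "\<lambda>A. weak_deriv \<Omega> A v"] weakly_T[OF sobolev_weakly[OF v] T]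
    by (simp add: multi_indices_def sum_nonneg)
  finally show ?thesis .
qed

text \<open>Weak derivatives, the strong equation and traces are taken on the domain and restricted
  to the element, so that neighbouring elements share one flux trace.\<close>

lemma element_consistency:
  assumes k: "1 \<le> k" and T: "T \<in> Th" and approx: "approximation_property Capp T (faces_of Fh T)"
    and f: "sqi_on \<Omega> f" and u: "poisson_solution \<Omega> f u" "u \<in> sobolev 2 \<Omega>"
    and g: "is_trace \<Omega> Fh u g" and \<gamma>: "\<And>i. i \<in> Basis \<Longrightarrow> is_trace \<Omega> Fh (weak_deriv \<Omega> {#i#} u) (\<gamma> i)"
    and p: "p \<in> polys k" and \<nu>: "fsqi Fh \<nu>"
  shows "\<bar>local_form k T (faces_of Fh T) (elem_proj k T u, faces_proj k Fh g) (p, \<nu>) - inner_on T f p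
      - (\<Sum>i\<in>Basis. \<Sum>F\<in>faces_of Fh T. (outward_normal T F \<bullet> i) * face_inner F (\<gamma> i) \<nu>)\<bar>
    \<le> err_const (real DIM('a)) Capp \<rho>
        * (diameter T / real k) * sobolev_norm 2 T u * sqrt (local_form k T (faces_of Fh T) (p, \<nu>) (p, \<nu>))"
proof -
  interpret e: element T "faces_of Fh T" Fh using element[OF T] .
  interpret a: approx_element T "faces_of Fh T" Fh k Capp
    using k approx by unfold_locales
  let ?w = "\<lambda>i. weak_deriv \<Omega> {#i#} u" and ?z = "\<lambda>i j. weak_deriv \<Omega> {#i, j#} u"
  have wd: "weakly \<Omega> {#i#} u (?w i)" if "i \<in> Basis" for i
    using sobolev_weakly[OF u(2), of "{#i#}"] that by (simp add: multi_indices_def)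
  have zd: "weakly \<Omega> {#j#} (?w i) (?z i j)" if "i \<in> Basis" "j \<in> Basis" for i j
    using sobolev_weakly[OF u(2), of "{#i, j#}"] that
    by (intro weakly_second[OF \<Omega>(1) that wd[OF that(1)]]) (simp add: multi_indices_def)
  have us: "sqi_on \<Omega> u" using u(2) by (simp add: sobolev_iff)
  have u1: "u \<in> sobolev 1 \<Omega>" by (rule sobolev_1I[OF us wd])
  have w1: "?w i \<in> sobolev 1 \<Omega>" if "i \<in> Basis" for i
    by (rule sobolev_1I[OF weakly_sqi[OF wd[OF that]] zd[OF that]])
  have sub: "faces_of Fh T \<subseteq> Fh" by (auto simp: faces_of_def)
  have gs: "fsqi Fh g" using g by (simp add: is_trace_def fsqi_def sq_integrable_eq_sqi)
  have w: "weakly T {#i#} u (?w i)" if "i \<in> Basis" for i using weakly_T[OF wd[OF that] T] that by simp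
  have z: "weakly T {#j#} (?w i) (?z i j)" if "i \<in> Basis" "j \<in> Basis" for i j
    using weakly_T[OF zd[OF that] T] that by simp
  have u2: "u \<in> sobolev 2 T"
    using u(2) sqi_T[OF us T] weakly_T[OF _ T] unfolding sobolev_iff multi_indices_def by blast
  have "AE x in lebesgue. x \<in> \<Omega> \<longrightarrow> (\<Sum>i\<in>Basis. ?z i i x) = - f x"
    using poisson_solution_strong[OF \<Omega>(1,3) u f] \<Omega>L by (simp add: AE_restrict_space_iff)
  then have strong: "AE x in lebesgue_on T. (\<Sum>i\<in>Basis. ?z i i x) = - f x"
    using TL[OF T] T_subset[OF T] by (auto simp: AE_restrict_space_iff elim!: eventually_mono)
  obtain c where c: "ball c (\<rho>\<^sup>2 * diameter T / 2) \<subseteq> T" using inball[OF T] by blast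
  have d: "(p, \<nu>) \<in> e.dofs k" using p \<nu> sub by (auto simp: e.dofs_def fsqi_def)
  have "local_form k T (faces_of Fh T) (elem_proj k T u, faces_proj k Fh g) (p, \<nu>)
      = local_form k T (faces_of Fh T) (a.interp u g) (p, \<nu>)"
    by (rule e.local_form_cong_left) (simp_all add: a.interp_def sk.faces_proj_subfamily[OF gs sub])
  then show ?thesis
    using a.consistency[OF trace_restrict[OF u1 g T] u2 w z trace_restrict[OF w1 \<gamma> T] sqi_T[OF f T] strong
        second_derivatives_le[OF u(2) T] \<rho> c d]
    by (simp add: a.t_sq)
qed

theorem error_estimate:
  assumes k: "1 \<le> k" and approx: "\<And>T. T \<in> Th \<Longrightarrow> approximation_property Capp T (faces_of Fh T)"
    and f: "sqi_on \<Omega> f" and u: "poisson_solution \<Omega> f u" "u \<in> sobolev 2 \<Omega>"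
    and \<mu>: "condensed_solution k \<Omega> Th Fh f \<mu>"
  shows "condensed_norm k Th Fh (\<lambda>x. \<mu> x - faces_proj k Fh (trace_on \<Omega> Fh u) x)
    \<le> err_const (real DIM('a)) Capp \<rho>
        * (mesh_size Th / real k) * sobolev_norm 2 \<Omega> u"
proof -
  let ?K = "err_const (real DIM('a)) Capp \<rho>"
  have K0: "0 \<le> ?K" by (simp add: err_const_nonneg)
  have u0: "u \<in> sobolev0 \<Omega>" using u(1) by (simp add: poisson_solution_def)
  then have u1: "u \<in> sobolev 1 \<Omega>" by (simp add: sobolev0_def)
  have w1: "weak_deriv \<Omega> {#i#} u \<in> sobolev 1 \<Omega>" if i: "i \<in> Basis" for i
  proof (rule sobolev_1I)
    have w: "weakly \<Omega> {#i#} u (weak_deriv \<Omega> {#i#} u)"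
      using sobolev_weakly[OF u(2), of "{#i#}"] i by (simp add: multi_indices_def)
    then show "sqi_on \<Omega> (weak_deriv \<Omega> {#i#} u)" by (rule weakly_sqi)
    show "weakly \<Omega> {#j#} (weak_deriv \<Omega> {#i#} u) (weak_deriv \<Omega> {#i, j#} u)" if "j \<in> Basis" for j
      using sobolev_weakly[OF u(2), of "{#i, j#}"] i that
      by (intro weakly_second[OF \<Omega>(1) i that w]) (simp add: multi_indices_def)
  qed
  define g where "g = trace_on \<Omega> Fh u"
  define \<gamma> where "\<gamma> i = trace_on \<Omega> Fh (weak_deriv \<Omega> {#i#} u)" for i
  have g: "is_trace \<Omega> Fh u g" unfolding g_def by (rule is_trace_trace_on[OF u1])
  have \<gamma>: "is_trace \<Omega> Fh (weak_deriv \<Omega> {#i#} u) (\<gamma> i)" if "i \<in> Basis" for i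
    unfolding \<gamma>_def by (rule is_trace_trace_on[OF w1[OF that]])
  have gs: "fsqi Fh g" using g by (simp add: is_trace_def fsqi_def sq_integrable_eq_sqi)
  let ?\<Pi> = "faces_proj k Fh g" and ?F = "\<lambda>T. faces_of Fh T"
  define \<nu> where "\<nu> x = \<mu> x - ?\<Pi> x" for x
  have \<mu>s: "\<mu> \<in> face_polys k Fh" "\<And>F x. F \<in> Fh \<Longrightarrow> F \<subseteq> frontier \<Omega> \<Longrightarrow> x \<in> F \<Longrightarrow> \<mu> x = 0"
    using \<mu> by (auto simp: condensed_solution_def skeletal_space_def)
  have \<Pi>: "?\<Pi> \<in> face_polys k Fh" by (rule sk.faces_proj_face_polys[OF gs])
  \<comment> \<open>The solution has zero trace on boundary faces, so its projection vanishes
    pointwise there and the error becomes an admissible test function.\<close>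
  have \<Pi>0: "?\<Pi> x = 0" if F: "F \<in> Fh" "F \<subseteq> frontier \<Omega>" "x \<in> F" for F x
  proof (rule sk.faces_proj_eqI[OF gs F(1) polys_zero _ F(3)])
    fix q :: "'a \<Rightarrow> real" assume "q \<in> polys k"
    then have "\<bar>face_inner F g q\<bar> \<le> face_norm F g * face_norm F q"
      using gs F(1) sk.polys_sqi[OF F(1)] by (intro l2_cauchy_schwarz) (auto simp: fsqi_def)
    then show "face_inner F (\<lambda>_. 0) q = face_inner F g q"
      using trace_boundary[OF u0 F(1,2)] by (simp add: g_def l2_inner_def)
  qed
  have \<nu>p: "\<nu> \<in> face_polys k Fh" using face_polys_comb[OF \<mu>s(1) \<Pi>, of "-1"] by (simp add: \<nu>_def[abs_def])
  have \<nu>0: "\<nu> x = 0" if "F \<in> Fh" "F \<subseteq> frontier \<Omega>" "x \<in> F" for F x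
    using \<mu>s(2)[OF that] \<Pi>0[OF that] by (simp add: \<nu>_def)
  have \<nu>s: "\<nu> \<in> skeletal_space k \<Omega> Fh" using \<nu>p \<nu>0 by (auto simp: skeletal_space_def)
  have \<nu>f: "fsqi Fh \<nu>" and \<mu>f: "fsqi Fh \<mu>" and \<Pi>f: "fsqi Fh ?\<Pi>"
    using sk.face_polys_fsqi \<nu>p \<mu>s(1) \<Pi> by blast+
  have restr: "fsqi (?F T) h" if "fsqi Fh h" for T h using that by (auto simp: fsqi_def faces_of_def)
  define V where "V T = (local_lift k T (?F T) \<nu>, \<nu>)" for T
  define M where "M T = (local_lift k T (?F T) \<mu>, \<mu>)" for T
  define I where "I T = (elem_proj k T u, ?\<Pi>)" for T
  define A where "A T = local_form k T (?F T) (V T) (V T)" for T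
  define S where "S T = sobolev_norm 2 T u" for T
  define \<Phi> where "\<Phi> T = (\<Sum>i\<in>Basis. \<Sum>F\<in>?F T. (outward_normal T F \<bullet> i) * face_inner F (\<gamma> i) \<nu>)" for T
  define R where "R T = local_form k T (?F T) (I T) (V T) - inner_on T f (fst (V T)) - \<Phi> T" for T
  have us: "sqi_on \<Omega> u" using u(2) by (simp add: sobolev_iff)
  have split: "A T = local_form k T (?F T) (M T) (V T) - local_form k T (?F T) (I T) (V T)"
    and A0: "0 \<le> A T" and lift: "local_lift k T (?F T) \<nu> \<in> polys k" if T: "T \<in> Th" for T
  proof -
    interpret e: element T "?F T" Fh using element[OF T] .
    interpret s: semi_inner "e.dofs k" pcomb "local_form k T (?F T)" by (rule e.semi_inner_local)
    show lift: "local_lift k T (?F T) \<nu> \<in> polys k" by (rule e.local_lift_polys[OF k restr[OF \<nu>f]])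
    have Vd: "V T \<in> e.dofs k" and Md: "M T \<in> e.dofs k"
      unfolding V_def M_def by (intro e.local_lift_dofs k restr \<nu>f \<mu>f)+
    have Id: "I T \<in> e.dofs k"
      by (simp add: I_def e.dofs_def e.elem_proj_polys[OF sqi_T[OF us T]] restr[OF \<Pi>f])
    show "0 \<le> A T" unfolding A_def by (rule s.form_nonneg[OF Vd])
    \<comment> \<open>Difference of discrete solution and interpolant. Its face part is
      \<open>\<nu>\<close>; its cell part need not be the lift of \<open>\<nu>\<close>, which the
      orthogonality of the lift compensates.\<close>
    define W where "W = pcomb (M T) (-1) (I T)"
    have W: "W = (fst W, \<nu>)" by (simp add: W_def pcomb_def M_def I_def \<nu>_def[abs_def])
    have Wd: "W \<in> e.dofs k" unfolding W_def by (rule e.pcomb_dofs[OF Md Id])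
    have "A T = local_form k T (?F T) (fst W, \<nu>) (V T)"
      unfolding A_def V_def
      by (rule e.local_lift_form_cong[OF k restr[OF \<nu>f] e.local_lift_dofs[OF k restr[OF \<nu>f]]]) (use Wd W in simp)
    also have "\<dots> = local_form k T (?F T) W (V T)" using W by simp
    also have "\<dots> = local_form k T (?F T) (M T) (V T) - local_form k T (?F T) (I T) (V T)"
      unfolding W_def using s.form_comb[OF Md Id Vd, of "-1"] by simp
    finally show "A T = local_form k T (?F T) (M T) (V T) - local_form k T (?F T) (I T) (V T)" .
  qed
  have cf: "condensed_form k Th Fh \<nu> \<nu> = (\<Sum>T\<in>Th. A T)"
    by (simp add: condensed_form_def global_form_def global_lift_def A_def V_def)
  have "(\<Sum>T\<in>Th. local_form k T (?F T) (M T) (V T)) = condensed_form k Th Fh \<mu> \<nu>"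
    by (simp add: condensed_form_def global_form_def global_lift_def M_def V_def)
  also have "\<dots> = inner_on \<Omega> f (broken_fun Th (global_lift k Fh \<nu>))"
    using \<mu> \<nu>s by (simp add: condensed_solution_def)
  also have "\<dots> = (\<Sum>T\<in>Th. inner_on T f (fst (V T)))"
    using smooth_polys[OF lift] by (subst broken_inner[OF f]) (simp_all add: global_lift_def V_def)
  finally have rhs: "(\<Sum>T\<in>Th. local_form k T (?F T) (M T) (V T)) = (\<Sum>T\<in>Th. inner_on T f (fst (V T)))" .
  \<comment> \<open>The fluxes of the exact gradient cancel globally, since \<open>\<nu>\<close>
    vanishes on boundary faces.\<close>
  have "(\<Sum>T\<in>Th. \<Phi> T) = (\<Sum>i\<in>(Basis :: 'a set). 0)"
    unfolding \<Phi>_def by (subst sum.swap) (intro sum.cong refl skeleton_sum \<nu>0)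
  then have \<Phi>0: "(\<Sum>T\<in>Th. \<Phi> T) = 0" by simp
  have R: "\<bar>R T\<bar> \<le> ?K * (mesh_size Th / real k) * (S T * sqrt (A T))" if T: "T \<in> Th" for T
  proof -
    have "\<bar>R T\<bar> \<le> ?K * (diameter T / real k) * S T * sqrt (A T)"
      using element_consistency[OF k T approx[OF T] f u g \<gamma> lift[OF T] \<nu>f]
      by (simp add: R_def S_def A_def V_def I_def \<Phi>_def)
    also have "\<dots> \<le> ?K * (mesh_size Th / real k) * S T * sqrt (A T)"
    proof (intro mult_right_mono mult_left_mono)
      show "diameter T / real k \<le> mesh_size Th / real k" using diameter_le[OF T] by (simp add: divide_right_mono)
      show "0 \<le> S T" by (simp add: S_def sobolev_norm_def sum_nonneg)
      show "0 \<le> sqrt (A T)" using A0[OF T] by simp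
    qed (rule K0)
    finally show ?thesis by (simp add: mult_ac)
  qed
  let ?h = "mesh_size Th / real k" and ?E = "sqrt (\<Sum>T\<in>Th. A T)"
  have h: "0 \<le> ?h" using mesh_size_nonneg by simp
  \<comment> \<open>Cauchy-Schwarz over the elements; the squared local H^2 norms add up to at most
    the global one.\<close>
  have SA: "(\<Sum>T\<in>Th. S T * sqrt (A T)) \<le> sobolev_norm 2 \<Omega> u * ?E"
  proof -
    have "(\<Sum>T\<in>Th. S T * sqrt (A T)) \<le> (\<Sum>T\<in>Th. \<bar>S T\<bar> * \<bar>sqrt (A T)\<bar>)"
      by (intro sum_mono) (simp add: abs_mult[symmetric])
    also have "\<dots> \<le> L2_set S Th * L2_set (\<lambda>T. sqrt (A T)) Th" by (rule L2_set_mult_ineq)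
    also have "L2_set (\<lambda>T. sqrt (A T)) Th = ?E" using A0 by (simp add: L2_set_def)
    also have "L2_set S Th * ?E \<le> sobolev_norm 2 \<Omega> u * ?E"
    proof (rule mult_right_mono)
      have "0 \<le> sobolev_norm 2 \<Omega> u" by (simp add: sobolev_norm_def sum_nonneg)
      then show "L2_set S Th \<le> sobolev_norm 2 \<Omega> u"
        using sobolev_norm_sum[OF u(2)] by (simp add: L2_set_def S_def real_le_lsqrt)
    qed (use A0 in \<open>simp add: sum_nonneg\<close>)
    finally show ?thesis .
  qed
  have "?E * ?E = (\<Sum>T\<in>Th. A T)" using A0 by (simp add: sum_nonneg)
  also have "\<dots> = (\<Sum>T\<in>Th. - R T)"
    using split rhs \<Phi>0 by (simp add: R_def sum_subtractf sum_negf)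
  also have "\<dots> \<le> (\<Sum>T\<in>Th. ?K * ?h * (S T * sqrt (A T)))"
    using R by (intro sum_mono) (auto simp: abs_le_iff)
  also have "\<dots> = ?K * ?h * (\<Sum>T\<in>Th. S T * sqrt (A T))" by (simp add: sum_distrib_left)
  also have "\<dots> \<le> ?K * ?h * (sobolev_norm 2 \<Omega> u * ?E)" by (rule mult_left_mono[OF SA mult_nonneg_nonneg[OF K0 h]])
  finally have "?E * ?E \<le> (?K * ?h * sobolev_norm 2 \<Omega> u) * ?E" by (simp add: mult.assoc)
  moreover have "0 \<le> ?E" using A0 by (simp add: sum_nonneg)
  moreover have "0 \<le> ?K * ?h * sobolev_norm 2 \<Omega> u"
    by (rule mult_nonneg_nonneg[OF mult_nonneg_nonneg[OF K0 h]]) (simp add: sobolev_norm_def sum_nonneg)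
  \<comment> \<open>One factor of the energy error cancels; if the error is zero, the bound is
    trivial.\<close>
  ultimately have "?E \<le> ?K * ?h * sobolev_norm 2 \<Omega> u"
    by (cases "?E = 0") (auto simp only: mult_le_cancel_right)
  then show ?thesis
    unfolding condensed_norm_def \<nu>_def[abs_def, symmetric, unfolded g_def] using cf by (simp add: \<nu>_def[abs_def] g_def)
qed

end

theorem theorem3p5:
  fixes \<Omega> :: "'a::euclidean_space set"
    and \<rho> Cqu Creg :: real
    and Capp :: "nat \<Rightarrow> real"
  assumes "DIM('a) = 2 \<or> DIM('a) = 3"
    and "open_convex_polytope \<Omega>"
    and "0 < \<rho>" "\<rho> < 1"
    and "elliptic_regularity Creg \<Omega>"
  shows "\<exists>C>0. \<forall>Th Fh.
      regular_convex_mesh \<rho> \<Omega> Th Fh \<and> quasi_uniform Cqu Th \<and>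
      (\<forall>T\<in>Th. approximation_property Capp T (faces_of Fh T)) \<and>
      (\<forall>T\<in>Th. elliptic_regularity Creg T) \<longrightarrow>
      (\<forall>k\<ge>1. \<forall>f u \<mu>.
         sq_integrable (lebesgue_on \<Omega>) f \<and> poisson_solution \<Omega> f u \<and>
         condensed_solution k \<Omega> Th Fh f \<mu> \<longrightarrow>
         condensed_norm k Th Fh (\<lambda>x. \<mu> x - faces_proj k Fh (trace_on \<Omega> Fh u) x)
           \<le> C * (mesh_size Th / real k) * l2_norm (lebesgue_on \<Omega>) f)"
proof -
  let ?K = "err_const (real DIM('a)) Capp \<rho>"
  have K0: "0 \<le> ?K" by (simp add: err_const_nonneg)
  \<comment> \<open>No sign is assumed for \<open>Creg\<close>, hence the absolute value; the
    \<open>+ 1\<close> makes \<open>C\<close> positive in any case.\<close>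
  define C where "C = ?K * \<bar>Creg\<bar> + 1"
  have C: "0 < C" using K0 by (simp add: C_def add_nonneg_pos)
  have "condensed_norm k Th Fh (\<lambda>x. \<mu> x - faces_proj k Fh (trace_on \<Omega> Fh u) x)
      \<le> C * (mesh_size Th / real k) * norm_on \<Omega> f"
    if m: "regular_convex_mesh \<rho> \<Omega> Th Fh" and a: "\<forall>T\<in>Th. approximation_property Capp T (faces_of Fh T)"
      and k: "1 \<le> k" and f: "sq_integrable (lebesgue_on \<Omega>) f" and u: "poisson_solution \<Omega> f u"
      and \<mu>: "condensed_solution k \<Omega> Th Fh f \<mu>" for Th Fh k f u \<mu>
  proof -
    interpret mesh \<rho> \<Omega> Th Fh using assms(1-3) m by unfold_locales
    have reg: "u \<in> sobolev 2 \<Omega>" "sobolev_norm 2 \<Omega> u \<le> Creg * norm_on \<Omega> f"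
      using assms(5) f u unfolding elliptic_regularity_def by blast+
    let ?h = "mesh_size Th / real k" and ?n = "norm_on \<Omega> f"
    have h: "0 \<le> ?h" using mesh_size_nonneg by simp
    have n: "0 \<le> ?n" by (rule l2_norm_nonneg)
    have "condensed_norm k Th Fh (\<lambda>x. \<mu> x - faces_proj k Fh (trace_on \<Omega> Fh u) x) \<le> ?K * ?h * sobolev_norm 2 \<Omega> u"
      using a f u \<mu> by (intro error_estimate[OF k] reg) (auto simp: sq_integrable_eq_sqi)
    also have "\<dots> \<le> ?K * ?h * (\<bar>Creg\<bar> * ?n)"
    proof (rule mult_left_mono)
      have "Creg * ?n \<le> \<bar>Creg\<bar> * ?n" using n by (intro mult_right_mono) auto
      then show "sobolev_norm 2 \<Omega> u \<le> \<bar>Creg\<bar> * ?n" using reg(2) by linarith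
    qed (rule mult_nonneg_nonneg[OF K0 h])
    also have "\<dots> = (?K * \<bar>Creg\<bar>) * (?h * ?n)" by (simp add: mult_ac)
    also have "\<dots> \<le> C * (?h * ?n)" using h n by (intro mult_right_mono mult_nonneg_nonneg) (auto simp: C_def)
    finally show ?thesis by (simp add: mult.assoc)
  qed
  then show ?thesis using C by blast
qed

end
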